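(* Let $(\mathcal C_L,\mathcal C_R,\mathcal C_0,\mathcal S_L,\mathcal S_R,1,\otimes,(-)^* )$ be a duality setup (see context), and let $(\mathcal C,\mathcal S)$ be either $(\mathcal C_L,\mathcal S_L)$ or $(\mathcal C_R,\mathcal S_R)$. If $M\in\mathcal C$ is semi-flat, then $M\in\varinjlim\mathcal S$. Conversely, if the duality setup is a strong duality setup, then every $M\in\varinjlim\mathcal S$ is semi-flat.
   Context: Direct limit means filtered colimit. For a class $\mathcal S$ of objects in a category $\mathcal C$, $\varinjlim\mathcal S$ is the class of objects of $\mathcal C$ that are direct limits of objects from $\mathcal S$. A collection $\mathcal S$ of objects generates an abelian category $\mathcal C$ if for every non-zero $A\to B$ there is some $S\to A$ with $S\in\mathcal S$ such that $S\to A\to B$ is non-zero. An object $K$ is finitely presented if $\mathcal C(K,-)$ commutes with filtered colimits. $\mathrm{Ext}$ means $\mathrm{Ext}^1$. For a class $\mathcal X$ of objects in an abelian category, $\mathcal X^\perp=\{Y\mid \mathrm{Ext}^1(X,Y)=0\ \forall X\in\mathcal X\}$. Duality setup: $\mathcal C_L,\mathcal C_0,\mathcal C_R$ are Grothendieck categories; $\mathcal S_L\subseteq\mathcal C_L$ and $\mathcal S_R\subseteq\mathcal C_R$ are generating sets of objects (viewed as full subcategories, sets being understood up to isomorphism) closed under extensions; $1\in\mathcal C_0$ is finitely presented; $-\otimes-\colon\mathcal C_R\times\mathcal C_L\to\mathcal C_0$ is a bifunctor preserving direct limits in each variable; and $(-)^*\colon\mathcal S_L\to\mathcal S_R$ is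 a duality (contravariant equivalence; its inverse is also written $(-)^*$) such that for every $S\in\mathcal S_L$ there are natural isomorphisms of abelian groups, also natural in $S$: $\mathcal C_0(1,S^*\otimes-)\cong\mathcal C_L(S,-)$ and $\mathcal C_0(1,-\otimes S)\cong\mathcal C_R(S^*,-)$ (hence the analogous isomorphisms for $S\in\mathcal S_R$). Strong duality setup: a duality setup in which, moreover, $1$ is $\mathrm{FP}_2$, i.e. $\mathrm{Ext}_{\mathcal C_0}(1,-)$ respects direct limits, and for every $S\in\mathcal S_L$ the functor $-\otimes S$ is exact and there are natural isomorphisms $\mathrm{Ext}_{\mathcal C_0}(1,S^*\otimes-)\cong\mathrm{Ext}_{\mathcal C_L}(S,-)$ and $\mathrm{Ext}_{\mathcal C_0}(1,-\otimes S)\cong\mathrm{Ext}_{\mathcal C_R}(S^*,-)$; by the duality between $\mathcal S_L$ and $\mathcal S_R$ similar conditions hold for $S\in\mathcal S_R$ (in particular $S\otimes-$ is exact for $S\in\mathcal S_R$). Semi-flat: put $\mathcal E_L=\mathcal S_L^\perp\subseteq\mathcal C_L$ and $\mathcal E_R=\mathcal S_R^\perp\subseteq\mathcal C_R$ (the acyclic objects). An object $M\in\mathcal C_L$ is flat if $-\otimes M\colon\mathcal C_R\to\mathcal C_0$ is exact, and semi-flat if it is flat and $\mathrm{Ext}^1_{\mathcal C_0}(1,E\otimes M)=0$ for all $E\in\mathcal E_R$. Symmetrically, $M\in\mathcal C_R$ is semi-flat if $M\otimes-\colon\mathcal C_L\to\mathcal C_0$ is exact and $\mathrm{Ext}^1_{\mathcal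 C_0}(1,M\otimes E)=0$ for all $E\in\mathcal E_L$. *)

theory Defs
  imports "HOL-Algebra.Group"
begin

unbundle cardinal_syntax

section \<open>Smallness\<close>

text \<open>
  Category theory here is relative to a universe, given by a type \<open>'u\<close> of (strongly) inaccessible
  cardinality: a set, over any type, is small if it has fewer elements than \<open>'u\<close>.  Every small
  category is then isomorphic to one whose objects and arrows are elements of \<open>'u\<close>, so that
  quantifying over diagrams of shape \<open>('u, 'u) cat\<close> accounts for all small diagrams.
\<close>

definition small :: "'u itself \<Rightarrow> 'x set \<Rightarrow> bool" where
  "small U X \<longleftrightarrow> |X| <o |UNIV :: 'u set|"

definition universe :: "'u itself \<Rightarrow> bool" where
  "universe U \<longleftrightarrow>
     natLeq <o |UNIV :: 'u set| \<and> regularCard |UNIV :: 'u set| \<and>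
     (\<forall>X :: 'u set. small U X \<longrightarrow> small U (Pow X))"


section \<open>Categories and functors\<close>

record ('o, 'm) cat =
  Obj :: "'o set"
  Arr :: "'m set"
  Dom :: "'m \<Rightarrow> 'o"
  Cod :: "'m \<Rightarrow> 'o"
  Cmp :: "'m \<Rightarrow> 'm \<Rightarrow> 'm"  (infixl "\<cdot>\<index>" 70)
  Idn :: "'o \<Rightarrow> 'm"

definition Hom :: "('o, 'm, 'x) cat_scheme \<Rightarrow> 'o \<Rightarrow> 'o \<Rightarrow> 'm set" where
  "Hom C A B = {f \<in> Arr C. Dom C f = A \<and> Cod C f = B}"

text \<open>Composition is in applicative order: \<open>g \<cdot> f\<close> is \<open>f\<close> followed by \<open>g\<close>.\<close>

locale category =
  fixes C :: "('o, 'm, 'x) cat_scheme" (structure)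
  assumes Dom_in: "f \<in> Arr C \<Longrightarrow> Dom C f \<in> Obj C"
    and Cod_in: "f \<in> Arr C \<Longrightarrow> Cod C f \<in> Obj C"
    and Idn_in: "A \<in> Obj C \<Longrightarrow> Idn C A \<in> Hom C A A"
    and Cmp_in: "f \<in> Hom C A B \<Longrightarrow> g \<in> Hom C B D \<Longrightarrow> g \<cdot> f \<in> Hom C A D"
    and Cmp_Idn: "f \<in> Hom C A B \<Longrightarrow> f \<cdot> Idn C A = f"
    and Idn_Cmp: "f \<in> Hom C A B \<Longrightarrow> Idn C B \<cdot> f = f"
    and Cmp_assoc: "f \<in> Hom C A B \<Longrightarrow> g \<in> Hom C B D \<Longrightarrow> h \<in> Hom C D E \<Longrightarrow>
      h \<cdot> (g \<cdot> f) = h \<cdot> g \<cdot> f"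

definition iso_arr :: "('o, 'm, 'x) cat_scheme \<Rightarrow> 'm \<Rightarrow> bool" where
  "iso_arr C f \<longleftrightarrow> f \<in> Arr C \<and>
     (\<exists>g \<in> Hom C (Cod C f) (Dom C f).
        g \<cdot>\<^bsub>C\<^esub> f = Idn C (Dom C f) \<and> f \<cdot>\<^bsub>C\<^esub> g = Idn C (Cod C f))"

definition isomorphic :: "('o, 'm, 'x) cat_scheme \<Rightarrow> 'o \<Rightarrow> 'o \<Rightarrow> bool" where
  "isomorphic C A B \<longleftrightarrow> (\<exists>f \<in> Hom C A B. iso_arr C f)"

definition op_cat :: "('o, 'm, 'x) cat_scheme \<Rightarrow> ('o, 'm, 'x) cat_scheme" where
  "op_cat C = C\<lparr>Dom := Cod C, Cod := Dom C, Cmp := (\<lambda>g f. f \<cdot>\<^bsub>C\<^esub> g)\<rparr>"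

definition full_subcat :: "('o, 'm, 'x) cat_scheme \<Rightarrow> 'o set \<Rightarrow> ('o, 'm, 'x) cat_scheme" where
  "full_subcat C S = C\<lparr>Obj := S, Arr := {f \<in> Arr C. Dom C f \<in> S \<and> Cod C f \<in> S}\<rparr>"

definition prod_cat ::
  "('a, 'm, 'x) cat_scheme \<Rightarrow> ('b, 'n, 'y) cat_scheme \<Rightarrow> ('a \<times> 'b, 'm \<times> 'n) cat" where
  "prod_cat A B =
     \<lparr>Obj = Obj A \<times> Obj B, Arr = Arr A \<times> Arr B,
      Dom = map_prod (Dom A) (Dom B), Cod = map_prod (Cod A) (Cod B),
      Cmp = (\<lambda>(g, g') (f, f'). (g \<cdot>\<^bsub>A\<^esub> f, g' \<cdot>\<^bsub>B\<^esub> f')),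
      Idn = map_prod (Idn A) (Idn B)\<rparr>"

record ('a, 'm, 'b, 'n) fctr =
  fob :: "'a \<Rightarrow> 'b"
  far :: "'m \<Rightarrow> 'n"

definition "functor" ::
  "('a, 'm, 'x) cat_scheme \<Rightarrow> ('b, 'n, 'y) cat_scheme \<Rightarrow> ('a, 'm, 'b, 'n) fctr \<Rightarrow> bool" where
  "functor A B F \<longleftrightarrow> category A \<and> category B \<and>
     (\<forall>X \<in> Obj A. fob F X \<in> Obj B) \<and>
     (\<forall>f \<in> Arr A. far F f \<in> Hom B (fob F (Dom A f)) (fob F (Cod A f))) \<and>
     (\<forall>X \<in> Obj A. far F (Idn A X) = Idn B (fob F X)) \<and>
     (\<forall>f \<in> Arr A. \<forall>g \<in> Arr A. Cod A f = Dom A g \<longrightarrow>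
        far F (g \<cdot>\<^bsub>A\<^esub> f) = far F g \<cdot>\<^bsub>B\<^esub> far F f)"

definition id_fctr :: "('a, 'm, 'a, 'm) fctr" where
  "id_fctr = \<lparr>fob = (\<lambda>X. X), far = (\<lambda>f. f)\<rparr>"

definition comp_fctr ::
  "('b, 'n, 'c, 'p) fctr \<Rightarrow> ('a, 'm, 'b, 'n) fctr \<Rightarrow> ('a, 'm, 'c, 'p) fctr" where
  "comp_fctr G F = \<lparr>fob = fob G \<circ> fob F, far = far G \<circ> far F\<rparr>"

definition nat_trans ::
  "('a, 'm, 'x) cat_scheme \<Rightarrow> ('b, 'n, 'y) cat_scheme \<Rightarrow>
   ('a, 'm, 'b, 'n) fctr \<Rightarrow> ('a, 'm, 'b, 'n) fctr \<Rightarrow> ('a \<Rightarrow> 'n) \<Rightarrow> bool" where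
  "nat_trans A B F G t \<longleftrightarrow> functor A B F \<and> functor A B G \<and>
     (\<forall>X \<in> Obj A. t X \<in> Hom B (fob F X) (fob G X)) \<and>
     (\<forall>f \<in> Arr A. t (Cod A f) \<cdot>\<^bsub>B\<^esub> far F f = far G f \<cdot>\<^bsub>B\<^esub> t (Dom A f))"

definition nat_isomorphic ::
  "('a, 'm, 'x) cat_scheme \<Rightarrow> ('b, 'n, 'y) cat_scheme \<Rightarrow>
   ('a, 'm, 'b, 'n) fctr \<Rightarrow> ('a, 'm, 'b, 'n) fctr \<Rightarrow> bool" where
  "nat_isomorphic A B F G \<longleftrightarrow>
     (\<exists>t. nat_trans A B F G t \<and> (\<forall>X \<in> Obj A. iso_arr B (t X)))"

definition equivalence ::
  "('a, 'm, 'x) cat_scheme \<Rightarrow> ('b, 'n, 'y) cat_scheme \<Rightarrow> ('a, 'm, 'b, 'n) fctr \<Rightarrow> bool" where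
  "equivalence A B F \<longleftrightarrow> functor A B F \<and>
     (\<exists>G. functor B A G \<and> nat_isomorphic A A (comp_fctr G F) id_fctr \<and>
          nat_isomorphic B B (comp_fctr F G) id_fctr)"

definition ess_small :: "'u itself \<Rightarrow> ('o, 'm, 'x) cat_scheme \<Rightarrow> 'o set \<Rightarrow> bool" where
  "ess_small U C S \<longleftrightarrow> S \<subseteq> Obj C \<and>
     (\<exists>T \<subseteq> S. small U T \<and> (\<forall>A \<in> S. \<exists>B \<in> T. isomorphic C A B))"


section \<open>Colimits and direct limits\<close>

definition cocone ::
  "('j, 'k, 'x) cat_scheme \<Rightarrow> ('o, 'm, 'y) cat_scheme \<Rightarrow> ('j, 'k, 'o, 'm) fctr \<Rightarrow>
   'o \<Rightarrow> ('j \<Rightarrow> 'm) \<Rightarrow> bool" where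
  "cocone J C F L l \<longleftrightarrow> functor J C F \<and> L \<in> Obj C \<and>
     (\<forall>j \<in> Obj J. l j \<in> Hom C (fob F j) L) \<and>
     (\<forall>u \<in> Arr J. l (Cod J u) \<cdot>\<^bsub>C\<^esub> far F u = l (Dom J u))"

definition is_colimit ::
  "('j, 'k, 'x) cat_scheme \<Rightarrow> ('o, 'm, 'y) cat_scheme \<Rightarrow> ('j, 'k, 'o, 'm) fctr \<Rightarrow>
   'o \<Rightarrow> ('j \<Rightarrow> 'm) \<Rightarrow> bool" where
  "is_colimit J C F L l \<longleftrightarrow> cocone J C F L l \<and>
     (\<forall>M t. cocone J C F M t \<longrightarrow> (\<exists>!h. h \<in> Hom C L M \<and> (\<forall>j \<in> Obj J. h \<cdot>\<^bsub>C\<^esub> l j = t j)))"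

definition small_cat :: "'u itself \<Rightarrow> ('j, 'k, 'x) cat_scheme \<Rightarrow> bool" where
  "small_cat U J \<longleftrightarrow> category J \<and> small U (Obj J) \<and> small U (Arr J)"

definition filtered :: "('j, 'k, 'x) cat_scheme \<Rightarrow> bool" where
  "filtered J \<longleftrightarrow> Obj J \<noteq> {} \<and>
     (\<forall>i \<in> Obj J. \<forall>j \<in> Obj J. \<exists>k \<in> Obj J. Hom J i k \<noteq> {} \<and> Hom J j k \<noteq> {}) \<and>
     (\<forall>u \<in> Arr J. \<forall>v \<in> Arr J. Dom J u = Dom J v \<and> Cod J u = Cod J v \<longrightarrow>
        (\<exists>w \<in> Arr J. Dom J w = Cod J u \<and> w \<cdot>\<^bsub>J\<^esub> u = w \<cdot>\<^bsub>J\<^esub> v))"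

definition cocomplete :: "'u itself \<Rightarrow> ('o, 'm, 'x) cat_scheme \<Rightarrow> bool" where
  "cocomplete U C \<longleftrightarrow>
     (\<forall>(J :: ('u, 'u) cat) F. small_cat U J \<and> functor J C F \<longrightarrow> (\<exists>L l. is_colimit J C F L l))"

definition direct_limits_of :: "'u itself \<Rightarrow> ('o, 'm, 'x) cat_scheme \<Rightarrow> 'o set \<Rightarrow> 'o set" where
  "direct_limits_of U C S =
     {M. \<exists>(J :: ('u, 'u) cat) F l. small_cat U J \<and> filtered J \<and> (\<forall>j \<in> Obj J. fob F j \<in> S) \<and>
           is_colimit J C F M l}"

definition preserves_direct_limits ::
  "'u itself \<Rightarrow> ('a, 'm, 'x) cat_scheme \<Rightarrow> ('b, 'n, 'y) cat_scheme \<Rightarrow>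
   ('a, 'm, 'b, 'n) fctr \<Rightarrow> bool" where
  "preserves_direct_limits U A B T \<longleftrightarrow>
     (\<forall>(J :: ('u, 'u) cat) F L l. small_cat U J \<and> filtered J \<and> is_colimit J A F L l \<longrightarrow>
        is_colimit J B (comp_fctr T F) (fob T L) (far T \<circ> l))"

text \<open>
  Functors to sets or abelian groups are given by an action \<open>H\<close> on objects (with values in sets)
  and an action \<open>Hm\<close> on arrows.  Below, the filtered colimit of the sets \<open>H (F j)\<close> is the usual
  quotient of their disjoint union, and \<open>H\<close> respects direct limits if the canonical map from it to
  \<open>H (colim F)\<close> is bijective.  For functors to abelian groups this is the right notion as well,
  because the forgetful functor to sets creates filtered colimits.
\<close>

definition colim_rel ::
  "('j, 'k, 'x) cat_scheme \<Rightarrow> ('j, 'k, 'o, 'm) fctr \<Rightarrow> ('o \<Rightarrow> 's set) \<Rightarrow> ('m \<Rightarrow> 's \<Rightarrow> 's) \<Rightarrow>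
   (('j \<times> 's) \<times> ('j \<times> 's)) set" where
  "colim_rel J F H Hm =
     {((i, x), (j, y)). i \<in> Obj J \<and> x \<in> H (fob F i) \<and> j \<in> Obj J \<and> y \<in> H (fob F j) \<and>
        (\<exists>k \<in> Obj J. \<exists>u \<in> Hom J i k. \<exists>v \<in> Hom J j k. Hm (far F u) x = Hm (far F v) y)}"

definition colim_set ::
  "('j, 'k, 'x) cat_scheme \<Rightarrow> ('j, 'k, 'o, 'm) fctr \<Rightarrow> ('o \<Rightarrow> 's set) \<Rightarrow> ('m \<Rightarrow> 's \<Rightarrow> 's) \<Rightarrow>
   ('j \<times> 's) set set" where
  "colim_set J F H Hm = (SIGMA j : Obj J. H (fob F j)) // colim_rel J F H Hm"

definition comparison_map :: "('m \<Rightarrow> 's \<Rightarrow> 's) \<Rightarrow> ('j \<Rightarrow> 'm) \<Rightarrow> ('j \<times> 's) set \<Rightarrow> 's" where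
  "comparison_map Hm l K = the_elem ((\<lambda>(j, x). Hm (l j) x) ` K)"

definition respects_direct_limits ::
  "'u itself \<Rightarrow> ('o, 'm, 'x) cat_scheme \<Rightarrow> ('o \<Rightarrow> 's set) \<Rightarrow> ('m \<Rightarrow> 's \<Rightarrow> 's) \<Rightarrow> bool" where
  "respects_direct_limits U C H Hm \<longleftrightarrow>
     (\<forall>(J :: ('u, 'u) cat) F L l. small_cat U J \<and> filtered J \<and> is_colimit J C F L l \<longrightarrow>
        bij_betw (comparison_map Hm l) (colim_set J F H Hm) (H L))"

definition finitely_presented :: "'u itself \<Rightarrow> ('o, 'm, 'x) cat_scheme \<Rightarrow> 'o \<Rightarrow> bool" where
  "finitely_presented U C K \<longleftrightarrow> K \<in> Obj C \<and>
     respects_direct_limits U C (Hom C K) (\<lambda>f x. f \<cdot>\<^bsub>C\<^esub> x)"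


section \<open>Abelian and Grothendieck categories\<close>

text \<open>\<open>Zer C A B\<close> is the zero arrow from \<open>A\<close> to \<open>B\<close>.\<close>

record ('o, 'm) add_cat = "('o, 'm) cat" +
  Add :: "'m \<Rightarrow> 'm \<Rightarrow> 'm"
  Zer :: "'o \<Rightarrow> 'o \<Rightarrow> 'm"

definition Hom_group :: "('o, 'm, 'x) add_cat_scheme \<Rightarrow> 'o \<Rightarrow> 'o \<Rightarrow> 'm monoid" where
  "Hom_group C A B = \<lparr>carrier = Hom C A B, monoid.mult = Add C, one = Zer C A B\<rparr>"

locale preadditive = category C for C :: "('o, 'm, 'x) add_cat_scheme" (structure) +
  assumes Hom_comm_group: "A \<in> Obj C \<Longrightarrow> B \<in> Obj C \<Longrightarrow> comm_group (Hom_group C A B)"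
    and Cmp_Add: "f \<in> Hom C A B \<Longrightarrow> f' \<in> Hom C A B \<Longrightarrow> g \<in> Hom C B D \<Longrightarrow>
      g \<cdot> Add C f f' = Add C (g \<cdot> f) (g \<cdot> f')"
    and Add_Cmp: "f \<in> Hom C A B \<Longrightarrow> g \<in> Hom C B D \<Longrightarrow> g' \<in> Hom C B D \<Longrightarrow>
      Add C g g' \<cdot> f = Add C (g \<cdot> f) (g' \<cdot> f)"

definition zero_object :: "('o, 'm, 'x) cat_scheme \<Rightarrow> 'o \<Rightarrow> bool" where
  "zero_object C Z \<longleftrightarrow> Z \<in> Obj C \<and>
     (\<forall>A \<in> Obj C. (\<exists>!f. f \<in> Hom C A Z) \<and> (\<exists>!f. f \<in> Hom C Z A))"

record ('o, 'm) biprod =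
  bp_ob :: 'o
  in1 :: 'm
  in2 :: 'm
  pr1 :: 'm
  pr2 :: 'm

definition is_biprod ::
  "('o, 'm, 'x) add_cat_scheme \<Rightarrow> 'o \<Rightarrow> 'o \<Rightarrow> ('o, 'm) biprod \<Rightarrow> bool" where
  "is_biprod C A B P \<longleftrightarrow>
     in1 P \<in> Hom C A (bp_ob P) \<and> in2 P \<in> Hom C B (bp_ob P) \<and>
     pr1 P \<in> Hom C (bp_ob P) A \<and> pr2 P \<in> Hom C (bp_ob P) B \<and>
     pr1 P \<cdot>\<^bsub>C\<^esub> in1 P = Idn C A \<and> pr2 P \<cdot>\<^bsub>C\<^esub> in2 P = Idn C B \<and>
     pr1 P \<cdot>\<^bsub>C\<^esub> in2 P = Zer C B A \<and> pr2 P \<cdot>\<^bsub>C\<^esub> in1 P = Zer C A B \<and>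
     Add C (in1 P \<cdot>\<^bsub>C\<^esub> pr1 P) (in2 P \<cdot>\<^bsub>C\<^esub> pr2 P) = Idn C (bp_ob P)"

definition is_kernel :: "('o, 'm, 'x) add_cat_scheme \<Rightarrow> 'm \<Rightarrow> 'm \<Rightarrow> bool" where
  "is_kernel C k f \<longleftrightarrow> k \<in> Arr C \<and> f \<in> Arr C \<and> Cod C k = Dom C f \<and>
     f \<cdot>\<^bsub>C\<^esub> k = Zer C (Dom C k) (Cod C f) \<and>
     (\<forall>h \<in> Arr C. Cod C h = Dom C f \<and> f \<cdot>\<^bsub>C\<^esub> h = Zer C (Dom C h) (Cod C f) \<longrightarrow>
        (\<exists>!u. u \<in> Hom C (Dom C h) (Dom C k) \<and> k \<cdot>\<^bsub>C\<^esub> u = h))"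

definition is_cokernel :: "('o, 'm, 'x) add_cat_scheme \<Rightarrow> 'm \<Rightarrow> 'm \<Rightarrow> bool" where
  "is_cokernel C c f \<longleftrightarrow> c \<in> Arr C \<and> f \<in> Arr C \<and> Dom C c = Cod C f \<and>
     c \<cdot>\<^bsub>C\<^esub> f = Zer C (Dom C f) (Cod C c) \<and>
     (\<forall>h \<in> Arr C. Dom C h = Cod C f \<and> h \<cdot>\<^bsub>C\<^esub> f = Zer C (Dom C f) (Cod C h) \<longrightarrow>
        (\<exists>!u. u \<in> Hom C (Cod C c) (Cod C h) \<and> u \<cdot>\<^bsub>C\<^esub> c = h))"

definition monic :: "('o, 'm, 'x) cat_scheme \<Rightarrow> 'm \<Rightarrow> bool" where
  "monic C f \<longleftrightarrow> f \<in> Arr C \<and>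
     (\<forall>g \<in> Arr C. \<forall>h \<in> Arr C. Cod C g = Dom C f \<and> Cod C h = Dom C f \<and> Dom C g = Dom C h \<and>
        f \<cdot>\<^bsub>C\<^esub> g = f \<cdot>\<^bsub>C\<^esub> h \<longrightarrow> g = h)"

definition epic :: "('o, 'm, 'x) cat_scheme \<Rightarrow> 'm \<Rightarrow> bool" where
  "epic C f \<longleftrightarrow> f \<in> Arr C \<and>
     (\<forall>g \<in> Arr C. \<forall>h \<in> Arr C. Dom C g = Cod C f \<and> Dom C h = Cod C f \<and> Cod C g = Cod C h \<and>
        g \<cdot>\<^bsub>C\<^esub> f = h \<cdot>\<^bsub>C\<^esub> f \<longrightarrow> g = h)"

locale abelian = preadditive +
  assumes ex_zero: "\<exists>Z. zero_object C Z"
    and ex_biprod: "A \<in> Obj C \<Longrightarrow> B \<in> Obj C \<Longrightarrow> \<exists>P. is_biprod C A B P"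
    and ex_kernel: "f \<in> Arr C \<Longrightarrow> \<exists>k. is_kernel C k f"
    and ex_cokernel: "f \<in> Arr C \<Longrightarrow> \<exists>c. is_cokernel C c f"
    and monic_is_kernel: "monic C f \<Longrightarrow> \<exists>g. is_kernel C f g"
    and epic_is_cokernel: "epic C f \<Longrightarrow> \<exists>g. is_cokernel C f g"

text \<open>\<open>short_exact C i p\<close>: the sequence \<open>0 \<rightarrow> Dom i \<rightarrow> Cod i = Dom p \<rightarrow> Cod p \<rightarrow> 0\<close> is exact.\<close>

definition short_exact :: "('o, 'm, 'x) add_cat_scheme \<Rightarrow> 'm \<Rightarrow> 'm \<Rightarrow> bool" where
  "short_exact C i p \<longleftrightarrow> is_kernel C i p \<and> is_cokernel C p i"

definition exact_functor ::
  "('a, 'm, 'x) add_cat_scheme \<Rightarrow> ('b, 'n, 'y) add_cat_scheme \<Rightarrow>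
   ('a, 'm, 'b, 'n) fctr \<Rightarrow> bool" where
  "exact_functor A B F \<longleftrightarrow> functor A B F \<and>
     (\<forall>i p. short_exact A i p \<longrightarrow> short_exact B (far F i) (far F p))"

definition direct_limits_exact :: "'u itself \<Rightarrow> ('o, 'm, 'x) add_cat_scheme \<Rightarrow> bool" where
  "direct_limits_exact U C \<longleftrightarrow>
     (\<forall>(J :: ('u, 'u) cat) F F' F'' s t L l L' l' L'' l'' f g.
        small_cat U J \<and> filtered J \<and>
        nat_trans J C F F' s \<and> nat_trans J C F' F'' t \<and>
        (\<forall>j \<in> Obj J. short_exact C (s j) (t j)) \<and>
        is_colimit J C F L l \<and> is_colimit J C F' L' l' \<and> is_colimit J C F'' L'' l'' \<and>
        f \<in> Hom C L L' \<and> (\<forall>j \<in> Obj J. f \<cdot>\<^bsub>C\<^esub> l j = l' j \<cdot>\<^bsub>C\<^esub> s j) \<and>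
        g \<in> Hom C L' L'' \<and> (\<forall>j \<in> Obj J. g \<cdot>\<^bsub>C\<^esub> l' j = l'' j \<cdot>\<^bsub>C\<^esub> t j) \<longrightarrow>
        short_exact C f g)"

definition generates :: "('o, 'm, 'x) add_cat_scheme \<Rightarrow> 'o set \<Rightarrow> bool" where
  "generates C S \<longleftrightarrow> S \<subseteq> Obj C \<and>
     (\<forall>f \<in> Arr C. f \<noteq> Zer C (Dom C f) (Cod C f) \<longrightarrow>
        (\<exists>A \<in> S. \<exists>g \<in> Hom C A (Dom C f). f \<cdot>\<^bsub>C\<^esub> g \<noteq> Zer C A (Cod C f)))"

locale grothendieck = abelian C
  for U :: "'u itself" and C :: "('o, 'm, 'x) add_cat_scheme" (structure) +
  assumes Hom_small: "A \<in> Obj C \<Longrightarrow> B \<in> Obj C \<Longrightarrow> small U (Hom C A B)"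
    and cocomplete: "cocomplete U C"
    and direct_limits_exact: "direct_limits_exact U C"
    and ex_generators: "\<exists>G. small U G \<and> generates C G"

text \<open>
  The class \<open>S\<close> is not required to be closed under isomorphism, so extensions are only
  required to be isomorphic to a member of \<open>S\<close>.
\<close>

definition extension_closed :: "('o, 'm, 'x) add_cat_scheme \<Rightarrow> 'o set \<Rightarrow> bool" where
  "extension_closed C S \<longleftrightarrow>
     (\<forall>i p. short_exact C i p \<and> Dom C i \<in> S \<and> Cod C p \<in> S \<longrightarrow>
        (\<exists>B \<in> S. isomorphic C (Cod C i) B))"


section \<open>Yoneda Ext\<close>

definition extensions :: "('o, 'm, 'x) add_cat_scheme \<Rightarrow> 'o \<Rightarrow> 'o \<Rightarrow> ('m \<times> 'm) set" where
  "extensions C X Y = {(i, p). short_exact C i p \<and> Dom C i = Y \<and> Cod C p = X}"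

definition ext_rel ::
  "('o, 'm, 'x) add_cat_scheme \<Rightarrow> 'o \<Rightarrow> 'o \<Rightarrow> (('m \<times> 'm) \<times> ('m \<times> 'm)) set" where
  "ext_rel C X Y =
     {((i, p), (i', p')). (i, p) \<in> extensions C X Y \<and> (i', p') \<in> extensions C X Y \<and>
        (\<exists>h \<in> Hom C (Cod C i) (Cod C i'). h \<cdot>\<^bsub>C\<^esub> i = i' \<and> p' \<cdot>\<^bsub>C\<^esub> h = p)}"

text \<open>
  For a class \<open>E\<close> of extensions of \<open>X\<close> by \<open>Y\<close>, the class \<open>ext_push C f E\<close> is the pushout of \<open>E\<close>
  along \<open>f\<close> out of \<open>Y\<close>, and \<open>ext_pull C g E\<close> is the pullback of \<open>E\<close> along \<open>g\<close> into \<open>X\<close>.  They are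
  described through morphisms of extensions that are the identity on \<open>X\<close> and on \<open>Y\<close>, respectively,
  as these determine the pushout and the pullback up to equivalence.
\<close>

definition ext_push ::
  "('o, 'm, 'x) add_cat_scheme \<Rightarrow> 'm \<Rightarrow> ('m \<times> 'm) set \<Rightarrow> ('m \<times> 'm) set" where
  "ext_push C f E =
     {(i', p'). short_exact C i' p' \<and> Dom C i' = Cod C f \<and>
        (\<exists>(i, p) \<in> E. \<exists>h \<in> Hom C (Cod C i) (Cod C i').
           h \<cdot>\<^bsub>C\<^esub> i = i' \<cdot>\<^bsub>C\<^esub> f \<and> p' \<cdot>\<^bsub>C\<^esub> h = p)}"

definition ext_pull ::
  "('o, 'm, 'x) add_cat_scheme \<Rightarrow> 'm \<Rightarrow> ('m \<times> 'm) set \<Rightarrow> ('m \<times> 'm) set" where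
  "ext_pull C g E =
     {(i', p'). short_exact C i' p' \<and> Cod C p' = Dom C g \<and>
        (\<exists>(i, p) \<in> E. \<exists>h \<in> Hom C (Cod C i') (Cod C i).
           h \<cdot>\<^bsub>C\<^esub> i' = i \<and> p \<cdot>\<^bsub>C\<^esub> h = g \<cdot>\<^bsub>C\<^esub> p')}"

definition biprod :: "('o, 'm, 'x) add_cat_scheme \<Rightarrow> 'o \<Rightarrow> 'o \<Rightarrow> ('o, 'm) biprod" where
  "biprod C A B = (SOME P. is_biprod C A B P)"

definition sum_arr :: "('o, 'm, 'x) add_cat_scheme \<Rightarrow> 'm \<Rightarrow> 'm \<Rightarrow> 'm" where
  "sum_arr C f g =
     (let P = biprod C (Dom C f) (Dom C g); Q = biprod C (Cod C f) (Cod C g)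
      in Add C (in1 Q \<cdot>\<^bsub>C\<^esub> f \<cdot>\<^bsub>C\<^esub> pr1 P) (in2 Q \<cdot>\<^bsub>C\<^esub> g \<cdot>\<^bsub>C\<^esub> pr2 P))"

definition diagonal :: "('o, 'm, 'x) add_cat_scheme \<Rightarrow> 'o \<Rightarrow> 'm" where
  "diagonal C X = (let P = biprod C X X in Add C (in1 P) (in2 P))"

definition codiagonal :: "('o, 'm, 'x) add_cat_scheme \<Rightarrow> 'o \<Rightarrow> 'm" where
  "codiagonal C Y = (let P = biprod C Y Y in Add C (pr1 P) (pr2 P))"

definition baer_sum ::
  "('o, 'm, 'x) add_cat_scheme \<Rightarrow> 'o \<Rightarrow> 'o \<Rightarrow>
   ('m \<times> 'm) set \<Rightarrow> ('m \<times> 'm) set \<Rightarrow> ('m \<times> 'm) set" where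
  "baer_sum C X Y E E' =
     ext_push C (codiagonal C Y) (ext_pull C (diagonal C X)
       {(sum_arr C i i', sum_arr C p p') | i p i' p'. (i, p) \<in> E \<and> (i', p') \<in> E'})"

definition split_extensions ::
  "('o, 'm, 'x) add_cat_scheme \<Rightarrow> 'o \<Rightarrow> 'o \<Rightarrow> ('m \<times> 'm) set" where
  "split_extensions C X Y =
     {(i, p) \<in> extensions C X Y. \<exists>s \<in> Hom C X (Dom C p). p \<cdot>\<^bsub>C\<^esub> s = Idn C X}"

definition Ext :: "('o, 'm, 'x) add_cat_scheme \<Rightarrow> 'o \<Rightarrow> 'o \<Rightarrow> ('m \<times> 'm) set monoid" where
  "Ext C X Y =
     \<lparr>carrier = extensions C X Y // ext_rel C X Y,
      monoid.mult = baer_sum C X Y, one = split_extensions C X Y\<rparr>"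

definition trivial_group :: "'g monoid \<Rightarrow> bool" where
  "trivial_group G \<longleftrightarrow> carrier G = {\<one>\<^bsub>G\<^esub>}"

definition perp :: "('o, 'm, 'x) add_cat_scheme \<Rightarrow> 'o set \<Rightarrow> 'o set" where
  "perp C S = {Y \<in> Obj C. \<forall>X \<in> S. trivial_group (Ext C X Y)}"


section \<open>Duality setups\<close>

text \<open>
  Natural isomorphism between functors \<open>G\<close> and \<open>H\<close> from a category to abelian groups, with \<open>Gm\<close>
  and \<open>Hm\<close> their actions on arrows.
\<close>

definition ab_nat_isomorphic ::
  "('a, 'm, 'x) cat_scheme \<Rightarrow> ('a \<Rightarrow> 'g monoid) \<Rightarrow> ('m \<Rightarrow> 'g \<Rightarrow> 'g) \<Rightarrow>
   ('a \<Rightarrow> 'h monoid) \<Rightarrow> ('m \<Rightarrow> 'h \<Rightarrow> 'h) \<Rightarrow> bool" where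
  "ab_nat_isomorphic A G Gm H Hm \<longleftrightarrow>
     (\<exists>t. (\<forall>X \<in> Obj A. t X \<in> iso (G X) (H X)) \<and>
          (\<forall>f \<in> Arr A. \<forall>x \<in> carrier (G (Dom A f)).
             t (Cod A f) (Gm f x) = Hm f (t (Dom A f) x)))"

text \<open>For a bifunctor \<open>T\<close> on \<open>A \<times> B\<close>: the functors \<open>T (-, M)\<close> and \<open>T (M, -)\<close>.\<close>

definition fix_right ::
  "('b, 'n, 'y) cat_scheme \<Rightarrow> ('a \<times> 'b, 'm \<times> 'n, 'c, 'p) fctr \<Rightarrow> 'b \<Rightarrow> ('a, 'm, 'c, 'p) fctr" where
  "fix_right B T M = \<lparr>fob = (\<lambda>X. fob T (X, M)), far = (\<lambda>f. far T (f, Idn B M))\<rparr>"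

definition fix_left ::
  "('a, 'm, 'x) cat_scheme \<Rightarrow> ('a \<times> 'b, 'm \<times> 'n, 'c, 'p) fctr \<Rightarrow> 'a \<Rightarrow> ('b, 'n, 'c, 'p) fctr" where
  "fix_left A T M = \<lparr>fob = (\<lambda>X. fob T (M, X)), far = (\<lambda>f. far T (Idn A M, f))\<rparr>"

text \<open>
  \<open>I\<close> is the object 1, \<open>T\<close> is the bifunctor \<open>- \<otimes> -\<close>, and \<open>D\<close> is the duality, a contravariant
  functor written as a functor on the opposite category.  The two families of natural isomorphisms
  are natural in both variables jointly.  Nonemptiness of \<open>SL\<close> takes the place of the convention
  that an extension-closed class contains the zero object.
\<close>

locale duality_setup =
  fixes U :: "'u itself"
    and CL :: "('l, 'lm) add_cat"
    and CR :: "('r, 'rm) add_cat"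
    and C0 :: "('z, 'zm) add_cat"
    and SL :: "'l set"
    and SR :: "'r set"
    and I :: 'z
    and T :: "('r \<times> 'l, 'rm \<times> 'lm, 'z, 'zm) fctr"
    and D :: "('l, 'lm, 'r, 'rm) fctr"
  assumes universe: "universe U"
    and CL: "grothendieck U CL"
    and CR: "grothendieck U CR"
    and C0: "grothendieck U C0"
    and SL: "ess_small U CL SL" "generates CL SL" "extension_closed CL SL" "SL \<noteq> {}"
    and SR: "ess_small U CR SR" "generates CR SR" "extension_closed CR SR"
    and I: "finitely_presented U C0 I"
    and bifunctor: "functor (prod_cat CR CL) C0 T"
    and T_right: "M \<in> Obj CL \<Longrightarrow> preserves_direct_limits U CR C0 (fix_right CL T M)"
    and T_left: "N \<in> Obj CR \<Longrightarrow> preserves_direct_limits U CL C0 (fix_left CR T N)"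
    and duality: "equivalence (op_cat (full_subcat CL SL)) (full_subcat CR SR) D"
    and Hom_L:
      "ab_nat_isomorphic (prod_cat (op_cat (full_subcat CL SL)) CL)
         (\<lambda>(S, X). Hom_group C0 I (fob T (fob D S, X))) (\<lambda>(s, f) x. far T (far D s, f) \<cdot>\<^bsub>C0\<^esub> x)
         (\<lambda>(S, X). Hom_group CL S X) (\<lambda>(s, f) x. f \<cdot>\<^bsub>CL\<^esub> x \<cdot>\<^bsub>CL\<^esub> s)"
    and Hom_R:
      "ab_nat_isomorphic (prod_cat (full_subcat CL SL) CR)
         (\<lambda>(S, X). Hom_group C0 I (fob T (X, S))) (\<lambda>(s, f) x. far T (f, s) \<cdot>\<^bsub>C0\<^esub> x)
         (\<lambda>(S, X). Hom_group CR (fob D S) X) (\<lambda>(s, f) x. f \<cdot>\<^bsub>CR\<^esub> x \<cdot>\<^bsub>CR\<^esub> far D s)"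

locale strong_duality_setup = duality_setup +
  assumes FP2: "respects_direct_limits U C0 (\<lambda>X. carrier (Ext C0 I X)) (ext_push C0)"
    and exact_SL: "S \<in> SL \<Longrightarrow> exact_functor CR C0 (fix_right CL T S)"
    and exact_SR: "R \<in> SR \<Longrightarrow> exact_functor CL C0 (fix_left CR T R)"
    and Ext_L: "S \<in> SL \<Longrightarrow>
      ab_nat_isomorphic CL
        (\<lambda>X. Ext C0 I (fob T (fob D S, X))) (\<lambda>f. ext_push C0 (far T (Idn CR (fob D S), f)))
        (\<lambda>X. Ext CL S X) (ext_push CL)"
    and Ext_R: "S \<in> SL \<Longrightarrow>
      ab_nat_isomorphic CR
        (\<lambda>X. Ext C0 I (fob T (X, S))) (\<lambda>f. ext_push C0 (far T (f, Idn CL S)))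
        (\<lambda>X. Ext CR (fob D S) X) (ext_push CR)"

definition semi_flat_L ::
  "('l, 'lm) add_cat \<Rightarrow> ('r, 'rm) add_cat \<Rightarrow> ('z, 'zm) add_cat \<Rightarrow> 'r set \<Rightarrow> 'z \<Rightarrow>
   ('r \<times> 'l, 'rm \<times> 'lm, 'z, 'zm) fctr \<Rightarrow> 'l \<Rightarrow> bool" where
  "semi_flat_L CL CR C0 SR I T M \<longleftrightarrow> M \<in> Obj CL \<and>
     exact_functor CR C0 (fix_right CL T M) \<and>
     (\<forall>E \<in> perp CR SR. trivial_group (Ext C0 I (fob T (E, M))))"

definition semi_flat_R ::
  "('l, 'lm) add_cat \<Rightarrow> ('r, 'rm) add_cat \<Rightarrow> ('z, 'zm) add_cat \<Rightarrow> 'l set \<Rightarrow> 'z \<Rightarrow>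
   ('r \<times> 'l, 'rm \<times> 'lm, 'z, 'zm) fctr \<Rightarrow> 'r \<Rightarrow> bool" where
  "semi_flat_R CL CR C0 SL I T M \<longleftrightarrow> M \<in> Obj CR \<and>
     exact_functor CL C0 (fix_left CR T M) \<and>
     (\<forall>E \<in> perp CL SL. trivial_group (Ext C0 I (fob T (M, E))))"

end

theory Submission
  imports Defs
begin

text \<open>
  A semi-flat \<open>M\<close> is the colimit of the generators over it, as soon as every arrow \<open>f\<close> from a generator
  \<open>B\<close> to \<open>M\<close> that kills an arrow \<open>g\<close> between generators factors through some \<open>w : B \<rightarrow> B'\<close> with
  \<open>w \<cdot> g = 0\<close>, where \<open>B'\<close> is again a generator.
  By duality \<open>f\<close> is an arrow \<open>1 \<rightarrow> B\<^sup>* \<otimes> M\<close>, and since tensoring with \<open>M\<close> is exact, it comes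
  from \<open>K \<otimes> M\<close>, where \<open>K\<close> is the kernel of \<open>g\<^sup>*\<close>.  Take an exact sequence
  \<open>0 \<rightarrow> E \<rightarrow> A \<rightarrow> K \<rightarrow> 0\<close> with \<open>E\<close> acyclic and \<open>A\<close> a direct limit of generators.  As
  \<open>Ext (1, E \<otimes> M) = 0\<close> and 1 is finitely presented, the arrow lifts to \<open>R \<otimes> M\<close> for a generator
  \<open>R\<close> over \<open>K\<close>, and dualizing back gives \<open>w\<close>.

  The sequence comes from a small object argument.  The generators are finitely presented, so kernels
  of epimorphisms between them are finitely generated.  Hence countably many steps suffice, and the
  objects all of whose maps from generators factor through a subobject that is a generator are preserved
  by the attachment of cells.

  Conversely, exactness, the vanishing of \<open>Ext\<close> and the tensor product all commute with direct limits
  in a strong duality setup.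
\<close>

section \<open>Preadditive and abelian categories\<close>

text \<open>The generators need not be projective, so arrows from 1 do not lift along arbitrary
  epimorphisms after tensoring with \<open>M\<close>; the only vanishing at hand is that of
  \<open>Ext (1, E \<otimes> M)\<close> for acyclic \<open>E\<close>. This dictates a cover of the
  kernel \<open>K\<close> whose own kernel is acyclic. The small object argument gives the cover the
  lifting property against kernels of epimorphisms between generators. Tested on the identity of a
  generator, this property makes the cover epic; tested on squares with zero lower arrow, it makes
  every extension of a generator by the kernel split.

  The obstacle is to keep the glued object a direct limit of generators. Being such a limit is not
  visibly stable under glueing, so the stronger property \<open>exhausted\<close> is carried along:
  gluing in one cell replaces a generator inside the old object by an extension of generators inside
  the new one.

  The two sides of the duality are not treated separately: the core argument speaks of a functor
  \<open>W\<close>, which is tensoring with \<open>M\<close> on either side, and of a contravariant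
  assignment, which is the duality or its inverse.\<close>

context category
begin

lemma Hom_Dom_Obj: "f \<in> Hom C A B \<Longrightarrow> A \<in> Obj C"
  and Hom_Cod_Obj: "f \<in> Hom C A B \<Longrightarrow> B \<in> Obj C"
  using Dom_in Cod_in by (auto simp: Hom_def)

lemma Arr_Cmp [simp]:
  assumes "f \<in> Arr C" "g \<in> Arr C" "Cod C f = Dom C g"
  shows "g \<cdot> f \<in> Arr C" "Dom C (g \<cdot> f) = Dom C f" "Cod C (g \<cdot> f) = Cod C g"
  using Cmp_in[of f "Dom C f" "Cod C f" g "Cod C g"] assms by (auto simp: Hom_def)

lemma Cmp_assoc_Arr:
  assumes "f \<in> Arr C" "g \<in> Arr C" "h \<in> Arr C" "Cod C f = Dom C g" "Cod C g = Dom C h"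
  shows "(h \<cdot> g) \<cdot> f = h \<cdot> (g \<cdot> f)"
  using Cmp_assoc[of f "Dom C f" "Cod C f" g "Cod C g" h "Cod C h"] assms by (auto simp: Hom_def)

lemma Idn_simps [simp]:
  assumes "A \<in> Obj C"
  shows "Idn C A \<in> Arr C" "Dom C (Idn C A) = A" "Cod C (Idn C A) = A"
  using Idn_in[OF assms] by (auto simp: Hom_def)

lemma Cmp_Idn_Arr [simp]: "f \<in> Arr C \<Longrightarrow> Dom C f = A \<Longrightarrow> f \<cdot> Idn C A = f"
  and Idn_Cmp_Arr [simp]: "f \<in> Arr C \<Longrightarrow> Cod C f = A \<Longrightarrow> Idn C A \<cdot> f = f"
  using Cmp_Idn[of f A "Cod C f"] Idn_Cmp[of f "Dom C f" A] by (auto simp: Hom_def)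

lemma Arr_Hom: "f \<in> Arr C \<Longrightarrow> f \<in> Hom C (Dom C f) (Cod C f)"
  by (simp add: Hom_def)

lemma HomD: "f \<in> Hom C A B \<Longrightarrow> f \<in> Arr C" "f \<in> Hom C A B \<Longrightarrow> Dom C f = A" "f \<in> Hom C A B \<Longrightarrow> Cod C f = B"
  by (simp_all add: Hom_def)

lemma iso_arr_inverse:
  assumes "f \<in> Hom C A B" "iso_arr C f"
  obtains g where "g \<in> Hom C B A" "g \<cdot> f = Idn C A" "f \<cdot> g = Idn C B"
  using assms unfolding iso_arr_def Hom_def by auto

lemma iso_arrI:
  assumes "f \<in> Hom C A B" "g \<in> Hom C B A" "g \<cdot> f = Idn C A" "f \<cdot> g = Idn C B"
  shows "iso_arr C f"
  using assms unfolding iso_arr_def Hom_def by auto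

lemma isomorphicE:
  assumes "isomorphic C A B"
  obtains f g where "f \<in> Hom C A B" "g \<in> Hom C B A" "g \<cdot> f = Idn C A" "f \<cdot> g = Idn C B"
  using assms iso_arr_inverse unfolding isomorphic_def by metis

lemma isomorphicI:
  assumes "f \<in> Hom C A B" "g \<in> Hom C B A" "g \<cdot> f = Idn C A" "f \<cdot> g = Idn C B"
  shows "isomorphic C A B"
  using iso_arrI[OF assms] assms(1) unfolding isomorphic_def by blast

lemma isomorphic_sym: "isomorphic C A B \<Longrightarrow> isomorphic C B A"
  by (metis isomorphicE isomorphicI)

lemma isomorphic_trans:
  assumes "isomorphic C A B" "isomorphic C B D" shows "isomorphic C A D"
proof -
  obtain f g where 1: "f \<in> Hom C A B" "g \<in> Hom C B A" "g \<cdot> f = Idn C A" "f \<cdot> g = Idn C B"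
    using isomorphicE[OF assms(1)] by metis
  obtain f' g' where 2: "f' \<in> Hom C B D" "g' \<in> Hom C D B" "g' \<cdot> f' = Idn C B" "f' \<cdot> g' = Idn C D"
    using isomorphicE[OF assms(2)] by metis
  have "(g \<cdot> g') \<cdot> (f' \<cdot> f) = g \<cdot> ((g' \<cdot> f') \<cdot> f)"
    using 1(1,2) 2(1,2) by (simp add: Hom_def Cmp_assoc_Arr)
  moreover have "(f' \<cdot> f) \<cdot> (g \<cdot> g') = f' \<cdot> ((f \<cdot> g) \<cdot> g')"
    using 1(1,2) 2(1,2) by (simp add: Hom_def Cmp_assoc_Arr)
  ultimately show ?thesis
    using 1 2 by (intro isomorphicI[of "f' \<cdot> f" _ _ "g \<cdot> g'"])
      (auto simp: Idn_Cmp Cmp_in intro: Cmp_in)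
qed

end

context preadditive
begin

lemma Hom_group_simps [simp]:
  "carrier (Hom_group C A B) = Hom C A B" "f \<otimes>\<^bsub>Hom_group C A B\<^esub> g = Add C f g"
  "\<one>\<^bsub>Hom_group C A B\<^esub> = Zer C A B"
  by (auto simp: Hom_group_def)

lemma Zer_in: "A \<in> Obj C \<Longrightarrow> B \<in> Obj C \<Longrightarrow> Zer C A B \<in> Hom C A B"
  using monoid.one_closed[OF group.is_monoid[OF comm_group.axioms(2)[OF Hom_comm_group]]] by simp

lemma Zer_simps [simp]:
  assumes "A \<in> Obj C" "B \<in> Obj C"
  shows "Zer C A B \<in> Arr C" "Dom C (Zer C A B) = A" "Cod C (Zer C A B) = B"
  using Zer_in[OF assms] by (auto simp: Hom_def)

lemma Add_in: "f \<in> Hom C A B \<Longrightarrow> g \<in> Hom C A B \<Longrightarrow> Add C f g \<in> Hom C A B"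
  using monoid.m_closed[OF group.is_monoid[OF comm_group.axioms(2)[OF Hom_comm_group]], of A B f g]
    Hom_Dom_Obj Hom_Cod_Obj by simp

lemma Add_Zer:
  assumes "f \<in> Hom C A B" shows "Add C f (Zer C A B) = f" "Add C (Zer C A B) f = f"
proof -
  interpret G: comm_group "Hom_group C A B"
    using Hom_comm_group Hom_Dom_Obj Hom_Cod_Obj assms by blast
  show "Add C f (Zer C A B) = f" "Add C (Zer C A B) f = f"
    using G.r_one[of f] G.l_one[of f] assms by auto
qed

lemma Add_commute:
  assumes "f \<in> Hom C A B" "g \<in> Hom C A B" shows "Add C f g = Add C g f"
proof -
  interpret G: comm_group "Hom_group C A B"
    using Hom_comm_group Hom_Dom_Obj Hom_Cod_Obj assms by blast
  show ?thesis using G.m_comm[of f g] assms by simp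
qed

lemma Add_cancel:
  assumes "f \<in> Hom C A B" "g \<in> Hom C A B" "Add C f g = f" shows "g = Zer C A B"
proof -
  interpret G: comm_group "Hom_group C A B"
    using Hom_comm_group Hom_Dom_Obj Hom_Cod_Obj assms by blast
  have "Add C g f = f" using Add_commute[OF assms(1,2)] assms(3) by simp
  then show ?thesis using G.r_cancel_one[of f g] assms(1,2) by simp
qed

text \<open>Since zero plus zero is zero, \<open>g \<cdot> Zer\<close> equals its own double, and
  cancellation makes it zero.\<close>

lemma Cmp_Zer:
  assumes "g \<in> Hom C B D" "A \<in> Obj C" shows "g \<cdot> Zer C A B = Zer C A D"
proof -
  have z: "Zer C A B \<in> Hom C A B" using Zer_in assms Hom_Dom_Obj by blast
  show ?thesis
    using Cmp_Add[OF z z assms(1)] Add_Zer[OF z] Add_cancel[OF Cmp_in[OF z assms(1)]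
        Cmp_in[OF z assms(1)]]
    by simp
qed

lemma Zer_Cmp:
  assumes "f \<in> Hom C A B" "D \<in> Obj C" shows "Zer C B D \<cdot> f = Zer C A D"
proof -
  have z: "Zer C B D \<in> Hom C B D" using Zer_in assms Hom_Cod_Obj by blast
  show ?thesis
    using Add_Cmp[OF assms(1) z z] Add_Zer[OF z] Add_cancel[OF Cmp_in[OF assms(1) z]
        Cmp_in[OF assms(1) z]]
    by simp
qed

text \<open>The difference of parallel arrows. The Hom group is read off from \<open>Dom\<close> and
  \<open>Cod\<close> of \<open>f\<close>, so that no objects have to be passed as arguments.\<close>

definition sub :: "'m \<Rightarrow> 'm \<Rightarrow> 'm" where
  "sub f g = Add C f (inv\<^bsub>Hom_group C (Dom C f) (Cod C f)\<^esub> g)"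

lemma sub_in:
  assumes "f \<in> Hom C A B" "g \<in> Hom C A B" shows "sub f g \<in> Hom C A B"
proof -
  interpret G: comm_group "Hom_group C A B"
    using Hom_comm_group Hom_Dom_Obj Hom_Cod_Obj assms by blast
  show ?thesis unfolding sub_def using Add_in[OF assms(1)] G.inv_closed[of g] assms
      by (auto simp: Hom_def)
qed

lemma sub_unique:
  assumes "f \<in> Hom C A B" "g \<in> Hom C A B" "h \<in> Hom C A B"
  shows "sub f g = h \<longleftrightarrow> f = Add C h g"
proof -
  interpret G: comm_group "Hom_group C A B"
    using Hom_comm_group Hom_Dom_Obj Hom_Cod_Obj assms by blast
  have "sub f g = f \<otimes>\<^bsub>Hom_group C A B\<^esub> inv\<^bsub>Hom_group C A B\<^esub> g"
    using assms(1) by (simp add: sub_def Hom_def)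
  then show ?thesis using G.inv_solve_right'[of h f g] assms by auto
qed

lemma Add_sub:
  assumes "f \<in> Hom C A B" "g \<in> Hom C A B" shows "Add C (sub f g) g = f" "Add C g (sub f g) = f"
  using sub_unique[OF assms sub_in[OF assms]] Add_commute[OF assms(2) sub_in[OF assms]] by auto

lemma Cmp_sub:
  assumes "f \<in> Hom C A B" "g \<in> Hom C A B" "h \<in> Hom C B D"
  shows "h \<cdot> sub f g = sub (h \<cdot> f) (h \<cdot> g)"
proof -
  have s: "sub f g \<in> Hom C A B" using sub_in assms by blast
  have "h \<cdot> f = Add C (h \<cdot> sub f g) (h \<cdot> g)"
    using Cmp_Add[OF s assms(2,3)] Add_sub[OF assms(1,2)] by simp
  then show ?thesis
    using sub_unique[OF Cmp_in[OF assms(1,3)] Cmp_in[OF assms(2,3)] Cmp_in[OF s assms(3)]] by simp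
qed

lemma sub_Cmp:
  assumes "f \<in> Hom C A B" "g \<in> Hom C B D" "h \<in> Hom C B D"
  shows "sub g h \<cdot> f = sub (g \<cdot> f) (h \<cdot> f)"
proof -
  have s: "sub g h \<in> Hom C B D" using sub_in assms by blast
  have "g \<cdot> f = Add C (sub g h \<cdot> f) (h \<cdot> f)"
    using Add_Cmp[OF assms(1) s assms(3)] Add_sub[OF assms(2,3)] by simp
  then show ?thesis
    using sub_unique[OF Cmp_in[OF assms(1,2)] Cmp_in[OF assms(1,3)] Cmp_in[OF assms(1) s]] by simp
qed

lemma sub_eq_Zer_iff:
  assumes "f \<in> Hom C A B" "g \<in> Hom C A B" shows "sub f g = Zer C A B \<longleftrightarrow> f = g"
  using sub_unique[OF assms Zer_in] Add_Zer[OF assms(2)] Hom_Dom_Obj Hom_Cod_Obj assms by metis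

lemma sub_Zer: "f \<in> Hom C A B \<Longrightarrow> sub f (Zer C A B) = f"
  using sub_unique[of f A B "Zer C A B" f] Zer_in Add_Zer Hom_Dom_Obj Hom_Cod_Obj by metis

lemma monicI:
  assumes "m \<in> Hom C A B" "\<And>Z h. h \<in> Hom C Z A \<Longrightarrow> m \<cdot> h = Zer C Z B \<Longrightarrow> h = Zer C Z A"
  shows "monic C m"
  unfolding monic_def
proof (intro conjI ballI impI)
  show "m \<in> Arr C" using assms(1) by (simp add: Hom_def)
  fix g h assume gh: "g \<in> Arr C" "h \<in> Arr C"
    "Cod C g = Dom C m \<and> Cod C h = Dom C m \<and> Dom C g = Dom C h \<and> m \<cdot> g = m \<cdot> h"
  then have H: "g \<in> Hom C (Dom C g) A" "h \<in> Hom C (Dom C g) A" using assms(1) by (auto simp: Hom_def)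
  have "m \<cdot> sub g h = Zer C (Dom C g) B"
    using Cmp_sub[OF H assms(1)] sub_eq_Zer_iff[OF Cmp_in[OF H(1) assms(1)]
        Cmp_in[OF H(2) assms(1)]] gh by simp
  then show "g = h" using assms(2)[OF sub_in[OF H]] sub_eq_Zer_iff[OF H] by simp
qed

lemma monicD:
  assumes "monic C m" "m \<in> Hom C A B" "g \<in> Hom C Z A" "h \<in> Hom C Z A" "m \<cdot> g = m \<cdot> h"
  shows "g = h"
  using assms unfolding monic_def by (simp add: Hom_def)

lemma monicD_Zer:
  assumes "monic C m" "m \<in> Hom C A B" "h \<in> Hom C Z A" "m \<cdot> h = Zer C Z B"
  shows "h = Zer C Z A"
  using monicD[OF assms(1-3) Zer_in] Cmp_Zer[OF assms(2)] assms Hom_Dom_Obj Hom_Cod_Obj by metis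

lemma epicI:
  assumes "e \<in> Hom C A B" "\<And>Z h. h \<in> Hom C B Z \<Longrightarrow> h \<cdot> e = Zer C A Z \<Longrightarrow> h = Zer C B Z"
  shows "epic C e"
  unfolding epic_def
proof (intro conjI ballI impI)
  show "e \<in> Arr C" using assms(1) by (simp add: Hom_def)
  fix g h assume gh: "g \<in> Arr C" "h \<in> Arr C"
    "Dom C g = Cod C e \<and> Dom C h = Cod C e \<and> Cod C g = Cod C h \<and> g \<cdot> e = h \<cdot> e"
  then have H: "g \<in> Hom C B (Cod C g)" "h \<in> Hom C B (Cod C g)" using assms(1) by (auto simp: Hom_def)
  have "sub g h \<cdot> e = Zer C A (Cod C g)"
    using sub_Cmp[OF assms(1) H] sub_eq_Zer_iff[OF Cmp_in[OF assms(1) H(1)]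
        Cmp_in[OF assms(1) H(2)]] gh by simp
  then show "g = h" using assms(2)[OF sub_in[OF H]] sub_eq_Zer_iff[OF H] by simp
qed

lemma epicD:
  assumes "epic C e" "e \<in> Hom C A B" "g \<in> Hom C B Z" "h \<in> Hom C B Z" "g \<cdot> e = h \<cdot> e"
  shows "g = h"
  using assms unfolding epic_def by (simp add: Hom_def)

lemma epicD_Zer:
  assumes "epic C e" "e \<in> Hom C A B" "h \<in> Hom C B Z" "h \<cdot> e = Zer C A Z"
  shows "h = Zer C B Z"
  using epicD[OF assms(1-3) Zer_in] Zer_Cmp[OF assms(2)] assms Hom_Dom_Obj Hom_Cod_Obj by metis

lemma is_kernel_Arr:
  assumes "is_kernel C k f"
  shows "k \<in> Hom C (Dom C k) (Cod C k)" "f \<in> Hom C (Cod C k) (Cod C f)"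
    "f \<cdot> k = Zer C (Dom C k) (Cod C f)" "Dom C f = Cod C k"
proof -
  have "k \<in> Arr C" "f \<in> Arr C" "Cod C k = Dom C f" "f \<cdot> k = Zer C (Dom C k) (Cod C f)"
    using assms unfolding is_kernel_def by blast+
  then show "k \<in> Hom C (Dom C k) (Cod C k)" "f \<in> Hom C (Cod C k) (Cod C f)"
    "f \<cdot> k = Zer C (Dom C k) (Cod C f)" "Dom C f = Cod C k"
    by (simp_all add: Hom_def)
qed

lemma is_cokernel_Arr:
  assumes "is_cokernel C c f"
  shows "f \<in> Hom C (Dom C f) (Cod C f)" "c \<in> Hom C (Cod C f) (Cod C c)"
    "c \<cdot> f = Zer C (Dom C f) (Cod C c)" "Dom C c = Cod C f"
proof -
  have "c \<in> Arr C" "f \<in> Arr C" "Dom C c = Cod C f" "c \<cdot> f = Zer C (Dom C f) (Cod C c)"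
    using assms unfolding is_cokernel_def by blast+
  then show "f \<in> Hom C (Dom C f) (Cod C f)" "c \<in> Hom C (Cod C f) (Cod C c)"
    "c \<cdot> f = Zer C (Dom C f) (Cod C c)" "Dom C c = Cod C f"
    by (simp_all add: Hom_def)
qed

text \<open>Uniqueness of factorizations is exactly monicity of \<open>k\<close>, so
  \<open>monic\<close> takes the place of the unique existence in the definition.\<close>

lemma is_kernelI:
  assumes "k \<in> Hom C N A" "f \<in> Hom C A B" "f \<cdot> k = Zer C N B" "monic C k"
    and "\<And>Z h. h \<in> Hom C Z A \<Longrightarrow> f \<cdot> h = Zer C Z B \<Longrightarrow> \<exists>u \<in> Hom C Z N. k \<cdot> u = h"
  shows "is_kernel C k f"
  unfolding is_kernel_def
proof (intro conjI ballI impI)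
  show "k \<in> Arr C" "f \<in> Arr C" "Cod C k = Dom C f" "f \<cdot> k = Zer C (Dom C k) (Cod C f)"
    using assms by (auto simp: Hom_def)
  fix h assume h: "h \<in> Arr C" "Cod C h = Dom C f \<and> f \<cdot> h = Zer C (Dom C h) (Cod C f)"
  then obtain u where u: "u \<in> Hom C (Dom C h) N" "k \<cdot> u = h"
    using assms(5)[of h "Dom C h"] assms(2) by (auto simp: Hom_def)
  then show "\<exists>!u. u \<in> Hom C (Dom C h) (Dom C k) \<and> k \<cdot> u = h"
    using monicD[OF assms(4,1)] assms(1) by (auto simp: Hom_def)
qed

lemma is_kernelD:
  assumes "is_kernel C k f" "f \<in> Hom C A B" "k \<in> Hom C N A"
  shows "f \<cdot> k = Zer C N B" "monic C k"
    "h \<in> Hom C Z A \<Longrightarrow> f \<cdot> h = Zer C Z B \<Longrightarrow> \<exists>u \<in> Hom C Z N. k \<cdot> u = h"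
proof -
  show z: "f \<cdot> k = Zer C N B"
    using is_kernel_Arr[OF assms(1)] HomD[OF assms(2)] HomD[OF assms(3)] by simp
  note k = assms(3)
  have ex: "\<exists>!u. u \<in> Hom C Z N \<and> k \<cdot> u = h"
    if "h \<in> Hom C Z A" "f \<cdot> h = Zer C Z B" for Z h
  proof -
    have "h \<in> Arr C" "Cod C h = Dom C f \<and> f \<cdot> h = Zer C (Dom C h) (Cod C f)" "Dom C h = Z" "Dom C k = N"
      using that assms(2,3) by (simp_all add: Hom_def)
    with assms(1) show ?thesis unfolding is_kernel_def by blast
  qed
  show "monic C k"
  proof (rule monicI[OF k])
    fix Z h assume h: "h \<in> Hom C Z N" "k \<cdot> h = Zer C Z A"
    have Z: "Z \<in> Obj C" using h Hom_Dom_Obj by blast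
    have "f \<cdot> Zer C Z A = Zer C Z B" using Cmp_Zer assms(2) Z by blast
    from ex[OF Zer_in this] show "h = Zer C Z N"
      using h Z k Zer_in[OF Z Hom_Dom_Obj[OF k]] Hom_Cod_Obj[OF k] Cmp_Zer[OF k Z] by blast
  qed
  show "\<exists>u \<in> Hom C Z N. k \<cdot> u = h" if "h \<in> Hom C Z A" "f \<cdot> h = Zer C Z B" using ex[OF that] by blast
qed

lemma is_cokernelI:
  assumes "c \<in> Hom C B L" "f \<in> Hom C A B" "c \<cdot> f = Zer C A L" "epic C c"
    and "\<And>Z h. h \<in> Hom C B Z \<Longrightarrow> h \<cdot> f = Zer C A Z \<Longrightarrow> \<exists>u \<in> Hom C L Z. u \<cdot> c = h"
  shows "is_cokernel C c f"
  unfolding is_cokernel_def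
proof (intro conjI ballI impI)
  show "c \<in> Arr C" "f \<in> Arr C" "Dom C c = Cod C f" "c \<cdot> f = Zer C (Dom C f) (Cod C c)"
    using assms by (auto simp: Hom_def)
  fix h assume h: "h \<in> Arr C" "Dom C h = Cod C f \<and> h \<cdot> f = Zer C (Dom C f) (Cod C h)"
  then obtain u where u: "u \<in> Hom C L (Cod C h)" "u \<cdot> c = h"
    using assms(5)[of h "Cod C h"] assms(2) by (auto simp: Hom_def)
  then show "\<exists>!u. u \<in> Hom C (Cod C c) (Cod C h) \<and> u \<cdot> c = h"
    using epicD[OF assms(4,1)] assms(1) by (auto simp: Hom_def)
qed

lemma is_cokernelD:
  assumes "is_cokernel C c f" "f \<in> Hom C A B" "c \<in> Hom C B L"
  shows "c \<cdot> f = Zer C A L" "epic C c"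
    "h \<in> Hom C B Z \<Longrightarrow> h \<cdot> f = Zer C A Z \<Longrightarrow> \<exists>u \<in> Hom C L Z. u \<cdot> c = h"
proof -
  show z: "c \<cdot> f = Zer C A L"
    using is_cokernel_Arr[OF assms(1)] HomD[OF assms(2)] HomD[OF assms(3)] by simp
  note c = assms(3)
  have ex: "\<exists>!u. u \<in> Hom C L Z \<and> u \<cdot> c = h"
    if "h \<in> Hom C B Z" "h \<cdot> f = Zer C A Z" for Z h
  proof -
    have "h \<in> Arr C" "Dom C h = Cod C f \<and> h \<cdot> f = Zer C (Dom C f) (Cod C h)" "Cod C h = Z" "Cod C c = L"
      using that assms(2,3) by (simp_all add: Hom_def)
    with assms(1) show ?thesis unfolding is_cokernel_def by blast
  qed
  show "epic C c"
  proof (rule epicI[OF c])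
    fix Z h assume h: "h \<in> Hom C L Z" "h \<cdot> c = Zer C B Z"
    have Z: "Z \<in> Obj C" using h Hom_Cod_Obj by blast
    have "Zer C B Z \<cdot> f = Zer C A Z" using Zer_Cmp assms(2) Z by blast
    from ex[OF Zer_in this] show "h = Zer C L Z"
      using h Z c Zer_in[OF Hom_Cod_Obj[OF c] Z] Hom_Dom_Obj[OF c] Zer_Cmp[OF c Z] by blast
  qed
  show "\<exists>u \<in> Hom C L Z. u \<cdot> c = h" if "h \<in> Hom C B Z" "h \<cdot> f = Zer C A Z" using ex[OF that] by blast
qed

lemma is_kernel_monic:
  assumes "is_kernel C k f" shows "monic C k"
  using is_kernelD(2)[OF assms is_kernel_Arr(2,1)[OF assms]] .

lemma short_exact_Hom:
  assumes "short_exact C i p"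
  shows "i \<in> Hom C (Dom C i) (Cod C i)" "p \<in> Hom C (Cod C i) (Cod C p)" "Dom C p = Cod C i"
proof -
  have k: "is_kernel C i p" using assms by (simp add: short_exact_def)
  show "i \<in> Hom C (Dom C i) (Cod C i)" "p \<in> Hom C (Cod C i) (Cod C p)" "Dom C p = Cod C i"
    by (fact is_kernel_Arr[OF k])+
qed

lemma short_exactD:
  assumes "short_exact C i p" "i \<in> Hom C A B" "p \<in> Hom C B D"
  shows "p \<cdot> i = Zer C A D" "monic C i" "epic C p"
    "h \<in> Hom C Z B \<Longrightarrow> p \<cdot> h = Zer C Z D \<Longrightarrow> \<exists>u \<in> Hom C Z A. i \<cdot> u = h"
    "h' \<in> Hom C B Z \<Longrightarrow> h' \<cdot> i = Zer C A Z \<Longrightarrow> \<exists>u \<in> Hom C D Z. u \<cdot> p = h'"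
proof -
  have k: "is_kernel C i p" and c: "is_cokernel C p i"
    using assms(1) by (simp_all add: short_exact_def)
  note k = is_kernelD[OF k assms(3,2)] and c = is_cokernelD[OF c assms(2,3)]
  show "p \<cdot> i = Zer C A D" "monic C i" "epic C p" by (fact k c)+
  show "h \<in> Hom C Z B \<Longrightarrow> p \<cdot> h = Zer C Z D \<Longrightarrow> \<exists>u \<in> Hom C Z A. i \<cdot> u = h"
    "h' \<in> Hom C B Z \<Longrightarrow> h' \<cdot> i = Zer C A Z \<Longrightarrow> \<exists>u \<in> Hom C D Z. u \<cdot> p = h'"
    by (fact k c)+
qed

end

section \<open>Monics as kernels and epics as cokernels\<close>

context abelian
begin

lemma kernel_exists:
  assumes "f \<in> Hom C A B"
  obtains N k where "k \<in> Hom C N A" "is_kernel C k f"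
proof -
  obtain k where k: "is_kernel C k f" using ex_kernel HomD(1)[OF assms] by blast
  show thesis using that[OF _ k] is_kernel_Arr[OF k] HomD[OF assms] by metis
qed

lemma cokernel_exists:
  assumes "f \<in> Hom C A B"
  obtains L c where "c \<in> Hom C B L" "is_cokernel C c f"
proof -
  obtain c where c: "is_cokernel C c f" using ex_cokernel HomD(1)[OF assms] by blast
  show thesis using that[OF _ c] is_cokernel_Arr[OF c] HomD[OF assms] by metis
qed

text \<open>The monic is the kernel of some \<open>g\<close>. As \<open>g\<close> kills
  \<open>m\<close>, it factors through the cokernel \<open>c\<close>, so whatever \<open>c\<close>
  kills is killed by \<open>g\<close> and factors through \<open>m\<close>.\<close>

lemma monic_kernel_of_cokernel:
  assumes "monic C m" "is_cokernel C c m" shows "is_kernel C m c"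
proof -
  note m = is_cokernel_Arr(1)[OF assms(2)] and c = is_cokernel_Arr(2)[OF assms(2)]
  define A B L where ABL: "A = Dom C m" "B = Cod C m" "L = Cod C c"
  note m = m[folded ABL] and c = c[folded ABL]
  note cD = is_cokernelD[OF assms(2) m c]
  obtain g where g: "is_kernel C m g" using monic_is_kernel assms(1) by blast
  define G where "G = Cod C g"
  have gH: "g \<in> Hom C B G" using is_kernel_Arr(2)[OF g] by (simp add: ABL G_def)
  note gD = is_kernelD[OF g gH m]
  obtain u where u: "u \<in> Hom C L G" "u \<cdot> c = g" using cD(3)[OF gH gD(1)] by blast
  show ?thesis
  proof (rule is_kernelI[OF m c cD(1) assms(1)])
    fix Z h assume h: "h \<in> Hom C Z B" "c \<cdot> h = Zer C Z L"
    have "g \<cdot> h = u \<cdot> (c \<cdot> h)" using Cmp_assoc[OF h(1) c u(1)] u(2) by simp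
    also have "\<dots> = Zer C Z G" using h Cmp_Zer[OF u(1)] Hom_Dom_Obj by metis
    finally show "\<exists>u \<in> Hom C Z A. m \<cdot> u = h" using gD(3)[OF h(1)] by blast
  qed
qed

text \<open>Dual argument: the epic is the cokernel of some \<open>g\<close>, and \<open>g\<close>
  factors through the kernel \<open>k\<close>.\<close>

lemma epic_cokernel_of_kernel:
  assumes "epic C e" "is_kernel C k e" shows "is_cokernel C e k"
proof -
  note k = is_kernel_Arr(1)[OF assms(2)] and e = is_kernel_Arr(2)[OF assms(2)]
  define N A B where NAB: "N = Dom C k" "A = Cod C k" "B = Cod C e"
  note k = k[folded NAB] and e = e[folded NAB]
  note kD = is_kernelD[OF assms(2) e k]
  obtain g where g: "is_cokernel C e g" using epic_is_cokernel assms(1) by blast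
  define G where "G = Dom C g"
  have gH: "g \<in> Hom C G A"
    using is_cokernel_Arr[OF g] HomD[OF e] unfolding G_def by metis
  note gD = is_cokernelD[OF g gH e]
  obtain u where u: "u \<in> Hom C G N" "k \<cdot> u = g" using kD(3)[OF gH gD(1)] by blast
  show ?thesis
  proof (rule is_cokernelI[OF e k kD(1) assms(1)])
    fix Z h assume h: "h \<in> Hom C A Z" "h \<cdot> k = Zer C N Z"
    have "h \<cdot> g = (h \<cdot> k) \<cdot> u" using Cmp_assoc[OF u(1) k h(1)] u(2) by simp
    also have "\<dots> = Zer C G Z" using h Zer_Cmp[OF u(1)] Hom_Cod_Obj by metis
    finally show "\<exists>u \<in> Hom C B Z. u \<cdot> e = h" using gD(3)[OF h(1)] by blast
  qed
qed

lemma short_exact_of_monic: "monic C m \<Longrightarrow> is_cokernel C c m \<Longrightarrow> short_exact C m c"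
  using monic_kernel_of_cokernel by (simp add: short_exact_def)

lemma short_exact_of_epic: "epic C e \<Longrightarrow> is_kernel C k e \<Longrightarrow> short_exact C k e"
  using epic_cokernel_of_kernel by (simp add: short_exact_def)

text \<open>The cokernel of an epic is zero. A monic is the kernel of its cokernel, so the identity
  of \<open>B\<close> factors through \<open>f\<close>.\<close>

lemma monic_epic_iso:
  assumes "f \<in> Hom C A B" "monic C f" "epic C f"
  obtains g where "g \<in> Hom C B A" "g \<cdot> f = Idn C A" "f \<cdot> g = Idn C B"
proof -
  note f = assms(1)
  obtain L c where c: "c \<in> Hom C B L" "is_cokernel C c f" using cokernel_exists[OF f] by metis
  note cD = is_cokernelD[OF c(2) f c(1)]
  have "c = Zer C B L" using epicD_Zer[OF assms(3) f c(1) cD(1)] .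
  then have "c \<cdot> Idn C B = Zer C B L" using c(1) Cmp_Idn by simp
  then obtain g where g: "g \<in> Hom C B A" "f \<cdot> g = Idn C B"
    using is_kernelD(3)[OF monic_kernel_of_cokernel[OF assms(2) c(2)] c(1) f Idn_in]
      Hom_Cod_Obj[OF f] by blast
  have "f \<cdot> (g \<cdot> f) = f \<cdot> Idn C A" using f g Cmp_assoc[OF f g(1) f] Idn_Cmp Cmp_Idn by simp
  then have "g \<cdot> f = Idn C A"
    using monicD[OF assms(2) f Cmp_in[OF f g(1)] Idn_in] f Hom_Dom_Obj by blast
  then show thesis using that g by blast
qed

end

section \<open>Pushouts and extensions\<close>

text \<open>In the applications \<open>k\<close> is the kernel of an epimorphism between generators
  and \<open>a\<close> the map along which it is glued to an object; then \<open>j\<close> includes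
  the old object into the new one and \<open>r\<close> is the attached cell.\<close>

definition (in category) pushout :: "'m \<Rightarrow> 'm \<Rightarrow> 'o \<Rightarrow> 'm \<Rightarrow> 'm \<Rightarrow> bool" where
  "pushout a k L j r \<longleftrightarrow> a \<in> Arr C \<and> k \<in> Arr C \<and> Dom C a = Dom C k \<and>
     j \<in> Hom C (Cod C a) L \<and> r \<in> Hom C (Cod C k) L \<and> j \<cdot> a = r \<cdot> k \<and>
     (\<forall>Z f g. f \<in> Hom C (Cod C a) Z \<and> g \<in> Hom C (Cod C k) Z \<and> f \<cdot> a = g \<cdot> k \<longrightarrow>
        (\<exists>!h. h \<in> Hom C L Z \<and> h \<cdot> j = f \<and> h \<cdot> r = g))"

context category
begin

lemma pushoutI:
  assumes "a \<in> Hom C N A" "k \<in> Hom C N R" "j \<in> Hom C A L" "r \<in> Hom C R L" "j \<cdot> a = r \<cdot> k"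
    and "\<And>Z f g. f \<in> Hom C A Z \<Longrightarrow> g \<in> Hom C R Z \<Longrightarrow> f \<cdot> a = g \<cdot> k \<Longrightarrow>
      \<exists>!h. h \<in> Hom C L Z \<and> h \<cdot> j = f \<and> h \<cdot> r = g"
  shows "pushout a k L j r"
  unfolding pushout_def using assms HomD[OF assms(1)] HomD[OF assms(2)] by simp

lemma pushoutD:
  assumes "pushout a k L j r" "a \<in> Hom C N A" "k \<in> Hom C N R"
  shows "j \<in> Hom C A L" "r \<in> Hom C R L" "j \<cdot> a = r \<cdot> k"
    "f \<in> Hom C A Z \<Longrightarrow> g \<in> Hom C R Z \<Longrightarrow> f \<cdot> a = g \<cdot> k \<Longrightarrow>
      \<exists>h \<in> Hom C L Z. h \<cdot> j = f \<and> h \<cdot> r = g"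
    "h \<in> Hom C L Z \<Longrightarrow> h' \<in> Hom C L Z \<Longrightarrow> h \<cdot> j = h' \<cdot> j \<Longrightarrow> h \<cdot> r = h' \<cdot> r \<Longrightarrow> h = h'"
proof -
  have *: "j \<in> Hom C A L \<and> r \<in> Hom C R L \<and> j \<cdot> a = r \<cdot> k \<and>
    (\<forall>Z f g. f \<in> Hom C A Z \<and> g \<in> Hom C R Z \<and> f \<cdot> a = g \<cdot> k \<longrightarrow>
        (\<exists>!h. h \<in> Hom C L Z \<and> h \<cdot> j = f \<and> h \<cdot> r = g))"
    using assms(1) HomD[OF assms(2)] HomD[OF assms(3)] unfolding pushout_def by blast
  then show 1: "j \<in> Hom C A L" "r \<in> Hom C R L" "j \<cdot> a = r \<cdot> k" by blast+
  show "\<exists>h \<in> Hom C L Z. h \<cdot> j = f \<and> h \<cdot> r = g"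
    if "f \<in> Hom C A Z" "g \<in> Hom C R Z" "f \<cdot> a = g \<cdot> k"
    using * that by blast
  show "h = h'" if h: "h \<in> Hom C L Z" "h' \<in> Hom C L Z" "h \<cdot> j = h' \<cdot> j" "h \<cdot> r = h' \<cdot> r"
  proof -
    have "(h \<cdot> j) \<cdot> a = (h \<cdot> r) \<cdot> k"
      using Cmp_assoc[OF assms(2) 1(1) h(1)] Cmp_assoc[OF assms(3) 1(2) h(1)] 1(3) by simp
    then have "\<exists>!u. u \<in> Hom C L Z \<and> u \<cdot> j = h \<cdot> j \<and> u \<cdot> r = h \<cdot> r"
      using * Cmp_in[OF 1(1) h(1)] Cmp_in[OF 1(2) h(1)] by blast
    then show ?thesis using h by metis
  qed
qed

end

section \<open>Biproducts and pushouts in abelian categories\<close>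

context abelian
begin

lemma biprodD:
  assumes "is_biprod C A B P"
  shows "in1 P \<in> Hom C A (bp_ob P)" "in2 P \<in> Hom C B (bp_ob P)"
    "pr1 P \<in> Hom C (bp_ob P) A" "pr2 P \<in> Hom C (bp_ob P) B"
    "pr1 P \<cdot> in1 P = Idn C A" "pr2 P \<cdot> in2 P = Idn C B"
    "pr1 P \<cdot> in2 P = Zer C B A" "pr2 P \<cdot> in1 P = Zer C A B"
    "Add C (in1 P \<cdot> pr1 P) (in2 P \<cdot> pr2 P) = Idn C (bp_ob P)"
  using assms unfolding is_biprod_def by blast+

lemma biprod_copair:
  assumes P: "is_biprod C A B P" and f: "f \<in> Hom C A Z" and g: "g \<in> Hom C B Z"
  shows "\<exists>h \<in> Hom C (bp_ob P) Z. h \<cdot> in1 P = f \<and> h \<cdot> in2 P = g"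
proof
  note d = biprodD[OF P]
  note fp = Cmp_in[OF d(3) f] and gq = Cmp_in[OF d(4) g]
  show "Add C (f \<cdot> pr1 P) (g \<cdot> pr2 P) \<in> Hom C (bp_ob P) Z" using Add_in[OF fp gq] .
  have "(f \<cdot> pr1 P) \<cdot> in1 P = f" "(g \<cdot> pr2 P) \<cdot> in2 P = g"
    "(f \<cdot> pr1 P) \<cdot> in2 P = Zer C B Z" "(g \<cdot> pr2 P) \<cdot> in1 P = Zer C A Z"
    using d(5-8) Cmp_assoc[OF d(1,3) f] Cmp_assoc[OF d(2,4) g]
      Cmp_assoc[OF d(2,3) f] Cmp_assoc[OF d(1,4) g] Cmp_Idn[OF f] Cmp_Idn[OF g]
      Cmp_Zer[OF f Hom_Dom_Obj[OF g]] Cmp_Zer[OF g Hom_Dom_Obj[OF f]] by simp_all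
  then show "Add C (f \<cdot> pr1 P) (g \<cdot> pr2 P) \<cdot> in1 P = f \<and> Add C (f \<cdot> pr1 P) (g \<cdot> pr2 P) \<cdot> in2 P = g"
    using Add_Cmp[OF d(1) fp gq] Add_Cmp[OF d(2) fp gq] Add_Zer[OF f] Add_Zer[OF g] by simp
qed

lemma biprod_expand_from:
  assumes P: "is_biprod C A B P" and h: "h \<in> Hom C (bp_ob P) Z"
  shows "h = Add C ((h \<cdot> in1 P) \<cdot> pr1 P) ((h \<cdot> in2 P) \<cdot> pr2 P)"
proof -
  note d = biprodD[OF P]
  show ?thesis
    using Cmp_Add[OF Cmp_in[OF d(3,1)] Cmp_in[OF d(4,2)] h] Cmp_assoc[OF d(3,1) h]
      Cmp_assoc[OF d(4,2) h] d(9) Cmp_Idn[OF h] by simp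
qed

lemma biprod_expand_to:
  assumes P: "is_biprod C A B P" and h: "h \<in> Hom C Z (bp_ob P)"
  shows "h = Add C (in1 P \<cdot> (pr1 P \<cdot> h)) (in2 P \<cdot> (pr2 P \<cdot> h))"
proof -
  note d = biprodD[OF P]
  show ?thesis
    using Add_Cmp[OF h Cmp_in[OF d(3,1)] Cmp_in[OF d(4,2)]] Cmp_assoc[OF h d(3,1)]
      Cmp_assoc[OF h d(4,2)] d(9) Idn_Cmp[OF h] by simp
qed

lemma biprod_ext:
  assumes "is_biprod C A B P" "h \<in> Hom C (bp_ob P) Z" "h' \<in> Hom C (bp_ob P) Z"
    "h \<cdot> in1 P = h' \<cdot> in1 P" "h \<cdot> in2 P = h' \<cdot> in2 P"
  shows "h = h'"
  using biprod_expand_from[OF assms(1,2)] biprod_expand_from[OF assms(1,3)] assms(4,5) by simp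

lemma biprod_ext_to:
  assumes "is_biprod C A B P" "h \<in> Hom C Z (bp_ob P)" "h' \<in> Hom C Z (bp_ob P)"
    "pr1 P \<cdot> h = pr1 P \<cdot> h'" "pr2 P \<cdot> h = pr2 P \<cdot> h'"
  shows "h = h'"
  using biprod_expand_to[OF assms(1,2)] biprod_expand_to[OF assms(1,3)] assms(4,5) by simp

lemma biprod_short_exact:
  assumes P: "is_biprod C A B P"
  shows "short_exact C (in1 P) (pr2 P)"
proof (rule short_exact_of_monic)
  note d = biprodD[OF P]
  show "monic C (in1 P)"
  proof (rule monicI[OF d(1)])
    fix Z h assume h: "h \<in> Hom C Z A" "in1 P \<cdot> h = Zer C Z (bp_ob P)"
    then show "h = Zer C Z A"
      using Cmp_assoc[OF h(1) d(1,3)] d(5) Idn_Cmp[OF h(1)] Cmp_Zer[OF d(3) Hom_Dom_Obj[OF h(1)]]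
          by simp
  qed
  show "is_cokernel C (pr2 P) (in1 P)"
  proof (rule is_cokernelI[OF d(4,1,8)])
    show "epic C (pr2 P)"
    proof (rule epicI[OF d(4)])
      fix Z h assume h: "h \<in> Hom C B Z" "h \<cdot> pr2 P = Zer C (bp_ob P) Z"
      then show "h = Zer C B Z"
        using Cmp_assoc[OF d(2,4) h(1)] d(6) Cmp_Idn[OF h(1)] Zer_Cmp[OF d(2) Hom_Cod_Obj[OF h(1)]]
            by simp
    qed
    fix Z h assume h: "h \<in> Hom C (bp_ob P) Z" "h \<cdot> in1 P = Zer C A Z"
    have "(h \<cdot> in2 P) \<cdot> pr2 P = h"
      using biprod_expand_from[OF P h(1)] h(2) Zer_Cmp[OF d(3) Hom_Cod_Obj[OF h(1)]]
        Add_Zer(2)[OF Cmp_in[OF d(4) Cmp_in[OF d(2) h(1)]]] by simp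
    then show "\<exists>u \<in> Hom C B Z. u \<cdot> pr2 P = h" using Cmp_in[OF d(2) h(1)] by blast
  qed
qed

text \<open>An arrow out of the biproduct kills the difference of the two composites precisely when
  its components agree on \<open>N\<close>, so both universal properties say the same.\<close>

lemma pushout_cokernel:
  assumes po: "pushout a k L j r" and a: "a \<in> Hom C N A" and k: "k \<in> Hom C N R"
    and P: "is_biprod C A R P"
    and c: "c \<in> Hom C (bp_ob P) L" "c \<cdot> in1 P = j" "c \<cdot> in2 P = r"
  shows "is_cokernel C c (sub (in2 P \<cdot> k) (in1 P \<cdot> a))"
proof -
  note bp = biprodD(1,2)[OF P]
  note D = pushoutD[OF po a k]
  note ik = Cmp_in[OF k bp(2)] and ia = Cmp_in[OF a bp(1)]
  have split: "h \<cdot> sub (in2 P \<cdot> k) (in1 P \<cdot> a) = sub ((h \<cdot> in2 P) \<cdot> k) ((h \<cdot> in1 P) \<cdot> a)"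
    if "h \<in> Hom C (bp_ob P) Z" for h Z
    using Cmp_sub[OF ik ia that] Cmp_assoc[OF k bp(2) that] Cmp_assoc[OF a bp(1) that] by simp
  have zero_iff: "h \<cdot> sub (in2 P \<cdot> k) (in1 P \<cdot> a) = Zer C N Z \<longleftrightarrow> (h \<cdot> in2 P) \<cdot> k = (h \<cdot> in1 P) \<cdot> a"
    if "h \<in> Hom C (bp_ob P) Z" for h Z
    using split[OF that] sub_eq_Zer_iff[OF Cmp_in[OF k Cmp_in[OF bp(2) that]]
        Cmp_in[OF a Cmp_in[OF bp(1) that]]] by simp
  show ?thesis
  proof (rule is_cokernelI[OF c(1) sub_in[OF ik ia]])
    show "c \<cdot> sub (in2 P \<cdot> k) (in1 P \<cdot> a) = Zer C N L" using zero_iff[OF c(1)] c D(3) by simp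
    show "epic C c"
    proof (rule epicI[OF c(1)])
      fix Z h assume h: "h \<in> Hom C L Z" "h \<cdot> c = Zer C (bp_ob P) Z"
      note Z = Hom_Cod_Obj[OF h(1)] and L = Hom_Dom_Obj[OF h(1)]
      have "h \<cdot> j = Zer C A Z" "h \<cdot> r = Zer C R Z"
        using Cmp_assoc[OF bp(1) c(1) h(1)] Cmp_assoc[OF bp(2) c(1) h(1)] c h(2)
          Zer_Cmp[OF bp(1) Z] Zer_Cmp[OF bp(2) Z] by simp_all
      then show "h = Zer C L Z"
        using D(5)[OF h(1) Zer_in[OF L Z]] Zer_Cmp[OF D(1) Z] Zer_Cmp[OF D(2) Z] by simp
    qed
    fix Z h assume h: "h \<in> Hom C (bp_ob P) Z" "h \<cdot> sub (in2 P \<cdot> k) (in1 P \<cdot> a) = Zer C N Z"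
    then obtain u where u: "u \<in> Hom C L Z" "u \<cdot> j = h \<cdot> in1 P" "u \<cdot> r = h \<cdot> in2 P"
      using D(4)[OF Cmp_in[OF bp(1) h(1)] Cmp_in[OF bp(2) h(1)]] zero_iff[OF h(1)] by metis
    then have "u \<cdot> c = h"
      using biprod_ext[OF P Cmp_in[OF c(1) u(1)] h(1)] Cmp_assoc[OF bp(1) c(1) u(1)]
        Cmp_assoc[OF bp(2) c(1) u(1)] c by simp
    then show "\<exists>u \<in> Hom C L Z. u \<cdot> c = h" using u(1) by blast
  qed
qed

text \<open>The same correspondence read backwards: the cokernel of the difference of the two maps
  into the biproduct is a pushout.\<close>

lemma pushout_exists:
  assumes a: "a \<in> Hom C N A" and k: "k \<in> Hom C N R"
  obtains L j r where "pushout a k L j r" "j \<in> Hom C A L" "r \<in> Hom C R L"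
proof -
  obtain P where P: "is_biprod C A R P" using ex_biprod Hom_Cod_Obj[OF a] Hom_Cod_Obj[OF k] by blast
  note i = biprodD(1,2)[OF P]
  note ik = Cmp_in[OF k i(2)] and ia = Cmp_in[OF a i(1)]
  define d where "d = sub (in2 P \<cdot> k) (in1 P \<cdot> a)"
  have d: "d \<in> Hom C N (bp_ob P)" using sub_in[OF ik ia] by (simp add: d_def)
  have zero_iff: "h \<cdot> d = Zer C N Z \<longleftrightarrow> (h \<cdot> in2 P) \<cdot> k = (h \<cdot> in1 P) \<cdot> a"
      if h: "h \<in> Hom C (bp_ob P) Z" for h Z
    using Cmp_sub[OF ik ia h] Cmp_assoc[OF k i(2) h] Cmp_assoc[OF a i(1) h]
      sub_eq_Zer_iff[OF Cmp_in[OF k Cmp_in[OF i(2) h]] Cmp_in[OF a Cmp_in[OF i(1) h]]]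
    by (simp add: d_def)
  obtain L c where c: "c \<in> Hom C (bp_ob P) L" "is_cokernel C c d" using cokernel_exists[OF d] by metis
  note cD = is_cokernelD[OF c(2) d c(1)]
  have "pushout a k L (c \<cdot> in1 P) (c \<cdot> in2 P)"
  proof (rule pushoutI[OF a k Cmp_in[OF i(1) c(1)] Cmp_in[OF i(2) c(1)]])
    show "c \<cdot> in1 P \<cdot> a = c \<cdot> in2 P \<cdot> k" using zero_iff[OF c(1)] cD(1) by simp
    fix Z f g assume fg: "f \<in> Hom C A Z" "g \<in> Hom C R Z" "f \<cdot> a = g \<cdot> k"
    obtain h where h: "h \<in> Hom C (bp_ob P) Z" "h \<cdot> in1 P = f" "h \<cdot> in2 P = g"
        using biprod_copair[OF P fg(1,2)] by blast
    then obtain u where u: "u \<in> Hom C L Z" "u \<cdot> c = h" using cD(3)[OF h(1)] zero_iff[OF h(1)] fg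
        by metis
    show "\<exists>!u. u \<in> Hom C L Z \<and> u \<cdot> (c \<cdot> in1 P) = f \<and> u \<cdot> (c \<cdot> in2 P) = g"
    proof (intro ex1I[of _ u] conjI)
      show "u \<in> Hom C L Z" "u \<cdot> (c \<cdot> in1 P) = f" "u \<cdot> (c \<cdot> in2 P) = g"
        using u h Cmp_assoc[OF i(1) c(1) u(1)] Cmp_assoc[OF i(2) c(1) u(1)] by simp_all
      fix v assume v: "v \<in> Hom C L Z \<and> v \<cdot> (c \<cdot> in1 P) = f \<and> v \<cdot> (c \<cdot> in2 P) = g"
      then have vH: "v \<in> Hom C L Z" by blast
      have "v \<cdot> c = h"
        using biprod_ext[OF P Cmp_in[OF c(1) vH] h(1)] v h Cmp_assoc[OF i(1) c(1) vH]
            Cmp_assoc[OF i(2) c(1) vH]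
        by simp
      then show "v = u" using epicD[OF cD(2) c(1) vH u(1)] u(2) by simp
    qed
  qed
  then show thesis using that Cmp_in[OF i(1) c(1)] Cmp_in[OF i(2) c(1)] by blast
qed

text \<open>The difference \<open>d\<close> into the biproduct has second component
  \<open>k\<close>, hence is monic and therefore the kernel of its cokernel \<open>c\<close>. If
  \<open>j\<close> kills \<open>z\<close>, then \<open>in1 P \<cdot> z\<close> is
  \<open>d \<cdot> w\<close> for some \<open>w\<close>; its second component
  \<open>k \<cdot> w\<close> vanishes, so \<open>w\<close> and then \<open>z\<close> are
  zero.\<close>

lemma pushout_monic:
  assumes po: "pushout a k L j r" and a: "a \<in> Hom C N A" and k: "k \<in> Hom C N R" and mk: "monic C k"
  shows "monic C j"
proof -
  note D = pushoutD[OF po a k]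
  obtain P where P: "is_biprod C A R P" using ex_biprod Hom_Cod_Obj[OF a] Hom_Cod_Obj[OF k] by blast
  note i = biprodD(1,2)[OF P] and p = biprodD(3,4)[OF P] and e = biprodD(5,6,8)[OF P]
  note ik = Cmp_in[OF k i(2)] and ia = Cmp_in[OF a i(1)]
  obtain c where c: "c \<in> Hom C (bp_ob P) L" "c \<cdot> in1 P = j" "c \<cdot> in2 P = r"
      using biprod_copair[OF P D(1,2)] by blast
  define d where "d = sub (in2 P \<cdot> k) (in1 P \<cdot> a)"
  have d: "d \<in> Hom C N (bp_ob P)" using sub_in[OF ik ia] by (simp add: d_def)
  have cok: "is_cokernel C c d" unfolding d_def by (rule pushout_cokernel[OF po a k P c])
  have pd: "pr2 P \<cdot> d = k"
    using Cmp_sub[OF ik ia p(2)] Cmp_assoc[OF k i(2) p(2)] Cmp_assoc[OF a i(1) p(2)] e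
      Idn_Cmp[OF k] Zer_Cmp[OF a Hom_Cod_Obj[OF k]] sub_Zer[OF k] by (simp add: d_def)
  have zero_of_k: "w = Zer C Z N" if "w \<in> Hom C Z N" "pr2 P \<cdot> (d \<cdot> w) = Zer C Z R" for w Z
    using monicD_Zer[OF mk k that(1)] that(2) Cmp_assoc[OF that(1) d p(2)] pd by simp
  have md: "monic C d"
  proof (rule monicI[OF d])
    fix Z h assume h: "h \<in> Hom C Z N" "d \<cdot> h = Zer C Z (bp_ob P)"
    then show "h = Zer C Z N" using zero_of_k[OF h(1)] Cmp_Zer[OF p(2) Hom_Dom_Obj[OF h(1)]] by simp
  qed
  note kd = is_kernelD[OF monic_kernel_of_cokernel[OF md cok] c(1) d]
  show ?thesis
  proof (rule monicI[OF D(1)])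
    fix Z z assume z: "z \<in> Hom C Z A" "j \<cdot> z = Zer C Z L"
    note Z = Hom_Dom_Obj[OF z(1)]
    have "c \<cdot> (in1 P \<cdot> z) = Zer C Z L" using z c Cmp_assoc[OF z(1) i(1) c(1)] by simp
    then obtain w where w: "w \<in> Hom C Z N" "d \<cdot> w = in1 P \<cdot> z" using kd(3)[OF Cmp_in[OF z(1) i(1)]]
        by blast
    have "pr2 P \<cdot> (in1 P \<cdot> z) = Zer C Z R"
      using Cmp_assoc[OF z(1) i(1) p(2)] e(3) Zer_Cmp[OF z(1) Hom_Cod_Obj[OF k]] by simp
    then have "w = Zer C Z N" using zero_of_k[OF w(1)] w(2) by simp
    then have "in1 P \<cdot> z = Zer C Z (bp_ob P)" using w(2) Cmp_Zer[OF d Z] by simp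
    then show "z = Zer C Z A"
      using Cmp_assoc[OF z(1) i(1) p(1)] e(1) Idn_Cmp[OF z(1)] Cmp_Zer[OF p(1) Z] by simp
  qed
qed

text \<open>The arrow \<open>q\<close> on \<open>R\<close> and zero on \<open>A\<close> agree on
  \<open>N\<close>. The induced \<open>e\<close> inherits from \<open>q\<close> that it is a
  cokernel, so gluing along \<open>k\<close> does not change the quotient.\<close>

lemma pushout_short_exact:
  assumes po: "pushout a k L j r" and a: "a \<in> Hom C N A" and k: "k \<in> Hom C N R"
    and se: "short_exact C k q" and q: "q \<in> Hom C R S"
  obtains e where "short_exact C j e" "e \<in> Hom C L S" "e \<cdot> r = q" "e \<cdot> j = Zer C A S"
proof -
  note D = pushoutD[OF po a k]
  note s = short_exactD[OF se k q]
  have S: "S \<in> Obj C" and A: "A \<in> Obj C" using q a Hom_Cod_Obj by blast+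
  have "Zer C A S \<cdot> a = q \<cdot> k" using Zer_Cmp[OF a S] s(1) by simp
  then obtain e where e: "e \<in> Hom C L S" "e \<cdot> j = Zer C A S" "e \<cdot> r = q"
    using D(4)[OF Zer_in[OF A S] q] by blast
  have "is_cokernel C e j"
  proof (rule is_cokernelI[OF e(1) D(1) e(2)])
    show "epic C e"
    proof (rule epicI[OF e(1)])
      fix Z h assume h: "h \<in> Hom C S Z" "h \<cdot> e = Zer C L Z"
      have "h \<cdot> q = Zer C R Z"
        using Cmp_assoc[OF D(2) e(1) h(1)] e(3) h(2) Zer_Cmp[OF D(2) Hom_Cod_Obj[OF h(1)]] by simp
      then show "h = Zer C S Z" using epicD_Zer[OF s(3) q h(1)] by simp
    qed
    fix Z g assume g: "g \<in> Hom C L Z" "g \<cdot> j = Zer C A Z"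
    have "(g \<cdot> r) \<cdot> k = Zer C N Z"
      using Cmp_assoc[OF k D(2) g(1)] Cmp_assoc[OF a D(1) g(1)]
          D(3) g(2) Zer_Cmp[OF a Hom_Cod_Obj[OF g(1)]]
      by simp
    then obtain u where u: "u \<in> Hom C S Z" "u \<cdot> q = g \<cdot> r" using s(5)[OF Cmp_in[OF D(2) g(1)]] by blast
    have "u \<cdot> e \<cdot> j = g \<cdot> j"
      using Cmp_assoc[OF D(1) e(1) u(1)] e(2) g(2) Cmp_Zer[OF u(1) A] by simp
    moreover have "u \<cdot> e \<cdot> r = g \<cdot> r" using Cmp_assoc[OF D(2) e(1) u(1)] e(3) u(2) by simp
    ultimately have "u \<cdot> e = g" using D(5)[OF Cmp_in[OF e(1) u(1)] g(1)] by blast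
    then show "\<exists>u \<in> Hom C S Z. u \<cdot> e = g" using u(1) by blast
  qed
  then have "short_exact C j e" using pushout_monic[OF po a k s(2)]
      by (rule short_exact_of_monic[rotated])
  then show thesis using that e by blast
qed

lemma short_exact_iso_left:
  assumes se: "short_exact C i p" and i: "i \<in> Hom C Y B" and p: "p \<in> Hom C B X"
    and f: "f \<in> Hom C Y' Y" and g: "g \<in> Hom C Y Y'" and gf: "g \<cdot> f = Idn C Y'" and fg: "f \<cdot> g = Idn C Y"
  shows "short_exact C (i \<cdot> f) p"
proof (rule short_exact_of_epic)
  note s = short_exactD[OF se i p]
  note fi = Cmp_in[OF f i]
  show "epic C p" by (fact s(3))
  show "is_kernel C (i \<cdot> f) p"
  proof (rule is_kernelI[OF fi p])
    show "p \<cdot> (i \<cdot> f) = Zer C Y' X"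
      using Cmp_assoc[OF f i p] s(1) Zer_Cmp[OF f Hom_Cod_Obj[OF p]] by simp
    show "monic C (i \<cdot> f)"
    proof (rule monicI[OF fi])
      fix Z h assume h: "h \<in> Hom C Z Y'" "i \<cdot> f \<cdot> h = Zer C Z B"
      have "f \<cdot> h = Zer C Z Y"
        using monicD_Zer[OF s(2) i Cmp_in[OF h(1) f]] Cmp_assoc[OF h(1) f i] h(2) by simp
      then show "h = Zer C Z Y'"
        using Cmp_assoc[OF h(1) f g] gf Idn_Cmp[OF h(1)] Cmp_Zer[OF g Hom_Dom_Obj[OF h(1)]] by simp
    qed
    fix Z h assume h: "h \<in> Hom C Z B" "p \<cdot> h = Zer C Z X"
    then obtain u where u: "u \<in> Hom C Z Y" "i \<cdot> u = h" using s(4) by blast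
    have "i \<cdot> f \<cdot> (g \<cdot> u) = h"
      using Cmp_assoc[OF Cmp_in[OF u(1) g] f i] Cmp_assoc[OF u(1) g f] fg Idn_Cmp[OF u(1)] u(2) by simp
    then show "\<exists>u \<in> Hom C Z Y'. i \<cdot> f \<cdot> u = h" using Cmp_in[OF u(1) g] by blast
  qed
qed

lemma short_exact_iso_right:
  assumes se: "short_exact C i p" and i: "i \<in> Hom C Y B" and p: "p \<in> Hom C B X"
    and f: "f \<in> Hom C X X'" and g: "g \<in> Hom C X' X" and gf: "g \<cdot> f = Idn C X" and fg: "f \<cdot> g = Idn C X'"
  shows "short_exact C i (f \<cdot> p)"
proof (rule short_exact_of_monic)
  note s = short_exactD[OF se i p]
  note pf = Cmp_in[OF p f]
  show "monic C i" by (fact s(2))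
  show "is_cokernel C (f \<cdot> p) i"
  proof (rule is_cokernelI[OF pf i])
    show "f \<cdot> p \<cdot> i = Zer C Y X'"
      using Cmp_assoc[OF i p f] s(1) Cmp_Zer[OF f Hom_Dom_Obj[OF i]] by simp
    show "epic C (f \<cdot> p)"
    proof (rule epicI[OF pf])
      fix Z h assume h: "h \<in> Hom C X' Z" "h \<cdot> (f \<cdot> p) = Zer C B Z"
      have "h \<cdot> f = Zer C X Z"
        using epicD_Zer[OF s(3) p Cmp_in[OF f h(1)]] Cmp_assoc[OF p f h(1)] h(2) by simp
      then show "h = Zer C X' Z"
        using Cmp_assoc[OF g f h(1)] fg Cmp_Idn[OF h(1)] Zer_Cmp[OF g Hom_Cod_Obj[OF h(1)]] by simp
    qed
    fix Z h assume h: "h \<in> Hom C B Z" "h \<cdot> i = Zer C Y Z"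
    then obtain u where u: "u \<in> Hom C X Z" "u \<cdot> p = h" using s(5) by blast
    have "u \<cdot> g \<cdot> (f \<cdot> p) = h"
      using Cmp_assoc[OF pf g u(1)] Cmp_assoc[OF p f g] gf Idn_Cmp[OF p] u(2) by simp
    then show "\<exists>u \<in> Hom C X' Z. u \<cdot> (f \<cdot> p) = h" using Cmp_in[OF g u(1)] by blast
  qed
qed

section \<open>Split extensions and the vanishing of Ext\<close>

lemma extensions_iff:
  "(i, p) \<in> extensions C X Y \<longleftrightarrow>
    (\<exists>B. short_exact C i p \<and> i \<in> Hom C Y B \<and> p \<in> Hom C B X)"
proof
  assume "(i, p) \<in> extensions C X Y"
  then have se: "short_exact C i p" and XY: "Dom C i = Y" "Cod C p = X"
      by (simp_all add: extensions_def)
  show "\<exists>B. short_exact C i p \<and> i \<in> Hom C Y B \<and> p \<in> Hom C B X"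
    using se short_exact_Hom(1,2)[OF se] unfolding XY by blast
next
  assume "\<exists>B. short_exact C i p \<and> i \<in> Hom C Y B \<and> p \<in> Hom C B X"
  then show "(i, p) \<in> extensions C X Y" unfolding extensions_def Hom_def by blast
qed

lemma split_extensions_iff:
  "(i, p) \<in> split_extensions C X Y \<longleftrightarrow>
    (\<exists>B. short_exact C i p \<and> i \<in> Hom C Y B \<and> p \<in> Hom C B X \<and> (\<exists>s \<in> Hom C X B. p \<cdot> s = Idn C X))"
proof -
  have "(i, p) \<in> split_extensions C X Y \<longleftrightarrow>
      (i, p) \<in> extensions C X Y \<and> (\<exists>s \<in> Hom C X (Dom C p). p \<cdot> s = Idn C X)"
    by (simp add: split_extensions_def)
  also have "\<dots> \<longleftrightarrow> (\<exists>B. short_exact C i p \<and> i \<in> Hom C Y B \<and> p \<in> Hom C B X \<and>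
      (\<exists>s \<in> Hom C X B. p \<cdot> s = Idn C X))"
    unfolding extensions_iff by (metis HomD(2))
  finally show ?thesis .
qed

text \<open>The identity minus \<open>s \<cdot> p\<close> is killed by \<open>p\<close>, hence
  factors through \<open>i\<close>; the factor is the retraction.\<close>

lemma split_extension_retraction:
  assumes se: "short_exact C i p" and i: "i \<in> Hom C Y B" and p: "p \<in> Hom C B X"
    and s: "s \<in> Hom C X B" "p \<cdot> s = Idn C X"
  obtains r where "r \<in> Hom C B Y" "r \<cdot> i = Idn C Y"
proof -
  note d = short_exactD[OF se i p]
  note ob = Hom_Dom_Obj[OF i] Hom_Dom_Obj[OF p] Hom_Cod_Obj[OF p]
  have sp: "s \<cdot> p \<in> Hom C B B" using Cmp_in p s by blast
  have "p \<cdot> sub (Idn C B) (s \<cdot> p) = Zer C B X"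
    using Cmp_sub[OF Idn_in[OF ob(2)] sp p] Cmp_assoc[OF p s(1) p] s(2) Cmp_Idn[OF p] Idn_Cmp[OF p]
      sub_eq_Zer_iff[OF p p] by simp
  then obtain r where r: "r \<in> Hom C B Y" "i \<cdot> r = sub (Idn C B) (s \<cdot> p)"
    using d(4)[OF sub_in[OF Idn_in[OF ob(2)] sp]] by blast
  have "i \<cdot> (r \<cdot> i) = i \<cdot> Idn C Y"
    using Cmp_assoc[OF i r(1) i] r(2) sub_Cmp[OF i Idn_in[OF ob(2)] sp] Cmp_assoc[OF i p s(1)] d(1)
      Cmp_Zer[OF s(1) ob(1)] Cmp_Idn[OF i] Idn_Cmp[OF i] sub_Zer[OF i] by simp
  then have "r \<cdot> i = Idn C Y" using monicD[OF d(2) i Cmp_in[OF i r(1)] Idn_in[OF ob(1)]] by simp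
  then show thesis using that r by blast
qed

text \<open>With a retraction \<open>r\<close> of \<open>i\<close> and a section \<open>s'\<close>
  of \<open>p'\<close>, the arrow \<open>i' \<cdot> r\<close> plus \<open>s' \<cdot> p\<close> is a
  morphism of extensions.\<close>

lemma split_extensions_related:
  assumes "(i, p) \<in> split_extensions C X Y" "(i', p') \<in> split_extensions C X Y"
  shows "((i, p), (i', p')) \<in> ext_rel C X Y"
proof -
  obtain B s where 1: "short_exact C i p" "i \<in> Hom C Y B" "p \<in> Hom C B X" "s \<in> Hom C X B"
      "p \<cdot> s = Idn C X"
    using assms(1) unfolding split_extensions_iff by blast
  obtain B' s' where 2: "short_exact C i' p'" "i' \<in> Hom C Y B'" "p' \<in> Hom C B' X" "s' \<in> Hom C X B'"
      "p' \<cdot> s' = Idn C X"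
    using assms(2) unfolding split_extensions_iff by blast
  obtain r where r: "r \<in> Hom C B Y" "r \<cdot> i = Idn C Y" using split_extension_retraction[OF 1] by metis
  note d1 = short_exactD[OF 1(1-3)] and d2 = short_exactD[OF 2(1-3)]
  note ir = Cmp_in[OF r(1) 2(2)] and sp = Cmp_in[OF 1(3) 2(4)]
  define h where "h = Add C (i' \<cdot> r) (s' \<cdot> p)"
  have h: "h \<in> Hom C B B'" unfolding h_def by (rule Add_in[OF ir sp])
  have "h \<cdot> i = i'"
    using Add_Cmp[OF 1(2) ir sp] Cmp_assoc[OF 1(2) r(1) 2(2)] Cmp_assoc[OF 1(2,3) 2(4)] d1(1) r(2)
      Cmp_Idn[OF 2(2)] Cmp_Zer[OF 2(4) Hom_Dom_Obj[OF 2(2)]] Add_Zer[OF 2(2)] by (simp add: h_def)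
  moreover have "p' \<cdot> h = p"
    using Cmp_Add[OF ir sp 2(3)] Cmp_assoc[OF r(1) 2(2,3)] Cmp_assoc[OF 1(3) 2(4,3)] d2(1) 2(5)
      Idn_Cmp[OF 1(3)] Zer_Cmp[OF r(1) Hom_Cod_Obj[OF 1(3)]] Add_Zer[OF 1(3)] by (simp add: h_def)
  moreover have "h \<in> Hom C (Cod C i) (Cod C i')" using h HomD(3)[OF 1(2)] HomD(3)[OF 2(2)] by simp
  moreover have "(i, p) \<in> extensions C X Y" "(i', p') \<in> extensions C X Y"
    using 1 2 unfolding extensions_iff by blast+
  ultimately show ?thesis unfolding ext_rel_def by blast
qed

lemma split_extensions_subset: "split_extensions C X Y \<subseteq> extensions C X Y"
  unfolding split_extensions_def by blast

lemma ext_rel_split: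
  assumes "(i, p) \<in> split_extensions C X Y" "((i, p), (i', p')) \<in> ext_rel C X Y"
  shows "(i', p') \<in> split_extensions C X Y"
proof -
  obtain B s where 1: "i \<in> Hom C Y B" "p \<in> Hom C B X" "s \<in> Hom C X B" "p \<cdot> s = Idn C X"
    using assms(1) unfolding split_extensions_iff by blast
  obtain h where h: "(i', p') \<in> extensions C X Y" "h \<in> Hom C (Cod C i) (Cod C i')" "p' \<cdot> h = p"
    using assms(2) unfolding ext_rel_def by blast
  obtain B' where 2: "short_exact C i' p'" "i' \<in> Hom C Y B'" "p' \<in> Hom C B' X"
    using h(1) unfolding extensions_iff by blast
  have hH: "h \<in> Hom C B B'" using h(2) HomD(3)[OF 1(1)] HomD(3)[OF 2(2)] by simp
  have "p' \<cdot> (h \<cdot> s) = Idn C X" using Cmp_assoc[OF 1(3) hH 2(3)] h(3) 1(4) by simp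
  then show ?thesis unfolding split_extensions_iff using 2 Cmp_in[OF 1(3) hH] by blast
qed

lemma split_extensions_class:
  "x \<in> split_extensions C X Y \<Longrightarrow> ext_rel C X Y `` {x} = split_extensions C X Y"
proof (intro equalityI subsetI)
  fix y assume x: "x \<in> split_extensions C X Y" and "y \<in> ext_rel C X Y `` {x}"
  then show "y \<in> split_extensions C X Y"
    using ext_rel_split[of "fst x" "snd x" X Y "fst y" "snd y"] by simp
next
  fix y assume "x \<in> split_extensions C X Y" "y \<in> split_extensions C X Y"
  then show "y \<in> ext_rel C X Y `` {x}"
    using split_extensions_related[of "fst x" "snd x" X Y "fst y" "snd y"] by simp
qed

lemma split_extensions_nonempty:
  assumes "X \<in> Obj C" "Y \<in> Obj C"
  shows "split_extensions C X Y \<noteq> {}"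
proof -
  obtain P where P: "is_biprod C Y X P" using ex_biprod[OF assms(2,1)] by blast
  have "(in1 P, pr2 P) \<in> split_extensions C X Y"
    unfolding split_extensions_iff using biprodD[OF P] biprod_short_exact[OF P] by blast
  then show ?thesis by blast
qed

text \<open>The neutral element of \<open>Ext\<close> is written down as the set of split
  extensions. It belongs to the quotient because split extensions exist and form a single
  class.\<close>

lemma split_extensions_in_Ext:
  assumes "X \<in> Obj C" "Y \<in> Obj C"
  shows "split_extensions C X Y \<in> carrier (Ext C X Y)"
proof -
  obtain x where x: "x \<in> split_extensions C X Y" using split_extensions_nonempty[OF assms] by blast
  then have "ext_rel C X Y `` {x} \<in> extensions C X Y // ext_rel C X Y"
    using split_extensions_subset by (intro quotientI) blast
  then show ?thesis using split_extensions_class[OF x] by (simp add: Ext_def)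
qed

lemma ext_rel_refl: "x \<in> extensions C X Y \<Longrightarrow> (x, x) \<in> ext_rel C X Y"
proof -
  assume x: "x \<in> extensions C X Y"
  obtain i p where Pair: "x = (i, p)" by (cases x)
  obtain B where B: "short_exact C i p" "i \<in> Hom C Y B" "p \<in> Hom C B X"
    using x unfolding Pair extensions_iff by blast
  have "Idn C B \<in> Hom C (Cod C i) (Cod C i)" "Idn C B \<cdot> i = i" "p \<cdot> Idn C B = p"
    using B Idn_in[OF Hom_Dom_Obj[OF B(3)]] HomD(3)[OF B(2)] Idn_Cmp Cmp_Idn by auto
  then show ?thesis using x unfolding Pair ext_rel_def by blast
qed

text \<open>By reflexivity of \<open>ext_rel\<close> an extension lies in its own class, so it
  splits as soon as this class is the neutral one. Acyclicity is used only through this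
  criterion.\<close>

lemma trivial_Ext_iff:
  assumes "X \<in> Obj C" "Y \<in> Obj C"
  shows "trivial_group (Ext C X Y) \<longleftrightarrow> extensions C X Y \<subseteq> split_extensions C X Y"
proof -
  have one: "\<one>\<^bsub>Ext C X Y\<^esub> = split_extensions C X Y" by (simp add: Ext_def)
  show ?thesis
  proof
    assume t: "trivial_group (Ext C X Y)"
    show "extensions C X Y \<subseteq> split_extensions C X Y"
    proof
      fix x assume x: "x \<in> extensions C X Y"
      then have "ext_rel C X Y `` {x} \<in> carrier (Ext C X Y)" by (simp add: Ext_def quotientI)
      then have "ext_rel C X Y `` {x} = split_extensions C X Y"
        using t by (simp add: trivial_group_def Ext_def)
      then show "x \<in> split_extensions C X Y" using ext_rel_refl[OF x] by blast
    qed
  next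
    assume s: "extensions C X Y \<subseteq> split_extensions C X Y"
    have "K = split_extensions C X Y" if K: "K \<in> carrier (Ext C X Y)" for K
    proof -
      obtain x where "x \<in> extensions C X Y" "K = ext_rel C X Y `` {x}"
        using K unfolding Ext_def by (auto elim: quotientE)
      then show ?thesis using s split_extensions_class by blast
    qed
    then have "carrier (Ext C X Y) = {split_extensions C X Y}"
      using split_extensions_in_Ext[OF assms] by blast
    then show "trivial_group (Ext C X Y)" unfolding trivial_group_def using one by (simp only:)
  qed
qed

text \<open>A morphism of extensions over \<open>X\<close> carries sections to sections. Conversely
  a split extension by \<open>Y'\<close> receives, from any split extension by \<open>Y\<close>, the
  map \<open>i' \<cdot> f \<cdot> r\<close> plus \<open>s' \<cdot> p\<close>. This identifies the
  neutral elements along a diagram.\<close>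

lemma ext_push_split:
  assumes f: "f \<in> Hom C Y Y'" and X: "X \<in> Obj C"
  shows "ext_push C f (split_extensions C X Y) = split_extensions C X Y'"
proof (intro equalityI subrelI)
  fix i' p' assume "(i', p') \<in> ext_push C f (split_extensions C X Y)"
  then obtain i p h where *: "short_exact C i' p'" "Dom C i' = Cod C f"
      "(i, p) \<in> split_extensions C X Y"
      "h \<in> Hom C (Cod C i) (Cod C i')" "p' \<cdot> h = p"
    unfolding ext_push_def by blast
  obtain B s where 1: "i \<in> Hom C Y B" "p \<in> Hom C B X" "s \<in> Hom C X B" "p \<cdot> s = Idn C X"
    using *(3) unfolding split_extensions_iff by blast
  note i' = short_exact_Hom[OF *(1)]
  have h: "h \<in> Hom C B (Cod C i')" using *(4) HomD(3)[OF 1(1)] by simp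
  have p': "p' \<in> Hom C (Cod C i') X" using *(5) i'(2) Cmp_in[OF h i'(2)] HomD(3)[OF 1(2)]
      by (auto simp: Hom_def)
  have "p' \<cdot> (h \<cdot> s) = Idn C X" using Cmp_assoc[OF 1(3) h p'] *(5) 1(4) by simp
  then show "(i', p') \<in> split_extensions C X Y'" unfolding split_extensions_iff
    using *(1,2) i'(1) p' Cmp_in[OF 1(3) h] HomD(3)[OF f] by auto
next
  fix i' p' assume "(i', p') \<in> split_extensions C X Y'"
  then obtain B' s' where 2: "short_exact C i' p'" "i' \<in> Hom C Y' B'" "p' \<in> Hom C B' X"
      "s' \<in> Hom C X B'" "p' \<cdot> s' = Idn C X"
    unfolding split_extensions_iff by blast
  obtain i p where ip: "(i, p) \<in> split_extensions C X Y"
    using split_extensions_nonempty[OF X Hom_Dom_Obj[OF f]] by auto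
  then obtain B s where 1: "short_exact C i p" "i \<in> Hom C Y B" "p \<in> Hom C B X" "s \<in> Hom C X B"
      "p \<cdot> s = Idn C X"
    unfolding split_extensions_iff by blast
  obtain r where r: "r \<in> Hom C B Y" "r \<cdot> i = Idn C Y" using split_extension_retraction[OF 1] by metis
  note d1 = short_exactD[OF 1(1-3)] and d2 = short_exactD[OF 2(1-3)]
  note fi = Cmp_in[OF f 2(2)]
  note ir = Cmp_in[OF r(1) fi] and sp = Cmp_in[OF 1(3) 2(4)]
  define h where "h = Add C (i' \<cdot> f \<cdot> r) (s' \<cdot> p)"
  have h: "h \<in> Hom C B B'" unfolding h_def by (rule Add_in[OF ir sp])
  have "h \<cdot> i = i' \<cdot> f"
    using Add_Cmp[OF 1(2) ir sp] Cmp_assoc[OF 1(2) r(1) fi] Cmp_assoc[OF 1(2,3) 2(4)] d1(1) r(2)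
      Cmp_Idn[OF fi] Cmp_Zer[OF 2(4) Hom_Dom_Obj[OF f]] Add_Zer[OF fi] by (simp add: h_def)
  moreover have "p' \<cdot> h = p"
    using Cmp_Add[OF ir sp 2(3)] Cmp_assoc[OF r(1) fi 2(3)] Cmp_assoc[OF f 2(2,3)]
        Cmp_assoc[OF 1(3) 2(4,3)] d2(1) 2(5)
      Idn_Cmp[OF 1(3)] Zer_Cmp[OF f X] Zer_Cmp[OF r(1) X] Add_Zer[OF 1(3)] by (simp add: h_def)
  moreover have "h \<in> Hom C (Cod C i) (Cod C i')" using h HomD(3)[OF 1(2)] HomD(3)[OF 2(2)] by simp
  moreover have "Dom C i' = Cod C f" using HomD(2)[OF 2(2)] HomD(3)[OF f] by simp
  ultimately show "(i', p') \<in> ext_push C f (split_extensions C X Y)"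
    unfolding ext_push_def using 2(1) ip by blast
qed

lemma split_isomorphic_left:
  assumes "isomorphic C Y Y'" "extensions C X Y \<subseteq> split_extensions C X Y"
  shows "extensions C X Y' \<subseteq> split_extensions C X Y'"
proof (intro subrelI)
  fix i p assume "(i, p) \<in> extensions C X Y'"
  then obtain B where B: "short_exact C i p" "i \<in> Hom C Y' B" "p \<in> Hom C B X"
      unfolding extensions_iff by blast
  obtain f g where fg: "f \<in> Hom C Y Y'" "g \<in> Hom C Y' Y" "g \<cdot> f = Idn C Y" "f \<cdot> g = Idn C Y'"
    using isomorphicE[OF assms(1)] by metis
  have "(i \<cdot> f, p) \<in> extensions C X Y"
    using short_exact_iso_left[OF B fg] Cmp_in[OF fg(1) B(2)] B(3) unfolding extensions_iff by blast
  then have "(i \<cdot> f, p) \<in> split_extensions C X Y" using assms(2) by blast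
  then obtain B' s where "p \<in> Hom C B' X" "s \<in> Hom C X B'" "p \<cdot> s = Idn C X"
    unfolding split_extensions_iff by blast
  moreover from this have "B' = B" using HomD(2)[OF B(3)] HomD(2) by metis
  ultimately show "(i, p) \<in> split_extensions C X Y'" using B unfolding split_extensions_iff by blast
qed

lemma split_isomorphic_right:
  assumes "isomorphic C X X'" "extensions C X Y \<subseteq> split_extensions C X Y"
  shows "extensions C X' Y \<subseteq> split_extensions C X' Y"
proof (intro subrelI)
  fix i p assume "(i, p) \<in> extensions C X' Y"
  then obtain B where B: "short_exact C i p" "i \<in> Hom C Y B" "p \<in> Hom C B X'"
      unfolding extensions_iff by blast
  obtain f g where fg: "f \<in> Hom C X X'" "g \<in> Hom C X' X" "g \<cdot> f = Idn C X" "f \<cdot> g = Idn C X'"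
    using isomorphicE[OF assms(1)] by metis
  have "(i, g \<cdot> p) \<in> extensions C X Y"
    using short_exact_iso_right[OF B fg(2,1,4,3)] Cmp_in[OF B(3) fg(2)]
        B(2) unfolding extensions_iff by blast
  then have "(i, g \<cdot> p) \<in> split_extensions C X Y" using assms(2) by blast
  then obtain B' s where s: "i \<in> Hom C Y B'" "s \<in> Hom C X B'" "g \<cdot> p \<cdot> s = Idn C X"
    unfolding split_extensions_iff by blast
  have "B' = B" using s(1) HomD(3)[OF B(2)] HomD(3) by metis
  then have sB: "s \<in> Hom C X B" using s by simp
  have "g \<cdot> (p \<cdot> s) = Idn C X" using Cmp_assoc[OF sB B(3) fg(2)] s(3) by simp
  then have "f \<cdot> (g \<cdot> (p \<cdot> s)) = f" using Cmp_Idn[OF fg(1)] by simp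
  then have "p \<cdot> s = f" using Cmp_assoc[OF Cmp_in[OF sB B(3)] fg(2,1)]
      fg(4) Idn_Cmp[OF Cmp_in[OF sB B(3)]] by simp
  then have "p \<cdot> (s \<cdot> g) = Idn C X'" using Cmp_assoc[OF fg(2) sB B(3)] fg(4) by simp
  then show "(i, p) \<in> split_extensions C X' Y"
    using B Cmp_in[OF fg(2) sB] unfolding split_extensions_iff by blast
qed

text \<open>The obstruction to lifting \<open>x\<close> along \<open>p\<close> is the pullback along
  \<open>x\<close> of the extension \<open>(i, p)\<close>. A section of the pullback, followed by
  the projection to \<open>A\<close>, is a lift.\<close>

lemma lift_of_split:
  assumes se: "short_exact C i p" and i: "i \<in> Hom C E A" and p: "p \<in> Hom C A K" and x: "x \<in> Hom C X K"
    and split: "extensions C X E \<subseteq> split_extensions C X E"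
  shows "\<exists>y \<in> Hom C X A. p \<cdot> y = x"
proof -
  note d = short_exactD[OF se i p]
  note ob = Hom_Dom_Obj[OF p] Hom_Dom_Obj[OF x] Hom_Cod_Obj[OF p] Hom_Dom_Obj[OF i]
  obtain P where P: "is_biprod C A X P" using ex_biprod[OF ob(1,2)] by blast
  note in12 = biprodD(1,2)[OF P] and pr = biprodD(3,4)[OF P] and e = biprodD(5-8)[OF P]
  note pp = Cmp_in[OF pr(1) p] and xp = Cmp_in[OF pr(2) x]
  \<comment> \<open>An arrow into the biproduct is killed by \<open>d'\<close> iff its components
    form a commutative square with \<open>p\<close> and \<open>x\<close>, so the kernel
    \<open>Q\<close> of \<open>d'\<close> is the pullback.\<close>
  define d' where "d' = sub (p \<cdot> pr1 P) (x \<cdot> pr2 P)"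
  have d': "d' \<in> Hom C (bp_ob P) K" unfolding d'_def by (rule sub_in[OF pp xp])
  have d'0: "d' \<cdot> z = Zer C Z K \<longleftrightarrow> p \<cdot> (pr1 P \<cdot> z) = x \<cdot> (pr2 P \<cdot> z)" if z: "z \<in> Hom C Z (bp_ob P)"
      for z Z
    using sub_Cmp[OF z pp xp] Cmp_assoc[OF z pr(1) p] Cmp_assoc[OF z pr(2) x]
      sub_eq_Zer_iff[OF Cmp_in[OF Cmp_in[OF z pr(1)] p] Cmp_in[OF Cmp_in[OF z pr(2)] x]]
          by (simp add: d'_def)
  have d'i: "d' \<cdot> in1 P = p"
    using sub_Cmp[OF in12(1) pp xp] Cmp_assoc[OF in12(1) pr(1) p] Cmp_assoc[OF in12(1) pr(2) x] e
      Cmp_Idn[OF p] Cmp_Zer[OF x ob(1)] sub_Zer[OF p] by (simp add: d'_def)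
  have ed': "epic C d'"
  proof (rule epicI[OF d'])
    fix Z h assume h: "h \<in> Hom C K Z" "h \<cdot> d' = Zer C (bp_ob P) Z"
    have "h \<cdot> p = Zer C A Z"
      using Cmp_assoc[OF in12(1) d' h(1)] d'i h(2) Zer_Cmp[OF in12(1) Hom_Cod_Obj[OF h(1)]] by simp
    then show "h = Zer C K Z" using epicD_Zer[OF d(3) p h(1)] by simp
  qed
  obtain Q k where k: "k \<in> Hom C Q (bp_ob P)" "is_kernel C k d'" using kernel_exists[OF d'] by metis
  note kD = is_kernelD[OF k(2) d' k(1)]
  note cD = is_cokernelD[OF epic_cokernel_of_kernel[OF ed' k(2)] k(1) d']
  note p2k = Cmp_in[OF k(1) pr(2)] and p1k = Cmp_in[OF k(1) pr(1)]
  have sq: "p \<cdot> (pr1 P \<cdot> k) = x \<cdot> (pr2 P \<cdot> k)" using d'0[OF k(1)] kD(1) by simp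
  \<comment> \<open>The projection of the pullback to \<open>X\<close> is epic: if \<open>h\<close>
    kills it, then \<open>h \<cdot> pr2 P\<close> kills the kernel of \<open>d'\<close> and factors
    through \<open>d'\<close> as \<open>u\<close>; restricting to \<open>A\<close> gives
    \<open>u \<cdot> p = 0\<close>, so \<open>u\<close> vanishes.\<close>
  have ep2k: "epic C (pr2 P \<cdot> k)"
  proof (rule epicI[OF p2k])
    fix Z h assume h: "h \<in> Hom C X Z" "h \<cdot> (pr2 P \<cdot> k) = Zer C Q Z"
    note Z = Hom_Cod_Obj[OF h(1)]
    have "h \<cdot> pr2 P \<cdot> k = Zer C Q Z" using Cmp_assoc[OF k(1) pr(2) h(1)] h(2) by simp
    then obtain u where u: "u \<in> Hom C K Z" "u \<cdot> d' = h \<cdot> pr2 P"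
        using cD(3)[OF Cmp_in[OF pr(2) h(1)]] by blast
    have "u \<cdot> p = Zer C A Z"
      using Cmp_assoc[OF in12(1) d' u(1)] d'i u(2) Cmp_assoc[OF in12(1) pr(2) h(1)]
          e(4) Cmp_Zer[OF h(1) ob(1)] by simp
    then have "u = Zer C K Z" using epicD_Zer[OF d(3) p u(1)] by simp
    then have "h \<cdot> pr2 P = Zer C (bp_ob P) Z" using u(2) Zer_Cmp[OF d' Z] by simp
    then show "h = Zer C X Z"
      using Cmp_assoc[OF in12(2) pr(2) h(1)] e(2) Cmp_Idn[OF h(1)] Zer_Cmp[OF in12(2) Z] by simp
  qed
  have "d' \<cdot> (in1 P \<cdot> i) = Zer C E K"
    using Cmp_assoc[OF i in12(1) d'] d'i d(1) by simp
  then obtain j where j: "j \<in> Hom C E Q" "k \<cdot> j = in1 P \<cdot> i" using kD(3)[OF Cmp_in[OF i in12(1)]]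
      by blast
  have p1j: "pr1 P \<cdot> k \<cdot> j = i"
    using Cmp_assoc[OF j(1) k(1) pr(1)] j(2) Cmp_assoc[OF i in12(1) pr(1)] e(1) Idn_Cmp[OF i] by simp
  have p2j: "pr2 P \<cdot> k \<cdot> j = Zer C E X"
    using Cmp_assoc[OF j(1) k(1) pr(2)] j(2) Cmp_assoc[OF i in12(1) pr(2)] e(4) Zer_Cmp[OF i ob(2)]
        by simp
  \<comment> \<open>An arrow into the pullback with zero component in \<open>X\<close> has its other
    component killed by \<open>p\<close>, hence it comes from \<open>E\<close>.\<close>
  have "is_kernel C j (pr2 P \<cdot> k)"
  proof (rule is_kernelI[OF j(1) p2k p2j])
    show "monic C j"
    proof (rule monicI[OF j(1)])
      fix Z z assume z: "z \<in> Hom C Z E" "j \<cdot> z = Zer C Z Q"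
      have "i \<cdot> z = Zer C Z A"
        using Cmp_assoc[OF z(1) j(1) p1k] p1j z(2) Cmp_Zer[OF p1k Hom_Dom_Obj[OF z(1)]] by simp
      then show "z = Zer C Z E" using monicD_Zer[OF d(2) i z(1)] by simp
    qed
    fix Z z assume z: "z \<in> Hom C Z Q" "pr2 P \<cdot> k \<cdot> z = Zer C Z X"
    note Z = Hom_Dom_Obj[OF z(1)]
    have "p \<cdot> (pr1 P \<cdot> k \<cdot> z) = x \<cdot> (pr2 P \<cdot> k \<cdot> z)"
      using Cmp_assoc[OF z(1) p1k p] Cmp_assoc[OF z(1) p2k x] sq by simp
    then have "p \<cdot> (pr1 P \<cdot> k \<cdot> z) = Zer C Z K" using z(2) Cmp_Zer[OF x Z] by simp
    then obtain w where w: "w \<in> Hom C Z E" "i \<cdot> w = pr1 P \<cdot> k \<cdot> z"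
        using d(4)[OF Cmp_in[OF z(1) p1k]] by blast
    have jw: "j \<cdot> w \<in> Hom C Z Q" using Cmp_in[OF w(1) j(1)] .
    have "k \<cdot> (j \<cdot> w) = k \<cdot> z"
    proof (rule biprod_ext_to[OF P Cmp_in[OF jw k(1)] Cmp_in[OF z(1) k(1)]])
      show "pr1 P \<cdot> (k \<cdot> (j \<cdot> w)) = pr1 P \<cdot> (k \<cdot> z)"
        using Cmp_assoc[OF jw k(1) pr(1)] Cmp_assoc[OF z(1) k(1) pr(1)] Cmp_assoc[OF w(1) j(1) p1k]
            p1j w(2) by simp
      show "pr2 P \<cdot> (k \<cdot> (j \<cdot> w)) = pr2 P \<cdot> (k \<cdot> z)"
        using Cmp_assoc[OF jw k(1) pr(2)] Cmp_assoc[OF z(1) k(1) pr(2)] Cmp_assoc[OF w(1) j(1) p2k]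
            p2j z(2)
          Zer_Cmp[OF w(1) ob(2)] by simp
    qed
    then have "j \<cdot> w = z" using monicD[OF kD(2) k(1) jw z(1)] by simp
    then show "\<exists>u \<in> Hom C Z E. j \<cdot> u = z" using w(1) by blast
  qed
  then have "short_exact C j (pr2 P \<cdot> k)" by (rule short_exact_of_epic[OF ep2k])
  then have "(j, pr2 P \<cdot> k) \<in> extensions C X E" unfolding extensions_iff using j(1) p2k by blast
  then have "(j, pr2 P \<cdot> k) \<in> split_extensions C X E" using split by blast
  then obtain B s where s: "j \<in> Hom C E B" "s \<in> Hom C X B" "pr2 P \<cdot> k \<cdot> s = Idn C X"
    unfolding split_extensions_iff by blast
  have sQ: "s \<in> Hom C X Q" using s(1,2) HomD(3)[OF j(1)] HomD(3)[OF s(1)] by simp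
  have "p \<cdot> (pr1 P \<cdot> k \<cdot> s) = x"
    using Cmp_assoc[OF sQ p1k p] sq Cmp_assoc[OF sQ p2k x] s(3) Cmp_Idn[OF x] by simp
  then show ?thesis using Cmp_in[OF sQ p1k] by blast
qed

end

section \<open>Small sets\<close>

lemma small_subset: "small U Y \<Longrightarrow> X \<subseteq> Y \<Longrightarrow> small U X"
  unfolding small_def using card_of_mono1 ordLeq_ordLess_trans by blast

lemma small_image: "small U X \<Longrightarrow> small U (f ` X)"
  unfolding small_def using card_of_image ordLeq_ordLess_trans by blast

lemma universe_infinite: "universe (U :: 'u itself) \<Longrightarrow> infinite (UNIV :: 'u set)"
  unfolding universe_def using natLeq_ordLeq_cinfinite ordLess_imp_ordLeq
  by (metis Field_card_of card_of_Card_order infinite_iff_natLeq_ordLeq)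

lemma small_nat: "universe U \<Longrightarrow> small U (X :: nat set)"
proof -
  assume "universe U"
  then have "small U (UNIV :: nat set)"
    unfolding universe_def small_def using card_of_nat ordIso_ordLess_trans by blast
  then show ?thesis by (rule small_subset) simp
qed

text \<open>This is where regularity of the universe enters, in the form of stability of the
  cardinal.\<close>

lemma small_Sigma:
  assumes "universe (U :: 'u itself)" "small U A" "\<And>a. a \<in> A \<Longrightarrow> small U (F a)"
  shows "small U (SIGMA a : A. F a)"
proof -
  have "stable |UNIV :: 'u set|"
    using assms(1) universe_infinite[OF assms(1)] card_of_Card_order unfolding universe_def
    by (intro regularCard_stable) (simp_all add: Field_card_of)
  then show ?thesis using assms(2,3) unfolding small_def by (rule stable_elim)
qed

lemma small_UN:
  assumes "universe U" "small U A" "\<And>a. a \<in> A \<Longrightarrow> small U (F a)"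
  shows "small U (\<Union>a\<in>A. F a)"
proof -
  have "(\<Union>a\<in>A. F a) \<subseteq> snd ` (SIGMA a : A. F a)" by force
  moreover have "small U (snd ` (SIGMA a : A. F a))" using assms by (intro small_image small_Sigma)
  ultimately show ?thesis using small_subset by blast
qed

lemma small_embed:
  assumes "small (U :: 'u itself) X"
  obtains e :: "'x \<Rightarrow> 'u" where "inj_on e (X :: 'x set)"
proof -
  have "|X| \<le>o |UNIV :: 'u set|" using assms unfolding small_def by (rule ordLess_imp_ordLeq)
  then show thesis using that unfolding card_of_ordLeq[symmetric] by blast
qed

text \<open>The strong limit property is assumed for subsets of \<open>'u\<close> only; an injection
  of \<open>X\<close> into \<open>'u\<close> carries it over.\<close>

lemma small_Pow:
  assumes U: "universe (U :: 'u itself)" and X: "small U X"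
  shows "small U (Pow X)"
proof -
  obtain e :: "_ \<Rightarrow> 'u" where e: "inj_on e X" using small_embed[OF X] by metis
  have "small U (Pow (e ` X))" using U small_image[OF X] unfolding universe_def by blast
  then have "small U ((`) (inv_into X e) ` Pow (e ` X))" by (rule small_image)
  moreover have "Pow X \<subseteq> (`) (inv_into X e) ` Pow (e ` X)"
  proof
    fix Y assume "Y \<in> Pow X"
    then have "Y = inv_into X e ` (e ` Y)" "e ` Y \<in> Pow (e ` X)"
      using e by (auto simp: inv_into_image_cancel)
    then show "Y \<in> (`) (inv_into X e) ` Pow (e ` X)" by blast
  qed
  ultimately show ?thesis by (rule small_subset)
qed


section \<open>Colimits over small categories of arbitrary type\<close>

text \<open>Renaming of objects and arrows along maps injective on \<open>J\<close>. Cocompleteness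
  and direct limits are stated for shapes over \<open>'u\<close>, whereas the diagrams below are
  indexed by finite sets, natural numbers and arrows.\<close>

definition transport_cat :: "('j \<Rightarrow> 'a) \<Rightarrow> ('k \<Rightarrow> 'b) \<Rightarrow> ('j, 'k, 'x) cat_scheme \<Rightarrow> ('a, 'b) cat" where
  "transport_cat e a J =
     (let ei = inv_into (Obj J) e; ai = inv_into (Arr J) a
      in \<lparr>Obj = e ` Obj J, Arr = a ` Arr J, Dom = (\<lambda>u. e (Dom J (ai u))), Cod = (\<lambda>u. e (Cod J (ai u))),
          Cmp = (\<lambda>v u. a (ai v \<cdot>\<^bsub>J\<^esub> ai u)), Idn = (\<lambda>j. a (Idn J (ei j)))\<rparr>)"

definition transport_fctr ::
  "('j \<Rightarrow> 'a) \<Rightarrow> ('k \<Rightarrow> 'b) \<Rightarrow> ('j, 'k, 'x) cat_scheme \<Rightarrow> ('j, 'k, 'o, 'm) fctr \<Rightarrow> ('a, 'b, 'o, 'm) fctr"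
      where
  "transport_fctr e a J F =
     \<lparr>fob = (\<lambda>j. fob F (inv_into (Obj J) e j)), far = (\<lambda>u. far F (inv_into (Arr J) a u))\<rparr>"

locale cat_transport = category J for J :: "('j, 'k, 'x) cat_scheme" (structure) +
  fixes e :: "'j \<Rightarrow> 'a" and a :: "'k \<Rightarrow> 'b"
  assumes e: "inj_on e (Obj J)" and a: "inj_on a (Arr J)"
begin

abbreviation "J' \<equiv> transport_cat e a J"
abbreviation "F' F \<equiv> transport_fctr e a J F"

lemma tr_simps [simp]:
  "Obj J' = e ` Obj J" "Arr J' = a ` Arr J"
  "u \<in> Arr J \<Longrightarrow> Dom J' (a u) = e (Dom J u)" "u \<in> Arr J \<Longrightarrow> Cod J' (a u) = e (Cod J u)"
  "u \<in> Arr J \<Longrightarrow> v \<in> Arr J \<Longrightarrow> Cmp J' (a v) (a u) = a (v \<cdot> u)"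
  "j \<in> Obj J \<Longrightarrow> Idn J' (e j) = a (Idn J j)"
  "j \<in> Obj J \<Longrightarrow> fob (F' F) (e j) = fob F j" "u \<in> Arr J \<Longrightarrow> far (F' F) (a u) = far F u"
  using e a by (simp_all add: transport_cat_def transport_fctr_def Let_def)

lemma Hom_tr: "i \<in> Obj J \<Longrightarrow> j \<in> Obj J \<Longrightarrow> Hom J' (e i) (e j) = a ` Hom J i j"
  using Dom_in Cod_in inj_onD[OF e] by (auto simp: Hom_def)

lemma Hom_trE:
  assumes "u \<in> Hom J' x y"
  obtains i j v where "x = e i" "y = e j" "u = a v" "i \<in> Obj J" "j \<in> Obj J" "v \<in> Hom J i j"
  using assms Dom_in Cod_in by (auto simp: Hom_def)

lemma category_tr: "category J'"
proof
  fix A B D E f g h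
  show "f \<in> Arr J' \<Longrightarrow> Dom J' f \<in> Obj J'" "f \<in> Arr J' \<Longrightarrow> Cod J' f \<in> Obj J'"
    using Dom_in Cod_in by auto
  show "A \<in> Obj J' \<Longrightarrow> Idn J' A \<in> Hom J' A A" using Hom_tr Idn_in by auto
  assume f: "f \<in> Hom J' A B"
  then obtain i j u where u: "A = e i" "B = e j" "f = a u" "i \<in> Obj J" "j \<in> Obj J" "u \<in> Hom J i j"
    by (rule Hom_trE)
  show "Cmp J' f (Idn J' A) = f" "Cmp J' (Idn J' B) f = f"
    using u Cmp_Idn[OF u(6)] Idn_Cmp[OF u(6)] HomD(1)[OF u(6)] by auto
  assume g: "g \<in> Hom J' B D"
  then obtain j' k v where v: "B = e j'" "D = e k" "g = a v" "j' \<in> Obj J" "k \<in> Obj J" "v \<in> Hom J j' k"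
    by (rule Hom_trE)
  have "j' = j" using u(2,5) v(1,4) inj_onD[OF e] by metis
  with v(6) have v6: "v \<in> Hom J j k" by simp
  show "Cmp J' g f \<in> Hom J' A D"
    using u v Cmp_in[OF u(6) v6] Hom_tr[of i k] HomD(1)[OF u(6)] HomD(1)[OF v6] by auto
  assume h: "h \<in> Hom J' D E"
  then obtain k' l w where w: "D = e k'" "E = e l" "h = a w" "k' \<in> Obj J" "l \<in> Obj J" "w \<in> Hom J k' l"
    by (rule Hom_trE)
  have "k' = k" using v(2,5) w(1,4) inj_onD[OF e] by metis
  with w(6) have w6: "w \<in> Hom J k l" by simp
  show "Cmp J' h (Cmp J' g f) = Cmp J' (Cmp J' h g) f"
    using u v w Cmp_assoc[OF u(6) v6 w6] HomD(1)[OF u(6)] HomD(1)[OF v6] HomD(1)[OF w6]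
      HomD(1)[OF Cmp_in[OF u(6) v6]] HomD(1)[OF Cmp_in[OF v6 w6]] by simp
qed

lemma functor_tr: "functor J C F \<Longrightarrow> functor J' C (F' F)"
  using category_tr Dom_in Cod_in Arr_Cmp(1) Idn_simps(1) inj_onD[OF e]
  unfolding functor_def by (auto 0 3)

lemma cocone_tr: "functor J C F \<Longrightarrow> cocone J' C (F' F) L t \<longleftrightarrow> cocone J C F L (t \<circ> e)"
  using functor_tr Dom_in Cod_in unfolding cocone_def by auto

lemma colimit_tr:
  assumes F: "functor J C F"
  shows "is_colimit J' C (F' F) L t \<longleftrightarrow> is_colimit J C F L (t \<circ> e)"
proof -
  \<comment> \<open>Cocones are constrained only at objects of \<open>J\<close>, where
    \<open>inv_into\<close> undoes \<open>e\<close>; so reindexing the legs is a bijection between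
    cocones on both diagrams.\<close>
  have "cocone J C F M (s \<circ> inv_into (Obj J) e \<circ> e) = cocone J C F M s" for M s
    using e Dom_in Cod_in unfolding cocone_def by auto
  then have cc: "cocone J' C (F' F) M (s \<circ> inv_into (Obj J) e) = cocone J C F M s" for M s
    using cocone_tr[OF F] by auto
  show ?thesis
  proof
    assume L: "is_colimit J' C (F' F) L t"
    show "is_colimit J C F L (t \<circ> e)" unfolding is_colimit_def
    proof (intro conjI allI impI)
      show "cocone J C F L (t \<circ> e)" using L cocone_tr[OF F] unfolding is_colimit_def by blast
      fix M s assume "cocone J C F M s"
      then have "cocone J' C (F' F) M (s \<circ> inv_into (Obj J) e)" using cc by blast
      then have "\<exists>!h. h \<in> Hom C L M \<and> (\<forall>j \<in> Obj J'. h \<cdot>\<^bsub>C\<^esub> t j = (s \<circ> inv_into (Obj J) e) j)"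
        using L unfolding is_colimit_def by blast
      then show "\<exists>!h. h \<in> Hom C L M \<and> (\<forall>j \<in> Obj J. h \<cdot>\<^bsub>C\<^esub> (t \<circ> e) j = s j)" using e by simp
    qed
  next
    assume L: "is_colimit J C F L (t \<circ> e)"
    show "is_colimit J' C (F' F) L t" unfolding is_colimit_def
    proof (intro conjI allI impI)
      show "cocone J' C (F' F) L t" using L cocone_tr[OF F] unfolding is_colimit_def by blast
      fix M s assume "cocone J' C (F' F) M s"
      then have "cocone J C F M (s \<circ> e)" using cocone_tr[OF F] by blast
      then have "\<exists>!h. h \<in> Hom C L M \<and> (\<forall>j \<in> Obj J. h \<cdot>\<^bsub>C\<^esub> (t \<circ> e) j = (s \<circ> e) j)"
        using L unfolding is_colimit_def by blast
      then show "\<exists>!h. h \<in> Hom C L M \<and> (\<forall>j \<in> Obj J'. h \<cdot>\<^bsub>C\<^esub> t j = s j)" by simp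
    qed
  qed
qed

lemma filtered_tr:
  assumes "filtered J" shows "filtered J'"
  unfolding filtered_def
proof (intro conjI ballI impI)
  show "Obj J' \<noteq> {}" using assms by (auto simp: filtered_def)
  fix x y assume "x \<in> Obj J'" "y \<in> Obj J'"
  then obtain i j where ij: "x = e i" "y = e j" "i \<in> Obj J" "j \<in> Obj J" by auto
  then obtain k where "k \<in> Obj J" "Hom J i k \<noteq> {}" "Hom J j k \<noteq> {}"
      using assms unfolding filtered_def by blast
  then show "\<exists>z \<in> Obj J'. Hom J' x z \<noteq> {} \<and> Hom J' y z \<noteq> {}" using ij Hom_tr by auto
next
  fix f g assume fg: "f \<in> Arr J'" "g \<in> Arr J'" "Dom J' f = Dom J' g \<and> Cod J' f = Cod J' g"
  then obtain u v where uv: "f = a u" "g = a v" "u \<in> Arr J" "v \<in> Arr J" by auto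
  then have "Dom J u = Dom J v \<and> Cod J u = Cod J v" using fg(3) Dom_in Cod_in inj_onD[OF e] by simp
  then obtain w where w: "w \<in> Arr J" "Dom J w = Cod J u" "w \<cdot> u = w \<cdot> v"
    using assms uv unfolding filtered_def by blast
  then show "\<exists>w \<in> Arr J'. Dom J' w = Cod J' f \<and> Cmp J' w f = Cmp J' w g"
    using uv by (intro bexI[of _ "a w"]) auto
qed

end

lemma small_cat_transport:
  assumes J: "small_cat (U :: 'u itself) J"
  obtains e :: "'j \<Rightarrow> 'u" and a :: "'k \<Rightarrow> 'u"
    where "cat_transport (J :: ('j, 'k, 'x) cat_scheme) e a" "small_cat U (transport_cat e a J)"
proof -
  have c: "category J" using J by (simp add: small_cat_def)
  obtain e :: "'j \<Rightarrow> 'u" where e: "inj_on e (Obj J)" using J small_embed unfolding small_cat_def by metis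
  obtain a :: "'k \<Rightarrow> 'u" where a: "inj_on a (Arr J)" using J small_embed unfolding small_cat_def by metis
  have t: "cat_transport J e a" using c e a by (simp add: cat_transport_def cat_transport_axioms_def)
  have "small_cat U (transport_cat e a J)"
    using J cat_transport.category_tr[OF t] cat_transport.tr_simps(1,2)[OF t] small_image
    unfolding small_cat_def by metis
  then show thesis using that t by blast
qed

lemma colimit_exists:
  assumes "cocomplete (U :: 'u itself) C" "small_cat U J" "functor J C F"
  obtains L l where "is_colimit J C F L l"
proof -
  obtain e :: "_ \<Rightarrow> 'u" and a :: "_ \<Rightarrow> 'u" where t: "cat_transport J e a"
      and s: "small_cat U (transport_cat e a J)"
    by (rule small_cat_transport[OF assms(2)])
  obtain L l where "is_colimit (transport_cat e a J) C (transport_fctr e a J F) L l"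
    using assms(1) s cat_transport.functor_tr[OF t assms(3)] unfolding cocomplete_def by blast
  then show thesis using cat_transport.colimit_tr[OF t assms(3)] that by blast
qed

lemma colimitD:
  assumes "is_colimit J C F L l"
  shows "functor J C F" "L \<in> Obj C" "j \<in> Obj J \<Longrightarrow> l j \<in> Hom C (fob F j) L"
    "u \<in> Hom J i j \<Longrightarrow> l j \<cdot>\<^bsub>C\<^esub> far F u = l i"
    "cocone J C F M t \<Longrightarrow> \<exists>h \<in> Hom C L M. \<forall>j \<in> Obj J. h \<cdot>\<^bsub>C\<^esub> l j = t j"
  using assms unfolding is_colimit_def cocone_def Hom_def by blast+

lemma functorD:
  assumes "functor A B F"
  shows "category A" "category B" "X \<in> Obj A \<Longrightarrow> fob F X \<in> Obj B"
    "f \<in> Hom A X Y \<Longrightarrow> far F f \<in> Hom B (fob F X) (fob F Y)"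
    "X \<in> Obj A \<Longrightarrow> far F (Idn A X) = Idn B (fob F X)"
    "f \<in> Hom A X Y \<Longrightarrow> g \<in> Hom A Y Z \<Longrightarrow> far F (g \<cdot>\<^bsub>A\<^esub> f) = far F g \<cdot>\<^bsub>B\<^esub> far F f"
  using assms unfolding functor_def Hom_def by auto

lemma colimit_ext:
  assumes L: "is_colimit J C F L l" and h: "h \<in> Hom C L M" "h' \<in> Hom C L M"
    and eq: "\<And>j. j \<in> Obj J \<Longrightarrow> h \<cdot>\<^bsub>C\<^esub> l j = h' \<cdot>\<^bsub>C\<^esub> l j"
  shows "h = h'"
proof -
  note D = colimitD[OF L]
  interpret C: category C using functorD(2)[OF D(1)] .
  interpret J: category J using functorD(1)[OF D(1)] .
  have "cocone J C F M (\<lambda>j. h \<cdot>\<^bsub>C\<^esub> l j)" unfolding cocone_def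
  proof (intro conjI ballI)
    show "functor J C F" "M \<in> Obj C" using D(1) h C.Hom_Cod_Obj by blast+
    show "h \<cdot>\<^bsub>C\<^esub> l j \<in> Hom C (fob F j) M" if "j \<in> Obj J" for j using C.Cmp_in[OF D(3)[OF that] h(1)] .
    fix u assume "u \<in> Arr J"
    then have u: "u \<in> Hom J (Dom J u) (Cod J u)" by (rule J.Arr_Hom)
    show "h \<cdot>\<^bsub>C\<^esub> l (Cod J u) \<cdot>\<^bsub>C\<^esub> far F u = h \<cdot>\<^bsub>C\<^esub> l (Dom J u)"
      using C.Cmp_assoc[OF functorD(4)[OF D(1) u] D(3)[OF J.Hom_Cod_Obj[OF u]] h(1)] D(4)[OF u] by simp
  qed
  then have "\<exists>!k. k \<in> Hom C L M \<and> (\<forall>j \<in> Obj J. k \<cdot>\<^bsub>C\<^esub> l j = h \<cdot>\<^bsub>C\<^esub> l j)"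
    using L unfolding is_colimit_def by blast
  then show ?thesis using h eq by metis
qed

text \<open>Surjectivity and injectivity of the canonical map from the colimit of the
  \<open>Hom C K (fob F j)\<close> to \<open>Hom C K L\<close>. In a filtered shape two arrows can
  be moved to a common stage first, so injectivity is phrased within one stage.\<close>

definition factors_through_stages ::
  "('j, 'k, 'x) cat_scheme \<Rightarrow> ('o, 'm, 'y) cat_scheme \<Rightarrow> ('j, 'k, 'o, 'm) fctr \<Rightarrow> 'o \<Rightarrow> ('j \<Rightarrow> 'm) \<Rightarrow> 'o \<Rightarrow>
      bool" where
  "factors_through_stages J C F L l K \<longleftrightarrow>
     (\<forall>f \<in> Hom C K L. \<exists>j \<in> Obj J. \<exists>g \<in> Hom C K (fob F j). l j \<cdot>\<^bsub>C\<^esub> g = f) \<and>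
     (\<forall>j \<in> Obj J. \<forall>g \<in> Hom C K (fob F j). \<forall>g' \<in> Hom C K (fob F j). l j \<cdot>\<^bsub>C\<^esub> g = l j \<cdot>\<^bsub>C\<^esub> g' \<longrightarrow>
        (\<exists>k \<in> Obj J. \<exists>u \<in> Hom J j k. far F u \<cdot>\<^bsub>C\<^esub> g = far F u \<cdot>\<^bsub>C\<^esub> g'))"

text \<open>
  The elementwise form of \<open>finitely_presented\<close>.  Unlike the latter it carries over, by \<open>compactD\<close> below, to
  small filtered categories of any type.
\<close>

definition compact :: "'u itself \<Rightarrow> ('o, 'm, 'x) cat_scheme \<Rightarrow> 'o \<Rightarrow> bool" where
  "compact U C K \<longleftrightarrow> K \<in> Obj C \<and>
     (\<forall>(J :: ('u, 'u) cat) F L l. small_cat U J \<and> filtered J \<and> is_colimit J C F L l \<longrightarrow>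
        factors_through_stages J C F L l K)"

lemma compactD:
  assumes K: "compact (U :: 'u itself) C K" and J: "small_cat U J" "filtered J"
      and L: "is_colimit J C F L l"
  shows "factors_through_stages J C F L l K"
proof -
  note F = colimitD(1)[OF L]
  obtain e :: "_ \<Rightarrow> 'u" and a :: "_ \<Rightarrow> 'u" where t: "cat_transport J e a"
      and s: "small_cat U (transport_cat e a J)"
    by (rule small_cat_transport[OF J(1)])
  interpret t: cat_transport J e a by (rule t)
  define l' where "l' = l \<circ> inv_into (Obj J) e"
  have l': "l' (e j) = l j" if "j \<in> Obj J" for j using that t.e by (simp add: l'_def)
  have "is_colimit J C F L (l' \<circ> e)"
    using L l' t.Dom_in t.Cod_in unfolding is_colimit_def cocone_def by simp
  then have "is_colimit t.J' C (t.F' F) L l'" using t.colimit_tr[OF F] by blast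
  then have fs: "factors_through_stages t.J' C (t.F' F) L l' K"
    using K s t.filtered_tr[OF J(2)] unfolding compact_def by blast
  show ?thesis unfolding factors_through_stages_def
  proof (intro conjI ballI impI)
    fix f assume "f \<in> Hom C K L"
    then obtain x g where "x \<in> Obj t.J'" "g \<in> Hom C K (fob (t.F' F) x)" "l' x \<cdot>\<^bsub>C\<^esub> g = f"
      using fs unfolding factors_through_stages_def by blast
    then obtain j where "j \<in> Obj J" "g \<in> Hom C K (fob F j)" "l j \<cdot>\<^bsub>C\<^esub> g = f" using l' by auto
    then show "\<exists>j \<in> Obj J. \<exists>g \<in> Hom C K (fob F j). l j \<cdot>\<^bsub>C\<^esub> g = f" by blast
  next
    fix j g g' assume *: "j \<in> Obj J" "g \<in> Hom C K (fob F j)" "g' \<in> Hom C K (fob F j)"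
        "l j \<cdot>\<^bsub>C\<^esub> g = l j \<cdot>\<^bsub>C\<^esub> g'"
    have "e j \<in> Obj t.J'" using * by simp
    moreover have "g \<in> Hom C K (fob (t.F' F) (e j))" "g' \<in> Hom C K (fob (t.F' F) (e j))"
      "l' (e j) \<cdot>\<^bsub>C\<^esub> g = l' (e j) \<cdot>\<^bsub>C\<^esub> g'" using * l' by simp_all
    ultimately obtain y u where yu: "y \<in> Obj t.J'" "u \<in> Hom t.J' (e j) y"
        "far (t.F' F) u \<cdot>\<^bsub>C\<^esub> g = far (t.F' F) u \<cdot>\<^bsub>C\<^esub> g'"
      using fs unfolding factors_through_stages_def by blast
    then obtain k where k: "y = e k" "k \<in> Obj J" by auto
    then obtain v where v: "u = a v" "v \<in> Hom J j k" using yu(2) t.Hom_tr[OF *(1) k(2)] by auto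
    then have "far F v \<cdot>\<^bsub>C\<^esub> g = far F v \<cdot>\<^bsub>C\<^esub> g'" using yu(3) t.HomD(1)[OF v(2)] by simp
    then show "\<exists>k \<in> Obj J. \<exists>u \<in> Hom J j k. far F u \<cdot>\<^bsub>C\<^esub> g = far F u \<cdot>\<^bsub>C\<^esub> g'" using k v by blast
  qed
qed

lemma direct_limits_ofI:
  assumes "small_cat (U :: 'u itself) J" "filtered J" "\<And>j. j \<in> Obj J \<Longrightarrow> fob F j \<in> S"
      "is_colimit J C F M l"
  shows "M \<in> direct_limits_of U C S"
proof -
  obtain e :: "_ \<Rightarrow> 'u" and a :: "_ \<Rightarrow> 'u" where t: "cat_transport J e a"
      and s: "small_cat U (transport_cat e a J)"
    by (rule small_cat_transport[OF assms(1)])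
  interpret t: cat_transport J e a by (rule t)
  note F = colimitD(1)[OF assms(4)]
  have "(l \<circ> inv_into (Obj J) e \<circ> e) j = l j" if "j \<in> Obj J" for j using that t.e by simp
  then have "is_colimit J C F M (l \<circ> inv_into (Obj J) e \<circ> e)"
    using assms(4) t.Dom_in t.Cod_in unfolding is_colimit_def cocone_def by simp
  then have "is_colimit t.J' C (t.F' F) M (l \<circ> inv_into (Obj J) e)" using t.colimit_tr[OF F] by blast
  moreover have "\<forall>j \<in> Obj t.J'. fob (t.F' F) j \<in> S" using assms(3) by auto
  ultimately show ?thesis using s t.filtered_tr[OF assms(2)] unfolding direct_limits_of_def by blast
qed

text \<open>\<open>comparison_map\<close> takes the only element of an image; equivalent pairs
  become equal at a later stage and hence have the same composite with the legs.\<close>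

lemma comparison_map_class:
  assumes L: "is_colimit J C F L l" and j: "j \<in> Obj J" and x: "x \<in> Hom C K (fob F j)"
  shows "comparison_map (\<lambda>f x. f \<cdot>\<^bsub>C\<^esub> x) l (colim_rel J F (Hom C K) (\<lambda>f x. f \<cdot>\<^bsub>C\<^esub> x) `` {(j, x)}) =
      l j \<cdot>\<^bsub>C\<^esub> x"
proof -
  let ?R = "colim_rel J F (Hom C K) (\<lambda>f x. f \<cdot>\<^bsub>C\<^esub> x)"
  note D = colimitD[OF L]
  interpret C: category C using functorD(2)[OF D(1)] .
  interpret J: category J using functorD(1)[OF D(1)] .
  have "((j, x), (j, x)) \<in> ?R"
    unfolding colim_rel_def using j x J.Idn_in[OF j] by blast
  moreover have "l i \<cdot>\<^bsub>C\<^esub> y = l j \<cdot>\<^bsub>C\<^esub> x" if R: "((j, x), (i, y)) \<in> ?R" for i y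
  proof -
    obtain k u v where uv: "k \<in> Obj J" "u \<in> Hom J j k" "v \<in> Hom J i k" "far F u \<cdot>\<^bsub>C\<^esub> x = far F v \<cdot>\<^bsub>C\<^esub> y"
      and y: "y \<in> Hom C K (fob F i)"
      using R unfolding colim_rel_def by blast
    show ?thesis
      using C.Cmp_assoc[OF x functorD(4)[OF D(1) uv(2)] D(3)[OF uv(1)]] D(4)[OF uv(2)]
        C.Cmp_assoc[OF y functorD(4)[OF D(1) uv(3)] D(3)[OF uv(1)]] D(4)[OF uv(3)] uv(4) by simp
  qed
  ultimately have "(\<lambda>(i, y). l i \<cdot>\<^bsub>C\<^esub> y) ` (?R `` {(j, x)}) = {l j \<cdot>\<^bsub>C\<^esub> x}"
  proof (intro equalityI subsetI)
    fix z assume "z \<in> (\<lambda>(i, y). l i \<cdot>\<^bsub>C\<^esub> y) ` (?R `` {(j, x)})"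
    then obtain i y where "((j, x), (i, y)) \<in> ?R" "z = l i \<cdot>\<^bsub>C\<^esub> y" by (elim imageE ImageE) auto
    then show "z \<in> {l j \<cdot>\<^bsub>C\<^esub> x}"
      using \<open>\<And>y i. ((j, x), (i, y)) \<in> ?R \<Longrightarrow> l i \<cdot>\<^bsub>C\<^esub> y = l j \<cdot>\<^bsub>C\<^esub> x\<close> by blast
  next
    fix z assume "z \<in> {l j \<cdot>\<^bsub>C\<^esub> x}"
    then show "z \<in> (\<lambda>(i, y). l i \<cdot>\<^bsub>C\<^esub> y) ` (?R `` {(j, x)})"
      using \<open>((j, x), (j, x)) \<in> ?R\<close> by (intro image_eqI[of _ _ "(j, x)"]) auto
  qed
  then show ?thesis unfolding comparison_map_def by simp
qed

lemma finitely_presented_compact: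
  assumes "finitely_presented U C K" shows "compact U C K"
  unfolding compact_def
proof (intro conjI allI impI)
  show "K \<in> Obj C" using assms unfolding finitely_presented_def by blast
  fix J :: "('a, 'a) cat" and F L l
  assume *: "small_cat U J \<and> filtered J \<and> is_colimit J C F L l"
  then have L: "is_colimit J C F L l" by blast
  note D = colimitD[OF L]
  interpret C: category C using functorD(2)[OF D(1)] .
  interpret J: category J using functorD(1)[OF D(1)] .
  let ?R = "colim_rel J F (Hom C K) (\<lambda>f x. f \<cdot>\<^bsub>C\<^esub> x)"
  have bij: "bij_betw (comparison_map (\<lambda>f x. f \<cdot>\<^bsub>C\<^esub> x) l) (colim_set J F (Hom C K) (\<lambda>f x. f \<cdot>\<^bsub>C\<^esub> x))
      (Hom C K L)"
    using assms * unfolding finitely_presented_def respects_direct_limits_def by blast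
  show "factors_through_stages J C F L l K" unfolding factors_through_stages_def
  proof (intro conjI ballI impI)
    fix f assume "f \<in> Hom C K L"
    then obtain Q where Q: "Q \<in> colim_set J F (Hom C K) (\<lambda>f x. f \<cdot>\<^bsub>C\<^esub> x)"
        "f = comparison_map (\<lambda>f x. f \<cdot>\<^bsub>C\<^esub> x) l Q"
      using bij unfolding bij_betw_def by blast
    then obtain j x where "j \<in> Obj J" "x \<in> Hom C K (fob F j)" "Q = ?R `` {(j, x)}"
      unfolding colim_set_def by (auto elim!: quotientE)
    then show "\<exists>j \<in> Obj J. \<exists>g \<in> Hom C K (fob F j). l j \<cdot>\<^bsub>C\<^esub> g = f"
      using Q(2) comparison_map_class[OF L] by metis
  next
    fix j g g' assume j: "j \<in> Obj J" and g: "g \<in> Hom C K (fob F j)" and g': "g' \<in> Hom C K (fob F j)"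
      and eq: "l j \<cdot>\<^bsub>C\<^esub> g = l j \<cdot>\<^bsub>C\<^esub> g'"
    have in_set: "?R `` {(j, x)} \<in> colim_set J F (Hom C K) (\<lambda>f x. f \<cdot>\<^bsub>C\<^esub> x)"
      if "x \<in> Hom C K (fob F j)" for x
      unfolding colim_set_def using j that by (intro quotientI) auto
    have "?R `` {(j, g)} = ?R `` {(j, g')}"
      using inj_onD[OF bij_betw_imp_inj_on[OF bij] _ in_set[OF g] in_set[OF g']]
        comparison_map_class[OF L j g] comparison_map_class[OF L j g'] eq by simp
    moreover have "((j, g'), (j, g')) \<in> ?R"
      unfolding colim_rel_def using j g' J.Idn_in[OF j] by blast
    ultimately have "((j, g), (j, g')) \<in> ?R" by blast
    then obtain k u v where uv: "k \<in> Obj J" "u \<in> Hom J j k" "v \<in> Hom J j k"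
        "far F u \<cdot>\<^bsub>C\<^esub> g = far F v \<cdot>\<^bsub>C\<^esub> g'"
      unfolding colim_rel_def by blast
    \<comment> \<open>Equality of the classes yields two possibly different arrows \<open>u\<close>
      and \<open>v\<close> from \<open>j\<close> to \<open>k\<close>; filteredness provides
      \<open>w\<close> that equalizes them.\<close>
    have "\<forall>u \<in> Arr J. \<forall>v \<in> Arr J. Dom J u = Dom J v \<and> Cod J u = Cod J v \<longrightarrow>
        (\<exists>w \<in> Arr J. Dom J w = Cod J u \<and> w \<cdot>\<^bsub>J\<^esub> u = w \<cdot>\<^bsub>J\<^esub> v)"
      using * unfolding filtered_def by blast
    then obtain w where w: "w \<in> Arr J" "Dom J w = k" "w \<cdot>\<^bsub>J\<^esub> u = w \<cdot>\<^bsub>J\<^esub> v"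
      using J.HomD[OF uv(2)] J.HomD[OF uv(3)] by metis
    then have wH: "w \<in> Hom J k (Cod J w)" by (simp add: Hom_def)
    note wu = J.Cmp_in[OF uv(2) wH]
    have "far F (w \<cdot>\<^bsub>J\<^esub> u) \<cdot>\<^bsub>C\<^esub> g = far F w \<cdot>\<^bsub>C\<^esub> (far F u \<cdot>\<^bsub>C\<^esub> g)"
      using C.Cmp_assoc[OF g functorD(4)[OF D(1) uv(2)] functorD(4)[OF D(1) wH]]
        functorD(6)[OF D(1) uv(2) wH] by simp
    moreover have "far F (w \<cdot>\<^bsub>J\<^esub> v) \<cdot>\<^bsub>C\<^esub> g' = far F w \<cdot>\<^bsub>C\<^esub> (far F v \<cdot>\<^bsub>C\<^esub> g')"
      using C.Cmp_assoc[OF g' functorD(4)[OF D(1) uv(3)] functorD(4)[OF D(1) wH]]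
        functorD(6)[OF D(1) uv(3) wH] by simp
    ultimately have "far F (w \<cdot>\<^bsub>J\<^esub> u) \<cdot>\<^bsub>C\<^esub> g = far F (w \<cdot>\<^bsub>J\<^esub> u) \<cdot>\<^bsub>C\<^esub> g'"
      using uv(4) w(3) by simp
    then show "\<exists>k \<in> Obj J. \<exists>u \<in> Hom J j k. far F u \<cdot>\<^bsub>C\<^esub> g = far F u \<cdot>\<^bsub>C\<^esub> g'"
      using wu J.Hom_Cod_Obj by blast
  qed
qed

section \<open>Directed systems\<close>

definition preorder_cat :: "'p set \<Rightarrow> ('p \<Rightarrow> 'p \<Rightarrow> bool) \<Rightarrow> ('p, 'p \<times> 'p) cat" where
  "preorder_cat P leq =
     \<lparr>Obj = P, Arr = {(p, q). p \<in> P \<and> q \<in> P \<and> leq p q}, Dom = fst, Cod = snd,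
      Cmp = (\<lambda>g f. (fst f, snd g)), Idn = (\<lambda>p. (p, p))\<rparr>"

definition system_fctr :: "('p \<Rightarrow> 'o) \<Rightarrow> ('p \<Rightarrow> 'p \<Rightarrow> 'm) \<Rightarrow> ('p, 'p \<times> 'p, 'o, 'm) fctr" where
  "system_fctr a f = \<lparr>fob = a, far = (\<lambda>(p, q). f p q)\<rparr>"

text \<open>Only a preorder is asked for, because arrows into a fixed object will be compared by
  factoring one through the other.\<close>

locale directed_system = category C for C :: "('o, 'm, 'x) cat_scheme" (structure) +
  fixes P :: "'p set" and leq :: "'p \<Rightarrow> 'p \<Rightarrow> bool" and a :: "'p \<Rightarrow> 'o" and \<phi> :: "'p \<Rightarrow> 'p \<Rightarrow> 'm"
  assumes nonempty: "P \<noteq> {}"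
    and le_refl: "p \<in> P \<Longrightarrow> leq p p"
    and le_trans: "p \<in> P \<Longrightarrow> q \<in> P \<Longrightarrow> r \<in> P \<Longrightarrow> leq p q \<Longrightarrow> leq q r \<Longrightarrow> leq p r"
    and directed: "p \<in> P \<Longrightarrow> q \<in> P \<Longrightarrow> \<exists>r \<in> P. leq p r \<and> leq q r"
    and trans_in: "p \<in> P \<Longrightarrow> q \<in> P \<Longrightarrow> leq p q \<Longrightarrow> \<phi> p q \<in> Hom C (a p) (a q)"
    and trans_refl: "p \<in> P \<Longrightarrow> \<phi> p p = Idn C (a p)"
    and trans_Cmp: "p \<in> P \<Longrightarrow> q \<in> P \<Longrightarrow> r \<in> P \<Longrightarrow> leq p q \<Longrightarrow> leq q r \<Longrightarrow> \<phi> q r \<cdot> \<phi> p q = \<phi> p r"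
begin

abbreviation "J \<equiv> preorder_cat P leq"
abbreviation "F \<equiv> system_fctr a \<phi>"

lemma J_simps [simp]:
  "Obj J = P" "Arr J = {(p, q). p \<in> P \<and> q \<in> P \<and> leq p q}" "Dom J u = fst u" "Cod J u = snd u"
  "v \<cdot>\<^bsub>J\<^esub> u = (fst u, snd v)" "Idn J p = (p, p)" "fob F p = a p" "far F (p, q) = \<phi> p q"
  by (simp_all add: preorder_cat_def system_fctr_def)

lemma Hom_J: "Hom J p q = (if p \<in> P \<and> q \<in> P \<and> leq p q then {(p, q)} else {})"
  by (auto simp: Hom_def)

lemma a_Obj: "p \<in> P \<Longrightarrow> a p \<in> Obj C"
  using trans_in[of p p] le_refl Hom_Dom_Obj by blast

lemma category_J: "category J"
  by unfold_locales (auto simp: Hom_J le_refl split: if_splits intro: le_trans)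

lemma functor_F: "functor J C F"
  unfolding functor_def using category_J category_axioms
  by (auto simp: a_Obj trans_in trans_refl trans_Cmp)

lemma filtered_J: "filtered J"
  unfolding filtered_def
proof (intro conjI ballI impI)
  fix u v assume "u \<in> Arr J" "v \<in> Arr J" "Dom J u = Dom J v \<and> Cod J u = Cod J v"
  then show "\<exists>w \<in> Arr J. Dom J w = Cod J u \<and> w \<cdot>\<^bsub>J\<^esub> u = w \<cdot>\<^bsub>J\<^esub> v"
    using le_refl by (intro bexI[of _ "(snd u, snd u)"]) auto
next
  fix i j assume ij: "i \<in> Obj J" "j \<in> Obj J"
  then obtain k where "k \<in> P" "leq i k" "leq j k" using directed[of i j] by auto
  then show "\<exists>k \<in> Obj J. Hom J i k \<noteq> {} \<and> Hom J j k \<noteq> {}"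
    using ij by (intro bexI[of _ k]) (simp_all add: Hom_J)
qed (simp add: nonempty)

lemma small_J: "universe U \<Longrightarrow> small U P \<Longrightarrow> small_cat U J"
proof -
  assume U: "universe U" "small U P"
  have "small U (P \<times> P)" by (rule small_Sigma[OF U U(2)])
  then have "small U (Arr J)" by (rule small_subset) auto
  then show ?thesis using U category_J by (simp add: small_cat_def)
qed

lemma cocone_J:
  assumes "Z \<in> Obj C" "\<And>p. p \<in> P \<Longrightarrow> t p \<in> Hom C (a p) Z"
    "\<And>p q. p \<in> P \<Longrightarrow> q \<in> P \<Longrightarrow> leq p q \<Longrightarrow> t q \<cdot> \<phi> p q = t p"
  shows "cocone J C F Z t"
  unfolding cocone_def using functor_F assms by auto

lemma colim_leg: "is_colimit J C F L l \<Longrightarrow> p \<in> P \<Longrightarrow> l p \<in> Hom C (a p) L"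
  using colimitD(3)[of J C F L l p] by simp

lemma colim_comm:
  "is_colimit J C F L l \<Longrightarrow> p \<in> P \<Longrightarrow> q \<in> P \<Longrightarrow> leq p q \<Longrightarrow> l q \<cdot> \<phi> p q = l p"
  using colimitD(4)[of J C F L l "(p, q)" p q] by (simp add: Hom_J)

lemma colim_univ:
  assumes "is_colimit J C F L l" "Z \<in> Obj C" "\<And>p. p \<in> P \<Longrightarrow> t p \<in> Hom C (a p) Z"
    "\<And>p q. p \<in> P \<Longrightarrow> q \<in> P \<Longrightarrow> leq p q \<Longrightarrow> t q \<cdot> \<phi> p q = t p"
  shows "\<exists>h \<in> Hom C L Z. \<forall>p \<in> P. h \<cdot> l p = t p"
  using colimitD(5)[OF assms(1) cocone_J[OF assms(2-)]] by simp

lemma colim_factor: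
  assumes "universe U" "small U P" "is_colimit J C F L l" "compact U C K" "f \<in> Hom C K L"
  shows "\<exists>p \<in> P. \<exists>g \<in> Hom C K (a p). l p \<cdot> g = f"
  using compactD[OF assms(4) small_J[OF assms(1,2)] filtered_J assms(3)] assms(5)
  unfolding factors_through_stages_def by simp

lemma colim_equal:
  assumes "universe U" "small U P" "is_colimit J C F L l" "compact U C K" "p \<in> P"
    "g \<in> Hom C K (a p)" "g' \<in> Hom C K (a p)" "l p \<cdot> g = l p \<cdot> g'"
  shows "\<exists>q \<in> P. leq p q \<and> \<phi> p q \<cdot> g = \<phi> p q \<cdot> g'"
proof -
  have "\<exists>k \<in> Obj J. \<exists>u \<in> Hom J p k. far F u \<cdot> g = far F u \<cdot> g'"
    using compactD[OF assms(4) small_J[OF assms(1,2)] filtered_J assms(3)] assms(5-8)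
    unfolding factors_through_stages_def J_simps by blast
  then show ?thesis by (auto simp: Hom_J split: if_splits)
qed

end


section \<open>Compactly generated categories\<close>

text \<open>\<open>T\<close> is a genuinely small set of representatives of a generating class, so
  that the arrows between generators form a small set and can index diagrams.\<close>

locale compact_gen = grothendieck U C for U :: "'u itself" and C :: "('o, 'm, 'x) add_cat_scheme"
    (structure) +
  fixes T :: "'o set"
  assumes universe: "universe U"
    and small_T: "small U T"
    and generates: "generates C T"
    and extension_closed: "extension_closed C T"
    and T_nonempty: "T \<noteq> {}"
    and compact: "S \<in> T \<Longrightarrow> compact U C S"
begin

lemma T_Obj: "S \<in> T \<Longrightarrow> S \<in> Obj C"
  using generates unfolding generates_def by blast

lemma zero_of_generators:
  assumes h: "h \<in> Hom C A B" and z: "\<And>S f. S \<in> T \<Longrightarrow> f \<in> Hom C S A \<Longrightarrow> h \<cdot> f = Zer C S B"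
  shows "h = Zer C A B"
proof (rule ccontr)
  assume "h \<noteq> Zer C A B"
  then obtain S g where "S \<in> T" "g \<in> Hom C S A" "h \<cdot> g \<noteq> Zer C S B"
    using generates HomD[OF h] unfolding generates_def by blast
  then show False using z by blast
qed

lemma epic_of_generators:
  assumes p: "p \<in> Hom C A K" and lift: "\<And>S x. S \<in> T \<Longrightarrow> x \<in> Hom C S K \<Longrightarrow> \<exists>y \<in> Hom C S A. p \<cdot> y = x"
  shows "epic C p"
proof (rule epicI[OF p])
  fix Z h assume h: "h \<in> Hom C K Z" "h \<cdot> p = Zer C A Z"
  show "h = Zer C K Z"
  proof (rule zero_of_generators[OF h(1)])
    fix S x assume S: "S \<in> T" "x \<in> Hom C S K"
    then obtain y where y: "y \<in> Hom C S A" "p \<cdot> y = x" using lift by blast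
    then show "h \<cdot> x = Zer C S Z"
      using Cmp_assoc[OF y(1) p h(1)] h(2) Zer_Cmp[OF y(1) Hom_Cod_Obj[OF h(1)]] by simp
  qed
qed

lemma monic_of_generators:
  assumes m: "m \<in> Hom C A B"
    and z: "\<And>S x. S \<in> T \<Longrightarrow> x \<in> Hom C S A \<Longrightarrow> m \<cdot> x = Zer C S B \<Longrightarrow> x = Zer C S A"
  shows "monic C m"
proof (rule monicI[OF m])
  fix Z h assume h: "h \<in> Hom C Z A" "m \<cdot> h = Zer C Z B"
  show "h = Zer C Z A"
  proof (rule zero_of_generators[OF h(1)])
    fix S f assume S: "S \<in> T" "f \<in> Hom C S Z"
    have "m \<cdot> (h \<cdot> f) = Zer C S B"
      using Cmp_assoc[OF S(2) h(1) m] h(2) Zer_Cmp[OF S(2) Hom_Cod_Obj[OF m]] by simp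
    then show "h \<cdot> f = Zer C S A" using z[OF S(1) Cmp_in[OF S(2) h(1)]] by blast
  qed
qed

text \<open>Biproducts are extensions, so up to isomorphism they stay in \<open>T\<close>. This is
  the source of all directedness among arrows from generators.\<close>

lemma T_copair:
  assumes S: "S \<in> T" "S' \<in> T" and f: "f \<in> Hom C S Y" and g: "g \<in> Hom C S' Y"
  shows "\<exists>Q \<in> T. \<exists>h \<in> Hom C Q Y. (\<exists>u \<in> Hom C S Q. h \<cdot> u = f) \<and> (\<exists>v \<in> Hom C S' Q. h \<cdot> v = g)"
proof -
  obtain P where P: "is_biprod C S S' P" using ex_biprod T_Obj S by blast
  note bp = biprodD[OF P]
  obtain h where h: "h \<in> Hom C (bp_ob P) Y" "h \<cdot> in1 P = f" "h \<cdot> in2 P = g"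
    using biprod_copair[OF P f g] by blast
  have "Dom C (in1 P) \<in> T" "Cod C (pr2 P) \<in> T" using HomD[OF bp(1)] HomD[OF bp(4)] S by simp_all
  then obtain Q where Q: "Q \<in> T" "isomorphic C (bp_ob P) Q"
    using extension_closed biprod_short_exact[OF P] HomD[OF bp(1)] unfolding extension_closed_def
        by metis
  obtain \<alpha> \<beta> where ab: "\<alpha> \<in> Hom C (bp_ob P) Q" "\<beta> \<in> Hom C Q (bp_ob P)" "\<beta> \<cdot> \<alpha> = Idn C (bp_ob P)"
    by (rule isomorphicE[OF Q(2)])
  have "(h \<cdot> \<beta>) \<cdot> (\<alpha> \<cdot> x) = h \<cdot> x" if x: "x \<in> Hom C Z (bp_ob P)" for x Z
    using Cmp_assoc[OF Cmp_in[OF x ab(1)] ab(2) h(1)] Cmp_assoc[OF x ab(1,2)] ab(3) Idn_Cmp[OF x]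
        by simp
  then have "(h \<cdot> \<beta>) \<cdot> (\<alpha> \<cdot> in1 P) = f" "(h \<cdot> \<beta>) \<cdot> (\<alpha> \<cdot> in2 P) = g" using bp(1,2) h by blast+
  then show ?thesis using Q(1) Cmp_in[OF ab(2) h(1)] Cmp_in[OF bp(1) ab(1)] Cmp_in[OF bp(2) ab(1)]
      by blast
qed

text \<open>
  The quotient of \<open>Y\<close> by the sum of the images of a directed family of arrows is the colimit of
  the quotients by the single images, so compact objects only see finitely many of them.
\<close>

lemma quotient_by_directed_family:
  assumes Y: "Y \<in> Obj C" and X: "X \<noteq> {}" "\<And>f. f \<in> X \<Longrightarrow> f \<in> Hom C (Dom C f) Y \<and> Dom C f \<in> T"
    and dir: "\<And>f g. f \<in> X \<Longrightarrow> g \<in> X \<Longrightarrow>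
      \<exists>h \<in> X. (\<exists>u \<in> Hom C (Dom C f) (Dom C h). h \<cdot> u = f) \<and> (\<exists>v \<in> Hom C (Dom C g) (Dom C h). h \<cdot> v = g)"
  obtains L d where "d \<in> Hom C Y L" "\<And>f. f \<in> X \<Longrightarrow> d \<cdot> f = Zer C (Dom C f) L"
    "\<And>K g. compact U C K \<Longrightarrow> g \<in> Hom C K Y \<Longrightarrow> d \<cdot> g = Zer C K L \<Longrightarrow>
       \<exists>f \<in> X. \<exists>Q c. c \<in> Hom C Y Q \<and> is_cokernel C c f \<and> c \<cdot> g = Zer C K Q"
    "\<And>K q v. compact U C Y \<Longrightarrow> compact U C K \<Longrightarrow> q \<in> Hom C Y K \<Longrightarrow> v \<in> Hom C K L \<Longrightarrow> v \<cdot> q = d \<Longrightarrow>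
       \<exists>f \<in> X. \<exists>Q c s. c \<in> Hom C Y Q \<and> is_cokernel C c f \<and> s \<in> Hom C K Q \<and> s \<cdot> q = c"
proof -
  \<comment> \<open>If \<open>f\<close> factors through \<open>g\<close>, then the cokernel of
    \<open>g\<close> kills \<open>f\<close>, which yields the transition from the quotient by
    \<open>f\<close> to the quotient by \<open>g\<close>.\<close>
  define leq where "leq f g \<longleftrightarrow> (\<exists>u \<in> Hom C (Dom C f) (Dom C g). g \<cdot> u = f)" for f g
  define c where "c f = (SOME c. is_cokernel C c f)" for f
  have c_cok: "is_cokernel C (c f) f" if "f \<in> X" for f
  proof -
    have "f \<in> Arr C" using X(2)[OF that] HomD(1) by blast
    then show ?thesis unfolding c_def using ex_cokernel someI_ex by metis
  qed
  have fH: "f \<in> Hom C (Dom C f) Y" if "f \<in> X" for f using X(2)[OF that] by blast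
  have c_in: "c f \<in> Hom C Y (Cod C (c f))" if "f \<in> X" for f
    using is_cokernel_Arr(2)[OF c_cok[OF that]] HomD(3)[OF fH[OF that]] by simp
  note cD = is_cokernelD[OF c_cok fH c_in]
  define \<phi> where "\<phi> f g = (SOME u. u \<in> Hom C (Cod C (c f)) (Cod C (c g)) \<and> u \<cdot> c f = c g)" for f g
  have \<phi>: "\<phi> f g \<in> Hom C (Cod C (c f)) (Cod C (c g)) \<and> \<phi> f g \<cdot> c f = c g"
    if fg: "f \<in> X" "g \<in> X" "leq f g" for f g
  proof -
    obtain u where u: "u \<in> Hom C (Dom C f) (Dom C g)" "g \<cdot> u = f" using fg(3) unfolding leq_def by blast
    have "c g \<cdot> f = Zer C (Dom C f) (Cod C (c g))"
      using Cmp_assoc[OF u(1) fH[OF fg(2)] c_in[OF fg(2)]] u(2) cD(1)[OF fg(2,2,2)]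
        Zer_Cmp[OF u(1) Hom_Cod_Obj[OF c_in[OF fg(2)]]] by simp
    then have "\<exists>u. u \<in> Hom C (Cod C (c f)) (Cod C (c g)) \<and> u \<cdot> c f = c g"
      using cD(3)[OF fg(1,1,1) c_in[OF fg(2)]] by blast
    then show ?thesis unfolding \<phi>_def by (rule someI_ex)
  qed
  have uniq: "u = u'" if "f \<in> X" "u \<in> Hom C (Cod C (c f)) Z" "u' \<in> Hom C (Cod C (c f)) Z"
      "u \<cdot> c f = u' \<cdot> c f"
    for f u u' Z
    using epicD[OF cD(2)[OF that(1,1,1)] c_in[OF that(1)] that(2-4)] .
  have le_refl: "leq f f" if "f \<in> X" for f
    unfolding leq_def using Idn_in[OF Hom_Dom_Obj[OF fH[OF that]]] Cmp_Idn[OF fH[OF that]] by blast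
  have le_trans: "leq f h" if fgh: "h \<in> X" "leq f g" "leq g h" for f g h
  proof -
    obtain u v where "u \<in> Hom C (Dom C f) (Dom C g)" "g \<cdot> u = f" "v \<in> Hom C (Dom C g) (Dom C h)"
        "h \<cdot> v = g"
      using fgh unfolding leq_def by blast
    then show ?thesis unfolding leq_def using Cmp_assoc[OF _ _ fH[OF fgh(1)]] Cmp_in by metis
  qed
  interpret D: directed_system C X leq "\<lambda>f. Cod C (c f)" \<phi>
  proof
    show "X \<noteq> {}" by (fact X(1))
    show "\<exists>r \<in> X. leq p r \<and> leq q r" if "p \<in> X" "q \<in> X" for p q using dir[OF that] unfolding leq_def
        by blast
    show "\<phi> p p = Idn C (Cod C (c p))" if p: "p \<in> X" for p
      using uniq[OF p, of "\<phi> p p" _ "Idn C (Cod C (c p))"] \<phi>[OF p p le_refl[OF p]]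
        Idn_in[OF Hom_Cod_Obj[OF c_in[OF p]]] Idn_Cmp[OF c_in[OF p]] by auto
    show "\<phi> q r \<cdot> \<phi> p q = \<phi> p r" if pqr: "p \<in> X" "q \<in> X" "r \<in> X" "leq p q" "leq q r" for p q r
    proof -
      note 1 = \<phi>[OF pqr(1,2,4)] and 2 = \<phi>[OF pqr(2,3,5)] and 3 = \<phi>[OF pqr(1,3) le_trans[OF pqr(3-5)]]
      show ?thesis
        using uniq[OF pqr(1) Cmp_in[OF conjunct1[OF 1] conjunct1[OF 2]] conjunct1[OF 3]]
          Cmp_assoc[OF c_in[OF pqr(1)] conjunct1[OF 1] conjunct1[OF 2]] 1 2 3 by simp
    qed
  qed (use \<phi> le_refl le_trans in blast)+
  have "small U (\<Union>S\<in>T. Hom C S Y)"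
    by (intro small_UN[OF universe small_T] Hom_small T_Obj Y)
  moreover have "X \<subseteq> (\<Union>S\<in>T. Hom C S Y)" using X(2) by blast
  ultimately have small_X: "small U X" by (rule small_subset)
  obtain L l where L: "is_colimit D.J C D.F L l"
    using colimit_exists[OF cocomplete D.small_J[OF universe small_X] D.functor_F] by metis
  obtain f0 where f0: "f0 \<in> X" using X(1) by blast
  \<comment> \<open>The composite through any other member of the family is the same, because any
    two members have a common upper bound.\<close>
  define d where "d = l f0 \<cdot> c f0"
  have leg: "l f \<in> Hom C (Cod C (c f)) L" if "f \<in> X" for f using D.colim_leg[OF L that] .
  have step: "l g \<cdot> c g = l f \<cdot> c f" if fg: "f \<in> X" "g \<in> X" "leq f g" for f g
    using Cmp_assoc[OF c_in[OF fg(1)] conjunct1[OF \<phi>[OF fg]] leg[OF fg(2)]] D.colim_comm[OF L fg]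
        \<phi>[OF fg] by simp
  have d_eq: "l f \<cdot> c f = d" if f: "f \<in> X" for f
  proof -
    obtain h where h: "h \<in> X" "leq f h" "leq f0 h" using D.directed[OF f f0] by blast
    then show ?thesis using step[OF f h(1,2)] step[OF f0 h(1,3)] by (simp add: d_def)
  qed
  have d: "d \<in> Hom C Y L" unfolding d_def by (rule Cmp_in[OF c_in[OF f0] leg[OF f0]])
  show thesis
  proof (rule that[OF d])
    fix f assume f: "f \<in> X"
    show "d \<cdot> f = Zer C (Dom C f) L"
      using Cmp_assoc[OF fH[OF f] c_in[OF f] leg[OF f]] d_eq[OF f] cD(1)[OF f f f]
        Cmp_Zer[OF leg[OF f] Hom_Dom_Obj[OF fH[OF f]]] by simp
  next
    fix K g assume K: "compact U C K" "g \<in> Hom C K Y" "d \<cdot> g = Zer C K L"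
    note KO = Hom_Dom_Obj[OF K(2)]
    note cg = Cmp_in[OF K(2) c_in[OF f0]]
    have z: "Zer C K (Cod C (c f0)) \<in> Hom C K (Cod C (c f0))"
        using Zer_in[OF KO Hom_Cod_Obj[OF c_in[OF f0]]] .
    have "l f0 \<cdot> (c f0 \<cdot> g) = l f0 \<cdot> Zer C K (Cod C (c f0))"
      using Cmp_assoc[OF K(2) c_in[OF f0] leg[OF f0]] K(3) Cmp_Zer[OF leg[OF f0] KO]
          by (simp add: d_def)
    then obtain h where h: "h \<in> X" "leq f0 h" "\<phi> f0 h \<cdot> (c f0 \<cdot> g) = \<phi> f0 h \<cdot> Zer C K (Cod C (c f0))"
      using D.colim_equal[OF universe small_X L K(1) f0 cg z] by blast
    note p = \<phi>[OF f0 h(1,2)]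
    have "c h \<cdot> g = Zer C K (Cod C (c h))"
      using Cmp_assoc[OF K(2) c_in[OF f0] conjunct1[OF p]] p h(3) Cmp_Zer[OF conjunct1[OF p] KO] by simp
    then show "\<exists>f \<in> X. \<exists>Q c. c \<in> Hom C Y Q \<and> is_cokernel C c f \<and> c \<cdot> g = Zer C K Q"
      using h(1) c_in[OF h(1)] c_cok[OF h(1)] by blast
  next
    fix K q v assume K: "compact U C Y" "compact U C K" "q \<in> Hom C Y K" "v \<in> Hom C K L" "v \<cdot> q = d"
    obtain f s where f: "f \<in> X" "s \<in> Hom C K (Cod C (c f))" "l f \<cdot> s = v"
      using D.colim_factor[OF universe small_X L K(2,4)] by blast
    have "l f \<cdot> (s \<cdot> q) = l f \<cdot> c f"
      using Cmp_assoc[OF K(3) f(2) leg[OF f(1)]] f(3) K(5) d_eq[OF f(1)] by simp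
    \<comment> \<open>Compactness of \<open>K\<close> moved the arrow \<open>v\<close> to a stage,
      but the equation with the quotient map holds there only after composing into the colimit.
      Compactness of \<open>Y\<close> makes it hold at a later stage.\<close>
    then obtain h where h: "h \<in> X" "leq f h" "\<phi> f h \<cdot> (s \<cdot> q) = \<phi> f h \<cdot> c f"
      using D.colim_equal[OF universe small_X L K(1) f(1) Cmp_in[OF K(3) f(2)] c_in[OF f(1)]] by blast
    note p = \<phi>[OF f(1) h(1,2)]
    have "(\<phi> f h \<cdot> s) \<cdot> q = c h" using Cmp_assoc[OF K(3) f(2) conjunct1[OF p]] h(3) p by simp
    then show "\<exists>f \<in> X. \<exists>Q c s. c \<in> Hom C Y Q \<and> is_cokernel C c f \<and> s \<in> Hom C K Q \<and> s \<cdot> q = c"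
      using h(1) c_in[OF h(1)] c_cok[OF h(1)] Cmp_in[OF f(2) conjunct1[OF p]] by blast
  qed
qed

text \<open>The family to which the quotient lemma is applied: the images of all generators over
  \<open>N\<close>. Two of them factor through a third by \<open>T_copair\<close>.\<close>

lemma images_directed:
  assumes k: "k \<in> Hom C N Y" and X: "X = {k \<cdot> f | S f. S \<in> T \<and> f \<in> Hom C S N}"
  shows "X \<noteq> {}" "\<And>f. f \<in> X \<Longrightarrow> f \<in> Hom C (Dom C f) Y \<and> Dom C f \<in> T"
    "\<And>f g. f \<in> X \<Longrightarrow> g \<in> X \<Longrightarrow>
      \<exists>h \<in> X. (\<exists>u \<in> Hom C (Dom C f) (Dom C h). h \<cdot> u = f) \<and> (\<exists>v \<in> Hom C (Dom C g) (Dom C h). h \<cdot> v = g)"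
proof -
  obtain S where "S \<in> T" using T_nonempty by blast
  then show "X \<noteq> {}" unfolding X using Zer_in[OF T_Obj Hom_Dom_Obj[OF k]] by blast
  show "f \<in> Hom C (Dom C f) Y \<and> Dom C f \<in> T" if fX: "f \<in> X" for f
  proof -
    obtain S f' where f: "f = k \<cdot> f'" "S \<in> T" "f' \<in> Hom C S N" using fX unfolding X by blast
    have "f \<in> Hom C S Y" using Cmp_in[OF f(3) k] f(1) by simp
    then show ?thesis using HomD(2) f(2) by metis
  qed
  fix f g assume "f \<in> X" "g \<in> X"
  then obtain S f' S' g' where f: "f = k \<cdot> f'" "S \<in> T" "f' \<in> Hom C S N" and g: "g = k \<cdot> g'" "S' \<in> T"
      "g' \<in> Hom C S' N"
    unfolding X by blast
  obtain Q h u v where Q: "Q \<in> T" "h \<in> Hom C Q N" "u \<in> Hom C S Q" "h \<cdot> u = f'" "v \<in> Hom C S' Q"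
      "h \<cdot> v = g'"
    using T_copair[OF f(2) g(2) f(3) g(3)] by blast
  have dom: "Dom C f = S" "Dom C g = S'" "Dom C (k \<cdot> h) = Q"
    using HomD(2)[OF Cmp_in[OF f(3) k]] HomD(2)[OF Cmp_in[OF g(3) k]] HomD(2)[OF Cmp_in[OF Q(2) k]]
        f(1) g(1) by simp_all
  have "k \<cdot> h \<in> X" unfolding X using Q by blast
  moreover have "k \<cdot> h \<cdot> u = f" "k \<cdot> h \<cdot> v = g"
    using Cmp_assoc[OF Q(3,2) k] Cmp_assoc[OF Q(5,2) k] Q f g by simp_all
  ultimately show "\<exists>h \<in> X. (\<exists>u \<in> Hom C (Dom C f) (Dom C h). h \<cdot> u = f) \<and>
      (\<exists>v \<in> Hom C (Dom C g) (Dom C h). h \<cdot> v = g)"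
    using Q(3,5) dom by metis
qed

text \<open>Generators are finitely generated: the quotient of \<open>S\<close> by all images of
  generators over \<open>B\<close> is zero, so the compact \<open>S\<close> already vanishes in the
  quotient by a single image.\<close>

lemma epic_onto_generator:
  assumes S: "S \<in> T" and p: "p \<in> Hom C B S" and ep: "epic C p"
  shows "\<exists>R \<in> T. \<exists>b \<in> Hom C R B. epic C (p \<cdot> b)"
proof -
  define X where "X = {p \<cdot> f | R f. R \<in> T \<and> f \<in> Hom C R B}"
  note dir = images_directed[OF p X_def]
  note SO = T_Obj[OF S]
  show ?thesis
  proof (rule quotient_by_directed_family[OF SO dir])
    fix L d assume d: "d \<in> Hom C S L" "\<And>f. f \<in> X \<Longrightarrow> d \<cdot> f = Zer C (Dom C f) L"
      and seen: "\<And>K g. compact U C K \<Longrightarrow> g \<in> Hom C K S \<Longrightarrow> d \<cdot> g = Zer C K L \<Longrightarrow>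
       \<exists>f \<in> X. \<exists>Q c. c \<in> Hom C S Q \<and> is_cokernel C c f \<and> c \<cdot> g = Zer C K Q"
    have "d \<cdot> p = Zer C B L"
    proof (rule zero_of_generators[OF Cmp_in[OF p d(1)]])
      fix R f assume R: "R \<in> T" "f \<in> Hom C R B"
      then have "p \<cdot> f \<in> X" unfolding X_def by blast
      then show "d \<cdot> p \<cdot> f = Zer C R L"
        using d(2) Cmp_assoc[OF R(2) p d(1)] HomD(2)[OF Cmp_in[OF R(2) p]] by metis
    qed
    then have "d = Zer C S L" by (rule epicD_Zer[OF ep p d(1)])
    then have "d \<cdot> Idn C S = Zer C S L" using Cmp_Idn[OF d(1)] by simp
    then obtain f Q c where f: "f \<in> X" "c \<in> Hom C S Q" "is_cokernel C c f" "c \<cdot> Idn C S = Zer C S Q"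
      using seen[OF compact[OF S] Idn_in[OF SO]] by blast
    then obtain R b where b: "f = p \<cdot> b" "R \<in> T" "b \<in> Hom C R B" unfolding X_def by blast
    note fH = Cmp_in[OF b(3) p]
    have c0: "c = Zer C S Q" using f(2,4) Cmp_Idn by simp
    have "epic C (p \<cdot> b)"
    proof (rule epicI[OF fH])
      fix Z h assume h: "h \<in> Hom C S Z" "h \<cdot> (p \<cdot> b) = Zer C R Z"
      then obtain u where "u \<in> Hom C Q Z" "u \<cdot> c = h"
        using is_cokernelD(3)[OF f(3)[unfolded b(1)] fH f(2)] by blast
      then show "h = Zer C S Z" using c0 Cmp_Zer[OF _ SO] by metis
    qed
    then show ?thesis using b by blast
  qed
qed

text \<open>The quotient of \<open>R\<close> by all images of generators over \<open>N\<close> kills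
  \<open>k\<close>, so it factors through \<open>q\<close>. As \<open>R\<close> and \<open>S\<close>
  are compact, the quotient \<open>c\<close> by a single image \<open>k \<cdot> e\<close> already
  factors through \<open>q\<close>, hence kills all of \<open>N\<close>.\<close>

lemma kernel_finitely_generated:
  assumes R: "R \<in> T" and S: "S \<in> T" and q: "q \<in> Hom C R S" and eq: "epic C q"
    and k: "k \<in> Hom C N R" "is_kernel C k q"
  shows "\<exists>R' \<in> T. \<exists>e \<in> Hom C R' N. epic C e"
proof -
  define X where "X = {k \<cdot> f | R f. R \<in> T \<and> f \<in> Hom C R N}"
  note dir = images_directed[OF k(1) X_def]
  note qD = is_cokernelD[OF epic_cokernel_of_kernel[OF eq k(2)] k(1) q]
  show ?thesis
  proof (rule quotient_by_directed_family[OF T_Obj[OF R] dir])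
    fix L d assume d: "d \<in> Hom C R L" "\<And>f. f \<in> X \<Longrightarrow> d \<cdot> f = Zer C (Dom C f) L"
      and seen: "\<And>K q v. compact U C R \<Longrightarrow> compact U C K \<Longrightarrow> q \<in> Hom C R K \<Longrightarrow> v \<in> Hom C K L \<Longrightarrow> v \<cdot> q = d \<Longrightarrow>
       \<exists>f \<in> X. \<exists>Q c s. c \<in> Hom C R Q \<and> is_cokernel C c f \<and> s \<in> Hom C K Q \<and> s \<cdot> q = c"
    have "d \<cdot> k = Zer C N L"
    proof (rule zero_of_generators[OF Cmp_in[OF k(1) d(1)]])
      fix R' f assume R': "R' \<in> T" "f \<in> Hom C R' N"
      then have "k \<cdot> f \<in> X" unfolding X_def by blast
      then show "d \<cdot> k \<cdot> f = Zer C R' L"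
        using d(2) Cmp_assoc[OF R'(2) k(1) d(1)] HomD(2)[OF Cmp_in[OF R'(2) k(1)]] by metis
    qed
    then obtain v where v: "v \<in> Hom C S L" "v \<cdot> q = d" using qD(3)[OF d(1)] by blast
    obtain f Q c s where f: "f \<in> X" "c \<in> Hom C R Q" "is_cokernel C c f" "s \<in> Hom C S Q" "s \<cdot> q = c"
      using seen[OF compact[OF R] compact[OF S] q v] by blast
    then obtain R' e where e: "f = k \<cdot> e" "R' \<in> T" "e \<in> Hom C R' N" unfolding X_def by blast
    have ck: "c \<cdot> k = Zer C N Q"
      using Cmp_assoc[OF k(1) q f(4)] f(5) qD(1) Cmp_Zer[OF f(4) Hom_Dom_Obj[OF k(1)]] by simp
    \<comment> \<open>A test arrow \<open>h\<close> lives on \<open>N\<close>, while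
      \<open>c\<close> is a quotient of \<open>R\<close>. Pushing \<open>h\<close> out along
      \<open>k\<close> extends it to \<open>r\<close> on \<open>R\<close>; this \<open>r\<close>
      kills \<open>k \<cdot> e\<close>, so it factors through \<open>c\<close> and kills
      \<open>k\<close>. Thus \<open>j \<cdot> h\<close> is zero, and \<open>j\<close> is
      monic.\<close>
    have "epic C e"
    proof (rule epicI[OF e(3)])
      fix Z h assume h: "h \<in> Hom C N Z" "h \<cdot> e = Zer C R' Z"
      obtain P j r where po: "pushout h k P j r" "j \<in> Hom C Z P" "r \<in> Hom C R P"
        using pushout_exists[OF h(1) k(1)] by metis
      note pD = pushoutD[OF po(1) h(1) k(1)]
      have "r \<cdot> (k \<cdot> e) = Zer C R' P"
        using Cmp_assoc[OF e(3) k(1) pD(2)] Cmp_assoc[OF e(3) h(1) pD(1)] pD(3) h(2)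
          Cmp_Zer[OF pD(1) T_Obj[OF e(2)]] by simp
      then obtain u where u: "u \<in> Hom C Q P" "u \<cdot> c = r"
        using is_cokernelD(3)[OF f(3)[unfolded e(1)] Cmp_in[OF e(3) k(1)] f(2) pD(2)] by blast
      have "j \<cdot> h = Zer C N P"
        using Cmp_assoc[OF k(1) f(2) u(1)] u(2) ck Cmp_Zer[OF u(1) Hom_Dom_Obj[OF k(1)]] pD(3) by simp
      then show "h = Zer C N Z"
        using monicD_Zer[OF pushout_monic[OF po(1) h(1) k(1) is_kernel_monic[OF k(2)]] pD(1) h(1)]
            by blast
    qed
    then show ?thesis using e by blast
  qed
qed

end

section \<open>Wide pushouts\<close>

text \<open>Simultaneous attachment to \<open>A\<close> of the cells \<open>k x\<close> along
  \<open>n x\<close>, for all \<open>x\<close> in \<open>F\<close>. Keeping \<open>F\<close> apart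
  from the families allows finite stages to be compared.\<close>

definition (in category) wide_pushout ::
  "'o \<Rightarrow> 'i set \<Rightarrow> ('i \<Rightarrow> 'm) \<Rightarrow> ('i \<Rightarrow> 'm) \<Rightarrow> 'o \<Rightarrow> 'm \<Rightarrow> ('i \<Rightarrow> 'm) \<Rightarrow> bool" where
  "wide_pushout A F k n L j r \<longleftrightarrow>
     j \<in> Hom C A L \<and> (\<forall>x\<in>F. r x \<in> Hom C (Cod C (k x)) L \<and> r x \<cdot> k x = j \<cdot> n x) \<and>
     (\<forall>Z f g. f \<in> Hom C A Z \<and> (\<forall>x\<in>F. g x \<in> Hom C (Cod C (k x)) Z \<and> g x \<cdot> k x = f \<cdot> n x) \<longrightarrow>
        (\<exists>!h. h \<in> Hom C L Z \<and> h \<cdot> j = f \<and> (\<forall>x\<in>F. h \<cdot> r x = g x)))"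

locale cells = category C for C :: "('o, 'm, 'x) cat_scheme" (structure) +
  fixes A :: 'o and X :: "'i set" and k n :: "'i \<Rightarrow> 'm"
  assumes A: "A \<in> Obj C"
    and k: "x \<in> X \<Longrightarrow> k x \<in> Hom C (Dom C (k x)) (Cod C (k x))"
    and n: "x \<in> X \<Longrightarrow> n x \<in> Hom C (Dom C (k x)) A"
begin

lemma wideD:
  assumes "wide_pushout A F k n L j r"
  shows "j \<in> Hom C A L" "x \<in> F \<Longrightarrow> r x \<in> Hom C (Cod C (k x)) L" "x \<in> F \<Longrightarrow> r x \<cdot> k x = j \<cdot> n x"
    "f \<in> Hom C A Z \<Longrightarrow> (\<And>x. x \<in> F \<Longrightarrow> g x \<in> Hom C (Cod C (k x)) Z) \<Longrightarrow>
       (\<And>x. x \<in> F \<Longrightarrow> g x \<cdot> k x = f \<cdot> n x) \<Longrightarrow> \<exists>h \<in> Hom C L Z. h \<cdot> j = f \<and> (\<forall>x\<in>F. h \<cdot> r x = g x)"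
  using assms unfolding wide_pushout_def by blast+

lemma wide_ext:
  assumes W: "wide_pushout A F k n L j r" and F: "F \<subseteq> X" and h: "h \<in> Hom C L Z" "h' \<in> Hom C L Z"
    and eq: "h \<cdot> j = h' \<cdot> j" "\<And>x. x \<in> F \<Longrightarrow> h \<cdot> r x = h' \<cdot> r x"
  shows "h = h'"
proof -
  note D = wideD[OF W]
  have "(h \<cdot> r x) \<cdot> k x = (h \<cdot> j) \<cdot> n x" if x: "x \<in> F" for x
    using Cmp_assoc[OF k D(2)[OF x] h(1)] Cmp_assoc[OF n D(1) h(1)] D(3)[OF x] F x by auto
  then have "\<forall>x\<in>F. h \<cdot> r x \<in> Hom C (Cod C (k x)) Z \<and> h \<cdot> r x \<cdot> k x = h \<cdot> j \<cdot> n x"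
    using Cmp_in[OF D(2) h(1)] by blast
  then have "\<exists>!u. u \<in> Hom C L Z \<and> u \<cdot> j = h \<cdot> j \<and> (\<forall>x\<in>F. u \<cdot> r x = h \<cdot> r x)"
    using W[unfolded wide_pushout_def, THEN conjunct2, THEN conjunct2, THEN spec[of _ Z],
        THEN spec[of _ "h \<cdot> j"], THEN spec[of _ "\<lambda>x. h \<cdot> r x"]] Cmp_in[OF D(1) h(1)] by blast
  then show ?thesis using h eq by metis
qed

lemma wide_pushoutI:
  assumes "j \<in> Hom C A L" "\<And>x. x \<in> F \<Longrightarrow> r x \<in> Hom C (Cod C (k x)) L" "\<And>x. x \<in> F \<Longrightarrow> r x \<cdot> k x = j \<cdot> n x"
    and "\<And>Z f g. f \<in> Hom C A Z \<Longrightarrow> (\<And>x. x \<in> F \<Longrightarrow> g x \<in> Hom C (Cod C (k x)) Z) \<Longrightarrow>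
       (\<And>x. x \<in> F \<Longrightarrow> g x \<cdot> k x = f \<cdot> n x) \<Longrightarrow> \<exists>h \<in> Hom C L Z. h \<cdot> j = f \<and> (\<forall>x\<in>F. h \<cdot> r x = g x)"
    and "\<And>Z h h'. h \<in> Hom C L Z \<Longrightarrow> h' \<in> Hom C L Z \<Longrightarrow> h \<cdot> j = h' \<cdot> j \<Longrightarrow>
       (\<And>x. x \<in> F \<Longrightarrow> h \<cdot> r x = h' \<cdot> r x) \<Longrightarrow> h = h'"
  shows "wide_pushout A F k n L j r"
  unfolding wide_pushout_def
proof (intro conjI ballI allI impI)
  fix Z f g assume *: "f \<in> Hom C A Z \<and> (\<forall>x\<in>F. g x \<in> Hom C (Cod C (k x)) Z \<and> g x \<cdot> k x = f \<cdot> n x)"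
  then obtain h where h: "h \<in> Hom C L Z" "h \<cdot> j = f" "\<forall>x\<in>F. h \<cdot> r x = g x" using assms(4)[of f Z g]
      by blast
  show "\<exists>!h. h \<in> Hom C L Z \<and> h \<cdot> j = f \<and> (\<forall>x\<in>F. h \<cdot> r x = g x)"
  proof (intro ex1I[of _ h] conjI)
    fix h' assume "h' \<in> Hom C L Z \<and> h' \<cdot> j = f \<and> (\<forall>x\<in>F. h' \<cdot> r x = g x)"
    then show "h' = h" using assms(5)[of h' Z h] h by simp
  qed (use h in blast)+
qed (use assms(1-3) in blast)+

lemma wide_pushout_empty: "wide_pushout A {} k n A (Idn C A) r"
proof (rule wide_pushoutI)
  show "Idn C A \<in> Hom C A A" using Idn_in[OF A] .
  show "\<exists>h \<in> Hom C A Z. h \<cdot> Idn C A = f \<and> (\<forall>x\<in>{}. h \<cdot> r x = g x)" if "f \<in> Hom C A Z" for Z f g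
    using that Cmp_Idn by blast
  show "h = h'" if "h \<in> Hom C A Z" "h' \<in> Hom C A Z" "h \<cdot> Idn C A = h' \<cdot> Idn C A" for Z h h'
    using that Cmp_Idn by simp
qed auto

lemma wide_pushout_insert:
  assumes W: "wide_pushout A F k n L j r" and F: "F \<subseteq> X" and x: "x \<in> X" "x \<notin> F"
    and P: "pushout (j \<cdot> n x) (k x) L' t \<rho>"
  shows "wide_pushout A (insert x F) k n L' (t \<cdot> j) ((\<lambda>y. t \<cdot> r y)(x := \<rho>))"
proof -
  note D = wideD[OF W]
  note jn = Cmp_in[OF n[OF x(1)] D(1)]
  note P' = pushoutD[OF P jn k[OF x(1)]]
  show ?thesis
  proof (rule wide_pushoutI)
    show "t \<cdot> j \<in> Hom C A L'" using Cmp_in[OF D(1) P'(1)] .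
    fix y assume y: "y \<in> insert x F"
    show "((\<lambda>y. t \<cdot> r y)(x := \<rho>)) y \<in> Hom C (Cod C (k y)) L'"
      using y P'(2) Cmp_in[OF D(2) P'(1)] by auto
    show "((\<lambda>y. t \<cdot> r y)(x := \<rho>)) y \<cdot> k y = t \<cdot> j \<cdot> n y"
    proof (cases "y = x")
      case True
      then show ?thesis using P'(3) Cmp_assoc[OF n[OF x(1)] D(1) P'(1)] by simp
    next
      case False
      then have y: "y \<in> F" "y \<in> X" using y F by auto
      show ?thesis using False D(3)[OF y(1)] Cmp_assoc[OF k[OF y(2)] D(2)[OF y(1)] P'(1)]
          Cmp_assoc[OF n[OF y(2)] D(1) P'(1)] by simp
    qed
  next
    fix Z f g assume f: "f \<in> Hom C A Z" and g: "\<And>y. y \<in> insert x F \<Longrightarrow> g y \<in> Hom C (Cod C (k y)) Z"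
      "\<And>y. y \<in> insert x F \<Longrightarrow> g y \<cdot> k y = f \<cdot> n y"
    obtain h where h: "h \<in> Hom C L Z" "h \<cdot> j = f" "\<forall>y\<in>F. h \<cdot> r y = g y"
      using D(4)[of f Z g] f g by blast
    have "h \<cdot> (j \<cdot> n x) = g x \<cdot> k x" using Cmp_assoc[OF n[OF x(1)] D(1) h(1)] h(2) g(2)[of x] by simp
    then obtain u where u: "u \<in> Hom C L' Z" "u \<cdot> t = h" "u \<cdot> \<rho> = g x"
      using P'(4)[OF h(1) g(1)[of x]] by blast
    show "\<exists>u \<in> Hom C L' Z. u \<cdot> (t \<cdot> j) = f \<and> (\<forall>y\<in>insert x F. u \<cdot> ((\<lambda>y. t \<cdot> r y)(x := \<rho>)) y = g y)"
      using u h x(2) Cmp_assoc[OF D(1) P'(1) u(1)] Cmp_assoc[OF D(2) P'(1) u(1)]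
      by (intro bexI[OF _ u(1)]) auto
  next
    fix Z u u' assume u: "u \<in> Hom C L' Z" "u' \<in> Hom C L' Z" "u \<cdot> (t \<cdot> j) = u' \<cdot> (t \<cdot> j)"
      "\<And>y. y \<in> insert x F \<Longrightarrow> u \<cdot> ((\<lambda>y. t \<cdot> r y)(x := \<rho>)) y = u' \<cdot> ((\<lambda>y. t \<cdot> r y)(x := \<rho>)) y"
    have "u \<cdot> t = u' \<cdot> t"
    proof (rule wide_ext[OF W F Cmp_in[OF P'(1) u(1)] Cmp_in[OF P'(1) u(2)]])
      show "u \<cdot> t \<cdot> j = u' \<cdot> t \<cdot> j"
        using u(3) Cmp_assoc[OF D(1) P'(1) u(1)] Cmp_assoc[OF D(1) P'(1) u(2)] by simp
      show "u \<cdot> t \<cdot> r y = u' \<cdot> t \<cdot> r y" if y: "y \<in> F" for y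
      proof -
        have "y \<noteq> x" using y x(2) by blast
        then show ?thesis
          using u(4)[of y] y Cmp_assoc[OF D(2)[OF y] P'(1) u(1)] Cmp_assoc[OF D(2)[OF y] P'(1) u(2)]
            by simp
      qed
    qed
    moreover have "u \<cdot> \<rho> = u' \<cdot> \<rho>" using u(4)[of x] by simp
    ultimately show "u = u'" using P'(5)[OF u(1,2)] by blast
  qed
qed

text \<open>The transition maps between finite stages are only known through the universal property.
  Still, the one adding a single cell is a pushout of that cell, so the results on one cell apply to
  it.\<close>

lemma pushout_of_wide_pushouts:
  assumes W: "wide_pushout A F k n L j r" and W': "wide_pushout A (insert x F) k n L' j' r'"
    and F: "F \<subseteq> X" and x: "x \<in> X" "x \<notin> F"
    and t: "t \<in> Hom C L L'" "t \<cdot> j = j'" "\<And>y. y \<in> F \<Longrightarrow> t \<cdot> r y = r' y"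
  shows "pushout (j \<cdot> n x) (k x) L' t (r' x)"
proof -
  note D = wideD[OF W] and D' = wideD[OF W']
  note nx = n[OF x(1)] and kx = k[OF x(1)] and rx = D'(2)[of x, simplified]
  note jn = Cmp_in[OF nx D(1)]
  have F': "insert x F \<subseteq> X" using F x by blast
  show ?thesis
  proof (rule pushoutI[OF jn kx t(1) rx])
    show "t \<cdot> (j \<cdot> n x) = r' x \<cdot> k x" using Cmp_assoc[OF nx D(1) t(1)] t(2) D'(3)[of x] by simp
    fix Z f g assume fg: "f \<in> Hom C L Z" "g \<in> Hom C (Cod C (k x)) Z" "f \<cdot> (j \<cdot> n x) = g \<cdot> k x"
    \<comment> \<open>The cells already present are mapped through \<open>L\<close> by
      \<open>f\<close>, the new one by \<open>g\<close>.\<close>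
    define g' where "g' = (\<lambda>y. f \<cdot> r y)(x := g)"
    have "\<exists>h \<in> Hom C L' Z. h \<cdot> j' = f \<cdot> j \<and> (\<forall>y\<in>insert x F. h \<cdot> r' y = g' y)"
    proof (rule D'(4)[OF Cmp_in[OF D(1) fg(1)]])
      fix y assume y: "y \<in> insert x F"
      show "g' y \<in> Hom C (Cod C (k y)) Z" using y fg(2) Cmp_in[OF D(2) fg(1)] by (auto simp: g'_def)
      show "g' y \<cdot> k y = f \<cdot> j \<cdot> n y"
      proof (cases "y = x")
        case True
        then show ?thesis using fg(3) Cmp_assoc[OF nx D(1) fg(1)] by (simp add: g'_def)
      next
        case False
        then have y: "y \<in> F" "y \<in> X" using y F by auto
        show ?thesis using False D(3)[OF y(1)] Cmp_assoc[OF k[OF y(2)] D(2)[OF y(1)] fg(1)]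
            Cmp_assoc[OF n[OF y(2)] D(1) fg(1)] by (simp add: g'_def)
      qed
    qed
    then obtain h where h: "h \<in> Hom C L' Z" "h \<cdot> j' = f \<cdot> j" "\<forall>y\<in>insert x F. h \<cdot> r' y = g' y" by blast
    have "h \<cdot> t = f"
    proof (rule wide_ext[OF W F Cmp_in[OF t(1) h(1)] fg(1)])
      show "h \<cdot> t \<cdot> j = f \<cdot> j" using Cmp_assoc[OF D(1) t(1) h(1)] t(2) h(2) by simp
      show "h \<cdot> t \<cdot> r y = f \<cdot> r y" if y: "y \<in> F" for y
      proof -
        have "h \<cdot> r' y = f \<cdot> r y" using h(3) y x(2) by (auto simp: g'_def)
        then show ?thesis using Cmp_assoc[OF D(2)[OF y] t(1) h(1)] t(3)[OF y] by simp
      qed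
    qed
    moreover have "h \<cdot> r' x = g" using h(3) by (simp add: g'_def)
    moreover have "h' = h" if h': "h' \<in> Hom C L' Z" "h' \<cdot> t = f" "h' \<cdot> r' x = g" for h'
    proof (rule wide_ext[OF W' F' h'(1) h(1)])
      show "h' \<cdot> j' = h \<cdot> j'" using Cmp_assoc[OF D(1) t(1) h'(1)] t(2) h'(2) h(2) by simp
      fix y assume y: "y \<in> insert x F"
      show "h' \<cdot> r' y = h \<cdot> r' y"
      proof (cases "y = x")
        case True
        then show ?thesis using h'(3) \<open>h \<cdot> r' x = g\<close> by simp
      next
        case False
        then have yF: "y \<in> F" using y by simp
        show ?thesis
          using Cmp_assoc[OF D(2)[OF yF] t(1) h'(1)] Cmp_assoc[OF D(2)[OF yF] t(1) h(1)] t(3)[OF yF]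
            h'(2) \<open>h \<cdot> t = f\<close> by simp
      qed
    qed
    ultimately show "\<exists>!h. h \<in> Hom C L' Z \<and> h \<cdot> t = f \<and> h \<cdot> r' x = g" using h(1) by blast
  qed
qed

end


section \<open>Objects exhausted by generators\<close>

lemma (in preadditive) monic_Cmp:
  assumes "f \<in> Hom C A B" "g \<in> Hom C B D" "monic C f" "monic C g"
  shows "monic C (g \<cdot> f)"
proof (rule monicI[OF Cmp_in[OF assms(1,2)]])
  fix Z h assume h: "h \<in> Hom C Z A" "g \<cdot> f \<cdot> h = Zer C Z D"
  have "f \<cdot> h = Zer C Z B"
    using monicD_Zer[OF assms(4,2) Cmp_in[OF h(1) assms(1)]] Cmp_assoc[OF h(1) assms(1,2)] h(2) by simp
  then show "h = Zer C Z A" by (rule monicD_Zer[OF assms(3,1) h(1)])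
qed

lemma (in preadditive) monic_of_retraction:
  assumes "f \<in> Hom C A B" "g \<in> Hom C B A" "g \<cdot> f = Idn C A"
  shows "monic C f"
proof (rule monicI[OF assms(1)])
  fix Z h assume h: "h \<in> Hom C Z A" "f \<cdot> h = Zer C Z B"
  show "h = Zer C Z A"
    using Cmp_assoc[OF h(1) assms(1,2)] assms(3) Idn_Cmp[OF h(1)]
        h(2) Cmp_Zer[OF assms(2) Hom_Dom_Obj[OF h(1)]]
    by simp
qed

context compact_gen
begin

text \<open>Stronger than being a direct limit of generators. Asking for a monic out of a generator
  is what makes the property survive pushouts of cells and colimits along monics.\<close>

definition exhausted :: "'o \<Rightarrow> bool" where
  "exhausted A \<longleftrightarrow> A \<in> Obj C \<and>
     (\<forall>S \<in> T. \<forall>f \<in> Hom C S A. \<exists>S' \<in> T. \<exists>m \<in> Hom C S' A. monic C m \<and> (\<exists>h \<in> Hom C S S'. m \<cdot> h = f))"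

lemma exhaustedD:
  assumes "exhausted A" "S \<in> T" "f \<in> Hom C S A"
  obtains S' m h where "S' \<in> T" "m \<in> Hom C S' A" "monic C m" "h \<in> Hom C S S'" "m \<cdot> h = f"
  using assms unfolding exhausted_def by blast

lemma exhausted_T: "S \<in> T \<Longrightarrow> exhausted S"
proof -
  assume S: "S \<in> T"
  note i = Idn_in[OF T_Obj[OF S]]
  have "monic C (Idn C S)" using monic_of_retraction[OF i i] Idn_Cmp[OF i] by simp
  then show ?thesis unfolding exhausted_def using S T_Obj i Idn_Cmp by blast
qed

lemma exhausted_embed:
  assumes A: "exhausted A" and j: "j \<in> Hom C A B" "monic C j"
    and fac: "\<And>S f. S \<in> T \<Longrightarrow> f \<in> Hom C S B \<Longrightarrow> \<exists>g \<in> Hom C S A. j \<cdot> g = f"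
  shows "exhausted B"
  unfolding exhausted_def
proof (intro conjI ballI)
  show "B \<in> Obj C" using Hom_Cod_Obj[OF j(1)] .
  fix S f assume S: "S \<in> T" "f \<in> Hom C S B"
  then obtain g where g: "g \<in> Hom C S A" "j \<cdot> g = f" using fac by blast
  obtain S' m h where m: "S' \<in> T" "m \<in> Hom C S' A" "monic C m" "h \<in> Hom C S S'" "m \<cdot> h = g"
    by (rule exhaustedD[OF A S(1) g(1)])
  have "j \<cdot> m \<cdot> h = f" using Cmp_assoc[OF m(4,2) j(1)] m(5) g(2) by simp
  then show "\<exists>S' \<in> T. \<exists>m \<in> Hom C S' B. monic C m \<and> (\<exists>h \<in> Hom C S S'. m \<cdot> h = f)"
    using m(1,4) Cmp_in[OF m(2) j(1)] monic_Cmp[OF m(2) j(1) m(3) j(2)] by blast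
qed

text \<open>Diagonal fill-in: \<open>m \<cdot> g\<close> kills the kernel of \<open>e\<close>, hence
  so does \<open>g\<close> because \<open>m\<close> is monic, and \<open>g\<close> descends along
  \<open>e\<close>.\<close>

lemma factor_through_epic:
  assumes e: "e \<in> Hom C R N" "epic C e" and n: "n \<in> Hom C N L" and m: "m \<in> Hom C B L" "monic C m"
    and g: "g \<in> Hom C R B" "m \<cdot> g = n \<cdot> e"
  shows "\<exists>g' \<in> Hom C N B. g' \<cdot> e = g \<and> m \<cdot> g' = n"
proof -
  obtain K k where k: "k \<in> Hom C K R" "is_kernel C k e" using kernel_exists[OF e(1)] by metis
  note K = Hom_Dom_Obj[OF k(1)]
  note cD = is_cokernelD[OF epic_cokernel_of_kernel[OF e(2) k(2)] k(1) e(1)]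
  have "m \<cdot> (g \<cdot> k) = Zer C K L"
    using Cmp_assoc[OF k(1) g(1) m(1)] g(2) Cmp_assoc[OF k(1) e(1) n] cD(1) Cmp_Zer[OF n K] by simp
  then have "g \<cdot> k = Zer C K B" by (rule monicD_Zer[OF m(2,1) Cmp_in[OF k(1) g(1)]])
  then obtain g' where g': "g' \<in> Hom C N B" "g' \<cdot> e = g" using cD(3)[OF g(1)] by blast
  have "(m \<cdot> g') \<cdot> e = n \<cdot> e" using Cmp_assoc[OF e(1) g'(1) m(1)] g'(2) g(2) by simp
  then have "m \<cdot> g' = n" using epicD[OF e(2,1) Cmp_in[OF g'(1) m(1)] n] by blast
  then show ?thesis using g' by blast
qed

text \<open>
  Attaching one cell: a map from a generator into the pushout lands, together with the cell itself,
  in an extension of \<open>S\<close> by a generator contained in \<open>B\<close>, because the kernel of an epimorphism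
  between generators is finitely generated.
\<close>

lemma exhausted_pushout:
  assumes B: "exhausted B" and R: "R \<in> T" and S: "S \<in> T" and q: "q \<in> Hom C R S" "epic C q"
    and k: "k \<in> Hom C N R" "is_kernel C k q" and b: "b \<in> Hom C N B" and po: "pushout b k B' h \<rho>"
  shows "exhausted B'"
  unfolding exhausted_def
proof (intro conjI ballI)
  note D = pushoutD[OF po b k(1)]
  show "B' \<in> Obj C" using Hom_Cod_Obj[OF D(1)] .
  fix S0 f assume S0: "S0 \<in> T" and f: "f \<in> Hom C S0 B'"
  obtain e where e: "short_exact C h e" "e \<in> Hom C B' S" "e \<cdot> \<rho> = q"
    using pushout_short_exact[OF po b k(1) short_exact_of_epic[OF q(2) k(2)] q(1)] by metis
  note eD = short_exactD[OF e(1) D(1) e(2)]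
  \<comment> \<open>One generator over \<open>B'\<close> captures both the given map and the
    attached cell. Containing the cell makes its map to \<open>S\<close> epic, since
    \<open>q\<close> is.\<close>
  obtain Y y u v where Y: "Y \<in> T" and y: "y \<in> Hom C Y B'" and u: "u \<in> Hom C S0 Y" "y \<cdot> u = f"
    and v: "v \<in> Hom C R Y" "y \<cdot> v = \<rho>"
    using T_copair[OF S0 R f D(2)] by blast
  note ey = Cmp_in[OF y e(2)]
  have "epic C (e \<cdot> y)"
  proof (rule epicI[OF ey])
    fix Z g assume g: "g \<in> Hom C S Z" "g \<cdot> (e \<cdot> y) = Zer C Y Z"
    have "g \<cdot> q = (g \<cdot> (e \<cdot> y)) \<cdot> v" using Cmp_assoc[OF v(1) ey g(1)] Cmp_assoc[OF v(1) y e(2)]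
        v(2) e(3) by simp
    then have "g \<cdot> q = Zer C R Z" using g(2) Zer_Cmp[OF v(1) Hom_Cod_Obj[OF g(1)]] by simp
    then show "g = Zer C S Z" by (rule epicD_Zer[OF q(2,1) g(1)])
  qed
  note epic_ey = this
  \<comment> \<open>\<open>N'\<close> is the part of \<open>Y\<close> that lands in
    \<open>B\<close>. It need not be a generator, but it is a quotient of one, namely of
    \<open>S2\<close>.\<close>
  obtain N' \<kappa> where \<kappa>: "\<kappa> \<in> Hom C N' Y" "is_kernel C \<kappa> (e \<cdot> y)" using kernel_exists[OF ey] by metis
  note \<kappa>D = is_kernelD[OF \<kappa>(2) ey \<kappa>(1)]
  obtain S2 \<epsilon> where \<epsilon>: "S2 \<in> T" "\<epsilon> \<in> Hom C S2 N'" "epic C \<epsilon>"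
    using kernel_finitely_generated[OF Y S ey epic_ey \<kappa>] by blast
  note y\<kappa> = Cmp_in[OF \<kappa>(1) y]
  have "e \<cdot> (y \<cdot> \<kappa>) = Zer C N' S" using Cmp_assoc[OF \<kappa>(1) y e(2)] \<kappa>D(1) by simp
  then obtain b' where b': "b' \<in> Hom C N' B" "h \<cdot> b' = y \<cdot> \<kappa>" using eD(4)[OF y\<kappa>] by blast
  \<comment> \<open>Exhaustedness of \<open>B\<close> applies to the generator \<open>S2\<close>;
    the diagonal fill-in then brings all of \<open>N'\<close> into the generator \<open>S3\<close>
    contained in \<open>B\<close>.\<close>
  obtain S3 m g where m: "S3 \<in> T" "m \<in> Hom C S3 B" "monic C m" "g \<in> Hom C S2 S3" "m \<cdot> g = b' \<cdot> \<epsilon>"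
    by (rule exhaustedD[OF B \<epsilon>(1) Cmp_in[OF \<epsilon>(2) b'(1)]])
  obtain g' where g': "g' \<in> Hom C N' S3" "m \<cdot> g' = b'"
    using factor_through_epic[OF \<epsilon>(2,3) b'(1) m(2,3,4,5)] by blast
  note hm = Cmp_in[OF m(2) D(1)]
  have hm_monic: "monic C (h \<cdot> m)" by (rule monic_Cmp[OF m(2) D(1) m(3) eD(2)])
  have hmg: "h \<cdot> m \<cdot> g' = y \<cdot> \<kappa>" using Cmp_assoc[OF g'(1) m(2) D(1)] g'(2) b'(2) by simp
  \<comment> \<open>Gluing \<open>Y\<close> to \<open>S3\<close> along \<open>N'\<close> gives an
    extension of \<open>S\<close> by \<open>S3\<close>, which by extension closure is again a
    generator up to isomorphism.\<close>
  obtain P j r where po': "pushout g' \<kappa> P j r" using pushout_exists[OF g'(1) \<kappa>(1)] by metis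
  note PD = pushoutD[OF po' g'(1) \<kappa>(1)]
  obtain e' where e': "short_exact C j e'" "e' \<in> Hom C P S" "e' \<cdot> r = e \<cdot> y" "e' \<cdot> j = Zer C S3 S"
    using pushout_short_exact[OF po' g'(1) \<kappa>(1) short_exact_of_epic[OF epic_ey \<kappa>(2)] ey] by metis
  obtain w where w: "w \<in> Hom C P B'" "w \<cdot> j = h \<cdot> m" "w \<cdot> r = y" using PD(4)[OF hm y hmg] by blast
  have "e \<cdot> w = e'"
  proof (rule PD(5)[OF Cmp_in[OF w(1) e(2)] e'(2)])
    show "e \<cdot> w \<cdot> j = e' \<cdot> j"
      using Cmp_assoc[OF PD(1) w(1) e(2)] w(2) Cmp_assoc[OF m(2) D(1) e(2)] eD(1) e'(4)
        Zer_Cmp[OF m(2) Hom_Cod_Obj[OF e(2)]] by simp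
    show "e \<cdot> w \<cdot> r = e' \<cdot> r" using Cmp_assoc[OF PD(2) w(1) e(2)] w(3) e'(3) by simp
  qed
  note ew = this
  \<comment> \<open>\<open>w\<close> lies over \<open>S\<close>, so what it kills comes from
    \<open>S3\<close>, and on \<open>S3\<close> it is the monic \<open>h \<cdot> m\<close>.\<close>
  have w_monic: "monic C w"
  proof (rule monicI[OF w(1)])
    fix Z z assume z: "z \<in> Hom C Z P" "w \<cdot> z = Zer C Z B'"
    note Z = Hom_Dom_Obj[OF z(1)]
    have "e' \<cdot> z = Zer C Z S" using Cmp_assoc[OF z(1) w(1) e(2)] ew z(2) Cmp_Zer[OF e(2) Z] by simp
    then obtain z' where z': "z' \<in> Hom C Z S3" "j \<cdot> z' = z"
        using short_exactD(4)[OF e'(1) PD(1) e'(2) z(1)] by blast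
    have "h \<cdot> m \<cdot> z' = Zer C Z B'" using Cmp_assoc[OF z'(1) PD(1) w(1)] w(2) z'(2) z(2) by simp
    then have "z' = Zer C Z S3" by (rule monicD_Zer[OF hm_monic hm z'(1)])
    then show "z = Zer C Z P" using z'(2) Cmp_Zer[OF PD(1) Z] by simp
  qed
  have "Dom C j \<in> T" "Cod C e' \<in> T" "Cod C j = P" using HomD[OF PD(1)] HomD[OF e'(2)] m(1) S by simp_all
  then obtain S4 where S4: "S4 \<in> T" "isomorphic C P S4"
    using extension_closed e'(1) unfolding extension_closed_def by metis
  obtain \<alpha> \<beta> where ab: "\<alpha> \<in> Hom C P S4" "\<beta> \<in> Hom C S4 P" "\<beta> \<cdot> \<alpha> = Idn C P" "\<alpha> \<cdot> \<beta> = Idn C S4"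
    by (rule isomorphicE[OF S4(2)])
  note ru = Cmp_in[OF u(1) PD(2)]
  have "w \<cdot> \<beta> \<cdot> (\<alpha> \<cdot> (r \<cdot> u)) = f"
    using Cmp_assoc[OF Cmp_in[OF ru ab(1)] ab(2) w(1)] Cmp_assoc[OF ru ab(1,2)] ab(3) Idn_Cmp[OF ru]
      Cmp_assoc[OF u(1) PD(2) w(1)] w(3) u(2) by simp
  moreover have "monic C (w \<cdot> \<beta>)" by (rule monic_Cmp[OF ab(2) w(1) monic_of_retraction[OF ab(2,1,4)]
      w_monic])
  ultimately show "\<exists>S' \<in> T. \<exists>m \<in> Hom C S' B'. monic C m \<and> (\<exists>h \<in> Hom C S0 S'. m \<cdot> h = f)"
    using S4(1) Cmp_in[OF ab(2) w(1)] Cmp_in[OF ru ab(1)] by blast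
qed

end

text \<open>A map from a compact generator that dies in the colimit dies at some stage, where the
  transition is monic.\<close>

lemma (in compact_gen) colimit_leg_monic:
  assumes D: "directed_system C P leq a \<phi>" and P: "small U P"
    and L: "is_colimit (preorder_cat P leq) C (system_fctr a \<phi>) L l"
    and mono: "\<And>p q. p \<in> P \<Longrightarrow> q \<in> P \<Longrightarrow> leq p q \<Longrightarrow> monic C (\<phi> p q)" and p: "p \<in> P"
  shows "monic C (l p)"
proof -
  interpret D: directed_system C P leq a \<phi> by (rule D)
  note lp = D.colim_leg[OF L p]
  show ?thesis
  proof (rule monic_of_generators[OF lp])
    fix S x assume S: "S \<in> T" and x: "x \<in> Hom C S (a p)" "l p \<cdot> x = Zer C S L"
    have z: "Zer C S (a p) \<in> Hom C S (a p)" using Zer_in[OF T_Obj[OF S] D.a_Obj[OF p]] .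
    have "l p \<cdot> x = l p \<cdot> Zer C S (a p)" using x(2) Cmp_Zer[OF lp T_Obj[OF S]] by simp
    then obtain q where q: "q \<in> P" "leq p q" "\<phi> p q \<cdot> x = \<phi> p q \<cdot> Zer C S (a p)"
      using D.colim_equal[OF universe P L compact[OF S] p x(1) z] by blast
    then show "x = Zer C S (a p)" using monicD[OF mono[OF p q(1,2)] D.trans_in[OF p q(1,2)] x(1) z]
        by blast
  qed
qed

lemma (in compact_gen) colimit_exhausted:
  assumes D: "directed_system C P leq a \<phi>" and P: "small U P"
    and L: "is_colimit (preorder_cat P leq) C (system_fctr a \<phi>) L l"
    and mono: "\<And>p q. p \<in> P \<Longrightarrow> q \<in> P \<Longrightarrow> leq p q \<Longrightarrow> monic C (\<phi> p q)"
    and ex: "\<And>p. p \<in> P \<Longrightarrow> exhausted (a p)"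
  shows "exhausted L"
  unfolding exhausted_def
proof (intro conjI ballI)
  interpret D: directed_system C P leq a \<phi> by (rule D)
  show "L \<in> Obj C" using colimitD(2)[OF L] .
  fix S f assume S: "S \<in> T" "f \<in> Hom C S L"
  obtain p g where p: "p \<in> P" "g \<in> Hom C S (a p)" "l p \<cdot> g = f"
    using D.colim_factor[OF universe P L compact[OF S(1)] S(2)] by blast
  obtain S' m h where m: "S' \<in> T" "m \<in> Hom C S' (a p)" "monic C m" "h \<in> Hom C S S'" "m \<cdot> h = g"
    by (rule exhaustedD[OF ex[OF p(1)] S(1) p(2)])
  note lp = D.colim_leg[OF L p(1)]
  have "l p \<cdot> m \<cdot> h = f" using Cmp_assoc[OF m(4,2) lp] m(5) p(3) by simp
  then show "\<exists>S' \<in> T. \<exists>m \<in> Hom C S' L. monic C m \<and> (\<exists>h \<in> Hom C S S'. m \<cdot> h = f)"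
    using m(1,4) Cmp_in[OF m(2) lp] monic_Cmp[OF m(2) lp m(3) colimit_leg_monic[OF D P L mono p(1)]]
        by blast
qed

section \<open>Special precovers\<close>

context compact_gen
begin

text \<open>Finitely many cells are attached one at a time; an arbitrary small family is the colimit
  of its finite subfamilies. All transitions are composites of pushouts of monics, so the colimit
  stays exhausted and contains \<open>A\<close>.\<close>

lemma attach_cells:
  fixes k n :: "'i \<Rightarrow> 'm"
  assumes A: "exhausted A" and X: "small U X"
    and cell: "\<And>x. x \<in> X \<Longrightarrow> \<exists>R \<in> T. \<exists>S \<in> T. \<exists>q \<in> Hom C R S. epic C q \<and> is_kernel C (k x) q"
    and n: "\<And>x. x \<in> X \<Longrightarrow> n x \<in> Hom C (Dom C (k x)) A"
  shows "\<exists>B j r. exhausted B \<and> j \<in> Hom C A B \<and> monic C j \<and>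
    (\<forall>x\<in>X. r x \<in> Hom C (Cod C (k x)) B \<and> r x \<cdot> k x = j \<cdot> n x) \<and>
    (\<forall>Z f g. f \<in> Hom C A Z \<and> (\<forall>x\<in>X. g x \<in> Hom C (Cod C (k x)) Z \<and> g x \<cdot> k x = f \<cdot> n x) \<longrightarrow>
       (\<exists>h \<in> Hom C B Z. h \<cdot> j = f \<and> (\<forall>x\<in>X. h \<cdot> r x = g x)))"
proof -
  have kH: "k x \<in> Hom C (Dom C (k x)) (Cod C (k x))" if "x \<in> X" for x
    using cell[OF that] is_kernel_Arr(1) by blast
  interpret W: cells C A X k n
    by unfold_locales (use A kH n in \<open>auto simp: exhausted_def\<close>)
  define P where "P = {F. F \<subseteq> X \<and> finite F}"
  define W where "W F = (\<lambda>(L, j, r). wide_pushout A F k n L j r)" for F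
  have insert_wide: "\<exists>L' j' r'. W (insert x F) (L', j', r')" if "W F (L, j, r)" "insert x F \<subseteq> X"
      "x \<notin> F" for x F L j r
  proof -
    have w: "wide_pushout A F k n L j r" and x: "x \<in> X" and F: "F \<subseteq> X" using that by (auto simp: W_def)
    obtain L' t \<rho> where po: "pushout (j \<cdot> n x) (k x) L' t \<rho>"
      using pushout_exists[OF Cmp_in[OF n[OF x] W.wideD(1)[OF w]] kH[OF x]] by metis
    show ?thesis using W.wide_pushout_insert[OF w F x that(3) po] unfolding W_def by blast
  qed
  have "\<exists>w. W F w" if F: "F \<in> P" for F
  proof -
    have "finite F" "F \<subseteq> X" using F by (auto simp: P_def)
    then show ?thesis
    proof (induction F rule: finite_induct)
      case empty
      show ?case using W.wide_pushout_empty unfolding W_def by blast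
    next
      case (insert x F)
      then show ?case using insert_wide[of F _ _ _ x] by fastforce
    qed
  qed
  then have W_some: "W F (SOME w. W F w)" if "F \<in> P" for F using someI_ex that by metis
  define L where "L F = fst (SOME w. W F w)" for F
  define i where "i F = fst (snd (SOME w. W F w))" for F
  define r where "r F = snd (snd (SOME w. W F w))" for F
  have w: "wide_pushout A F k n (L F) (i F) (r F)" if "F \<in> P" for F
    using W_some[OF that] by (simp add: W_def L_def i_def r_def case_prod_beta)
  have PX: "F \<subseteq> X" if "F \<in> P" for F using that by (simp add: P_def)
  note D = W.wideD[OF w]
  define \<phi> where "\<phi> F G = (SOME t. t \<in> Hom C (L F) (L G) \<and> t \<cdot> i F = i G \<and>
      (\<forall>x\<in>F. t \<cdot> r F x = r G x))" for F G
  have \<phi>: "\<phi> F G \<in> Hom C (L F) (L G) \<and> \<phi> F G \<cdot> i F = i G \<and> (\<forall>x\<in>F. \<phi> F G \<cdot> r F x = r G x)"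
    if "F \<in> P" "G \<in> P" "F \<subseteq> G" for F G
  proof -
    have "\<exists>t \<in> Hom C (L F) (L G). t \<cdot> i F = i G \<and> (\<forall>x\<in>F. t \<cdot> r F x = r G x)"
      using that D by (intro D(4)) auto
    then have "\<exists>t. t \<in> Hom C (L F) (L G) \<and> t \<cdot> i F = i G \<and> (\<forall>x\<in>F. t \<cdot> r F x = r G x)" by blast
    then show ?thesis unfolding \<phi>_def by (rule someI_ex)
  qed
  have uniq: "t = t'" if "F \<in> P" "t \<in> Hom C (L F) Z" "t' \<in> Hom C (L F) Z" "t \<cdot> i F = t' \<cdot> i F"
    "\<And>x. x \<in> F \<Longrightarrow> t \<cdot> r F x = t' \<cdot> r F x" for F t t' Z
    using W.wide_ext[OF w[OF that(1)] PX[OF that(1)] that(2-5)] .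
  have \<phi>_trans: "\<phi> G H \<cdot> \<phi> F G = \<phi> F H" if "F \<in> P" "G \<in> P" "H \<in> P" "F \<subseteq> G" "G \<subseteq> H" for F G H
  proof -
    note 1 = \<phi>[OF that(1,2,4)] and 2 = \<phi>[OF that(2,3,5)]
        and 3 = \<phi>[OF that(1,3) subset_trans[OF that(4,5)]]
    have 1: "\<phi> F G \<in> Hom C (L F) (L G)" "\<phi> F G \<cdot> i F = i G" "\<And>x. x \<in> F \<Longrightarrow> \<phi> F G \<cdot> r F x = r G x"
      and 2: "\<phi> G H \<in> Hom C (L G) (L H)" "\<phi> G H \<cdot> i G = i H" "\<And>x. x \<in> G \<Longrightarrow> \<phi> G H \<cdot> r G x = r H x"
      and 3: "\<phi> F H \<in> Hom C (L F) (L H)" "\<phi> F H \<cdot> i F = i H" "\<And>x. x \<in> F \<Longrightarrow> \<phi> F H \<cdot> r F x = r H x"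
      using 1 2 3 by blast+
    show ?thesis
    proof (rule uniq[OF that(1) Cmp_in[OF 1(1) 2(1)] 3(1)])
      show "\<phi> G H \<cdot> \<phi> F G \<cdot> i F = \<phi> F H \<cdot> i F"
        using Cmp_assoc[OF D(1)[OF that(1)] 1(1) 2(1)] 1(2) 2(2) 3(2) by simp
      show "\<phi> G H \<cdot> \<phi> F G \<cdot> r F x = \<phi> F H \<cdot> r F x" if x: "x \<in> F" for x
        using Cmp_assoc[OF D(2)[OF \<open>F \<in> P\<close> x] 1(1) 2(1)] 1(3)[OF x] 2(3)[of x] 3(3)[OF x] x \<open>F \<subseteq> G\<close>
            by auto
    qed
  qed
  have \<phi>_refl: "\<phi> F F = Idn C (L F)" if F: "F \<in> P" for F
  proof (rule uniq[OF F])
    note 1 = \<phi>[OF F F subset_refl]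
    show "\<phi> F F \<in> Hom C (L F) (L F)" "Idn C (L F) \<in> Hom C (L F) (L F)"
      using 1 Idn_in Hom_Dom_Obj by blast+
    show "\<phi> F F \<cdot> i F = Idn C (L F) \<cdot> i F" using 1 Idn_Cmp[OF D(1)[OF F]] by simp
    show "\<phi> F F \<cdot> r F x = Idn C (L F) \<cdot> r F x" if "x \<in> F" for x
        using 1 that Idn_Cmp[OF D(2)[OF F that]] by simp
  qed
  have step: "monic C (\<phi> F (insert x F)) \<and> (exhausted (L F) \<longrightarrow> exhausted (L (insert x F)))"
    if F: "F \<in> P" and x: "x \<in> X" "x \<notin> F" for F x
  proof -
    have F': "insert x F \<in> P" using F x by (auto simp: P_def)
    note p = \<phi>[OF F F' subset_insertI]
    have po: "pushout (i F \<cdot> n x) (k x) (L (insert x F)) (\<phi> F (insert x F)) (r (insert x F) x)"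
      using p by (intro W.pushout_of_wide_pushouts[OF w[OF F] w[OF F'] PX[OF F] x]) blast+
    note b = Cmp_in[OF n[OF x(1)] D(1)[OF F]]
    obtain R S q where R: "R \<in> T" "S \<in> T" "q \<in> Hom C R S" "epic C q" "is_kernel C (k x) q"
        using cell[OF x(1)] by blast
    have "Cod C (k x) = R" using is_kernel_Arr(4)[OF R(5)] HomD(2)[OF R(3)] by simp
    then have kR: "k x \<in> Hom C (Dom C (k x)) R" using kH[OF x(1)] by simp
    show ?thesis
      using pushout_monic[OF po b kH[OF x(1)] is_kernel_monic[OF R(5)]]
        exhausted_pushout[OF _ R(1,2,3,4) kR R(5) b po] by blast
  qed
  have \<phi>_monic: "monic C (\<phi> F G)" if "F \<in> P" "G \<in> P" "F \<subseteq> G" for F G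
  proof -
    \<comment> \<open>Any inclusion of finite sets is a chain of single insertions, so the induction
      runs over the set that is added to \<open>F\<close>.\<close>
    have mono: "F \<union> H \<in> P \<longrightarrow> monic C (\<phi> F (F \<union> H))" if "finite H" for H
      using that
    proof (induction H rule: finite_induct)
      case empty
      have "Idn C (L F) \<in> Hom C (L F) (L F)" using Idn_in Hom_Cod_Obj D(1)[OF \<open>F \<in> P\<close>] by blast
      then show ?case using \<phi>_refl[OF \<open>F \<in> P\<close>] monic_of_retraction Idn_Cmp by simp
    next
      case (insert x H)
      show ?case
      proof
        assume FH: "F \<union> insert x H \<in> P"
        then have FH': "F \<union> H \<in> P" and x: "x \<in> X" by (auto simp: P_def)
        show "monic C (\<phi> F (F \<union> insert x H))"
        proof (cases "x \<in> F \<union> H")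
          case True
          then have "F \<union> insert x H = F \<union> H" by blast
          then show ?thesis using insert.IH FH' by simp
        next
          case False
          have eq: "F \<union> insert x H = insert x (F \<union> H)" by blast
          have 1: "\<phi> F (F \<union> H) \<in> Hom C (L F) (L (F \<union> H))" using \<phi>[OF \<open>F \<in> P\<close> FH'] by blast
          have 2: "\<phi> (F \<union> H) (insert x (F \<union> H)) \<in> Hom C (L (F \<union> H)) (L (insert x (F \<union> H)))"
            using \<phi>[OF FH' FH[unfolded eq]] by blast
          have "monic C (\<phi> (F \<union> H) (insert x (F \<union> H)) \<cdot> \<phi> F (F \<union> H))"
            using monic_Cmp[OF 1 2] insert.IH FH' step[OF FH' x False] by blast
          then show ?thesis
            using \<phi>_trans[OF \<open>F \<in> P\<close> FH' FH[unfolded eq] Un_upper1 subset_insertI] unfolding eq by simp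
        qed
      qed
    qed
    have "F \<union> G = G" "finite G" using that by (auto simp: P_def)
    then show ?thesis using mono[of G] that(2) by simp
  qed
  have empty_P: "{} \<in> P" by (simp add: P_def)
  have AO: "A \<in> Obj C" using A by (simp add: exhausted_def)
  \<comment> \<open>The stage for the empty set was picked by choice, so it is not \<open>A\<close>
    itself; \<open>h0\<close> becomes the inverse of \<open>i {}\<close>.\<close>
  have "\<exists>h \<in> Hom C (L {}) A. h \<cdot> i {} = Idn C A \<and> (\<forall>x\<in>{}. h \<cdot> r {} x = undefined)"
    using Idn_in[OF AO] by (intro D(4)[OF empty_P]) auto
  then obtain h0 where h0: "h0 \<in> Hom C (L {}) A" "h0 \<cdot> i {} = Idn C A" by blast
  note i0 = D(1)[OF empty_P]
  have i0h0: "i {} \<cdot> h0 = Idn C (L {})"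
  proof (rule uniq[OF empty_P Cmp_in[OF h0(1) i0] Idn_in[OF Hom_Cod_Obj[OF i0]]])
    show "i {} \<cdot> h0 \<cdot> i {} = Idn C (L {}) \<cdot> i {}"
      using Cmp_assoc[OF i0 h0(1) i0] h0(2) Cmp_Idn[OF i0] Idn_Cmp[OF i0] by simp
  qed simp
  have i0_monic: "monic C (i {})" by (rule monic_of_retraction[OF i0 h0])
  have ex0: "exhausted (L {})"
  proof (rule exhausted_embed[OF A i0 i0_monic])
    fix S f assume f: "f \<in> Hom C S (L {})"
    show "\<exists>g \<in> Hom C S A. i {} \<cdot> g = f"
      using Cmp_assoc[OF f h0(1) i0] i0h0 Idn_Cmp[OF f] Cmp_in[OF f h0(1)] by metis
  qed
  have ex: "exhausted (L F)" if F: "F \<in> P" for F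
  proof -
    have "finite F" using F by (simp add: P_def)
    then show ?thesis using F
    proof (induction F rule: finite_induct)
      case empty
      show ?case by (rule ex0)
    next
      case (insert x F)
      then have "F \<in> P" "x \<in> X" by (auto simp: P_def)
      then show ?case using step[of F x] insert by blast
    qed
  qed
  have ds: "directed_system C P (\<subseteq>) L \<phi>"
  proof
    show "P \<noteq> {}" using empty_P by blast
    show "\<exists>H \<in> P. F \<subseteq> H \<and> G \<subseteq> H" if "F \<in> P" "G \<in> P" for F G
      using that by (intro bexI[of _ "F \<union> G"]) (auto simp: P_def)
  qed (use \<phi> \<phi>_refl \<phi>_trans in auto)
  interpret DS: directed_system C P "(\<subseteq>)" L \<phi> by (rule ds)
  have small_P: "small U P" by (rule small_subset[OF small_Pow[OF universe X]]) (auto simp: P_def)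
  obtain B l where B: "is_colimit DS.J C DS.F B l"
    using colimit_exists[OF cocomplete DS.small_J[OF universe small_P] DS.functor_F] by metis
  have leg: "l F \<in> Hom C (L F) B" if "F \<in> P" for F using DS.colim_leg[OF B that] .
  have comm: "l G \<cdot> \<phi> F G = l F" if "F \<in> P" "G \<in> P" "F \<subseteq> G" for F G using DS.colim_comm[OF B that] .
  define j where "j = l {} \<cdot> i {}"
  \<comment> \<open>The cell \<open>x\<close> already lives at the stage of the singleton; any
    finite set containing \<open>x\<close> gives the same map into \<open>B\<close>.\<close>
  define s where "s x = l {x} \<cdot> r {x} x" for x
  have j: "j \<in> Hom C A B" unfolding j_def by (rule Cmp_in[OF i0 leg[OF empty_P]])
  have j_eq: "l F \<cdot> i F = j" if F: "F \<in> P" for F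
  proof -
    note p = \<phi>[OF empty_P F empty_subsetI]
    show ?thesis
      using Cmp_assoc[OF i0 conjunct1[OF p] leg[OF F]] comm[OF empty_P F empty_subsetI] p
          by (simp add: j_def)
  qed
  have sing: "{x} \<in> P" if "x \<in> X" for x using that by (simp add: P_def)
  have s_eq: "l F \<cdot> r F x = s x" if F: "F \<in> P" and x: "x \<in> F" for F x
  proof -
    have x1: "{x} \<in> P" "{x} \<subseteq> F" using F x by (auto simp: P_def)
    note p = \<phi>[OF x1(1) F x1(2)]
    have "r {x} x \<in> Hom C (Cod C (k x)) (L {x})" using D(2)[OF x1(1)] by simp
    from Cmp_assoc[OF this conjunct1[OF p] leg[OF F]] show ?thesis using comm[OF x1(1) F x1(2)] p
        by (simp add: s_def)
  qed
  have "monic C j" unfolding j_def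
    by (rule monic_Cmp[OF i0 leg[OF empty_P] i0_monic colimit_leg_monic[OF ds small_P B \<phi>_monic
        empty_P]])
  moreover have "exhausted B" by (rule colimit_exhausted[OF ds small_P B \<phi>_monic ex])
  moreover have "s x \<in> Hom C (Cod C (k x)) B \<and> s x \<cdot> k x = j \<cdot> n x" if x: "x \<in> X" for x
  proof -
    have rx: "r {x} x \<in> Hom C (Cod C (k x)) (L {x})" "r {x} x \<cdot> k x = i {x} \<cdot> n x"
      using D(2,3)[OF sing[OF x], of x] by simp_all
    note lx = leg[OF sing[OF x]]
    show ?thesis
      using Cmp_in[OF rx(1) lx] Cmp_assoc[OF kH[OF x] rx(1) lx] rx(2)
        Cmp_assoc[OF n[OF x] D(1)[OF sing[OF x]] lx] j_eq[OF sing[OF x]] by (simp add: s_def)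
  qed
  moreover have "\<exists>h \<in> Hom C B Z. h \<cdot> j = f \<and> (\<forall>x\<in>X. h \<cdot> s x = g x)"
    if f: "f \<in> Hom C A Z" and g: "\<forall>x\<in>X. g x \<in> Hom C (Cod C (k x)) Z \<and> g x \<cdot> k x = f \<cdot> n x" for Z f g
  proof -
    have "\<exists>h. h \<in> Hom C (L F) Z \<and> h \<cdot> i F = f \<and> (\<forall>x\<in>F. h \<cdot> r F x = g x)" if F: "F \<in> P" for F
      using D(4)[OF F f, of g] g PX[OF F] by blast
    then obtain t where t: "\<And>F. F \<in> P \<Longrightarrow> t F \<in> Hom C (L F) Z \<and> t F \<cdot> i F = f \<and> (\<forall>x\<in>F. t F \<cdot> r F x = g x)"
      by metis
    have "\<exists>h \<in> Hom C B Z. \<forall>F \<in> P. h \<cdot> l F = t F"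
    proof (rule DS.colim_univ[OF B Hom_Cod_Obj[OF f]])
      show "t F \<in> Hom C (L F) Z" if "F \<in> P" for F using t[OF that] by blast
      fix F G assume FG: "F \<in> P" "G \<in> P" "F \<subseteq> G"
      note tF = t[OF FG(1)] and tG = t[OF FG(2)] and p = \<phi>[OF FG]
      show "t G \<cdot> \<phi> F G = t F"
      proof (rule uniq[OF FG(1) Cmp_in[OF conjunct1[OF p] conjunct1[OF tG]] conjunct1[OF tF]])
        show "t G \<cdot> \<phi> F G \<cdot> i F = t F \<cdot> i F"
          using Cmp_assoc[OF D(1)[OF FG(1)] conjunct1[OF p] conjunct1[OF tG]] p tF tG by simp
        show "t G \<cdot> \<phi> F G \<cdot> r F x = t F \<cdot> r F x" if x: "x \<in> F" for x
          using Cmp_assoc[OF D(2)[OF FG(1) x] conjunct1[OF p] conjunct1[OF tG]] p tF tG x FG(3) by auto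
      qed
    qed
    then obtain h where h: "h \<in> Hom C B Z" "\<forall>F \<in> P. h \<cdot> l F = t F" by blast
    have "h \<cdot> j = f"
      using Cmp_assoc[OF i0 leg[OF empty_P] h(1)] h(2) empty_P t[OF empty_P] by (simp add: j_def)
    moreover have "h \<cdot> s x = g x" if x: "x \<in> X" for x
    proof -
      have "r {x} x \<in> Hom C (Cod C (k x)) (L {x})" using D(2)[OF sing[OF x]] by simp
      from Cmp_assoc[OF this leg[OF sing[OF x]] h(1)] show ?thesis
        using h(2) sing[OF x] t[OF sing[OF x]] by (simp add: s_def)
    qed
    ultimately show ?thesis using h(1) by blast
  qed
  ultimately show ?thesis using j by blast
qed

text \<open>A fixed choice of kernel, so that cells are parametrized by the epimorphism
  alone.\<close>

definition ker :: "'m \<Rightarrow> 'm" where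
  "ker q = (SOME k. is_kernel C k q)"

lemma ker:
  assumes "q \<in> Hom C R S"
  shows "is_kernel C (ker q) q" "ker q \<in> Hom C (Dom C (ker q)) R"
proof -
  show k: "is_kernel C (ker q) q"
    unfolding ker_def using ex_kernel[OF HomD(1)[OF assms]] by (rule someI_ex)
  show "ker q \<in> Hom C (Dom C (ker q)) R"
    using is_kernel_Arr(1,4)[OF k] HomD(2)[OF assms] by simp
qed

text \<open>Every square from \<open>ker q\<close> to \<open>p\<close> acquires a diagonal once
  \<open>A\<close> is enlarged to \<open>B\<close>. For \<open>B = A\<close> and \<open>j\<close>
  the identity this is the right lifting property of \<open>p\<close> against kernels of
  epimorphisms between generators.\<close>

definition solves :: "'m \<Rightarrow> 'm \<Rightarrow> 'm \<Rightarrow> 'o \<Rightarrow> 'o \<Rightarrow> 'o \<Rightarrow> bool" where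
  "solves p j p' A B K \<longleftrightarrow>
     (\<forall>R \<in> T. \<forall>S \<in> T. \<forall>q \<in> Hom C R S. \<forall>n \<in> Hom C (Dom C (ker q)) A. \<forall>\<rho> \<in> Hom C R K.
        epic C q \<and> p \<cdot> n = \<rho> \<cdot> ker q \<longrightarrow> (\<exists>h \<in> Hom C R B. h \<cdot> ker q = j \<cdot> n \<and> p' \<cdot> h = \<rho>))"

text \<open>All lifting problems are solved at once by attaching one cell for each of them; the
  universal property extends \<open>p\<close> over the cells by their lower arrows.\<close>

lemma one_step:
  assumes A: "exhausted A" and p: "p \<in> Hom C A K"
  shows "\<exists>B p'. exhausted B \<and> p' \<in> Hom C B K \<and>
    (\<exists>j \<in> Hom C A B. monic C j \<and> p' \<cdot> j = p \<and> solves p j p' A B K)"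
proof -
  have AO: "A \<in> Obj C" using A by (simp add: exhausted_def)
  define Q where "Q = (\<Union>R\<in>T. \<Union>S\<in>T. Hom C R S)"
  \<comment> \<open>The lifting problems: \<open>q\<close> names the cell, \<open>n\<close> is the
    upper and \<open>\<rho>\<close> the lower arrow of the square.\<close>
  define X where "X = {(q, n, \<rho>). \<exists>R \<in> T. \<exists>S \<in> T. q \<in> Hom C R S \<and> n \<in> Hom C (Dom C (ker q)) A \<and>
    \<rho> \<in> Hom C R K \<and> epic C q \<and> p \<cdot> n = \<rho> \<cdot> ker q}"
  have "small U Q" unfolding Q_def by (intro small_UN[OF universe small_T] Hom_small T_Obj)
  moreover have "small U (Hom C (Dom C (ker q)) A \<times> Hom C (Dom C q) K)" if "q \<in> Q" for q
  proof -
    obtain R S where RS: "R \<in> T" "S \<in> T" "q \<in> Hom C R S" using \<open>q \<in> Q\<close> unfolding Q_def by blast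
    have "Dom C (ker q) \<in> Obj C" "Dom C q \<in> Obj C"
      using Hom_Dom_Obj[OF ker(2)[OF RS(3)]] Hom_Dom_Obj[OF RS(3)] HomD(2)[OF RS(3)] by simp_all
    then show ?thesis by (intro small_Sigma[OF universe] Hom_small AO Hom_Cod_Obj[OF p])
  qed
  ultimately have "small U (SIGMA q : Q. Hom C (Dom C (ker q)) A \<times> Hom C (Dom C q) K)"
    by (rule small_Sigma[OF universe])
  moreover have "X \<subseteq> (SIGMA q : Q. Hom C (Dom C (ker q)) A \<times> Hom C (Dom C q) K)"
  proof
    fix x assume "x \<in> X"
    then obtain q n \<rho> R S where x: "x = (q, n, \<rho>)" "R \<in> T" "S \<in> T" "q \<in> Hom C R S"
        "n \<in> Hom C (Dom C (ker q)) A" "\<rho> \<in> Hom C R K"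
      unfolding X_def by blast
    then have "q \<in> Q" "Dom C q = R" using HomD(2)[OF x(4)] unfolding Q_def by blast+
    then show "x \<in> (SIGMA q : Q. Hom C (Dom C (ker q)) A \<times> Hom C (Dom C q) K)" using x by simp
  qed
  ultimately have X: "small U X" by (rule small_subset)
  have XE: "\<exists>R \<in> T. \<exists>S \<in> T. fst x \<in> Hom C R S \<and> epic C (fst x) \<and> is_kernel C (ker (fst x)) (fst x) \<and>
      Cod C (ker (fst x)) = R \<and> fst (snd x) \<in> Hom C (Dom C (ker (fst x))) A \<and> snd (snd x) \<in> Hom C R K \<and>
      p \<cdot> fst (snd x) = snd (snd x) \<cdot> ker (fst x)" if xX: "x \<in> X" for x
  proof -
    obtain q n \<rho> R S where x: "x = (q, n, \<rho>)" "R \<in> T" "S \<in> T" "q \<in> Hom C R S"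
        "n \<in> Hom C (Dom C (ker q)) A"
        "\<rho> \<in> Hom C R K" "epic C q" "p \<cdot> n = \<rho> \<cdot> ker q"
      using xX unfolding X_def by blast
    then show ?thesis using ker[OF x(4)] HomD(3)[OF ker(2)[OF x(4)]] by auto
  qed
  have "\<exists>B j r. exhausted B \<and> j \<in> Hom C A B \<and> monic C j \<and>
    (\<forall>x\<in>X. r x \<in> Hom C (Cod C (ker (fst x))) B \<and> r x \<cdot> ker (fst x) = j \<cdot> fst (snd x)) \<and>
    (\<forall>Z f g. f \<in> Hom C A Z \<and> (\<forall>x\<in>X. g x \<in> Hom C (Cod C (ker (fst x))) Z \<and>
        g x \<cdot> ker (fst x) = f \<cdot> fst (snd x)) \<longrightarrow>
       (\<exists>h \<in> Hom C B Z. h \<cdot> j = f \<and> (\<forall>x\<in>X. h \<cdot> r x = g x)))"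
    by (rule attach_cells[OF A X]) (use XE in blast)+
  then obtain B j r where B: "exhausted B" "j \<in> Hom C A B" "monic C j"
    and r: "\<And>x. x \<in> X \<Longrightarrow> r x \<in> Hom C (Cod C (ker (fst x))) B \<and> r x \<cdot> ker (fst x) = j \<cdot> fst (snd x)"
    and univ: "\<And>Z f g. f \<in> Hom C A Z \<Longrightarrow>
       (\<forall>x\<in>X. g x \<in> Hom C (Cod C (ker (fst x))) Z \<and> g x \<cdot> ker (fst x) = f \<cdot> fst (snd x)) \<Longrightarrow>
       (\<exists>h \<in> Hom C B Z. h \<cdot> j = f \<and> (\<forall>x\<in>X. h \<cdot> r x = g x))"
    by blast
  have "\<exists>h \<in> Hom C B K. h \<cdot> j = p \<and> (\<forall>x\<in>X. h \<cdot> r x = snd (snd x))"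
  proof (rule univ[OF p], intro ballI)
    fix x assume "x \<in> X"
    from XE[OF this] show "snd (snd x) \<in> Hom C (Cod C (ker (fst x))) K \<and>
        snd (snd x) \<cdot> ker (fst x) = p \<cdot> fst (snd x)"
      by auto
  qed
  then obtain p' where p': "p' \<in> Hom C B K" "p' \<cdot> j = p" "\<And>x. x \<in> X \<Longrightarrow> p' \<cdot> r x = snd (snd x)" by blast
  have "solves p j p' A B K" unfolding solves_def
  proof (intro ballI impI)
    fix R S q n \<rho> assume *: "R \<in> T" "S \<in> T" "q \<in> Hom C R S" "n \<in> Hom C (Dom C (ker q)) A"
        "\<rho> \<in> Hom C R K"
      "epic C q \<and> p \<cdot> n = \<rho> \<cdot> ker q"
    then have x: "(q, n, \<rho>) \<in> X" unfolding X_def by blast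
    have "r (q, n, \<rho>) \<in> Hom C R B" "r (q, n, \<rho>) \<cdot> ker q = j \<cdot> n"
      using r[OF x] HomD(3)[OF ker(2)[OF *(3)]] by simp_all
    moreover have "p' \<cdot> r (q, n, \<rho>) = \<rho>" using p'(3)[OF x] by simp
    ultimately show "\<exists>h \<in> Hom C R B. h \<cdot> ker q = j \<cdot> n \<and> p' \<cdot> h = \<rho>" by blast
  qed
  then show ?thesis using B p' by blast
qed

end

lemma (in category) chain_system:
  fixes A :: "nat \<Rightarrow> 'o" and j :: "nat \<Rightarrow> 'm"
  assumes A: "\<And>i. A i \<in> Obj C" and j: "\<And>i. j i \<in> Hom C (A i) (A (Suc i))"
  shows "\<exists>\<phi>. directed_system C UNIV (\<le>) A \<phi> \<and> (\<forall>i. \<phi> i (Suc i) = j i) \<and>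
    (\<forall>m n. m \<le> n \<longrightarrow> \<phi> m (Suc n) = j n \<cdot> \<phi> m n)"
proof -
  \<comment> \<open>\<open>c m d\<close> is the composite of the \<open>d\<close> steps that start
    at stage \<open>m\<close>; counting by length makes composition an addition.\<close>
  define c where "c m = rec_nat (Idn C (A m)) (\<lambda>d f. j (m + d) \<cdot> f)" for m
  have c0: "c m 0 = Idn C (A m)" and cS: "c m (Suc d) = j (m + d) \<cdot> c m d" for m d
    by (simp_all add: c_def)
  have c_in: "c m d \<in> Hom C (A m) (A (m + d))" for m d
    by (induction d) (use Idn_in[OF A] Cmp_in j in \<open>auto simp: c0 cS\<close>)
  have c_add: "c (m + d) e \<cdot> c m d = c m (d + e)" for m d e
  proof (induction e)
    case 0
    show ?case using Idn_Cmp[OF c_in] by (simp add: c0)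
  next
    case (Suc e)
    have "c (m + d) (Suc e) \<cdot> c m d = j (m + d + e) \<cdot> (c (m + d) e \<cdot> c m d)"
      using Cmp_assoc[OF c_in c_in j] by (simp add: cS)
    then show ?case using Suc by (simp add: cS add.assoc)
  qed
  define \<phi> where "\<phi> m n = c m (n - m)" for m n
  have "directed_system C UNIV (\<le>) A \<phi>"
  proof
    show "\<exists>r \<in> UNIV. p \<le> r \<and> q \<le> r" for p q :: nat by (intro bexI[of _ "max p q"]) auto
    show "\<phi> p q \<in> Hom C (A p) (A q)" if "p \<le> q" for p q
      using c_in[of p "q - p"] that by (simp add: \<phi>_def)
    show "\<phi> p p = Idn C (A p)" for p by (simp add: \<phi>_def c0)
    show "\<phi> q r \<cdot> \<phi> p q = \<phi> p r" if "p \<le> q" "q \<le> r" for p q r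
      using c_add[of p "q - p" "r - q"] that by (simp add: \<phi>_def)
  qed auto
  moreover have "\<phi> i (Suc i) = j i" for i using Cmp_Idn[OF j] by (simp add: \<phi>_def cS c0)
  moreover have "\<phi> m (Suc n) = j n \<cdot> \<phi> m n" if "m \<le> n" for m n
    using that by (simp add: \<phi>_def Suc_diff_le cS)
  ultimately show ?thesis by blast
qed

context compact_gen
begin

text \<open>Iterating \<open>one_step\<close> along the natural numbers: a lifting problem over the
  colimit descends to a finite stage and is solved at the next one.\<close>

lemma exists_lifting_cover:
  assumes K: "K \<in> Obj C"
  shows "\<exists>A. \<exists>p \<in> Hom C A K. exhausted A \<and> solves p (Idn C A) p A A K"
proof -
  obtain S where S: "S \<in> T" using T_nonempty by blast
  let ?P = "\<lambda>(n :: nat) (A, p). exhausted A \<and> p \<in> Hom C A K"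
  let ?Q = "\<lambda>(n :: nat) (A, p) (B, p'). \<exists>j \<in> Hom C A B. monic C j \<and> p' \<cdot> j = p \<and> solves p j p' A B K"
  have "\<exists>f. \<forall>n. ?P n (f n) \<and> ?Q n (f n) (f (Suc n))"
  proof (rule dependent_nat_choice)
    \<comment> \<open>Any exhausted start will do, here the zero arrow from a generator; epicness is
      a consequence of the lifting property.\<close>
    show "\<exists>x. ?P 0 x" using exhausted_T[OF S] Zer_in[OF T_Obj[OF S] K] by blast
    fix x n assume "?P n x"
    then obtain A p where x: "x = (A, p)" "exhausted A" "p \<in> Hom C A K" by (cases x) auto
    then obtain B p' where "exhausted B \<and> p' \<in> Hom C B K \<and>
        (\<exists>j \<in> Hom C A B. monic C j \<and> p' \<cdot> j = p \<and> solves p j p' A B K)"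
      using one_step[OF x(2,3)] by blast
    then show "\<exists>y. ?P (Suc n) y \<and> ?Q n x y" using x by (intro exI[of _ "(B, p')"]) simp
  qed
  then obtain f where f: "\<And>n. ?P n (f n) \<and> ?Q n (f n) (f (Suc n))" by blast
  define A where "A n = fst (f n)" for n
  define p where "p n = snd (f n)" for n
  have Ap: "exhausted (A n)" "p n \<in> Hom C (A n) K" for n
    using f[of n] by (auto simp: A_def p_def case_prod_beta)
  have "\<exists>j. \<forall>n. j n \<in> Hom C (A n) (A (Suc n)) \<and> monic C (j n) \<and> p (Suc n) \<cdot> j n = p n \<and>
      solves (p n) (j n) (p (Suc n)) (A n) (A (Suc n)) K"
    using f by (intro choice allI) (auto simp: A_def p_def case_prod_beta Bex_def)
  then obtain j where j: "\<And>n. j n \<in> Hom C (A n) (A (Suc n))" "\<And>n. monic C (j n)"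
      "\<And>n. p (Suc n) \<cdot> j n = p n"
    and sol: "\<And>n. solves (p n) (j n) (p (Suc n)) (A n) (A (Suc n)) K"
    by blast
  have AO: "A n \<in> Obj C" for n using Ap(1) by (simp add: exhausted_def)
  obtain \<phi> where ds: "directed_system C UNIV (\<le>) A \<phi>" and \<phi>1: "\<And>i. \<phi> i (Suc i) = j i"
    and \<phi>S: "\<And>m n. m \<le> n \<Longrightarrow> \<phi> m (Suc n) = j n \<cdot> \<phi> m n"
    using chain_system[of A j, OF AO j(1)] by blast
  interpret D: directed_system C UNIV "(\<le>)" A \<phi> by (rule ds)
  have \<phi>_in: "\<phi> m n \<in> Hom C (A m) (A n)" if "m \<le> n" for m n using D.trans_in that by blast
  have \<phi>_monic: "monic C (\<phi> m n)" if "m \<le> n" for m n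
    using that
  proof (induction n rule: dec_induct)
    case base
    show ?case using monic_of_retraction[OF Idn_in[OF AO] Idn_in[OF AO]] Idn_Cmp[OF Idn_in[OF AO]]
        D.trans_refl by simp
  next
    case (step n)
    then show ?case using \<phi>S monic_Cmp[OF \<phi>_in j(1) _ j(2)] by simp
  qed
  have \<phi>_p: "p n \<cdot> \<phi> m n = p m" if "m \<le> n" for m n
    using that
  proof (induction n rule: dec_induct)
    case base
    show ?case using D.trans_refl Cmp_Idn[OF Ap(2)] by simp
  next
    case (step n)
    then show ?case using \<phi>S Cmp_assoc[OF \<phi>_in j(1) Ap(2)] j(3) by simp
  qed
  have sm: "small U (UNIV :: nat set)" by (rule small_nat[OF universe])
  obtain L l where L: "is_colimit D.J C D.F L l"
    using colimit_exists[OF cocomplete D.small_J[OF universe sm] D.functor_F] by metis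
  have leg: "l n \<in> Hom C (A n) L" for n using D.colim_leg[OF L] by blast
  have leg_monic: "monic C (l n)" for n by (rule colimit_leg_monic[OF ds sm L \<phi>_monic UNIV_I])
  have leg_S: "l (Suc n) \<cdot> j n = l n" for n
    using D.colim_comm[OF L, of n "Suc n"] \<phi>1 by simp
  have exL: "exhausted L" by (rule colimit_exhausted[OF ds sm L \<phi>_monic Ap(1)])
  obtain P where P: "P \<in> Hom C L K" "\<And>n. P \<cdot> l n = p n"
    using D.colim_univ[OF L K, of p] Ap(2) \<phi>_p by blast
  have LO: "L \<in> Obj C" using colimitD(2)[OF L] .
  have "solves P (Idn C L) P L L K" unfolding solves_def
  proof (intro ballI impI)
    fix R S q n \<rho> assume R: "R \<in> T" and S: "S \<in> T" and q: "q \<in> Hom C R S"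
        and n: "n \<in> Hom C (Dom C (ker q)) L"
      and \<rho>: "\<rho> \<in> Hom C R K" and qn: "epic C q \<and> P \<cdot> n = \<rho> \<cdot> ker q"
    \<comment> \<open>The domain of \<open>ker q\<close> is finitely generated rather than compact.
      Its generator \<open>R'\<close> maps to a finite stage, and since the leg is monic the
      diagonal fill-in moves \<open>n\<close> itself there.\<close>
    obtain R' e where e: "R' \<in> T" "e \<in> Hom C R' (Dom C (ker q))" "epic C e"
      using kernel_finitely_generated[OF R S q _ ker(2,1)[OF q]] qn by blast
    obtain i g where g: "g \<in> Hom C R' (A i)" "l i \<cdot> g = n \<cdot> e"
      using D.colim_factor[OF universe sm L compact[OF e(1)] Cmp_in[OF e(2) n]] by blast
    obtain n' where n': "n' \<in> Hom C (Dom C (ker q)) (A i)" "l i \<cdot> n' = n"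
      using factor_through_epic[OF e(2,3) n leg leg_monic g] by blast
    have "p i \<cdot> n' = \<rho> \<cdot> ker q" using Cmp_assoc[OF n'(1) leg P(1)] P(2) n'(2) qn by simp
    then obtain h where h: "h \<in> Hom C R (A (Suc i))" "h \<cdot> ker q = j i \<cdot> n'" "p (Suc i) \<cdot> h = \<rho>"
      using sol[of i] R S q n'(1) \<rho> qn unfolding solves_def by blast
    have "l (Suc i) \<cdot> h \<cdot> ker q = Idn C L \<cdot> n"
      using Cmp_assoc[OF ker(2)[OF q] h(1) leg] h(2) Cmp_assoc[OF n'(1) j(1) leg]
          leg_S n'(2) Idn_Cmp[OF n] by simp
    moreover have "P \<cdot> (l (Suc i) \<cdot> h) = \<rho>" using Cmp_assoc[OF h(1) leg P(1)] P(2) h(3) by simp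
    ultimately show "\<exists>h \<in> Hom C R L. h \<cdot> ker q = Idn C L \<cdot> n \<and> P \<cdot> h = \<rho>" using Cmp_in[OF h(1) leg]
        by blast
  qed
  then show ?thesis using P(1) exL by blast
qed

text \<open>The lifting property yields both halves: lifting against zero kernels makes
  \<open>p\<close> epic, and squares with zero lower arrow extend arrows into the kernel
  \<open>E\<close>.\<close>

lemma special_precover:
  assumes K: "K \<in> Obj C"
  shows "\<exists>A E i p. short_exact C i p \<and> i \<in> Hom C E A \<and> p \<in> Hom C A K \<and> exhausted A \<and>
    (\<forall>S \<in> T. extensions C S E \<subseteq> split_extensions C S E)"
proof -
  obtain A p where p: "p \<in> Hom C A K" and A: "exhausted A" and sol: "solves p (Idn C A) p A A K"
    using exists_lifting_cover[OF K] by blast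
  have lift: "\<exists>h \<in> Hom C R A. h \<cdot> ker q = n \<and> p \<cdot> h = \<rho>"
    if "R \<in> T" "S \<in> T" "q \<in> Hom C R S" "epic C q" "n \<in> Hom C (Dom C (ker q)) A" "\<rho> \<in> Hom C R K"
        "p \<cdot> n = \<rho> \<cdot> ker q"
    for R S q n \<rho>
    using sol that Idn_Cmp[OF that(5)] unfolding solves_def by metis
  have "epic C p"
  proof (rule epic_of_generators[OF p])
    fix S x assume S: "S \<in> T" and x: "x \<in> Hom C S K"
    \<comment> \<open>The cell is the kernel of the identity of \<open>S\<close>, a zero arrow. Its
      square commutes trivially, and a diagonal is a lift of \<open>x\<close>.\<close>
    note i = Idn_in[OF T_Obj[OF S]]
    note kI = ker[OF i]
    note N = Hom_Dom_Obj[OF kI(2)]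
    have ei: "epic C (Idn C S)"
    proof (rule epicI[OF i])
      show "h = Zer C S Z" if "h \<in> Hom C S Z" "h \<cdot> Idn C S = Zer C S Z" for Z h
        using that Cmp_Idn by simp
    qed
    have k0: "ker (Idn C S) = Zer C (Dom C (ker (Idn C S))) S"
      using is_kernelD(1)[OF kI(1) i kI(2)] Idn_Cmp[OF kI(2)] by simp
    have z: "Zer C (Dom C (ker (Idn C S))) A \<in> Hom C (Dom C (ker (Idn C S))) A"
      using Zer_in[OF N Hom_Dom_Obj[OF p]] .
    have "p \<cdot> Zer C (Dom C (ker (Idn C S))) A = x \<cdot> ker (Idn C S)"
      using Cmp_Zer[OF p N] Cmp_Zer[OF x N] k0 by simp
    then show "\<exists>y \<in> Hom C S A. p \<cdot> y = x" using lift[OF S S i ei z x] by blast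
  qed
  note ep = this
  obtain E i where i: "i \<in> Hom C E A" "is_kernel C i p" using kernel_exists[OF p] by metis
  note iD = is_kernelD[OF i(2) p i(1)]
  have "extensions C S E \<subseteq> split_extensions C S E" if S: "S \<in> T" for S
  proof (intro subrelI)
    fix i' p' assume "(i', p') \<in> extensions C S E"
    then obtain B where B: "short_exact C i' p'" "i' \<in> Hom C E B" "p' \<in> Hom C B S"
        unfolding extensions_iff by blast
    note BD = short_exactD[OF B]
    \<comment> \<open>The middle term \<open>B\<close> is arbitrary, but a generator inside reach of
      it already covers \<open>S\<close>. The given extension is then controlled by the arrow
      \<open>n\<close> from the kernel of this cover to \<open>E\<close>.\<close>
    obtain R b where R: "R \<in> T" and b: "b \<in> Hom C R B" and e: "epic C (p' \<cdot> b)"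
      using epic_onto_generator[OF S B(3) BD(3)] by blast
    note q = Cmp_in[OF b B(3)]
    note k = ker[OF q]
    note N = Hom_Dom_Obj[OF k(2)]
    note kD = is_kernelD[OF k(1) q k(2)]
    note cD = is_cokernelD[OF epic_cokernel_of_kernel[OF e k(1)] k(2) q]
    have "p' \<cdot> (b \<cdot> ker (p' \<cdot> b)) = Zer C (Dom C (ker (p' \<cdot> b))) S"
      using Cmp_assoc[OF k(2) b B(3)] kD(1) by simp
    then obtain n where n: "n \<in> Hom C (Dom C (ker (p' \<cdot> b))) E" "i' \<cdot> n = b \<cdot> ker (p' \<cdot> b)"
      using BD(4)[OF Cmp_in[OF k(2) b]] by blast
    \<comment> \<open>With zero as lower arrow the diagonal lands in \<open>E\<close>, so it extends
      \<open>n\<close> to all of \<open>R\<close>.\<close>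
    have z: "Zer C R K \<in> Hom C R K" using Zer_in[OF T_Obj[OF R] K] .
    have "p \<cdot> (i \<cdot> n) = Zer C R K \<cdot> ker (p' \<cdot> b)"
      using Cmp_assoc[OF n(1) i(1) p] iD(1) Zer_Cmp[OF n(1) K] Zer_Cmp[OF k(2) K] by simp
    then obtain h where h: "h \<in> Hom C R A" "h \<cdot> ker (p' \<cdot> b) = i \<cdot> n" "p \<cdot> h = Zer C R K"
      using lift[OF R S q e Cmp_in[OF n(1) i(1)] z] by blast
    obtain h' where h': "h' \<in> Hom C R E" "i \<cdot> h' = h" using iD(3)[OF h(1,3)] by blast
    have "i \<cdot> (h' \<cdot> ker (p' \<cdot> b)) = i \<cdot> n" using Cmp_assoc[OF k(2) h'(1) i(1)] h'(2) h(2) by simp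
    then have h'n: "h' \<cdot> ker (p' \<cdot> b) = n" using monicD[OF iD(2) i(1) Cmp_in[OF k(2) h'(1)] n(1)]
        by simp
    note ih = Cmp_in[OF h'(1) B(2)]
    have "sub b (i' \<cdot> h') \<cdot> ker (p' \<cdot> b) = Zer C (Dom C (ker (p' \<cdot> b))) B"
      using sub_Cmp[OF k(2) b ih] Cmp_assoc[OF k(2) h'(1) B(2)] h'n n(2)
        sub_eq_Zer_iff[OF Cmp_in[OF k(2) b] Cmp_in[OF k(2) b]] by simp
    \<comment> \<open>After subtracting the extension of \<open>n\<close>, the map \<open>b\<close>
      kills the kernel of the cover and descends to \<open>S\<close>; the correction lies in
      \<open>E\<close>, so the result is a section.\<close>
    then obtain s where s: "s \<in> Hom C S B" "s \<cdot> (p' \<cdot> b) = sub b (i' \<cdot> h')"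
        using cD(3)[OF sub_in[OF b ih]] by blast
    have "(p' \<cdot> s) \<cdot> (p' \<cdot> b) = Idn C S \<cdot> (p' \<cdot> b)"
      using Cmp_assoc[OF q s(1) B(3)] s(2) Cmp_sub[OF b ih B(3)] Cmp_assoc[OF h'(1) B(2,3)] BD(1)
        Zer_Cmp[OF h'(1) T_Obj[OF S]] sub_Zer[OF q] Idn_Cmp[OF q] by simp
    then have "p' \<cdot> s = Idn C S"
      using epicD[OF e q Cmp_in[OF s(1) B(3)] Idn_in[OF T_Obj[OF S]]] by simp
    then show "(i', p') \<in> split_extensions C S E" using B s(1) unfolding split_extensions_iff by blast
  qed
  then show ?thesis using short_exact_of_epic[OF ep i(2)] i(1) p A by blast
qed

end

section \<open>Direct limits of generators\<close>

text \<open>Arrows are stored with source and target, since \<open>u\<close> alone determines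
  neither.\<close>

definition slice_cat :: "('o, 'm, 'x) cat_scheme \<Rightarrow> 'o set \<Rightarrow> 'o \<Rightarrow> ('m, 'm \<times> 'm \<times> 'm) cat" where
  "slice_cat C T M =
     \<lparr>Obj = {f. Dom C f \<in> T \<and> f \<in> Hom C (Dom C f) M},
      Arr = {(f, u, g). Dom C f \<in> T \<and> f \<in> Hom C (Dom C f) M \<and> Dom C g \<in> T \<and> g \<in> Hom C (Dom C g) M \<and>
        u \<in> Hom C (Dom C f) (Dom C g) \<and> g \<cdot>\<^bsub>C\<^esub> u = f},
      Dom = (\<lambda>(f, u, g). f), Cod = (\<lambda>(f, u, g). g),
      Cmp = (\<lambda>(_, v, h) (f, u, _). (f, v \<cdot>\<^bsub>C\<^esub> u, h)), Idn = (\<lambda>f. (f, Idn C (Dom C f), f))\<rparr>"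

definition slice_fctr :: "('o, 'm, 'x) cat_scheme \<Rightarrow> ('m, 'm \<times> 'm \<times> 'm, 'o, 'm) fctr" where
  "slice_fctr C = \<lparr>fob = Dom C, far = (\<lambda>(f, u, g). u)\<rparr>"

context compact_gen
begin

lemma slice_simps [simp]:
  "f \<in> Obj (slice_cat C T M) \<longleftrightarrow> Dom C f \<in> T \<and> f \<in> Hom C (Dom C f) M"
  "(f, u, g) \<in> Arr (slice_cat C T M) \<longleftrightarrow> f \<in> Obj (slice_cat C T M) \<and> g \<in> Obj (slice_cat C T M) \<and>
     u \<in> Hom C (Dom C f) (Dom C g) \<and> g \<cdot> u = f"
  "Dom (slice_cat C T M) (f, u, g) = f" "Cod (slice_cat C T M) (f, u, g) = g"
  "(f', v, h) \<cdot>\<^bsub>slice_cat C T M\<^esub> (f, u, g') = (f, v \<cdot> u, h)"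
  "Idn (slice_cat C T M) f = (f, Idn C (Dom C f), f)"
  "fob (slice_fctr C) f = Dom C f" "far (slice_fctr C) (f, u, g) = u"
  by (auto simp: slice_cat_def slice_fctr_def)

lemma slice_HomE:
  assumes "x \<in> Hom (slice_cat C T M) f g"
  obtains u where "x = (f, u, g)" "u \<in> Hom C (Dom C f) (Dom C g)" "g \<cdot> u = f"
    "f \<in> Obj (slice_cat C T M)" "g \<in> Obj (slice_cat C T M)"
  using assms by (cases x) (auto simp: Hom_def)

lemma slice_HomI:
  assumes "f \<in> Obj (slice_cat C T M)" "g \<in> Obj (slice_cat C T M)" "u \<in> Hom C (Dom C f) (Dom C g)"
      "g \<cdot> u = f"
  shows "(f, u, g) \<in> Hom (slice_cat C T M) f g"
  using assms by (simp add: Hom_def)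

lemma slice_category: "category (slice_cat C T M)"
proof
  fix x A B D E f g h
  show "f \<in> Arr (slice_cat C T M) \<Longrightarrow> Dom (slice_cat C T M) f \<in> Obj (slice_cat C T M)"
    "f \<in> Arr (slice_cat C T M) \<Longrightarrow> Cod (slice_cat C T M) f \<in> Obj (slice_cat C T M)"
    by (cases f; simp)+
  show "A \<in> Obj (slice_cat C T M) \<Longrightarrow> Idn (slice_cat C T M) A \<in> Hom (slice_cat C T M) A A"
    using Idn_in[OF T_Obj] Cmp_Idn[of A "Dom C A" M] by (auto intro!: slice_HomI)
  assume f: "f \<in> Hom (slice_cat C T M) A B"
  then obtain u where u: "f = (A, u, B)" "u \<in> Hom C (Dom C A) (Dom C B)" "B \<cdot> u = A"
      "A \<in> Obj (slice_cat C T M)" "B \<in> Obj (slice_cat C T M)"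
    by (rule slice_HomE)
  show "f \<cdot>\<^bsub>slice_cat C T M\<^esub> Idn (slice_cat C T M) A = f" "Idn (slice_cat C T M) B \<cdot>\<^bsub>slice_cat C T M\<^esub> f = f"
    using u Cmp_Idn[OF u(2)] Idn_Cmp[OF u(2)] by simp_all
  assume g: "g \<in> Hom (slice_cat C T M) B D"
  then obtain v where v: "g = (B, v, D)" "v \<in> Hom C (Dom C B) (Dom C D)" "D \<cdot> v = B"
      "D \<in> Obj (slice_cat C T M)"
    by (rule slice_HomE)
  have "D \<in> Hom C (Dom C D) M" using v(4) by simp
  from Cmp_assoc[OF u(2) v(2) this] have "D \<cdot> (v \<cdot> u) = A" using u v by simp
  then show "g \<cdot>\<^bsub>slice_cat C T M\<^esub> f \<in> Hom (slice_cat C T M) A D"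
    using u(1,4) v(1,4) Cmp_in[OF u(2) v(2)] slice_HomI[of A M D "v \<cdot> u"] slice_simps(5) by metis
  assume h: "h \<in> Hom (slice_cat C T M) D E"
  then obtain w where w: "h = (D, w, E)" "w \<in> Hom C (Dom C D) (Dom C E)" by (rule slice_HomE)
  show "h \<cdot>\<^bsub>slice_cat C T M\<^esub> (g \<cdot>\<^bsub>slice_cat C T M\<^esub> f) = h \<cdot>\<^bsub>slice_cat C T M\<^esub> g \<cdot>\<^bsub>slice_cat C T M\<^esub> f"
    using u(1) v(1) w(1) Cmp_assoc[OF u(2) v(2) w(2)] by simp
qed

lemma slice_functor: "functor (slice_cat C T M) C (slice_fctr C)"
  unfolding functor_def using slice_category category_axioms
  by (auto simp: T_Obj)

lemma slice_small:
  assumes M: "M \<in> Obj C"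
  shows "small_cat U (slice_cat C T M)"
proof -
  let ?X = "Obj (slice_cat C T M)" and ?H = "\<Union>S\<in>T. \<Union>S'\<in>T. Hom C S S'"
  have "small U (\<Union>S\<in>T. Hom C S M)" by (intro small_UN[OF universe small_T] Hom_small T_Obj M)
  moreover have "?X \<subseteq> (\<Union>S\<in>T. Hom C S M)" by auto
  ultimately have X: "small U ?X" by (rule small_subset)
  have H: "small U ?H" by (intro small_UN[OF universe small_T] Hom_small T_Obj)
  have "small U (?X \<times> ?H \<times> ?X)" by (intro small_Sigma[OF universe] X H)
  moreover have "Arr (slice_cat C T M) \<subseteq> ?X \<times> ?H \<times> ?X"
  proof
    fix x assume "x \<in> Arr (slice_cat C T M)"
    then show "x \<in> ?X \<times> ?H \<times> ?X" by (cases x) auto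
  qed
  ultimately have "small U (Arr (slice_cat C T M))" by (rule small_subset)
  then show ?thesis using X slice_category by (simp add: small_cat_def)
qed

text \<open>The hypothesis works twice. Applied to the difference of two parallel arrows it makes
  the slice category filtered; applied to an arrow at a stage that dies in \<open>M\<close>, it
  makes the comparison from the colimit to \<open>M\<close> monic. That comparison is epic because
  the generators over \<open>M\<close> already reach everything.\<close>

lemma direct_limit_of_generators:
  assumes M: "M \<in> Obj C"
    and fac: "\<And>S S' g f. S \<in> T \<Longrightarrow> S' \<in> T \<Longrightarrow> g \<in> Hom C S S' \<Longrightarrow> f \<in> Hom C S' M \<Longrightarrow> f \<cdot> g = Zer C S M \<Longrightarrow>
      \<exists>S'' \<in> T. \<exists>w \<in> Hom C S' S''. \<exists>f' \<in> Hom C S'' M. w \<cdot> g = Zer C S S'' \<and> f' \<cdot> w = f"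
  shows "M \<in> direct_limits_of U C T"
proof -
  let ?J = "slice_cat C T M" and ?F = "slice_fctr C"
  have filtered: "filtered ?J"
    unfolding filtered_def
  proof (intro conjI ballI impI)
    obtain S where "S \<in> T" using T_nonempty by blast
    then have "Zer C S M \<in> Obj ?J" using Zer_in[OF T_Obj M] T_Obj M by simp
    then show "Obj ?J \<noteq> {}" by blast
    fix f g assume f: "f \<in> Obj ?J" and g: "g \<in> Obj ?J"
    have fH: "Dom C f \<in> T" "f \<in> Hom C (Dom C f) M" and gH: "Dom C g \<in> T" "g \<in> Hom C (Dom C g) M"
      using f g by simp_all
    obtain Q h u v where Q: "Q \<in> T" "h \<in> Hom C Q M" "u \<in> Hom C (Dom C f) Q" "h \<cdot> u = f"
        "v \<in> Hom C (Dom C g) Q" "h \<cdot> v = g"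
      using T_copair[OF fH(1) gH(1) fH(2) gH(2)] by blast
    have "Dom C h = Q" using HomD(2)[OF Q(2)] .
    then have "h \<in> Obj ?J" "(f, u, h) \<in> Hom ?J f h" "(g, v, h) \<in> Hom ?J g h"
      using Q f g by (auto intro!: slice_HomI)
    then show "\<exists>k \<in> Obj ?J. Hom ?J f k \<noteq> {} \<and> Hom ?J g k \<noteq> {}" by blast
  next
    fix x y assume "x \<in> Arr ?J" "y \<in> Arr ?J" "Dom ?J x = Dom ?J y \<and> Cod ?J x = Cod ?J y"
    then obtain f u g v where x: "x = (f, u, g)" and y: "y = (f, v, g)"
      and u: "u \<in> Hom C (Dom C f) (Dom C g)" "g \<cdot> u = f" and v: "v \<in> Hom C (Dom C f) (Dom C g)"
          "g \<cdot> v = f"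
      and f: "Dom C f \<in> T" "f \<in> Hom C (Dom C f) M" and g: "Dom C g \<in> T" "g \<in> Hom C (Dom C g) M"
      by (cases x; cases y) auto
    have "g \<cdot> sub u v = Zer C (Dom C f) M"
      using Cmp_sub[OF u(1) v(1) g(2)] u(2) v(2) sub_eq_Zer_iff[OF f(2,2)] by simp
    then obtain S'' w f' where w: "S'' \<in> T" "w \<in> Hom C (Dom C g) S''" "f' \<in> Hom C S'' M"
        "w \<cdot> sub u v = Zer C (Dom C f) S''" "f' \<cdot> w = g"
      using fac[OF f(1) g(1) sub_in[OF u(1) v(1)] g(2)] by blast
    have "w \<cdot> u = w \<cdot> v"
      using Cmp_sub[OF u(1) v(1) w(2)] w(4) sub_eq_Zer_iff[OF Cmp_in[OF u(1) w(2)]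
          Cmp_in[OF v(1) w(2)]] by simp
    moreover have "Dom C f' = S''" using HomD(2)[OF w(3)] .
    ultimately show "\<exists>z \<in> Arr ?J. Dom ?J z = Cod ?J x \<and> z \<cdot>\<^bsub>?J\<^esub> x = z \<cdot>\<^bsub>?J\<^esub> y"
      using w g unfolding x y by (intro bexI[of _ "(g, w, f')"]) simp_all
  qed
  obtain L l where L: "is_colimit ?J C ?F L l"
    using colimit_exists[OF cocomplete slice_small[OF M] slice_functor] by metis
  have leg: "l f \<in> Hom C S L" if "S \<in> T" "f \<in> Hom C S M" for f S
    using colimitD(3)[OF L, of f] that HomD(2)[OF that(2)] by simp
  have comm: "l g \<cdot> u = l (g \<cdot> u)" if "S \<in> T" "S' \<in> T" "u \<in> Hom C S S'" "g \<in> Hom C S' M" for S S' u g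
  proof -
    have "(g \<cdot> u, u, g) \<in> Hom ?J (g \<cdot> u) g"
      using that HomD(2)[OF that(4)] Cmp_in[OF that(3,4)] HomD(2)[OF Cmp_in[OF that(3,4)]]
      by (intro slice_HomI) simp_all
    from colimitD(4)[OF L this] show ?thesis by simp
  qed
  have "cocone ?J C ?F M (\<lambda>f. f)"
    unfolding cocone_def using slice_functor M by auto
  note cM = this
  obtain h where h: "h \<in> Hom C L M" "\<And>S f. S \<in> T \<Longrightarrow> f \<in> Hom C S M \<Longrightarrow> h \<cdot> l f = f"
    using colimitD(5)[OF L cM] HomD(2) by fastforce
  have "epic C h" by (rule epic_of_generators[OF h(1)]) (use h(2) leg in blast)
  moreover have "monic C h"
  proof (rule monic_of_generators[OF h(1)])
    fix S z assume S: "S \<in> T" and z: "z \<in> Hom C S L" "h \<cdot> z = Zer C S M"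
    have "factors_through_stages ?J C ?F L l S"
      by (rule compactD[OF compact[OF S] slice_small[OF M] filtered L])
    then obtain f g where "f \<in> Obj ?J" "g \<in> Hom C S (fob ?F f)" "l f \<cdot> g = z"
      using z(1) unfolding factors_through_stages_def by blast
    then have f: "Dom C f \<in> T" "f \<in> Hom C (Dom C f) M" "g \<in> Hom C S (Dom C f)" "l f \<cdot> g = z" by simp_all
    have "f \<cdot> g = Zer C S M" using Cmp_assoc[OF f(3) leg[OF f(1,2)] h(1)] h(2)[OF f(1,2)] f(4) z(2)
        by simp
    then obtain S'' w f' where w: "S'' \<in> T" "w \<in> Hom C (Dom C f) S''" "f' \<in> Hom C S'' M"
        "w \<cdot> g = Zer C S S''" "f' \<cdot> w = f"
      using fac[OF S f(1,3,2)] by blast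
    have "z = l f' \<cdot> (w \<cdot> g)"
      using comm[OF f(1) w(1,2,3)] w(5) f(4) Cmp_assoc[OF f(3) w(2) leg[OF w(1,3)]] by simp
    then show "z = Zer C S L" using w(4) Cmp_Zer[OF leg[OF w(1,3)] T_Obj[OF S]] by simp
  qed
  ultimately obtain k where k: "k \<in> Hom C M L" "k \<cdot> h = Idn C L" "h \<cdot> k = Idn C M"
    using monic_epic_iso[OF h(1)] by metis
  \<comment> \<open>The objects of the slice are themselves the legs of the tautological cocone on
    \<open>M\<close>, and the isomorphism \<open>h\<close> matches them with the legs
    \<open>l\<close>.\<close>
  have "is_colimit ?J C ?F M (\<lambda>f. f)" unfolding is_colimit_def
  proof (intro conjI allI impI)
    show "cocone ?J C ?F M (\<lambda>f. f)" by (rule cM)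
    fix Z t assume "cocone ?J C ?F Z t"
    then obtain u where u: "u \<in> Hom C L Z" "\<And>f. f \<in> Obj ?J \<Longrightarrow> u \<cdot> l f = t f" using colimitD(5)[OF L]
        by blast
    show "\<exists>!v. v \<in> Hom C M Z \<and> (\<forall>f \<in> Obj ?J. v \<cdot> f = t f)"
    proof (intro ex1I[of _ "u \<cdot> k"] conjI ballI)
      show "u \<cdot> k \<in> Hom C M Z" using Cmp_in[OF k(1) u(1)] .
      fix f assume f: "f \<in> Obj ?J"
      then have fH: "Dom C f \<in> T" "f \<in> Hom C (Dom C f) M" by simp_all
      have "k \<cdot> f = l f"
        using Cmp_assoc[OF leg[OF fH] h(1) k(1)] h(2)[OF fH] k(2) Idn_Cmp[OF leg[OF fH]] by simp
      then show "u \<cdot> k \<cdot> f = t f" using Cmp_assoc[OF fH(2) k(1) u(1)] u(2)[OF f] by simp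
    next
      fix v assume v: "v \<in> Hom C M Z \<and> (\<forall>f \<in> Obj ?J. v \<cdot> f = t f)"
      have "v \<cdot> h = u"
      proof (rule colimit_ext[OF L Cmp_in[OF h(1) conjunct1[OF v]] u(1)])
        fix f assume f: "f \<in> Obj ?J"
        then have fH: "Dom C f \<in> T" "f \<in> Hom C (Dom C f) M" by simp_all
        show "v \<cdot> h \<cdot> l f = u \<cdot> l f"
          using Cmp_assoc[OF leg[OF fH] h(1) conjunct1[OF v]] h(2)[OF fH] v f u(2)[OF f] by simp
      qed
      then show "v = u \<cdot> k"
        using Cmp_assoc[OF k(1) h(1) conjunct1[OF v]] k(3) Cmp_Idn[OF conjunct1[OF v]] by simp
    qed
  qed
  then show ?thesis by (rule direct_limits_ofI[OF slice_small[OF M] filtered, rotated]) simp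
qed

text \<open>If \<open>f\<close> factors as \<open>m \<cdot> h\<close> with \<open>m\<close> monic,
  then \<open>h\<close> already kills whatever \<open>f\<close> kills, so \<open>h\<close> is the
  arrow that the criterion asks for.\<close>

lemma exhausted_direct_limit:
  assumes A: "exhausted A"
  shows "A \<in> direct_limits_of U C T"
proof (rule direct_limit_of_generators)
  show "A \<in> Obj C" using A by (simp add: exhausted_def)
  fix S S' g f assume S: "S \<in> T" "S' \<in> T" "g \<in> Hom C S S'" "f \<in> Hom C S' A" "f \<cdot> g = Zer C S A"
  obtain S'' m h where m: "S'' \<in> T" "m \<in> Hom C S'' A" "monic C m" "h \<in> Hom C S' S''" "m \<cdot> h = f"
    by (rule exhaustedD[OF A S(2,4)])
  have "m \<cdot> (h \<cdot> g) = Zer C S A" using Cmp_assoc[OF S(3) m(4,2)] m(5) S(5) by simp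
  then have "h \<cdot> g = Zer C S S''" by (rule monicD_Zer[OF m(3,2) Cmp_in[OF S(3) m(4)]])
  then show "\<exists>S'' \<in> T. \<exists>w \<in> Hom C S' S''. \<exists>f' \<in> Hom C S'' A. w \<cdot> g = Zer C S S'' \<and> f' \<cdot> w = f"
    using m by blast
qed

text \<open>\<open>W\<close> stands for tensoring with a semi-flat object on either side. The
  special precover of \<open>K\<close> is used in two moves: acyclicity of its kernel lifts
  \<open>x\<close> to \<open>W A\<close>, and compactness of \<open>I\<close> brings the lift to a
  single generator.\<close>

lemma lift_to_generator:
  fixes W :: "('o, 'm, 'z, 'n) fctr" and C0 :: "('z, 'n, 'y) add_cat_scheme"
  assumes C0: "abelian C0" and I: "compact U C0 I"
    and W: "preserves_direct_limits U C C0 W" "exact_functor C C0 W"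
    and perp: "\<And>E. E \<in> perp C T \<Longrightarrow> trivial_group (Ext C0 I (fob W E))"
    and K: "K \<in> Obj C" and x: "x \<in> Hom C0 I (fob W K)"
  shows "\<exists>R \<in> T. \<exists>r \<in> Hom C R K. \<exists>y \<in> Hom C0 I (fob W R). far W r \<cdot>\<^bsub>C0\<^esub> y = x"
proof -
  interpret C0: abelian C0 by (rule C0)
  have F: "functor C C0 W" using W(2) by (simp add: exact_functor_def)
  obtain A E i p where e: "short_exact C i p" "i \<in> Hom C E A" "p \<in> Hom C A K" "exhausted A"
    and E: "\<And>S. S \<in> T \<Longrightarrow> extensions C S E \<subseteq> split_extensions C S E"
    using special_precover[OF K] by blast
  note EO = Hom_Dom_Obj[OF e(2)]
  have IO: "I \<in> Obj C0" using C0.Hom_Dom_Obj[OF x] .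
  have "E \<in> perp C T" unfolding perp_def using EO E trivial_Ext_iff[OF T_Obj EO] by blast
  then have "trivial_group (Ext C0 I (fob W E))" by (rule perp)
  then have split: "extensions C0 I (fob W E) \<subseteq> split_extensions C0 I (fob W E)"
    using C0.trivial_Ext_iff[OF IO functorD(3)[OF F EO]] by simp
  have "short_exact C0 (far W i) (far W p)" using W(2) e(1) by (simp add: exact_functor_def)
  then obtain y where y: "y \<in> Hom C0 I (fob W A)" "far W p \<cdot>\<^bsub>C0\<^esub> y = x"
    using C0.lift_of_split[OF _ functorD(4)[OF F e(2)] functorD(4)[OF F e(3)] x split] by blast
  obtain J :: "('u, 'u) cat" and G l where J: "small_cat U J" "filtered J" "\<And>j. j \<in> Obj J \<Longrightarrow>
      fob G j \<in> T" "is_colimit J C G A l"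
    using exhausted_direct_limit[OF e(4)] unfolding direct_limits_of_def by blast
  have "is_colimit J C0 (comp_fctr W G) (fob W A) (far W \<circ> l)"
    using W(1) J unfolding preserves_direct_limits_def by blast
  then have "factors_through_stages J C0 (comp_fctr W G) (fob W A) (far W \<circ> l) I"
    by (rule compactD[OF I J(1,2)])
  then obtain j z where j: "j \<in> Obj J" and z: "z \<in> Hom C0 I (fob W (fob G j))" "far W (l j) \<cdot>\<^bsub>C0\<^esub> z = y"
    using y(1) unfolding factors_through_stages_def comp_fctr_def by auto
  note lj = colimitD(3)[OF J(4) j]
  have "far W (p \<cdot> l j) \<cdot>\<^bsub>C0\<^esub> z = x"
    using functorD(6)[OF F lj e(3)] C0.Cmp_assoc[OF z(1) functorD(4)[OF F lj]
        functorD(4)[OF F e(3)]] z(2) y(2) by simp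
  then show ?thesis using J(3)[OF j] Cmp_in[OF lj e(3)] z(1) by blast
qed

end

lemma (in abelian) epic_monic_factorization:
  assumes f: "f \<in> Hom C A B" and k: "k \<in> Hom C K A" "is_kernel C k f"
  shows "\<exists>Q. \<exists>e \<in> Hom C A Q. \<exists>m \<in> Hom C Q B. short_exact C k e \<and> monic C m \<and> m \<cdot> e = f"
proof -
  note kD = is_kernelD[OF k(2) f k(1)]
  obtain Q e where e: "e \<in> Hom C A Q" "is_cokernel C e k" using cokernel_exists[OF k(1)] by metis
  note eD = is_cokernelD[OF e(2) k(1) e(1)]
  obtain m where m: "m \<in> Hom C Q B" "m \<cdot> e = f" using eD(3)[OF f kD(1)] by blast
  have "monic C m"
  proof (rule monicI[OF m(1)])
    fix Z z assume z: "z \<in> Hom C Z Q" "m \<cdot> z = Zer C Z B"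
    obtain Q' c where c: "c \<in> Hom C Q Q'" "is_cokernel C c z" using cokernel_exists[OF z(1)] by metis
    note cD = is_cokernelD[OF c(2) z(1) c(1)]
    obtain m' where m': "m' \<in> Hom C Q' B" "m' \<cdot> c = m" using cD(3)[OF m(1) z(2)] by blast
    note ce = Cmp_in[OF e(1) c(1)]
    have "epic C (c \<cdot> e)"
    proof (rule epicI[OF ce])
      fix Y h assume h: "h \<in> Hom C Q' Y" "h \<cdot> (c \<cdot> e) = Zer C A Y"
      have "h \<cdot> c \<cdot> e = Zer C A Y" using Cmp_assoc[OF e(1) c(1) h(1)] h(2) by simp
      then have "h \<cdot> c = Zer C Q Y" by (rule epicD_Zer[OF eD(2) e(1) Cmp_in[OF c(1) h(1)]])
      then show "h = Zer C Q' Y" by (rule epicD_Zer[OF cD(2) c(1) h(1)])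
    qed
    note ep = this
    obtain K2 k2 where k2: "k2 \<in> Hom C K2 A" "is_kernel C k2 (c \<cdot> e)" using kernel_exists[OF ce]
        by metis
    note k2D = is_kernelD[OF k2(2) ce k2(1)]
    note K2 = Hom_Dom_Obj[OF k2(1)]
    note ceD = is_cokernelD[OF epic_cokernel_of_kernel[OF ep k2(2)] k2(1) ce]
    have "f \<cdot> k2 = m' \<cdot> (c \<cdot> e \<cdot> k2)"
      using m(2) m'(2) Cmp_assoc[OF e(1) c(1) m'(1)] Cmp_assoc[OF k2(1) ce m'(1)] by simp
    then have "f \<cdot> k2 = Zer C K2 B" using k2D(1) Cmp_Zer[OF m'(1) K2] by simp
    then obtain y where y: "y \<in> Hom C K2 K" "k \<cdot> y = k2" using kD(3)[OF k2(1)] by blast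
    have "e \<cdot> k2 = Zer C K2 Q" using Cmp_assoc[OF y(1) k(1) e(1)]
        y(2) eD(1) Zer_Cmp[OF y(1) Hom_Cod_Obj[OF e(1)]] by simp
    then obtain v where v: "v \<in> Hom C Q' Q" "v \<cdot> (c \<cdot> e) = e" using ceD(3)[OF e(1)] by blast
    note QO = Hom_Dom_Obj[OF c(1)]
    have "v \<cdot> c \<cdot> e = Idn C Q \<cdot> e" using Cmp_assoc[OF e(1) c(1) v(1)] v(2) Idn_Cmp[OF e(1)] by simp
    then have "v \<cdot> c = Idn C Q" by (rule epicD[OF eD(2) e(1) Cmp_in[OF c(1) v(1)] Idn_in[OF QO]])
    then show "z = Zer C Z Q"
      using Cmp_assoc[OF z(1) c(1) v(1)] cD(1) Cmp_Zer[OF v(1) Hom_Dom_Obj[OF z(1)]]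
          Idn_Cmp[OF z(1)] by simp
  qed
  moreover have "short_exact C k e" by (rule short_exact_of_monic[OF is_kernel_monic[OF k(2)] e(2)])
  ultimately show ?thesis using e(1) m by blast
qed

text \<open>Common form of the two natural isomorphisms, with \<open>vo A X\<close> the tensor
  product of the dual of \<open>A\<close> and \<open>X\<close>, and \<open>vm\<close> its action on
  arrows. Additivity is recorded as reflection of zero.\<close>

definition hom_representation ::
  "('z, 'n, 'y) add_cat_scheme \<Rightarrow> 'z \<Rightarrow> ('o, 'm, 'x) add_cat_scheme \<Rightarrow> 'o set \<Rightarrow>
   ('o \<Rightarrow> 'o \<Rightarrow> 'z) \<Rightarrow> ('m \<Rightarrow> 'm \<Rightarrow> 'n) \<Rightarrow> ('o \<Rightarrow> 'o \<Rightarrow> 'n \<Rightarrow> 'm) \<Rightarrow> bool" where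
  "hom_representation C0 I C S vo vm \<tau> \<longleftrightarrow>
     (\<forall>A \<in> S. \<forall>X \<in> Obj C. bij_betw (\<tau> A X) (Hom C0 I (vo A X)) (Hom C A X) \<and>
        (\<forall>x \<in> Hom C0 I (vo A X). \<tau> A X x = Zer C A X \<longrightarrow> x = Zer C0 I (vo A X))) \<and>
     (\<forall>A \<in> S. \<forall>B \<in> S. \<forall>X Y. \<forall>s \<in> Hom C B A. \<forall>f \<in> Hom C X Y. \<forall>x \<in> Hom C0 I (vo A X).
        \<tau> B Y (vm s f \<cdot>\<^bsub>C0\<^esub> x) = f \<cdot>\<^bsub>C\<^esub> \<tau> A X x \<cdot>\<^bsub>C\<^esub> s)"

lemma hom_representationD:
  assumes "hom_representation C0 I C S vo vm \<tau>" "A \<in> S" "X \<in> Obj C"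
  shows "bij_betw (\<tau> A X) (Hom C0 I (vo A X)) (Hom C A X)"
    "x \<in> Hom C0 I (vo A X) \<Longrightarrow> \<tau> A X x \<in> Hom C A X"
    "f \<in> Hom C A X \<Longrightarrow> \<exists>x \<in> Hom C0 I (vo A X). \<tau> A X x = f"
    "x \<in> Hom C0 I (vo A X) \<Longrightarrow> \<tau> A X x = Zer C A X \<Longrightarrow> x = Zer C0 I (vo A X)"
proof -
  show b: "bij_betw (\<tau> A X) (Hom C0 I (vo A X)) (Hom C A X)"
    using assms unfolding hom_representation_def by blast
  show "x \<in> Hom C0 I (vo A X) \<Longrightarrow> \<tau> A X x \<in> Hom C A X" using bij_betwE[OF b] by blast
  show "\<exists>x \<in> Hom C0 I (vo A X). \<tau> A X x = f" if "f \<in> Hom C A X"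
    using that unfolding bij_betw_imp_surj_on[OF b, symmetric] by blast
  show "x \<in> Hom C0 I (vo A X) \<Longrightarrow> \<tau> A X x = Zer C A X \<Longrightarrow> x = Zer C0 I (vo A X)"
    using assms unfolding hom_representation_def by blast
qed

lemma hom_representation_natural:
  "hom_representation C0 I C S vo vm \<tau> \<Longrightarrow> A \<in> S \<Longrightarrow> B \<in> S \<Longrightarrow> s \<in> Hom C B A \<Longrightarrow> f \<in> Hom C X Y \<Longrightarrow>
    x \<in> Hom C0 I (vo A X) \<Longrightarrow> \<tau> B Y (vm s f \<cdot>\<^bsub>C0\<^esub> x) = f \<cdot>\<^bsub>C\<^esub> \<tau> A X x \<cdot>\<^bsub>C\<^esub> s"
  unfolding hom_representation_def by blast

text \<open>
  Here \<open>d\<close> and \<open>dm\<close> are a duality from \<open>S\<close> to the other side, \<open>W\<close> is tensoring with \<open>M\<close>, and \<open>\<tau>\<close>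
  identifies the arrows from \<open>I\<close> to \<open>vo A X\<close>, the tensor product of \<open>d A\<close> and \<open>X\<close>, with those from
  \<open>A\<close> to \<open>X\<close>.  If \<open>f\<close> kills \<open>g\<close>, then the arrow corresponding to \<open>f\<close> comes from \<open>K \<otimes> M\<close> for the kernel \<open>K\<close> of \<open>dm g\<close>.  Lifting it to a
  generator mapping to \<open>K\<close> and dualizing back factors \<open>f\<close> through an arrow that kills \<open>g\<close>.
\<close>

lemma direct_limit_of_lifting:
  fixes W :: "('r, 'rm, 'z, 'n) fctr" and C0 :: "('z, 'n, 'y) add_cat_scheme"
    and C' :: "('r, 'rm, 'w) add_cat_scheme" and C :: "('o, 'm, 'x) add_cat_scheme"
  assumes gen: "compact_gen U C T" and gen': "compact_gen U C' T'" and C0: "abelian C0"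
      and I: "compact U C0 I"
    and W: "preserves_direct_limits U C' C0 W" "exact_functor C' C0 W"
    and perp: "\<And>E. E \<in> perp C' T' \<Longrightarrow> trivial_group (Ext C0 I (fob W E))"
    and M: "M \<in> Obj C"
    and S: "T \<subseteq> S" "S \<subseteq> Obj C" "\<And>A. A \<in> S \<Longrightarrow> \<exists>B \<in> T. isomorphic C A B"
    and d: "\<And>A B u. A \<in> S \<Longrightarrow> B \<in> S \<Longrightarrow> u \<in> Hom C A B \<Longrightarrow> dm u \<in> Hom C' (d B) (d A)"
    and dm: "\<And>A B D u v. A \<in> S \<Longrightarrow> B \<in> S \<Longrightarrow> D \<in> S \<Longrightarrow> u \<in> Hom C A B \<Longrightarrow> v \<in> Hom C B D \<Longrightarrow>
      dm (v \<cdot>\<^bsub>C\<^esub> u) = dm u \<cdot>\<^bsub>C'\<^esub> dm v"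
    and full: "\<And>A B v. A \<in> S \<Longrightarrow> B \<in> S \<Longrightarrow> v \<in> Hom C' (d B) (d A) \<Longrightarrow> \<exists>u \<in> Hom C A B. dm u = v"
    and faithful: "\<And>A B u v. A \<in> S \<Longrightarrow> B \<in> S \<Longrightarrow> u \<in> Hom C A B \<Longrightarrow> v \<in> Hom C A B \<Longrightarrow> dm u = dm v \<Longrightarrow> u = v"
    and ess: "\<And>R. R \<in> T' \<Longrightarrow> \<exists>A \<in> S. isomorphic C' R (d A)"
    and rep: "hom_representation C0 I C S vo vm \<tau>"
    and vo: "\<And>A. A \<in> S \<Longrightarrow> vo A M = fob W (d A)"
    and vm: "\<And>A B u. A \<in> S \<Longrightarrow> B \<in> S \<Longrightarrow> u \<in> Hom C A B \<Longrightarrow> vm u (Idn C M) = far W (dm u)"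
  shows "M \<in> direct_limits_of U C T"
proof -
  interpret C: compact_gen U C T by (rule gen)
  interpret C': compact_gen U C' T' by (rule gen')
  interpret C0: abelian C0 by (rule C0)
  have F: "functor C' C0 W" using W(2) by (simp add: exact_functor_def)
  note repD = hom_representationD[OF rep _ M]
  have t_nat: "\<tau> A M (far W (dm u) \<cdot>\<^bsub>C0\<^esub> x) = \<tau> B M x \<cdot>\<^bsub>C\<^esub> u"
    if A: "A \<in> S" and B: "B \<in> S" and u: "u \<in> Hom C A B" and x: "x \<in> Hom C0 I (fob W (d B))" for A B u x
    using hom_representation_natural[OF rep B A u C.Idn_in[OF M], of x] x vo[OF B] vm[OF A B u]
      C.Idn_Cmp[OF repD(2)[OF B, of x]] by simp
  show ?thesis
  proof (rule C.direct_limit_of_generators[OF M])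
    fix A B g f assume AB: "A \<in> T" "B \<in> T" and g: "g \<in> Hom C A B" and f: "f \<in> Hom C B M"
      and fg: "f \<cdot>\<^bsub>C\<^esub> g = Zer C A M"
    have AS: "A \<in> S" "B \<in> S" using AB S(1) by blast+
    obtain x where x: "x \<in> Hom C0 I (fob W (d B))" "\<tau> B M x = f"
      using repD(3)[OF AS(2) f] vo[OF AS(2)] by auto
    note dg = d[OF AS g]
    note Wdg = functorD(4)[OF F dg]
    have "far W (dm g) \<cdot>\<^bsub>C0\<^esub> x = Zer C0 I (fob W (d A))"
      using repD(4)[OF AS(1)] vo[OF AS(1)] C0.Cmp_in[OF x(1) Wdg] t_nat[OF AS g x(1)] x(2) fg by simp
    note Wx = this
    obtain K k where k: "k \<in> Hom C' K (d B)" "is_kernel C' k (dm g)" using C'.kernel_exists[OF dg]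
        by metis
    \<comment> \<open>Exactness of \<open>W\<close> speaks of short exact sequences, so
      \<open>dm g\<close> is split into the cokernel of its kernel and a monic, each of which
      belongs to one.\<close>
    obtain Q e m where e: "e \<in> Hom C' (d B) Q" and m: "m \<in> Hom C' Q (d A)"
      and ke: "short_exact C' k e" "monic C' m" "m \<cdot>\<^bsub>C'\<^esub> e = dm g"
      using C'.epic_monic_factorization[OF dg k] by blast
    note We = functorD(4)[OF F e] and Wm = functorD(4)[OF F m] and Wk = functorD(4)[OF F k(1)]
    have "monic C0 (far W m)"
    proof -
      obtain Q' c where "c \<in> Hom C' (d A) Q'" "is_cokernel C' c m" using C'.cokernel_exists[OF m]
          by metis
      then have "short_exact C' m c" using C'.short_exact_of_monic ke(2) by blast
      then have "short_exact C0 (far W m) (far W c)" using W(2) by (simp add: exact_functor_def)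
      then show ?thesis using C0.is_kernel_monic unfolding short_exact_def by blast
    qed
    moreover have "far W m \<cdot>\<^bsub>C0\<^esub> (far W e \<cdot>\<^bsub>C0\<^esub> x) = Zer C0 I (fob W (d A))"
      using C0.Cmp_assoc[OF x(1) We Wm] functorD(6)[OF F e m] ke(3) Wx by simp
    ultimately have "far W e \<cdot>\<^bsub>C0\<^esub> x = Zer C0 I (fob W Q)"
        using C0.monicD_Zer[OF _ Wm C0.Cmp_in[OF x(1) We]] by blast
    moreover have "short_exact C0 (far W k) (far W e)" using W(2) ke(1) by (simp add: exact_functor_def)
    ultimately obtain y where y: "y \<in> Hom C0 I (fob W K)" "far W k \<cdot>\<^bsub>C0\<^esub> y = x"
      using C0.short_exactD(4)[OF _ Wk We x(1)] by blast
    obtain R r z where R: "R \<in> T'" and r: "r \<in> Hom C' R K" and z: "z \<in> Hom C0 I (fob W R)"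
        "far W r \<cdot>\<^bsub>C0\<^esub> z = y"
      using C'.lift_to_generator[OF C0 I W perp C'.Hom_Dom_Obj[OF k(1)] y(1)] by blast
    obtain D where D: "D \<in> S" "isomorphic C' R (d D)" using ess[OF R] by blast
    obtain \<alpha> \<beta> where ab: "\<alpha> \<in> Hom C' R (d D)" "\<beta> \<in> Hom C' (d D) R" "\<beta> \<cdot>\<^bsub>C'\<^esub> \<alpha> = Idn C' R"
      by (rule C'.isomorphicE[OF D(2)])
    note kr = C'.Cmp_in[OF r k(1)]
    note krb = C'.Cmp_in[OF ab(2) kr]
    obtain w where w: "w \<in> Hom C B D" "dm w = k \<cdot>\<^bsub>C'\<^esub> r \<cdot>\<^bsub>C'\<^esub> \<beta>" using full[OF AS(2) D(1) krb] by blast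
    define z' where "z' = far W \<alpha> \<cdot>\<^bsub>C0\<^esub> z"
    note Wa = functorD(4)[OF F ab(1)] and Wb = functorD(4)[OF F ab(2)]
    have z': "z' \<in> Hom C0 I (fob W (d D))" unfolding z'_def by (rule C0.Cmp_in[OF z(1) Wa])
    have "k \<cdot>\<^bsub>C'\<^esub> r \<cdot>\<^bsub>C'\<^esub> \<beta> \<cdot>\<^bsub>C'\<^esub> \<alpha> = k \<cdot>\<^bsub>C'\<^esub> r"
      using C'.Cmp_assoc[OF ab(1,2) kr] ab(3) C'.Cmp_Idn[OF kr] by simp
    then have "far W (dm w) \<cdot>\<^bsub>C0\<^esub> z' = far W (k \<cdot>\<^bsub>C'\<^esub> r) \<cdot>\<^bsub>C0\<^esub> z"
      using functorD(6)[OF F ab(1) krb] C0.Cmp_assoc[OF z(1) Wa functorD(4)[OF F krb]] w(2)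
          by (simp add: z'_def)
    also have "\<dots> = x"
      using functorD(6)[OF F r k(1)] C0.Cmp_assoc[OF z(1) functorD(4)[OF F r] Wk] z(2) y(2) by simp
    finally have tw: "\<tau> D M z' \<cdot>\<^bsub>C\<^esub> w = f" using t_nat[OF AS(2) D(1) w(1) z'] x(2) by simp
    note wg = C.Cmp_in[OF g w(1)]
    have AO: "A \<in> Obj C" "D \<in> Obj C" using AS(1) D(1) S(2) by blast+
    note dD = C'.Hom_Dom_Obj[OF krb] and dA = C'.Hom_Cod_Obj[OF dg]
    have dwg: "dm (w \<cdot>\<^bsub>C\<^esub> g) = Zer C' (d D) (d A)"
      using dm[OF AS D(1) g w(1)] w(2) C'.Cmp_assoc[OF ab(2) kr dg] C'.Cmp_assoc[OF r k(1) dg]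
        C'.is_kernelD(1)[OF k(2) dg k(1)] C'.Zer_Cmp[OF r dA] C'.Zer_Cmp[OF ab(2) dA] by simp
    \<comment> \<open>The duality is not assumed additive, so \<open>dm\<close> of a zero arrow
      cannot be computed directly. Instead \<open>dm\<close> sends every composite of
      \<open>w\<close> after \<open>g\<close> with an endomorphism of \<open>D\<close> to zero;
      faithfulness then equates the composites with the identity and with zero.\<close>
    have "dm (u \<cdot>\<^bsub>C\<^esub> (w \<cdot>\<^bsub>C\<^esub> g)) = Zer C' (d D) (d A)" if u: "u \<in> Hom C D D" for u
      using dm[OF AS(1) D(1,1) wg u] dwg C'.Zer_Cmp[OF d[OF D(1,1) u] dA] by simp
    then have "Idn C D \<cdot>\<^bsub>C\<^esub> (w \<cdot>\<^bsub>C\<^esub> g) = Zer C D D \<cdot>\<^bsub>C\<^esub> (w \<cdot>\<^bsub>C\<^esub> g)"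
      using faithful[OF AS(1) D(1) C.Cmp_in[OF wg C.Idn_in[OF AO(2)]]
          C.Cmp_in[OF wg C.Zer_in[OF AO(2,2)]]]
        C.Idn_in[OF AO(2)] C.Zer_in[OF AO(2,2)] by simp
    then have wg0: "w \<cdot>\<^bsub>C\<^esub> g = Zer C A D" using C.Idn_Cmp[OF wg] C.Zer_Cmp[OF wg AO(2)] by simp
    \<comment> \<open>\<open>D\<close> is only a member of the large class; the criterion wants its
      representative in \<open>T\<close>.\<close>
    obtain D' where D': "D' \<in> T" "isomorphic C D D'" using S(3)[OF D(1)] by blast
    obtain a b where c: "a \<in> Hom C D D'" "b \<in> Hom C D' D" "b \<cdot>\<^bsub>C\<^esub> a = Idn C D"
        by (rule C.isomorphicE[OF D'(2)])
    have tz: "\<tau> D M z' \<in> Hom C D M" using repD(2)[OF D(1)] z' vo[OF D(1)] by simp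
    have "a \<cdot>\<^bsub>C\<^esub> w \<cdot>\<^bsub>C\<^esub> g = Zer C A D'" using C.Cmp_assoc[OF g w(1) c(1)] wg0 C.Cmp_Zer[OF c(1) AO(1)]
        by simp
    moreover have "\<tau> D M z' \<cdot>\<^bsub>C\<^esub> b \<cdot>\<^bsub>C\<^esub> (a \<cdot>\<^bsub>C\<^esub> w) = f"
      using C.Cmp_assoc[OF C.Cmp_in[OF w(1) c(1)] c(2) tz] C.Cmp_assoc[OF w(1) c(1,2)]
          c(3) C.Idn_Cmp[OF w(1)] tw by simp
    ultimately show "\<exists>S'' \<in> T. \<exists>w \<in> Hom C B S''. \<exists>f' \<in> Hom C S'' M. w \<cdot>\<^bsub>C\<^esub> g = Zer C A S'' \<and> f' \<cdot>\<^bsub>C\<^esub> w = f"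
      using D'(1) C.Cmp_in[OF w(1) c(1)] C.Cmp_in[OF c(2) tz] by blast
  qed
qed

section \<open>Equivalences and bifunctors\<close>

lemma nat_transD:
  assumes "nat_trans A B F G t"
  shows "functor A B F" "functor A B G" "X \<in> Obj A \<Longrightarrow> t X \<in> Hom B (fob F X) (fob G X)"
    "f \<in> Hom A X Y \<Longrightarrow> t Y \<cdot>\<^bsub>B\<^esub> far F f = far G f \<cdot>\<^bsub>B\<^esub> t X"
  using assms unfolding nat_trans_def Hom_def by auto

lemma comp_id_simps [simp]:
  "fob (comp_fctr G F) X = fob G (fob F X)" "far (comp_fctr G F) f = far G (far F f)"
  "fob id_fctr X = X" "far id_fctr f = f"
  by (simp_all add: comp_fctr_def id_fctr_def)

lemma faithful_of_left_inverse:
  assumes F: "functor A B F" and GF: "nat_isomorphic A A (comp_fctr G F) id_fctr"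
    and u: "u \<in> Hom A X Y" "v \<in> Hom A X Y" "far F u = far F v"
  shows "u = v"
proof -
  interpret A: category A using functorD(1)[OF F] .
  obtain t where t: "nat_trans A A (comp_fctr G F) id_fctr t" "\<forall>X \<in> Obj A. iso_arr A (t X)"
    using GF unfolding nat_isomorphic_def by blast
  have X: "X \<in> Obj A" using A.Hom_Dom_Obj[OF u(1)] .
  note tX = nat_transD(3)[OF t(1) X, simplified]
  obtain s where s: "s \<in> Hom A X (fob G (fob F X))" "t X \<cdot>\<^bsub>A\<^esub> s = Idn A X"
    using A.iso_arr_inverse[OF tX] t(2) X by blast
  have "u \<cdot>\<^bsub>A\<^esub> t X = v \<cdot>\<^bsub>A\<^esub> t X"
    using nat_transD(4)[OF t(1) u(1)] nat_transD(4)[OF t(1) u(2)] u(3) by simp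
  then have "u \<cdot>\<^bsub>A\<^esub> (t X \<cdot>\<^bsub>A\<^esub> s) = v \<cdot>\<^bsub>A\<^esub> (t X \<cdot>\<^bsub>A\<^esub> s)"
    using A.Cmp_assoc[OF s(1) tX u(1)] A.Cmp_assoc[OF s(1) tX u(2)] by simp
  then show ?thesis using s(2) A.Cmp_Idn[OF u(1)] A.Cmp_Idn[OF u(2)] by simp
qed

text \<open>The candidate \<open>u\<close> is \<open>far G v\<close> conjugated by the isomorphisms
  \<open>t\<close>. Then \<open>far G\<close> agrees on \<open>far F u\<close> and \<open>v\<close>,
  and \<open>G\<close> is faithful because it too has a left inverse up to isomorphism.\<close>

lemma full_of_inverse:
  assumes F: "functor A B F" and G: "functor B A G"
    and GF: "nat_isomorphic A A (comp_fctr G F) id_fctr"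
        and FG: "nat_isomorphic B B (comp_fctr F G) id_fctr"
    and X: "X \<in> Obj A" and Y: "Y \<in> Obj A" and v: "v \<in> Hom B (fob F X) (fob F Y)"
  shows "\<exists>u \<in> Hom A X Y. far F u = v"
proof -
  interpret A: category A using functorD(1)[OF F] .
  obtain t where t: "nat_trans A A (comp_fctr G F) id_fctr t" "\<forall>X \<in> Obj A. iso_arr A (t X)"
    using GF unfolding nat_isomorphic_def by blast
  note tX = nat_transD(3)[OF t(1) X, simplified] and tY = nat_transD(3)[OF t(1) Y, simplified]
  obtain s where s: "s \<in> Hom A X (fob G (fob F X))" "s \<cdot>\<^bsub>A\<^esub> t X = Idn A (fob G (fob F X))"
    using A.iso_arr_inverse[OF tX] t(2) X by blast
  obtain r where r: "r \<in> Hom A Y (fob G (fob F Y))" "r \<cdot>\<^bsub>A\<^esub> t Y = Idn A (fob G (fob F Y))"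
    using A.iso_arr_inverse[OF tY] t(2) Y by blast
  note Gv = functorD(4)[OF G v]
  define u where "u = t Y \<cdot>\<^bsub>A\<^esub> far G v \<cdot>\<^bsub>A\<^esub> s"
  note tg = A.Cmp_in[OF Gv tY]
  have u: "u \<in> Hom A X Y" unfolding u_def by (rule A.Cmp_in[OF s(1) tg])
  note GFu = functorD(4)[OF G functorD(4)[OF F u]]
  have "t Y \<cdot>\<^bsub>A\<^esub> far G (far F u) = t Y \<cdot>\<^bsub>A\<^esub> far G v"
    using nat_transD(4)[OF t(1) u] A.Cmp_assoc[OF tX s(1) tg] s(2) A.Cmp_Idn[OF tg] by (simp add: u_def)
  then have "r \<cdot>\<^bsub>A\<^esub> t Y \<cdot>\<^bsub>A\<^esub> far G (far F u) = r \<cdot>\<^bsub>A\<^esub> t Y \<cdot>\<^bsub>A\<^esub> far G v"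
    using A.Cmp_assoc[OF GFu tY r(1)] A.Cmp_assoc[OF Gv tY r(1)] by simp
  then have "far G (far F u) = far G v" using r(2) A.Idn_Cmp[OF GFu] A.Idn_Cmp[OF Gv] by simp
  then have "far F u = v" by (rule faithful_of_left_inverse[OF G FG functorD(4)[OF F u] v])
  then show ?thesis using u by blast
qed

lemma Hom_full_subcat: "A \<in> S \<Longrightarrow> B \<in> S \<Longrightarrow> Hom (full_subcat C S) A B = Hom C A B"
  by (auto simp: full_subcat_def Hom_def)

lemma Hom_op_cat: "Hom (op_cat C) A B = Hom C B A"
  by (auto simp: op_cat_def Hom_def)

lemma full_op_simps [simp]:
  "Obj (full_subcat C S) = S" "g \<cdot>\<^bsub>full_subcat C S\<^esub> f = g \<cdot>\<^bsub>C\<^esub> f" "Idn (full_subcat C S) = Idn C"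
  "Obj (op_cat C) = Obj C" "g \<cdot>\<^bsub>op_cat C\<^esub> f = f \<cdot>\<^bsub>C\<^esub> g" "Idn (op_cat C) = Idn C"
  by (simp_all add: full_subcat_def op_cat_def)

lemma prod_cat_simps [simp]:
  "Obj (prod_cat A B) = Obj A \<times> Obj B"
  "(g, g') \<cdot>\<^bsub>prod_cat A B\<^esub> (f, f') = (g \<cdot>\<^bsub>A\<^esub> f, g' \<cdot>\<^bsub>B\<^esub> f')"
  "Idn (prod_cat A B) (X, X') = (Idn A X, Idn B X')"
  "(f, f') \<in> Hom (prod_cat A B) (X, X') (Y, Y') \<longleftrightarrow> f \<in> Hom A X Y \<and> f' \<in> Hom B X' Y'"
  by (auto simp: prod_cat_def Hom_def)

locale bifunctor = A: category A + B: category B + C0: category C0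
  for A :: "('a, 'p, 'x) cat_scheme" and B :: "('b, 'q, 'y) cat_scheme"
      and C0 :: "('z, 'n, 'w) cat_scheme"
    and T :: "('a \<times> 'b, 'p \<times> 'q, 'z, 'n) fctr" +
  assumes T: "functor (prod_cat A B) C0 T"
begin

lemma T_Obj: "X \<in> Obj A \<Longrightarrow> M \<in> Obj B \<Longrightarrow> fob T (X, M) \<in> Obj C0"
  using functorD(3)[OF T, of "(X, M)"] by simp

lemma T_in: "f \<in> Hom A X Y \<Longrightarrow> g \<in> Hom B M N \<Longrightarrow> far T (f, g) \<in> Hom C0 (fob T (X, M)) (fob T (Y, N))"
  using functorD(4)[OF T, of "(f, g)" "(X, M)" "(Y, N)"] by simp

lemma T_Idn: "X \<in> Obj A \<Longrightarrow> M \<in> Obj B \<Longrightarrow> far T (Idn A X, Idn B M) = Idn C0 (fob T (X, M))"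
  using functorD(5)[OF T, of "(X, M)"] by simp

lemma T_Cmp:
  "f \<in> Hom A X Y \<Longrightarrow> g \<in> Hom B M N \<Longrightarrow> f' \<in> Hom A Y Z \<Longrightarrow> g' \<in> Hom B N L \<Longrightarrow>
    far T (f', g') \<cdot>\<^bsub>C0\<^esub> far T (f, g) = far T (f' \<cdot>\<^bsub>A\<^esub> f, g' \<cdot>\<^bsub>B\<^esub> g)"
  using functorD(6)[OF T, of "(f, g)" "(X, M)" "(Y, N)" "(f', g')" "(Z, L)"] by simp

lemma T_interchange:
  assumes f: "f \<in> Hom A X Y" and g: "g \<in> Hom B M N"
  shows "far T (f, Idn B N) \<cdot>\<^bsub>C0\<^esub> far T (Idn A X, g) = far T (f, g)"
    "far T (Idn A Y, g) \<cdot>\<^bsub>C0\<^esub> far T (f, Idn B M) = far T (f, g)"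
proof -
  note ob = A.Hom_Dom_Obj[OF f] A.Hom_Cod_Obj[OF f] B.Hom_Dom_Obj[OF g] B.Hom_Cod_Obj[OF g]
  show "far T (f, Idn B N) \<cdot>\<^bsub>C0\<^esub> far T (Idn A X, g) = far T (f, g)"
    using T_Cmp[OF A.Idn_in[OF ob(1)] g f B.Idn_in[OF ob(4)]] A.Cmp_Idn[OF f] B.Idn_Cmp[OF g] by simp
  show "far T (Idn A Y, g) \<cdot>\<^bsub>C0\<^esub> far T (f, Idn B M) = far T (f, g)"
    using T_Cmp[OF f B.Idn_in[OF ob(3)] A.Idn_in[OF ob(2)] g] A.Idn_Cmp[OF f] B.Cmp_Idn[OF g] by simp
qed

lemma fix_right_simps [simp]:
  "fob (fix_right B T M) X = fob T (X, M)" "far (fix_right B T M) f = far T (f, Idn B M)"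
  by (simp_all add: fix_right_def)

lemma fix_left_simps [simp]:
  "fob (fix_left A T X) M = fob T (X, M)" "far (fix_left A T X) f = far T (Idn A X, f)"
  by (simp_all add: fix_left_def)

lemma fix_right_functor:
  assumes M: "M \<in> Obj B" shows "functor A C0 (fix_right B T M)"
  unfolding functor_def
proof (intro conjI ballI impI)
  note i = B.Idn_in[OF M]
  show "category A" "category C0" by (rule A.category_axioms, rule C0.category_axioms)
  show "X \<in> Obj A \<Longrightarrow> fob (fix_right B T M) X \<in> Obj C0" for X using T_Obj M by simp
  show "f \<in> Arr A \<Longrightarrow> far (fix_right B T M) f \<in> Hom C0 (fob (fix_right B T M) (Dom A f)) (fob
      (fix_right B T M) (Cod A f))" for f
    using T_in[OF A.Arr_Hom i] by simp
  show "X \<in> Obj A \<Longrightarrow> far (fix_right B T M) (Idn A X) = Idn C0 (fob (fix_right B T M) X)" for X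
      using T_Idn M by simp
  fix f g assume fg: "f \<in> Arr A" "g \<in> Arr A" "Cod A f = Dom A g"
  have "f \<in> Hom A (Dom A f) (Dom A g)" "g \<in> Hom A (Dom A g) (Cod A g)" using fg
      by (simp_all add: Hom_def)
  from T_Cmp[OF this(1) i this(2) i]
  show "far (fix_right B T M) (g \<cdot>\<^bsub>A\<^esub> f) = far (fix_right B T M) g \<cdot>\<^bsub>C0\<^esub> far (fix_right B T M) f"
    using B.Idn_Cmp[OF i] by simp
qed

text \<open>Lets the statement on exactness in the first variable be used for the second
  one.\<close>

lemma swap_bifunctor:
  "bifunctor B A C0 \<lparr>fob = (\<lambda>(M, X). fob T (X, M)), far = (\<lambda>(g, f). far T (f, g))\<rparr>"
      (is "bifunctor B A C0 ?T")
proof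
  have cat: "category (prod_cat B A)"
    by unfold_locales (auto simp: prod_cat_def Hom_def A.Dom_in A.Cod_in B.Dom_in B.Cod_in
        A.Cmp_assoc_Arr B.Cmp_assoc_Arr)
  show "functor (prod_cat B A) C0 ?T"
    unfolding functor_def
  proof (intro conjI ballI impI)
    show "category (prod_cat B A)" "category C0" by (rule cat, rule C0.category_axioms)
    show "fob ?T X \<in> Obj C0" if "X \<in> Obj (prod_cat B A)" for X using that T_Obj by auto
    show "far ?T (Idn (prod_cat B A) X) = Idn C0 (fob ?T X)" if "X \<in> Obj (prod_cat B A)" for X
      using that T_Idn by auto
    show "far ?T f \<in> Hom C0 (fob ?T (Dom (prod_cat B A) f)) (fob ?T (Cod (prod_cat B A) f))"
      if "f \<in> Arr (prod_cat B A)" for f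
      using that T_in[OF A.Arr_Hom B.Arr_Hom] by (auto simp: prod_cat_def)
    fix f g assume "f \<in> Arr (prod_cat B A)" "g \<in> Arr (prod_cat B A)"
        "Cod (prod_cat B A) f = Dom (prod_cat B A) g"
    then obtain a b a' b' where f: "f = (b, a)" and g: "g = (b', a')"
      and ab: "a \<in> Hom A (Dom A a) (Dom A a')" "b \<in> Hom B (Dom B b) (Dom B b')"
        "a' \<in> Hom A (Dom A a') (Cod A a')" "b' \<in> Hom B (Dom B b') (Cod B b')"
      by (cases f; cases g) (auto simp: prod_cat_def Hom_def)
    show "far ?T (g \<cdot>\<^bsub>prod_cat B A\<^esub> f) = far ?T g \<cdot>\<^bsub>C0\<^esub> far ?T f"
      using T_Cmp[OF ab] unfolding f g by simp
  qed
qed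

end

text \<open>For a fixed short exact sequence, tensoring with the stages gives a diagram of short
  exact sequences. Its colimit is the sequence tensored with \<open>M\<close>, and direct limits are
  exact in the target.\<close>

lemma exact_of_direct_limit:
  fixes A :: "('a, 'p, 'x) add_cat_scheme" and C0 :: "('z, 'n, 'w) add_cat_scheme"
      and J :: "('u, 'u) cat"
  assumes bif: "bifunctor A B C0 T" and A: "preadditive A"
    and C0: "direct_limits_exact (U :: 'u itself) C0"
    and J: "small_cat U J" "filtered J" and L: "is_colimit J B F M l"
    and pres: "\<And>X. X \<in> Obj A \<Longrightarrow> preserves_direct_limits U B C0 (fix_left A T X)"
    and ex: "\<And>j. j \<in> Obj J \<Longrightarrow> exact_functor A C0 (fix_right B T (fob F j))"
  shows "exact_functor A C0 (fix_right B T M)"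
proof -
  interpret bifunctor A B C0 T by (rule bif)
  interpret A: preadditive A by (rule A)
  interpret J: category J using functorD(1)[OF colimitD(1)[OF L]] .
  note F = colimitD(1)[OF L] and MO = colimitD(2)[OF L] and leg = colimitD(3)[OF L]
  have col: "is_colimit J C0 (comp_fctr (fix_left A T X) F) (fob T (X, M)) (\<lambda>j. far T (Idn A X, l j))"
    if "X \<in> Obj A" for X
    using pres[OF that] J L unfolding preserves_direct_limits_def by (auto simp: comp_def)
  have nat: "nat_trans J C0 (comp_fctr (fix_left A T X) F) (comp_fctr (fix_left A T Y) F) (\<lambda>j. far T
      (f, Idn B (fob F j)))"
    if f: "f \<in> Hom A X Y" for X Y f
    unfolding nat_trans_def
  proof (intro conjI ballI)
    show "functor J C0 (comp_fctr (fix_left A T X) F)" "functor J C0 (comp_fctr (fix_left A T Y) F)"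
      using colimitD(1)[OF col] A.Hom_Dom_Obj[OF f] A.Hom_Cod_Obj[OF f] by blast+
    show "far T (f, Idn B (fob F j)) \<in> Hom C0 (fob (comp_fctr (fix_left A T X) F) j) (fob (comp_fctr
        (fix_left A T Y) F) j)"
      if "j \<in> Obj J" for j
      using T_in[OF f B.Idn_in[OF functorD(3)[OF F that]]] by simp
    fix u assume "u \<in> Arr J"
    note Fu = functorD(4)[OF F J.Arr_Hom[OF this]]
    show "far T (f, Idn B (fob F (Cod J u))) \<cdot>\<^bsub>C0\<^esub> far (comp_fctr (fix_left A T X) F) u =
        far (comp_fctr (fix_left A T Y) F) u \<cdot>\<^bsub>C0\<^esub> far T (f, Idn B (fob F (Dom J u)))"
      using T_interchange[OF f Fu] by simp
  qed
  have comm: "far T (f, Idn B M) \<cdot>\<^bsub>C0\<^esub> far T (Idn A X, l j) = far T (Idn A Y, l j) \<cdot>\<^bsub>C0\<^esub> far T (f, Idn B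
      (fob F j))"
    if "f \<in> Hom A X Y" "j \<in> Obj J" for f X Y j
    using T_interchange[OF that(1) leg[OF that(2)]] by simp
  show ?thesis
    unfolding exact_functor_def
  proof (intro conjI allI impI)
    show "functor A C0 (fix_right B T M)" by (rule fix_right_functor[OF MO])
    fix i p assume se: "short_exact A i p"
    define X Y Z where "X = Dom A i" and "Y = Cod A i" and "Z = Cod A p"
    have i: "i \<in> Hom A X Y" and p: "p \<in> Hom A Y Z"
      using A.short_exact_Hom[OF se] unfolding X_def Y_def Z_def by blast+
    note XYZ = A.Hom_Dom_Obj[OF i] A.Hom_Cod_Obj[OF i] A.Hom_Cod_Obj[OF p]
    have "short_exact C0 (far T (i, Idn B (fob F j))) (far T (p, Idn B (fob F j)))" if "j \<in> Obj J" for j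
      using ex[OF that] se by (auto simp: exact_functor_def)
    then have "short_exact C0 (far T (i, Idn B M)) (far T (p, Idn B M))"
      using C0[unfolded direct_limits_exact_def, rule_format, of J
          "comp_fctr (fix_left A T X) F" "comp_fctr (fix_left A T Y) F" "\<lambda>j. far T (i, Idn B (fob F j))"
          "comp_fctr (fix_left A T Z) F" "\<lambda>j. far T (p, Idn B (fob F j))"
          "fob T (X, M)" "\<lambda>j. far T (Idn A X, l j)" "fob T (Y, M)" "\<lambda>j. far T (Idn A Y, l j)"
          "fob T (Z, M)" "\<lambda>j. far T (Idn A Z, l j)" "far T (i, Idn B M)" "far T (p, Idn B M)"]
        J nat[OF i] nat[OF p] col[OF XYZ(1)] col[OF XYZ(2)] col[OF XYZ(3)]
        T_in[OF i B.Idn_in[OF MO]] T_in[OF p B.Idn_in[OF MO]] comm[OF i] comm[OF p] by blast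
    then show "short_exact C0 (far (fix_right B T M) i) (far (fix_right B T M) p)" by simp
  qed
qed

text \<open>At every stage the only class is the split one, and these are pushed to one another, so
  the colimit of the sets has at most one element. The comparison bijection bounds Ext of the limit
  likewise.\<close>

lemma trivial_Ext_of_direct_limit:
  fixes C0 :: "('z, 'n, 'w) add_cat_scheme" and J :: "('u, 'u) cat"
  assumes C0: "abelian C0" and I: "I \<in> Obj C0"
    and FP2: "respects_direct_limits (U :: 'u itself) C0 (\<lambda>X. carrier (Ext C0 I X)) (ext_push C0)"
    and J: "small_cat U J" "filtered J" and L: "is_colimit J C0 F M l"
    and tr: "\<And>j. j \<in> Obj J \<Longrightarrow> trivial_group (Ext C0 I (fob F j))"
  shows "trivial_group (Ext C0 I M)"
proof -
  interpret C0: abelian C0 by (rule C0)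
  interpret J: category J using functorD(1)[OF colimitD(1)[OF L]] .
  note F = colimitD(1)[OF L]
  let ?H = "\<lambda>X. carrier (Ext C0 I X)"
  let ?R = "colim_rel J F ?H (ext_push C0)"
  let ?s = "\<lambda>X. split_extensions C0 I X"
  have H: "?H (fob F j) = {?s (fob F j)}" if "j \<in> Obj J" for j
    using tr[OF that] by (simp add: trivial_group_def Ext_def)
  \<comment> \<open>Two stages have a common successor, where both split classes become the split
    class there; so one equivalence class contains all stages.\<close>
  have "?R `` {(j, ?s (fob F j))} = {(i, ?s (fob F i)) | i. i \<in> Obj J}" (is "?A = ?B")
      if j: "j \<in> Obj J" for j
  proof (intro equalityI subsetI)
    fix y assume "y \<in> ?A"
    then have "fst y \<in> Obj J" "snd y \<in> ?H (fob F (fst y))" unfolding colim_rel_def by auto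
    then show "y \<in> ?B" using H by (cases y) auto
  next
    fix y assume "y \<in> ?B"
    then obtain i where i: "y = (i, ?s (fob F i))" "i \<in> Obj J" by blast
    obtain k u v where k: "k \<in> Obj J" "u \<in> Hom J j k" "v \<in> Hom J i k"
      using J(2) j i(2) unfolding filtered_def by blast
    have "ext_push C0 (far F u) (?s (fob F j)) = ext_push C0 (far F v) (?s (fob F i))"
      using C0.ext_push_split[OF functorD(4)[OF F k(2)] I]
          C0.ext_push_split[OF functorD(4)[OF F k(3)] I] by simp
    then show "y \<in> ?A" unfolding colim_rel_def using i j k H by auto
  qed
  note class_eq = this
  have "colim_set J F ?H (ext_push C0) \<subseteq> {{(i, ?s (fob F i)) | i. i \<in> Obj J}}"
  proof
    fix Q assume "Q \<in> colim_set J F ?H (ext_push C0)"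
    then obtain j x where "j \<in> Obj J" "x \<in> ?H (fob F j)" "Q = ?R `` {(j, x)}"
      unfolding colim_set_def by (elim quotientE) blast
    then show "Q \<in> {{(i, ?s (fob F i)) | i. i \<in> Obj J}}" using H class_eq by simp
  qed
  moreover have "bij_betw (comparison_map (ext_push C0) l) (colim_set J F ?H (ext_push C0)) (?H M)"
    using FP2 J L unfolding respects_direct_limits_def by blast
  ultimately have "?H M \<subseteq> {comparison_map (ext_push C0) l {(i, ?s (fob F i)) | i. i \<in> Obj J}}"
    unfolding bij_betw_def by blast
  moreover have "?s M \<in> ?H M" by (rule C0.split_extensions_in_Ext[OF I colimitD(2)[OF L]])
  ultimately have "?H M = {?s M}" by blast
  then show ?thesis unfolding trivial_group_def by (simp add: Ext_def)
qed

lemma trivial_Ext_of_iso: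
  assumes C: "abelian C" and X: "X \<in> Obj C" and Y: "Y \<in> Obj C"
    and t: "t \<in> iso (Ext C X Y) G" and G: "trivial_group G"
  shows "trivial_group (Ext C X Y)"
proof -
  interpret abelian C by (rule C)
  have b: "bij_betw t (carrier (Ext C X Y)) {\<one>\<^bsub>G\<^esub>}"
    using t G by (simp add: iso_def trivial_group_def)
  have s: "split_extensions C X Y \<in> carrier (Ext C X Y)" by (rule split_extensions_in_Ext[OF X Y])
  have "x = split_extensions C X Y" if x: "x \<in> carrier (Ext C X Y)" for x
  proof (rule inj_onD[OF bij_betw_imp_inj_on[OF b] _ x s])
    have "t x \<in> {\<one>\<^bsub>G\<^esub>}" "t (split_extensions C X Y) \<in> {\<one>\<^bsub>G\<^esub>}"
      using bij_betwE[OF b] x s by blast+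
    then show "t x = t (split_extensions C X Y)" by simp
  qed
  then have "carrier (Ext C X Y) = {split_extensions C X Y}" using s by blast
  then show ?thesis unfolding trivial_group_def by (simp add: Ext_def)
qed

text \<open>\<open>W\<close> is tensoring with the dual of \<open>S\<close>. The representation
  identifies arrows from \<open>S\<close> to \<open>X\<close> with arrows from \<open>I\<close> to
  \<open>W X\<close>, so preservation of direct limits by \<open>W\<close> and compactness of
  \<open>I\<close> combine.\<close>

lemma compact_of_representation:
  assumes I: "compact (U :: 'u itself) C0 I" and S: "S \<in> SS" "SS \<subseteq> Obj C"
      and W: "preserves_direct_limits U C C0 W"
    and rep: "hom_representation C0 I C SS vo vm \<tau>"
    and vo: "\<And>X. X \<in> Obj C \<Longrightarrow> vo S X = fob W X"
    and vm: "\<And>X Y f. f \<in> Hom C X Y \<Longrightarrow> vm (Idn C S) f = far W f"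
  shows "compact U C S"
  unfolding compact_def
proof (intro conjI allI impI)
  show SO: "S \<in> Obj C" using S by blast
  fix J :: "('u, 'u) cat" and F L l assume *: "small_cat U J \<and> filtered J \<and> is_colimit J C F L l"
  then have J: "small_cat U J" "filtered J" and L: "is_colimit J C F L l" by blast+
  note F = colimitD(1)[OF L] and leg = colimitD(3)[OF L]
  interpret C: category C using functorD(2)[OF F] .
  interpret J: category J using functorD(1)[OF F] .
  have L0: "is_colimit J C0 (comp_fctr W F) (fob W L) (far W \<circ> l)"
    using W * unfolding preserves_direct_limits_def by blast
  interpret C0: category C0 using functorD(2)[OF colimitD(1)[OF L0]] .
  note legs = colimitD(3)[OF L0]
  have fs: "factors_through_stages J C0 (comp_fctr W F) (fob W L) (far W \<circ> l) I"
      by (rule compactD[OF I J L0])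
  have bij: "bij_betw (\<tau> S X) (Hom C0 I (fob W X)) (Hom C S X)"
    and tin: "\<And>x. x \<in> Hom C0 I (fob W X) \<Longrightarrow> \<tau> S X x \<in> Hom C S X"
    and surj: "\<And>f. f \<in> Hom C S X \<Longrightarrow> \<exists>x \<in> Hom C0 I (fob W X). \<tau> S X x = f" if "X \<in> Obj C" for X
    using hom_representationD[OF rep S(1) that] vo[OF that] by simp_all
  have inj: "x = y"
    if "X \<in> Obj C" "x \<in> Hom C0 I (fob W X)" "y \<in> Hom C0 I (fob W X)" "\<tau> S X x = \<tau> S X y" for X x y
    using inj_onD[OF bij_betw_imp_inj_on[OF bij[OF that(1)]] that(4,2,3)] .
  have nat: "\<tau> S Y (far W f \<cdot>\<^bsub>C0\<^esub> x) = f \<cdot>\<^bsub>C\<^esub> \<tau> S X x"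
    if f: "f \<in> Hom C X Y" and x: "x \<in> Hom C0 I (fob W X)" for X Y f x
    using hom_representation_natural[OF rep S(1,1) C.Idn_in[OF SO] f, of x]
        vo[OF C.Hom_Dom_Obj[OF f]] vm[OF f] x
      C.Cmp_Idn[OF C.Cmp_in[OF tin[OF C.Hom_Dom_Obj[OF f] x] f]] by simp
  show "factors_through_stages J C F L l S"
    unfolding factors_through_stages_def
  proof (intro conjI ballI impI)
    fix f assume "f \<in> Hom C S L"
    then obtain x where x: "x \<in> Hom C0 I (fob W L)" "\<tau> S L x = f" using surj colimitD(2)[OF L] by blast
    then obtain j y where y: "j \<in> Obj J" "y \<in> Hom C0 I (fob (comp_fctr W F) j)"
        "(far W \<circ> l) j \<cdot>\<^bsub>C0\<^esub> y = x"
      using fs unfolding factors_through_stages_def by blast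
    have y2: "y \<in> Hom C0 I (fob W (fob F j))" using y(2) by simp
    have "l j \<cdot>\<^bsub>C\<^esub> \<tau> S (fob F j) y = f" using nat[OF leg[OF y(1)] y2] y(3) x(2) by simp
    then show "\<exists>j \<in> Obj J. \<exists>g \<in> Hom C S (fob F j). l j \<cdot>\<^bsub>C\<^esub> g = f"
      using y(1) tin[OF functorD(3)[OF F y(1)] y2] by blast
  next
    fix j g g' assume j: "j \<in> Obj J" and g: "g \<in> Hom C S (fob F j)" "g' \<in> Hom C S (fob F j)"
        "l j \<cdot>\<^bsub>C\<^esub> g = l j \<cdot>\<^bsub>C\<^esub> g'"
    note Fj = functorD(3)[OF F j]
    obtain x where x: "x \<in> Hom C0 I (fob W (fob F j))" "\<tau> S (fob F j) x = g" using surj[OF Fj g(1)]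
        by blast
    obtain x' where x': "x' \<in> Hom C0 I (fob W (fob F j))" "\<tau> S (fob F j) x' = g'"
        using surj[OF Fj g(2)] by blast
    have lj: "far W (l j) \<in> Hom C0 (fob W (fob F j)) (fob W L)" using legs[OF j] by simp
    have "far W (l j) \<cdot>\<^bsub>C0\<^esub> x = far W (l j) \<cdot>\<^bsub>C0\<^esub> x'"
      using inj[OF colimitD(2)[OF L] C0.Cmp_in[OF x(1) lj] C0.Cmp_in[OF x'(1) lj]]
        nat[OF leg[OF j] x(1)] nat[OF leg[OF j] x'(1)] x(2) x'(2) g(3) by simp
    then have eq: "(far W \<circ> l) j \<cdot>\<^bsub>C0\<^esub> x = (far W \<circ> l) j \<cdot>\<^bsub>C0\<^esub> x'" by simp
    have xs: "x \<in> Hom C0 I (fob (comp_fctr W F) j)" "x' \<in> Hom C0 I (fob (comp_fctr W F) j)"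
        using x(1) x'(1) by simp_all
    obtain k u where k: "k \<in> Obj J" "u \<in> Hom J j k"
        "far (comp_fctr W F) u \<cdot>\<^bsub>C0\<^esub> x = far (comp_fctr W F) u \<cdot>\<^bsub>C0\<^esub> x'"
      using fs j xs eq unfolding factors_through_stages_def by blast
    note Fu = functorD(4)[OF F k(2)]
    have "far F u \<cdot>\<^bsub>C\<^esub> g = far F u \<cdot>\<^bsub>C\<^esub> g'"
      using nat[OF Fu x(1)] nat[OF Fu x'(1)] k(3) x(2) x'(2) by simp
    then show "\<exists>k \<in> Obj J. \<exists>u \<in> Hom J j k. far F u \<cdot>\<^bsub>C\<^esub> g = far F u \<cdot>\<^bsub>C\<^esub> g'" using k by blast
  qed
qed

text \<open>The small object argument indexes diagrams by generators, which requires passing from an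
  essentially small class to a small set of representatives.\<close>

lemma compact_gen_of_ess_small:
  assumes U: "universe U" and C: "grothendieck U C" and S: "ess_small U C S" "generates C S"
      "extension_closed C S" "S \<noteq> {}"
    and compact: "\<And>A. A \<in> S \<Longrightarrow> compact U C A"
  shows "\<exists>T \<subseteq> S. compact_gen U C T \<and> (\<forall>A \<in> S. \<exists>B \<in> T. isomorphic C A B)"
proof -
  interpret C: grothendieck U C by (rule C)
  obtain T where T: "T \<subseteq> S" "small U T" "\<And>A. A \<in> S \<Longrightarrow> \<exists>B \<in> T. isomorphic C A B"
    using S(1) unfolding ess_small_def by blast
  have "generates C T" unfolding generates_def
  proof (intro conjI ballI impI)
    show "T \<subseteq> Obj C" using T(1) S(2) unfolding generates_def by blast
    fix f assume f: "f \<in> Arr C" "f \<noteq> Zer C (Dom C f) (Cod C f)"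
    obtain A g where A: "A \<in> S" "g \<in> Hom C A (Dom C f)" "f \<cdot>\<^bsub>C\<^esub> g \<noteq> Zer C A (Cod C f)"
      using S(2) f unfolding generates_def by blast
    obtain B where B: "B \<in> T" "isomorphic C A B" using T(3)[OF A(1)] by blast
    obtain a b where ab: "a \<in> Hom C A B" "b \<in> Hom C B A" "b \<cdot>\<^bsub>C\<^esub> a = Idn C A"
        by (rule C.isomorphicE[OF B(2)])
    note gb = C.Cmp_in[OF ab(2) A(2)] and fH = C.Arr_Hom[OF f(1)]
    have "f \<cdot>\<^bsub>C\<^esub> (g \<cdot>\<^bsub>C\<^esub> b) \<noteq> Zer C B (Cod C f)"
    proof
      assume z: "f \<cdot>\<^bsub>C\<^esub> (g \<cdot>\<^bsub>C\<^esub> b) = Zer C B (Cod C f)"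
      have "g = g \<cdot>\<^bsub>C\<^esub> b \<cdot>\<^bsub>C\<^esub> a" using C.Cmp_assoc[OF ab(1,2) A(2)] ab(3) C.Cmp_Idn[OF A(2)] by simp
      then have "f \<cdot>\<^bsub>C\<^esub> g = f \<cdot>\<^bsub>C\<^esub> (g \<cdot>\<^bsub>C\<^esub> b) \<cdot>\<^bsub>C\<^esub> a" using C.Cmp_assoc[OF ab(1) gb fH] by simp
      then show False using z A(3) C.Zer_Cmp[OF ab(1) C.Hom_Cod_Obj[OF fH]] by simp
    qed
    then show "\<exists>A \<in> T. \<exists>g \<in> Hom C A (Dom C f). f \<cdot>\<^bsub>C\<^esub> g \<noteq> Zer C A (Cod C f)" using B(1) gb by blast
  qed
  moreover have "extension_closed C T" unfolding extension_closed_def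
  proof (intro allI impI)
    fix i p assume "short_exact C i p \<and> Dom C i \<in> T \<and> Cod C p \<in> T"
    then obtain B where B: "B \<in> S" "isomorphic C (Cod C i) B"
        using S(3) T(1) unfolding extension_closed_def by blast
    then obtain B' where "B' \<in> T" "isomorphic C B B'" using T(3) by blast
    then show "\<exists>B \<in> T. isomorphic C (Cod C i) B" using C.isomorphic_trans[OF B(2)] by blast
  qed
  moreover have "T \<noteq> {}" using S(4) T(3) by blast
  ultimately have "compact_gen U C T"
    using U T(1,2) compact C by (auto simp: compact_gen_def compact_gen_axioms_def)
  then show ?thesis using T by blast
qed

text \<open>Semi-flatness tests against objects acyclic for the whole class, while the special
  precover produces acyclicity for the representatives only. Splitting transports along isomorphisms
  and closes the gap.\<close>

lemma perp_of_ess_small: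
  assumes C: "abelian C" and T: "T \<subseteq> S" "S \<subseteq> Obj C" "\<And>A. A \<in> S \<Longrightarrow> \<exists>B \<in> T. isomorphic C A B"
  shows "perp C T \<subseteq> perp C S"
proof
  interpret abelian C by (rule C)
  fix E assume "E \<in> perp C T"
  then have E: "E \<in> Obj C" "\<And>B. B \<in> T \<Longrightarrow> trivial_group (Ext C B E)" unfolding perp_def by blast+
  have "trivial_group (Ext C A E)" if A: "A \<in> S" for A
  proof -
    obtain B where B: "B \<in> T" "isomorphic C A B" using T(3)[OF A] by blast
    have "B \<in> Obj C" "A \<in> Obj C" using A B(1) T(1,2) by blast+
    then show ?thesis
      using E(2)[OF B(1)] split_isomorphic_right[OF isomorphic_sym[OF B(2)]] trivial_Ext_iff E(1)
          by blast
  qed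
  then show "E \<in> perp C S" unfolding perp_def using E(1) by blast
qed

section \<open>Duality setups\<close>

lemma iso_Hom_group:
  assumes "preadditive C" "preadditive C'" "A \<in> Obj C" "B \<in> Obj C" "A' \<in> Obj C'" "B' \<in> Obj C'"
    and h: "h \<in> iso (Hom_group C A B) (Hom_group C' A' B')"
  shows "bij_betw h (Hom C A B) (Hom C' A' B')"
    "x \<in> Hom C A B \<Longrightarrow> h x = Zer C' A' B' \<Longrightarrow> x = Zer C A B"
proof -
  interpret C: preadditive C by (rule assms(1))
  interpret C': preadditive C' by (rule assms(2))
  show b: "bij_betw h (Hom C A B) (Hom C' A' B')" using h by (simp add: iso_def)
  have "group (Hom_group C A B)" "group (Hom_group C' A' B')"
    using C.Hom_comm_group[OF assms(3,4)] C'.Hom_comm_group[OF assms(5,6)]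
        by (simp_all add: comm_group.axioms(2))
  then have "h (Zer C A B) = Zer C' A' B'" using h hom_one[of h] by (fastforce simp: iso_def)
  then show "x \<in> Hom C A B \<Longrightarrow> h x = Zer C' A' B' \<Longrightarrow> x = Zer C A B"
    using inj_onD[OF bij_betw_imp_inj_on[OF b], of x "Zer C A B"] C.Zer_in[OF assms(3,4)] by simp
qed

section \<open>The inverse duality, compactness of the generators, and semi-flat objects as direct
  limits\<close>

context duality_setup
begin

interpretation L: grothendieck U CL by (rule CL)
interpretation R: grothendieck U CR by (rule CR)
interpretation Z: grothendieck U C0 by (rule C0)
interpretation T: bifunctor CR CL C0 T by unfold_locales (rule bifunctor)

abbreviation "SLop \<equiv> op_cat (full_subcat CL SL)"
abbreviation "SRcat \<equiv> full_subcat CR SR"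

lemma SL_Obj: "S \<in> SL \<Longrightarrow> S \<in> Obj CL" and SR_Obj: "R \<in> SR \<Longrightarrow> R \<in> Obj CR"
  using SL(1) SR(1) unfolding ess_small_def by blast+

lemma Hom_SLop: "A \<in> SL \<Longrightarrow> B \<in> SL \<Longrightarrow> Hom SLop A B = Hom CL B A"
  by (simp add: Hom_op_cat Hom_full_subcat)

lemma Hom_SRcat: "A \<in> SR \<Longrightarrow> B \<in> SR \<Longrightarrow> Hom SRcat A B = Hom CR A B"
  by (rule Hom_full_subcat)

text \<open>The inverse duality, fixed once so that both sides can feed the same core
  argument.\<close>

definition G :: "('r, 'rm, 'l, 'lm) fctr" where
  "G = (SOME G. functor SRcat SLop G \<and> nat_isomorphic SLop SLop (comp_fctr G D) id_fctr \<and>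
     nat_isomorphic SRcat SRcat (comp_fctr D G) id_fctr)"

lemma D_functor: "functor SLop SRcat D"
  and G_functor: "functor SRcat SLop G"
  and GD: "nat_isomorphic SLop SLop (comp_fctr G D) id_fctr"
  and DG: "nat_isomorphic SRcat SRcat (comp_fctr D G) id_fctr"
proof -
  show "functor SLop SRcat D" using duality unfolding equivalence_def by blast
  have "\<exists>G. functor SRcat SLop G \<and> nat_isomorphic SLop SLop (comp_fctr G D) id_fctr \<and>
     nat_isomorphic SRcat SRcat (comp_fctr D G) id_fctr"
    using duality unfolding equivalence_def by blast
  from someI_ex[OF this]
  show "functor SRcat SLop G" "nat_isomorphic SLop SLop (comp_fctr G D) id_fctr"
    "nat_isomorphic SRcat SRcat (comp_fctr D G) id_fctr"
    unfolding G_def by blast+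
qed

lemma D_SR: "S \<in> SL \<Longrightarrow> fob D S \<in> SR" and G_SL: "R \<in> SR \<Longrightarrow> fob G R \<in> SL"
  using functorD(3)[OF D_functor] functorD(3)[OF G_functor] by simp_all

lemma D_in: "A \<in> SL \<Longrightarrow> B \<in> SL \<Longrightarrow> u \<in> Hom CL A B \<Longrightarrow> far D u \<in> Hom CR (fob D B) (fob D A)"
  using functorD(4)[OF D_functor, of u B A] by (simp add: Hom_SLop Hom_SRcat D_SR)

lemma G_in: "A \<in> SR \<Longrightarrow> B \<in> SR \<Longrightarrow> u \<in> Hom CR A B \<Longrightarrow> far G u \<in> Hom CL (fob G B) (fob G A)"
  using functorD(4)[OF G_functor, of u A B] by (simp add: Hom_SLop Hom_SRcat G_SL)

lemma D_Cmp:
  "A \<in> SL \<Longrightarrow> B \<in> SL \<Longrightarrow> E \<in> SL \<Longrightarrow> u \<in> Hom CL A B \<Longrightarrow> v \<in> Hom CL B E \<Longrightarrow>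
    far D (v \<cdot>\<^bsub>CL\<^esub> u) = far D u \<cdot>\<^bsub>CR\<^esub> far D v"
  using functorD(6)[OF D_functor, of v E B u A] by (simp add: Hom_SLop)

lemma G_Cmp:
  "A \<in> SR \<Longrightarrow> B \<in> SR \<Longrightarrow> E \<in> SR \<Longrightarrow> u \<in> Hom CR A B \<Longrightarrow> v \<in> Hom CR B E \<Longrightarrow>
    far G (v \<cdot>\<^bsub>CR\<^esub> u) = far G u \<cdot>\<^bsub>CL\<^esub> far G v"
  using functorD(6)[OF G_functor, of u A B v E] by (simp add: Hom_SRcat)

lemma D_Idn: "A \<in> SL \<Longrightarrow> far D (Idn CL A) = Idn CR (fob D A)"
  using functorD(5)[OF D_functor, of A] by simp

lemma G_Idn: "A \<in> SR \<Longrightarrow> far G (Idn CR A) = Idn CL (fob G A)"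
  using functorD(5)[OF G_functor, of A] by simp

lemma D_faithful: "A \<in> SL \<Longrightarrow> B \<in> SL \<Longrightarrow> u \<in> Hom CL A B \<Longrightarrow> v \<in> Hom CL A B \<Longrightarrow> far D u = far D v \<Longrightarrow> u = v"
  using faithful_of_left_inverse[OF D_functor GD, of u B A v] by (simp add: Hom_SLop)

lemma G_faithful: "A \<in> SR \<Longrightarrow> B \<in> SR \<Longrightarrow> u \<in> Hom CR A B \<Longrightarrow> v \<in> Hom CR A B \<Longrightarrow> far G u = far G v \<Longrightarrow> u = v"
  using faithful_of_left_inverse[OF G_functor DG, of u A B v] by (simp add: Hom_SRcat)

lemma D_full: "A \<in> SL \<Longrightarrow> B \<in> SL \<Longrightarrow> v \<in> Hom CR (fob D B) (fob D A) \<Longrightarrow> \<exists>u \<in> Hom CL A B. far D u = v"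
  using full_of_inverse[OF D_functor G_functor GD DG, of B A v] by (simp add: Hom_SLop Hom_SRcat D_SR)

lemma G_full: "A \<in> SR \<Longrightarrow> B \<in> SR \<Longrightarrow> v \<in> Hom CL (fob G B) (fob G A) \<Longrightarrow> \<exists>u \<in> Hom CR A B. far G u = v"
  using full_of_inverse[OF G_functor D_functor DG GD, of A B v] by (simp add: Hom_SLop Hom_SRcat G_SL)

text \<open>Naturality is given for the isomorphisms \<open>\<epsilon>\<close> from the double dual;
  conjugating with them yields it for their inverses \<open>\<eta>\<close>.\<close>

lemma DG_unit:
  "\<exists>\<eta> \<epsilon>. (\<forall>A \<in> SR. \<eta> A \<in> Hom CR A (fob D (fob G A)) \<and> \<epsilon> A \<in> Hom CR (fob D (fob G A)) A \<and>
     \<epsilon> A \<cdot>\<^bsub>CR\<^esub> \<eta> A = Idn CR A \<and> \<eta> A \<cdot>\<^bsub>CR\<^esub> \<epsilon> A = Idn CR (fob D (fob G A))) \<and>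
   (\<forall>A \<in> SR. \<forall>B \<in> SR. \<forall>v \<in> Hom CR A B. far D (far G v) \<cdot>\<^bsub>CR\<^esub> \<eta> A = \<eta> B \<cdot>\<^bsub>CR\<^esub> v)"
proof -
  obtain \<epsilon> where e: "nat_trans SRcat SRcat (comp_fctr D G) id_fctr \<epsilon>"
      "\<forall>X \<in> Obj SRcat. iso_arr SRcat (\<epsilon> X)"
    using DG unfolding nat_isomorphic_def by blast
  interpret S: category SRcat using functorD(1)[OF G_functor] .
  have DGS: "fob D (fob G A) \<in> SR" if "A \<in> SR" for A using D_SR[OF G_SL[OF that]] .
  have eH: "\<epsilon> A \<in> Hom CR (fob D (fob G A)) A" if "A \<in> SR" for A
    using nat_transD(3)[OF e(1), of A] that DGS[OF that] by (simp add: Hom_SRcat)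
  have "\<exists>h. h \<in> Hom CR A (fob D (fob G A)) \<and> h \<cdot>\<^bsub>CR\<^esub> \<epsilon> A = Idn CR (fob D (fob G A)) \<and>
      \<epsilon> A \<cdot>\<^bsub>CR\<^esub> h = Idn CR A"
    if A: "A \<in> SR" for A
  proof -
    have "\<epsilon> A \<in> Hom SRcat (fob D (fob G A)) A" "iso_arr SRcat (\<epsilon> A)"
      using eH[OF A] A DGS[OF A] e(2) by (simp_all add: Hom_SRcat)
    then obtain h where "h \<in> Hom SRcat A (fob D (fob G A))" "h \<cdot>\<^bsub>SRcat\<^esub> \<epsilon> A = Idn SRcat (fob D (fob G A))"
        "\<epsilon> A \<cdot>\<^bsub>SRcat\<^esub> h = Idn SRcat A"
      by (rule S.iso_arr_inverse)
    then show ?thesis using A DGS[OF A] by (auto simp: Hom_SRcat)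
  qed
  then obtain \<eta> where eta: "\<And>A. A \<in> SR \<Longrightarrow> \<eta> A \<in> Hom CR A (fob D (fob G A)) \<and>
      \<eta> A \<cdot>\<^bsub>CR\<^esub> \<epsilon> A = Idn CR (fob D (fob G A)) \<and> \<epsilon> A \<cdot>\<^bsub>CR\<^esub> \<eta> A = Idn CR A"
    by metis
  have "far D (far G v) \<cdot>\<^bsub>CR\<^esub> \<eta> A = \<eta> B \<cdot>\<^bsub>CR\<^esub> v" if AB: "A \<in> SR" "B \<in> SR" and v: "v \<in> Hom CR A B" for A B v
  proof -
    note hA = eta[OF AB(1)] and hB = eta[OF AB(2)]
    have vS: "v \<in> Hom SRcat A B" using v AB by (simp add: Hom_SRcat)
    note Gv = D_in[OF G_SL[OF AB(2)] G_SL[OF AB(1)] G_in[OF AB v]]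
    have nat: "\<epsilon> B \<cdot>\<^bsub>CR\<^esub> far D (far G v) = v \<cdot>\<^bsub>CR\<^esub> \<epsilon> A" using nat_transD(4)[OF e(1) vS] by simp
    have "far D (far G v) \<cdot>\<^bsub>CR\<^esub> \<eta> A = (\<eta> B \<cdot>\<^bsub>CR\<^esub> \<epsilon> B) \<cdot>\<^bsub>CR\<^esub> (far D (far G v) \<cdot>\<^bsub>CR\<^esub> \<eta> A)"
      using hB R.Idn_Cmp[OF R.Cmp_in[OF conjunct1[OF hA] Gv]] by simp
    also have "\<dots> = \<eta> B \<cdot>\<^bsub>CR\<^esub> (\<epsilon> B \<cdot>\<^bsub>CR\<^esub> far D (far G v) \<cdot>\<^bsub>CR\<^esub> \<eta> A)"
      using R.Cmp_assoc[OF R.Cmp_in[OF conjunct1[OF hA] Gv] eH[OF AB(2)] conjunct1[OF hB]]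
        R.Cmp_assoc[OF conjunct1[OF hA] Gv eH[OF AB(2)]] by simp
    also have "\<dots> = \<eta> B \<cdot>\<^bsub>CR\<^esub> v"
      using nat R.Cmp_assoc[OF conjunct1[OF hA] eH[OF AB(1)] v] hA R.Cmp_Idn[OF v] by simp
    finally show ?thesis .
  qed
  then show ?thesis using eta eH by (intro exI[of _ \<eta>] exI[of _ \<epsilon>]) blast
qed

lemma D_ess_surj: "R \<in> SR \<Longrightarrow> \<exists>S \<in> SL. isomorphic CR R (fob D S)"
  using DG_unit R.isomorphicI G_SL by metis

lemma G_ess_surj:
  assumes S: "S \<in> SL" shows "\<exists>R \<in> SR. isomorphic CL S (fob G R)"
proof -
  obtain t where t: "nat_trans SLop SLop (comp_fctr G D) id_fctr t" "\<forall>X \<in> Obj SLop. iso_arr SLop (t X)"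
    using GD unfolding nat_isomorphic_def by blast
  interpret A: category SLop using functorD(1)[OF D_functor] .
  have GS: "fob G (fob D S) \<in> SL" using G_SL[OF D_SR[OF S]] .
  have "t S \<in> Hom SLop (fob G (fob D S)) S" "iso_arr SLop (t S)" using nat_transD(3)[OF t(1), of S]
      t(2) S by simp_all
  then obtain h where "h \<in> Hom SLop S (fob G (fob D S))" "h \<cdot>\<^bsub>SLop\<^esub> t S = Idn SLop (fob G (fob D S))"
      "t S \<cdot>\<^bsub>SLop\<^esub> h = Idn SLop S"
    by (rule A.iso_arr_inverse)
  \<comment> \<open>\<open>t S\<close> is an arrow of the opposite category, so in \<open>CL\<close>
    it points from \<open>S\<close> to its double dual.\<close>
  moreover have "t S \<in> Hom CL S (fob G (fob D S))"
    using nat_transD(3)[OF t(1), of S] S GS by (simp add: Hom_SLop)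
  ultimately have "isomorphic CL S (fob G (fob D S))"
    using S GS by (intro L.isomorphicI[of "t S" _ _ h]) (simp_all add: Hom_SLop)
  then show ?thesis using D_SR[OF S] by blast
qed

lemma I_Obj: "I \<in> Obj C0"
  using I unfolding finitely_presented_def by blast

lemma I_compact: "compact U C0 I"
  by (rule finitely_presented_compact[OF I])

lemma representation_L:
  "\<exists>\<tau>. hom_representation C0 I CL SL (\<lambda>S X. fob T (fob D S, X)) (\<lambda>s f. far T (far D s, f)) \<tau>"
proof -
  obtain t where iso: "\<forall>X \<in> Obj (prod_cat SLop CL). t X \<in> iso
        ((\<lambda>(S, X). Hom_group C0 I (fob T (fob D S, X))) X) ((\<lambda>(S, X). Hom_group CL S X) X)"
    and nat: "\<forall>f \<in> Arr (prod_cat SLop CL).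
      \<forall>x \<in> carrier ((\<lambda>(S, X). Hom_group C0 I (fob T (fob D S, X))) (Dom (prod_cat SLop CL) f)).
        t (Cod (prod_cat SLop CL) f) ((\<lambda>(s, f) x. far T (far D s, f) \<cdot>\<^bsub>C0\<^esub> x) f x) =
          (\<lambda>(s, f) x. f \<cdot>\<^bsub>CL\<^esub> x \<cdot>\<^bsub>CL\<^esub> s) f (t (Dom (prod_cat SLop CL) f) x)"
    using Hom_L unfolding ab_nat_isomorphic_def by blast
  have 1: "bij_betw (t (S, X)) (Hom C0 I (fob T (fob D S, X))) (Hom CL S X) \<and>
      (\<forall>x \<in> Hom C0 I (fob T (fob D S, X)). t (S, X) x = Zer CL S X \<longrightarrow>
          x = Zer C0 I (fob T (fob D S, X)))" if "S \<in> SL" "X \<in> Obj CL" for S X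
  proof -
    have "t (S, X) \<in> iso (Hom_group C0 I (fob T (fob D S, X))) (Hom_group CL S X)"
      using bspec[OF iso, of "(S, X)"] that by simp
    then show ?thesis
      using iso_Hom_group[OF Z.preadditive_axioms L.preadditive_axioms I_Obj T.T_Obj[OF SR_Obj[OF
          D_SR[OF that(1)]] that(2)]
          SL_Obj[OF that(1)] that(2)] by blast
  qed
  have 2: "t (S', Y) (far T (far D s, f) \<cdot>\<^bsub>C0\<^esub> x) = f \<cdot>\<^bsub>CL\<^esub> t (S, X) x \<cdot>\<^bsub>CL\<^esub> s"
    if "S \<in> SL" "S' \<in> SL" "s \<in> Hom CL S' S" "f \<in> Hom CL X Y" "x \<in> Hom C0 I (fob T (fob D S, X))"
        for S S' s f X Y x
  proof -
    have "(s, f) \<in> Arr (prod_cat SLop CL)" "Dom (prod_cat SLop CL) (s, f) = (S, X)"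
        "Cod (prod_cat SLop CL) (s, f) = (S', Y)"
      using that L.HomD[OF that(3)] L.HomD[OF that(4)]
          by (simp_all add: prod_cat_def op_cat_def full_subcat_def)
    with bspec[OF nat this(1)] show ?thesis using that(5) by simp
  qed
  show ?thesis unfolding hom_representation_def using 1 2 by (intro exI[of _ "\<lambda>S X. t (S, X)"]) blast
qed

text \<open>The given isomorphism represents Hom from objects of the form \<open>fob D S\<close>.
  For \<open>A\<close> in \<open>SR\<close> it is used at \<open>fob G A\<close> and then
  precomposed with \<open>\<eta>\<close> from \<open>A\<close> to its double dual.\<close>

lemma representation_R:
  "\<exists>\<rho>. hom_representation C0 I CR SR (\<lambda>R X. fob T (X, fob G R)) (\<lambda>s f. far T (f, far G s)) \<rho>"
proof -
  let ?P = "prod_cat (full_subcat CL SL) CR"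
  obtain t where iso: "\<forall>X \<in> Obj ?P. t X \<in> iso
        ((\<lambda>(S, X). Hom_group C0 I (fob T (X, S))) X) ((\<lambda>(S, X). Hom_group CR (fob D S) X) X)"
    and nat: "\<forall>f \<in> Arr ?P. \<forall>x \<in> carrier ((\<lambda>(S, X). Hom_group C0 I (fob T (X, S))) (Dom ?P f)).
        t (Cod ?P f) ((\<lambda>(s, f) x. far T (f, s) \<cdot>\<^bsub>C0\<^esub> x) f x) =
          (\<lambda>(s, f) x. f \<cdot>\<^bsub>CR\<^esub> x \<cdot>\<^bsub>CR\<^esub> far D s) f (t (Dom ?P f) x)"
    using Hom_R unfolding ab_nat_isomorphic_def by blast
  have 1: "bij_betw (t (S, X)) (Hom C0 I (fob T (X, S))) (Hom CR (fob D S) X) \<and>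
      (\<forall>x \<in> Hom C0 I (fob T (X, S)). t (S, X) x = Zer CR (fob D S) X \<longrightarrow> x = Zer C0 I (fob T (X, S)))"
          if "S \<in> SL" "X \<in> Obj CR" for S X
  proof -
    have "t (S, X) \<in> iso (Hom_group C0 I (fob T (X, S))) (Hom_group CR (fob D S) X)"
      using bspec[OF iso, of "(S, X)"] that by simp
    then show ?thesis
      using iso_Hom_group[OF Z.preadditive_axioms R.preadditive_axioms I_Obj T.T_Obj[OF that(2)
          SL_Obj[OF that(1)]]
          SR_Obj[OF D_SR[OF that(1)]] that(2)] by blast
  qed
  have 2: "t (S', Y) (far T (f, s) \<cdot>\<^bsub>C0\<^esub> x) = f \<cdot>\<^bsub>CR\<^esub> t (S, X) x \<cdot>\<^bsub>CR\<^esub> far D s"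
    if "S \<in> SL" "S' \<in> SL" "s \<in> Hom CL S S'" "f \<in> Hom CR X Y" "x \<in> Hom C0 I (fob T (X, S))"
        for S S' s f X Y x
  proof -
    have "(s, f) \<in> Arr ?P" "Dom ?P (s, f) = (S, X)" "Cod ?P (s, f) = (S', Y)"
      using that L.HomD[OF that(3)] R.HomD[OF that(4)] by (simp_all add: prod_cat_def full_subcat_def)
    with bspec[OF nat this(1)] show ?thesis using that(5) by simp
  qed
  obtain \<eta> \<epsilon> where e: "\<And>A. A \<in> SR \<Longrightarrow> \<eta> A \<in> Hom CR A (fob D (fob G A)) \<and>
      \<epsilon> A \<in> Hom CR (fob D (fob G A)) A \<and>
     \<epsilon> A \<cdot>\<^bsub>CR\<^esub> \<eta> A = Idn CR A \<and> \<eta> A \<cdot>\<^bsub>CR\<^esub> \<epsilon> A = Idn CR (fob D (fob G A))"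
    and eta_nat: "\<And>A B v. A \<in> SR \<Longrightarrow> B \<in> SR \<Longrightarrow> v \<in> Hom CR A B \<Longrightarrow> far D (far G v) \<cdot>\<^bsub>CR\<^esub> \<eta> A = \<eta> B \<cdot>\<^bsub>CR\<^esub> v"
    using DG_unit by blast
  define \<rho> where "\<rho> A X x = t (fob G A, X) x \<cdot>\<^bsub>CR\<^esub> \<eta> A" for A X x
  have 3: "bij_betw (\<rho> A X) (Hom C0 I (fob T (X, fob G A))) (Hom CR A X) \<and>
      (\<forall>x \<in> Hom C0 I (fob T (X, fob G A)). \<rho> A X x = Zer CR A X \<longrightarrow> x = Zer C0 I (fob T (X, fob G A)))"
    if A: "A \<in> SR" and X: "X \<in> Obj CR" for A X
  proof (intro conjI ballI impI)
    note b = 1[OF G_SL[OF A] X] and eA = e[OF A]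
    have "bij_betw (\<lambda>y. y \<cdot>\<^bsub>CR\<^esub> \<eta> A) (Hom CR (fob D (fob G A)) X) (Hom CR A X)"
    proof (rule bij_betw_byWitness[where f' = "\<lambda>y. y \<cdot>\<^bsub>CR\<^esub> \<epsilon> A"])
      show "\<forall>y \<in> Hom CR (fob D (fob G A)) X. y \<cdot>\<^bsub>CR\<^esub> \<eta> A \<cdot>\<^bsub>CR\<^esub> \<epsilon> A = y"
      proof
        fix y assume y: "y \<in> Hom CR (fob D (fob G A)) X"
        show "y \<cdot>\<^bsub>CR\<^esub> \<eta> A \<cdot>\<^bsub>CR\<^esub> \<epsilon> A = y"
          using R.Cmp_assoc[OF conjunct1[OF conjunct2[OF eA]] conjunct1[OF eA] y] eA R.Cmp_Idn[OF y]
            by simp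
      qed
      show "\<forall>y \<in> Hom CR A X. y \<cdot>\<^bsub>CR\<^esub> \<epsilon> A \<cdot>\<^bsub>CR\<^esub> \<eta> A = y"
      proof
        fix y assume y: "y \<in> Hom CR A X"
        show "y \<cdot>\<^bsub>CR\<^esub> \<epsilon> A \<cdot>\<^bsub>CR\<^esub> \<eta> A = y"
          using R.Cmp_assoc[OF conjunct1[OF eA] conjunct1[OF conjunct2[OF eA]] y] eA R.Cmp_Idn[OF y]
            by simp
      qed
      show "(\<lambda>y. y \<cdot>\<^bsub>CR\<^esub> \<eta> A) ` Hom CR (fob D (fob G A)) X \<subseteq> Hom CR A X"
        "(\<lambda>y. y \<cdot>\<^bsub>CR\<^esub> \<epsilon> A) ` Hom CR A X \<subseteq> Hom CR (fob D (fob G A)) X"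
        using R.Cmp_in eA by blast+
    qed
    moreover have "\<rho> A X = (\<lambda>y. y \<cdot>\<^bsub>CR\<^esub> \<eta> A) \<circ> t (fob G A, X)" by (simp add: fun_eq_iff \<rho>_def)
    ultimately show "bij_betw (\<rho> A X) (Hom C0 I (fob T (X, fob G A))) (Hom CR A X)"
      using bij_betw_trans[OF conjunct1[OF b]] by simp
    fix x assume x: "x \<in> Hom C0 I (fob T (X, fob G A))" "\<rho> A X x = Zer CR A X"
    have tx: "t (fob G A, X) x \<in> Hom CR (fob D (fob G A)) X" using bij_betwE[OF conjunct1[OF b]]
        x(1) by blast
    have "t (fob G A, X) x = \<rho> A X x \<cdot>\<^bsub>CR\<^esub> \<epsilon> A"
      using R.Cmp_assoc[OF conjunct1[OF conjunct2[OF eA]] conjunct1[OF eA] tx] eA R.Cmp_Idn[OF tx]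
          by (simp add: \<rho>_def)
    then have "t (fob G A, X) x = Zer CR (fob D (fob G A)) X"
      using x(2) R.Zer_Cmp[OF conjunct1[OF conjunct2[OF eA]] X] by simp
    then show "x = Zer C0 I (fob T (X, fob G A))" using b x(1) by blast
  qed
  have 4: "\<rho> B Y (far T (f, far G v) \<cdot>\<^bsub>C0\<^esub> x) = f \<cdot>\<^bsub>CR\<^esub> \<rho> A X x \<cdot>\<^bsub>CR\<^esub> v"
    if A: "A \<in> SR" and B: "B \<in> SR" and v: "v \<in> Hom CR B A" and f: "f \<in> Hom CR X Y"
      and x: "x \<in> Hom C0 I (fob T (X, fob G A))" for A B v f X Y x
  proof -
    note GA = G_SL[OF A] and GB = G_SL[OF B] and eA = conjunct1[OF e[OF A]]
        and eB = conjunct1[OF e[OF B]]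
    have tx: "t (fob G A, X) x \<in> Hom CR (fob D (fob G A)) X"
      using bij_betwE[OF conjunct1[OF 1[OF GA R.Hom_Dom_Obj[OF f]]]] x by blast
    note ftx = R.Cmp_in[OF tx f]
    note DGv = D_in[OF GA GB G_in[OF B A v]]
    have "\<rho> B Y (far T (f, far G v) \<cdot>\<^bsub>C0\<^esub> x) = f \<cdot>\<^bsub>CR\<^esub> t (fob G A, X) x \<cdot>\<^bsub>CR\<^esub> far D (far G v) \<cdot>\<^bsub>CR\<^esub> \<eta> B"
      using 2[OF GA GB G_in[OF B A v] f x] by (simp add: \<rho>_def)
    also have "\<dots> = f \<cdot>\<^bsub>CR\<^esub> t (fob G A, X) x \<cdot>\<^bsub>CR\<^esub> (\<eta> A \<cdot>\<^bsub>CR\<^esub> v)"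
      using R.Cmp_assoc[OF eB DGv ftx] eta_nat[OF B A v] by simp
    also have "\<dots> = f \<cdot>\<^bsub>CR\<^esub> \<rho> A X x \<cdot>\<^bsub>CR\<^esub> v"
      using R.Cmp_assoc[OF v eA ftx] R.Cmp_assoc[OF eA tx f] by (simp add: \<rho>_def)
    finally show ?thesis .
  qed
  show ?thesis unfolding hom_representation_def using 3 4 by (intro exI[of _ \<rho>]) blast
qed

lemma compact_SL:
  assumes S: "S \<in> SL" shows "compact U CL S"
proof -
  obtain \<tau> where rep: "hom_representation C0 I CL SL (\<lambda>S X. fob T (fob D S, X)) (\<lambda>s f. far T (far D
      s, f)) \<tau>"
    using representation_L by blast
  show ?thesis
    by (rule compact_of_representation[OF I_compact S _ T_left[OF SR_Obj[OF D_SR[OF S]]] rep])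
      (use SL_Obj D_Idn[OF S] in auto)
qed

lemma compact_SR:
  assumes S: "S \<in> SR" shows "compact U CR S"
proof -
  obtain \<rho> where rep: "hom_representation C0 I CR SR (\<lambda>R X. fob T (X, fob G R)) (\<lambda>s f. far T (f, far
      G s)) \<rho>"
    using representation_R by blast
  show ?thesis
    by (rule compact_of_representation[OF I_compact S _ T_right[OF SL_Obj[OF G_SL[OF S]]] rep])
      (use SR_Obj G_Idn[OF S] in auto)
qed

lemma SR_nonempty: "SR \<noteq> {}"
  using SL(4) D_SR by blast

lemma generators_L: "\<exists>TL \<subseteq> SL. compact_gen U CL TL \<and> (\<forall>A \<in> SL. \<exists>B \<in> TL. isomorphic CL A B)"
  by (rule compact_gen_of_ess_small[OF universe CL SL compact_SL])

lemma generators_R: "\<exists>TR \<subseteq> SR. compact_gen U CR TR \<and> (\<forall>A \<in> SR. \<exists>B \<in> TR. isomorphic CR A B)"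
  by (rule compact_gen_of_ess_small[OF universe CR SR SR_nonempty compact_SR])

lemma direct_limits_of_mono: "TT \<subseteq> S \<Longrightarrow> direct_limits_of V C TT \<subseteq> direct_limits_of V C S"
  unfolding direct_limits_of_def by blast

theorem semi_flat_L_direct_limit:
  assumes sf: "semi_flat_L CL CR C0 SR I T M"
  shows "M \<in> direct_limits_of U CL SL"
proof -
  obtain TL where TL: "TL \<subseteq> SL" "compact_gen U CL TL" "\<And>A. A \<in> SL \<Longrightarrow> \<exists>B \<in> TL. isomorphic CL A B"
    using generators_L by blast
  obtain TR where TR: "TR \<subseteq> SR" "compact_gen U CR TR" "\<And>A. A \<in> SR \<Longrightarrow> \<exists>B \<in> TR. isomorphic CR A B"
    using generators_R by blast
  have M: "M \<in> Obj CL" and ex: "exact_functor CR C0 (fix_right CL T M)"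
    and perp: "\<And>E. E \<in> perp CR SR \<Longrightarrow> trivial_group (Ext C0 I (fob T (E, M)))"
    using sf unfolding semi_flat_L_def by blast+
  obtain \<tau> where rep: "hom_representation C0 I CL SL (\<lambda>S X. fob T (fob D S, X)) (\<lambda>s f. far T (far D
      s, f)) \<tau>"
    using representation_L by blast
  have perp': "E \<in> perp CR SR" if "E \<in> perp CR TR" for E
    using perp_of_ess_small[OF R.abelian_axioms TR(1) _ TR(3)] SR_Obj that by blast
  have "M \<in> direct_limits_of U CL TL"
  proof (rule direct_limit_of_lifting[OF TL(2) TR(2) Z.abelian_axioms I_compact T_right[OF M] ex,
        where S = SL and d = "fob D" and dm = "far D", OF _ _ _ _ _ _ _ _ _ _ rep])
    show "\<exists>A \<in> SL. isomorphic CR R (fob D A)" if "R \<in> TR" for R using D_ess_surj that TR(1) by blast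
    show "trivial_group (Ext C0 I (fob (fix_right CL T M) E))" if "E \<in> perp CR TR" for E
      using perp[OF perp'[OF that]] by simp
    show "SL \<subseteq> Obj CL" using SL_Obj by blast
    show "fob T (fob D A, M) = fob (fix_right CL T M) (fob D A)" for A by simp
    show "far T (far D u, Idn CL M) = far (fix_right CL T M) (far D u)" for u by simp
  qed (use M TL D_in D_Cmp D_full D_faithful in blast)+
  then show ?thesis using direct_limits_of_mono[OF TL(1)] by blast
qed

text \<open>Mirror image of the left case: \<open>G\<close> takes the place of \<open>D\<close>, and
  \<open>W\<close> is tensoring with \<open>M\<close> from the left.\<close>

theorem semi_flat_R_direct_limit:
  assumes sf: "semi_flat_R CL CR C0 SL I T M"
  shows "M \<in> direct_limits_of U CR SR"
proof -
  obtain TL where TL: "TL \<subseteq> SL" "compact_gen U CL TL" "\<And>A. A \<in> SL \<Longrightarrow> \<exists>B \<in> TL. isomorphic CL A B"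
    using generators_L by blast
  obtain TR where TR: "TR \<subseteq> SR" "compact_gen U CR TR" "\<And>A. A \<in> SR \<Longrightarrow> \<exists>B \<in> TR. isomorphic CR A B"
    using generators_R by blast
  have M: "M \<in> Obj CR" and ex: "exact_functor CL C0 (fix_left CR T M)"
    and perp: "\<And>E. E \<in> perp CL SL \<Longrightarrow> trivial_group (Ext C0 I (fob T (M, E)))"
    using sf unfolding semi_flat_R_def by blast+
  obtain \<rho> where rep: "hom_representation C0 I CR SR (\<lambda>R X. fob T (X, fob G R)) (\<lambda>s f. far T (f, far
      G s)) \<rho>"
    using representation_R by blast
  have perp': "E \<in> perp CL SL" if "E \<in> perp CL TL" for E
    using perp_of_ess_small[OF L.abelian_axioms TL(1) _ TL(3)] SL_Obj that by blast
  have "M \<in> direct_limits_of U CR TR"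
  proof (rule direct_limit_of_lifting[OF TR(2) TL(2) Z.abelian_axioms I_compact T_left[OF M] ex,
        where S = SR and d = "fob G" and dm = "far G", OF _ _ _ _ _ _ _ _ _ _ rep])
    show "\<exists>A \<in> SR. isomorphic CL R (fob G A)" if "R \<in> TL" for R using G_ess_surj that TL(1) by blast
    show "trivial_group (Ext C0 I (fob (fix_left CR T M) E))" if "E \<in> perp CL TL" for E
      using perp[OF perp'[OF that]] by simp
    show "SR \<subseteq> Obj CR" using SR_Obj by blast
    show "fob T (M, fob G A) = fob (fix_left CR T M) (fob G A)" for A by simp
    show "far T (Idn CR M, far G u) = far (fix_left CR T M) (far G u)" for u by simp
  qed (use M TR G_in G_Cmp G_full G_faithful in blast)+
  then show ?thesis using direct_limits_of_mono[OF TR(1)] by blast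
qed

end

section \<open>Direct limits of generators are semi-flat in a strong duality setup\<close>

context strong_duality_setup
begin

interpretation L: grothendieck U CL by (rule CL)
interpretation R: grothendieck U CR by (rule CR)
interpretation Z: grothendieck U C0 by (rule C0)
interpretation T: bifunctor CR CL C0 T by unfold_locales (rule bifunctor)

text \<open>The group is Ext from the dual of \<open>S\<close> to \<open>E\<close>, and that dual
  lies in \<open>SR\<close>.\<close>

lemma trivial_Ext_tensor_SL:
  assumes S: "S \<in> SL" and E: "E \<in> perp CR SR"
  shows "trivial_group (Ext C0 I (fob T (E, S)))"
proof -
  have EO: "E \<in> Obj CR" and tr: "trivial_group (Ext CR (fob D S) E)"
    using E D_SR[OF S] unfolding perp_def by blast+
  obtain t where "\<forall>X \<in> Obj CR. t X \<in> iso (Ext C0 I (fob T (X, S))) (Ext CR (fob D S) X)"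
    using Ext_R[OF S] unfolding ab_nat_isomorphic_def by blast
  then show ?thesis
    using trivial_Ext_of_iso[OF Z.abelian_axioms I_Obj T.T_Obj[OF EO SL_Obj[OF S]] _ tr] EO by blast
qed

text \<open>The Ext isomorphism is given for duals \<open>fob D S'\<close>, to which
  \<open>S\<close> is merely isomorphic; hence the extra transport along the tensored
  isomorphism.\<close>

lemma trivial_Ext_tensor_SR:
  assumes S: "S \<in> SR" and E: "E \<in> perp CL SL"
  shows "trivial_group (Ext C0 I (fob T (S, E)))"
proof -
  obtain S' where S': "S' \<in> SL" "isomorphic CR S (fob D S')" using D_ess_surj[OF S] by blast
  have EO: "E \<in> Obj CL" and tr: "trivial_group (Ext CL S' E)"
    using E S'(1) unfolding perp_def by blast+
  obtain t where "\<forall>X \<in> Obj CL. t X \<in> iso (Ext C0 I (fob T (fob D S', X))) (Ext CL S' X)"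
    using Ext_L[OF S'(1)] unfolding ab_nat_isomorphic_def by blast
  then have t1: "trivial_group (Ext C0 I (fob T (fob D S', E)))"
    using trivial_Ext_of_iso[OF Z.abelian_axioms I_Obj T.T_Obj[OF SR_Obj[OF D_SR[OF S'(1)]] EO]
        _ tr] EO by blast
  obtain a b where ab: "a \<in> Hom CR S (fob D S')" "b \<in> Hom CR (fob D S') S"
      "b \<cdot>\<^bsub>CR\<^esub> a = Idn CR S" "a \<cdot>\<^bsub>CR\<^esub> b = Idn CR (fob D S')"
    by (rule R.isomorphicE[OF S'(2)])
  note i = L.Idn_in[OF EO]
  have "isomorphic C0 (fob T (fob D S', E)) (fob T (S, E))"
  proof (rule Z.isomorphicI[OF T.T_in[OF ab(2) i] T.T_in[OF ab(1) i]])
    show "far T (a, Idn CL E) \<cdot>\<^bsub>C0\<^esub> far T (b, Idn CL E) = Idn C0 (fob T (fob D S', E))"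
      using T.T_Cmp[OF ab(2) i ab(1) i] ab(4) L.Idn_Cmp[OF i] T.T_Idn[OF R.Hom_Cod_Obj[OF ab(1)] EO]
          by simp
    show "far T (b, Idn CL E) \<cdot>\<^bsub>C0\<^esub> far T (a, Idn CL E) = Idn C0 (fob T (S, E))"
      using T.T_Cmp[OF ab(1) i ab(2) i] ab(3) L.Idn_Cmp[OF i] T.T_Idn[OF SR_Obj[OF S] EO] by simp
  qed
  then show ?thesis
    using Z.split_isomorphic_left t1 Z.trivial_Ext_iff[OF I_Obj] T.T_Obj[OF SR_Obj[OF S] EO]
      T.T_Obj[OF SR_Obj[OF D_SR[OF S'(1)]] EO] by blast
qed

theorem direct_limit_semi_flat_L:
  assumes M: "M \<in> direct_limits_of U CL SL"
  shows "semi_flat_L CL CR C0 SR I T M"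
proof -
  obtain J :: "('a, 'a) cat" and F l where J: "small_cat U J" "filtered J" "\<And>j. j \<in> Obj J \<Longrightarrow>
      fob F j \<in> SL"
    and L: "is_colimit J CL F M l"
    using M unfolding direct_limits_of_def by blast
  have "exact_functor CR C0 (fix_right CL T M)"
    by (rule exact_of_direct_limit[OF T.bifunctor_axioms R.preadditive_axioms Z.direct_limits_exact
        J(1,2) L T_left exact_SL[OF J(3)]])
  moreover have "trivial_group (Ext C0 I (fob T (E, M)))" if E: "E \<in> perp CR SR" for E
  proof -
    have "E \<in> Obj CR" using E unfolding perp_def by blast
    then have "is_colimit J C0 (comp_fctr (fix_left CR T E) F) (fob (fix_left CR T E) M) (far
        (fix_left CR T E) \<circ> l)"
      using T_left J L unfolding preserves_direct_limits_def by blast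
    then have "trivial_group (Ext C0 I (fob (fix_left CR T E) M))"
      by (rule trivial_Ext_of_direct_limit[OF Z.abelian_axioms I_Obj FP2 J(1,2)])
        (use trivial_Ext_tensor_SL[OF J(3) E] in simp)
    then show ?thesis by simp
  qed
  ultimately show ?thesis unfolding semi_flat_L_def using colimitD(2)[OF L] by blast
qed

theorem direct_limit_semi_flat_R:
  assumes M: "M \<in> direct_limits_of U CR SR"
  shows "semi_flat_R CL CR C0 SL I T M"
proof -
  \<comment> \<open>With the arguments exchanged, tensoring from the left becomes tensoring from the
    right, the form in which exactness of limits was shown.\<close>
  let ?T = "\<lparr>fob = (\<lambda>(M, X). fob T (X, M)), far = (\<lambda>(g, f). far T (f, g))\<rparr>"
  have swap: "fix_right CR ?T X = fix_left CR T X" "fix_left CL ?T Y = fix_right CL T Y" for X Y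
    by (simp_all add: fix_right_def fix_left_def)
  obtain J :: "('a, 'a) cat" and F l where J: "small_cat U J" "filtered J" "\<And>j. j \<in> Obj J \<Longrightarrow>
      fob F j \<in> SR"
    and L: "is_colimit J CR F M l"
    using M unfolding direct_limits_of_def by blast
  have "exact_functor CL C0 (fix_right CR ?T M)"
    by (rule exact_of_direct_limit[OF T.swap_bifunctor L.preadditive_axioms Z.direct_limits_exact
        J(1,2) L])
      (use T_right exact_SR[OF J(3)] in \<open>simp_all add: swap\<close>)
  then have "exact_functor CL C0 (fix_left CR T M)" by (simp add: swap)
  moreover have "trivial_group (Ext C0 I (fob T (M, E)))" if E: "E \<in> perp CL SL" for E
  proof -
    have "E \<in> Obj CL" using E unfolding perp_def by blast
    then have "is_colimit J C0 (comp_fctr (fix_right CL T E) F) (fob (fix_right CL T E) M) (far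
        (fix_right CL T E) \<circ> l)"
      using T_right J L unfolding preserves_direct_limits_def by blast
    then have "trivial_group (Ext C0 I (fob (fix_right CL T E) M))"
      by (rule trivial_Ext_of_direct_limit[OF Z.abelian_axioms I_Obj FP2 J(1,2)])
        (use trivial_Ext_tensor_SR[OF J(3) E] in simp)
    then show ?thesis by simp
  qed
  ultimately show ?thesis unfolding semi_flat_R_def using colimitD(2)[OF L] by blast
qed

end

theorem theorem1:
  fixes CL :: "('l, 'lm) add_cat"
    and CR :: "('r, 'rm) add_cat"
    and C0 :: "('z, 'zm) add_cat"
    and SL :: "'l set"
    and SR :: "'r set"
    and I :: 'z
    and T :: "('r \<times> 'l, 'rm \<times> 'lm, 'z, 'zm) fctr"
    and D :: "('l, 'lm, 'r, 'rm) fctr"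
  assumes "duality_setup TYPE('u) CL CR C0 SL SR I T D"
  shows "(\<forall>M \<in> Obj CL. semi_flat_L CL CR C0 SR I T M \<longrightarrow> M \<in> direct_limits_of TYPE('u) CL SL) \<and>
    (\<forall>M \<in> Obj CR. semi_flat_R CL CR C0 SL I T M \<longrightarrow> M \<in> direct_limits_of TYPE('u) CR SR) \<and>
    (strong_duality_setup TYPE('u) CL CR C0 SL SR I T D \<longrightarrow>
      (\<forall>M \<in> direct_limits_of TYPE('u) CL SL. semi_flat_L CL CR C0 SR I T M) \<and>
      (\<forall>M \<in> direct_limits_of TYPE('u) CR SR. semi_flat_R CL CR C0 SL I T M))"
proof (intro conjI ballI impI)
  show "semi_flat_L CL CR C0 SR I T M \<Longrightarrow> M \<in> direct_limits_of TYPE('u) CL SL" for M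
    by (rule duality_setup.semi_flat_L_direct_limit[OF assms])
  show "semi_flat_R CL CR C0 SL I T M \<Longrightarrow> M \<in> direct_limits_of TYPE('u) CR SR" for M
    by (rule duality_setup.semi_flat_R_direct_limit[OF assms])
  assume strong: "strong_duality_setup TYPE('u) CL CR C0 SL SR I T D"
  show "M \<in> direct_limits_of TYPE('u) CL SL \<Longrightarrow> semi_flat_L CL CR C0 SR I T M" for M
    by (rule strong_duality_setup.direct_limit_semi_flat_L[OF strong])
  show "M \<in> direct_limits_of TYPE('u) CR SR \<Longrightarrow> semi_flat_R CL CR C0 SL I T M" for M
    by (rule strong_duality_setup.direct_limit_semi_flat_R[OF strong])
qed

end
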